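(* Let $h^+,h^-:\mathbb{R}_+\to\mathbb{R}_+$ be bounded Borel functions with $\frac12\int_0^\infty(h^+(u)+h^-(u))\,du=1$. Let $H(l)=\frac12\int_0^l(h^+(u)+h^-(u))\,du$ for $l\ge0$ and $$M_t^{h^+,h^-}=1-H(L_t^0)+X_t^+h^+(L_t^0)+X_t^-h^-(L_t^0),\qquad t\ge0.$$ 1. Let $s\ge0$ and $\Gamma_s\in\mathcal{F}_s$. Then $$\lim_{t\to\infty}\frac{E_0\big[1_{\Gamma_s}\big(h^+(L_t^0)1_{\{X_t>0\}}+h^-(L_t^0)1_{\{X_t<0\}}\big)\big]}{E_0\big[h^+(L_t^0)1_{\{X_t>0\}}+h^-(L_t^0)1_{\{X_t<0\}}\big]}=E_0[1_{\Gamma_s}M_s^{h^+,h^-}].$$ 2. Let $Q_0^{h^+,h^-}$ be the probability measure on $(\Omega,\mathcal{F}_\infty)$ satisfying $Q_0^{h^+,h^-}(\Gamma_s)=E_0[1_{\Gamma_s}M_s^{h^+,h^-}]$ for any $s\ge0$ and $\Gamma_s\in\mathcal{F}_s$. Then, under $Q_0^{h^+,h^-}$, the process $$\Big(X_t-\int_0^t\frac{h^+(L_s^0)1_{\{X_s>0\}}-h^-(L_s^0)1_{\{X_s<0\}}}{M_s^{h^+,h^-}}\,ds;\ t\ge0\Big)$$ is a Brownian motion.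
   Context: $\Omega=\mathcal{C}(\mathbb{R}_+,\mathbb{R})$ is the canonical space, $(X_t)_{t\ge0}$ the coordinate process, $\mathcal{F}_t=\sigma(X_s;0\le s\le t)$, $\mathcal{F}_\infty=\sigma(X_s;s\ge0)$; $P_0$ is the Wiener measure started at $0$, with expectation $E_0$. $x^+=\max(x,0)$, $x^-=\max(-x,0)$. $(L_t^0)_{t\ge0}$ is the (continuous semimartingale) local time at $0$ of $(X_t)$, normalized so that $|X_t|-L_t^0$ is a $P_0$-martingale. The process $(M_t^{h^+,h^-})$ is a $P_0$-martingale with $M_0^{h^+,h^-}=1$. *)

theory Defs
  imports "HOL-Probability.Probability"
begin

text \<open>
  The canonical space of continuous paths on the half line.  A path is a function on all reals,
  fixed to the value \<^term>\<open>undefined\<close> at negative times, so that it is determined by its restriction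
  to \<^term>\<open>{0::real..}\<close>.  The coordinate process is evaluation, so \<open>X\<^sub>t\<close> at \<open>w\<close> is written \<^term>\<open>w t\<close>.
\<close>

type_synonym path = "real \<Rightarrow> real"

definition path_space :: "path set" where
  "path_space = {w \<in> extensional {0..}. continuous_on {0..} w}"

definition coord_sigma :: "real set \<Rightarrow> path measure" where
  "coord_sigma T = sigma path_space
     {{w \<in> path_space. w s \<in> A} | s A. s \<in> T \<and> A \<in> sets (borel :: real measure)}"

definition Filt :: "real \<Rightarrow> path measure" where
  "Filt t = coord_sigma {0..t}"

definition Filt_inf :: "path measure" where
  "Filt_inf = coord_sigma {0..}"

text \<open>Standard Brownian motion started at 0, with respect to its own filtration.\<close>

definition brownian_motion :: "'a measure \<Rightarrow> (real \<Rightarrow> 'a \<Rightarrow> real) \<Rightarrow> bool" where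
  "brownian_motion M B \<longleftrightarrow>
     prob_space M \<and>
     (\<forall>t\<ge>0. B t \<in> borel_measurable M) \<and>
     (AE w in M. B 0 w = 0) \<and>
     (AE w in M. continuous_on {0..} (\<lambda>t. B t w)) \<and>
     (\<forall>s t. 0 \<le> s \<and> s < t \<longrightarrow>
        distributed M lborel (\<lambda>w. B t w - B s w) (\<lambda>x. ennreal (normal_density 0 (sqrt (t - s)) x))) \<and>
     (\<forall>(n::nat) \<tau>. 0 \<le> \<tau> 0 \<and> (\<forall>i<n. \<tau> i \<le> \<tau> (Suc i)) \<longrightarrow>
        prob_space.indep_vars M (\<lambda>_. borel) (\<lambda>i w. B (\<tau> (Suc i)) w - B (\<tau> i) w) {..<n})"

definition wiener_measure :: "path measure \<Rightarrow> bool" where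
  "wiener_measure P \<longleftrightarrow> sets P = sets Filt_inf \<and> brownian_motion P (\<lambda>t w. w t)"

definition path_martingale :: "path measure \<Rightarrow> (real \<Rightarrow> path \<Rightarrow> real) \<Rightarrow> bool" where
  "path_martingale P N \<longleftrightarrow>
     (\<forall>t\<ge>0. N t \<in> borel_measurable (Filt t) \<and> integrable P (N t)) \<and>
     (\<forall>s t. 0 \<le> s \<and> s \<le> t \<longrightarrow> (AE w in P. real_cond_exp P (Filt s) (N t) w = N s w))"

text \<open>
  The Ito integral against the coordinate process: at each time, the mean-square limit of
  elementary integrals of simple predictable integrands
  \<open>\<Sum>i<n. \<xi> i * indicator {\<tau> i<..\<tau> (Suc i)}\<close>.
\<close>

definition simple_integrand :: "nat \<Rightarrow> (nat \<Rightarrow> real) \<Rightarrow> (nat \<Rightarrow> path \<Rightarrow> real) \<Rightarrow> bool" where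
  "simple_integrand n \<tau> \<xi> \<longleftrightarrow>
     0 \<le> \<tau> 0 \<and> (\<forall>i<n. \<tau> i \<le> \<tau> (Suc i)) \<and>
     (\<forall>i<n. \<xi> i \<in> borel_measurable (Filt (\<tau> i)) \<and> bounded (\<xi> i ` path_space))"

definition simple_process ::
    "nat \<Rightarrow> (nat \<Rightarrow> real) \<Rightarrow> (nat \<Rightarrow> path \<Rightarrow> real) \<Rightarrow> real \<Rightarrow> path \<Rightarrow> real" where
  "simple_process n \<tau> \<xi> s w = (\<Sum>i<n. \<xi> i w * indicator {\<tau> i<..\<tau> (Suc i)} s)"

definition simple_integral ::
    "nat \<Rightarrow> (nat \<Rightarrow> real) \<Rightarrow> (nat \<Rightarrow> path \<Rightarrow> real) \<Rightarrow> real \<Rightarrow> path \<Rightarrow> real" where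
  "simple_integral n \<tau> \<xi> t w = (\<Sum>i<n. \<xi> i w * (w (min t (\<tau> (Suc i))) - w (min t (\<tau> i))))"

definition is_ito_integral ::
    "path measure \<Rightarrow> (real \<Rightarrow> path \<Rightarrow> real) \<Rightarrow> (real \<Rightarrow> path \<Rightarrow> real) \<Rightarrow> bool" where
  "is_ito_integral P K I \<longleftrightarrow>
     (\<lambda>(s, w). K s w) \<in> borel_measurable (restrict_space borel {0..} \<Otimes>\<^sub>M Filt_inf) \<and>
     (\<forall>t\<ge>0. I t \<in> borel_measurable (Filt t) \<and>
       (\<exists>n \<tau> \<xi>.
          (\<forall>k::nat. simple_integrand (n k) (\<tau> k) (\<xi> k)) \<and>
          (\<lambda>k. \<integral>\<^sup>+w. (\<integral>\<^sup>+s\<in>{0..t}. ennreal ((simple_process (n k) (\<tau> k) (\<xi> k) s w - K s w)\<^sup>2) \<partial>lborel) \<partial>P)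
             \<longlonglongrightarrow> 0 \<and>
          (\<lambda>k. \<integral>\<^sup>+w. ennreal ((simple_integral (n k) (\<tau> k) (\<xi> k) t w - I t w)\<^sup>2) \<partial>P)
             \<longlonglongrightarrow> 0))"

text \<open>
  The semimartingale local time at 0 of the coordinate process, defined by Tanaka's formula
  \<open>\<bar>X\<^sub>t\<bar> = \<bar>X\<^sub>0\<bar> + \<integral>\<^sub>0\<^sup>t sgn(X\<^sub>s) dX\<^sub>s + L\<^sub>t\<close> with \<open>sgn 0 = -1\<close>.

  Adaptedness refers to the raw filtration, while continuity and monotonicity of the paths are only
  almost sure.  The former matters under measures which, like \<open>Q\<close> in the theorem, are absolutely
  continuous with respect to \<^term>\<open>P\<close> on each \<^term>\<open>Filt t\<close> but not on \<^term>\<open>Filt_inf\<close>.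
  Nonnegativity is required at every path because the functions \<open>h\<close> to be composed with \<^term>\<open>L\<close>
  are only given on the half line.
\<close>

definition local_time_0 :: "path measure \<Rightarrow> (real \<Rightarrow> path \<Rightarrow> real) \<Rightarrow> bool" where
  "local_time_0 P L \<longleftrightarrow>
     (\<forall>t\<ge>0. L t \<in> borel_measurable (Filt t) \<and> (\<forall>w\<in>path_space. 0 \<le> L t w)) \<and>
     (AE w in P. L 0 w = 0 \<and> continuous_on {0..} (\<lambda>t. L t w) \<and> mono_on {0..} (\<lambda>t. L t w)) \<and>
     is_ito_integral P (\<lambda>s w. if w s > 0 then 1 else - 1) (\<lambda>t w. \<bar>w t\<bar> - \<bar>w 0\<bar> - L t w)"

definition H_fun :: "(real \<Rightarrow> real) \<Rightarrow> (real \<Rightarrow> real) \<Rightarrow> real \<Rightarrow> real" where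
  "H_fun hp hm l = 1 / 2 * (LBINT u:{0..l}. hp u + hm u)"

definition M_proc ::
    "(real \<Rightarrow> real) \<Rightarrow> (real \<Rightarrow> real) \<Rightarrow> (real \<Rightarrow> path \<Rightarrow> real) \<Rightarrow> real \<Rightarrow> path \<Rightarrow> real" where
  "M_proc hp hm L t w =
     1 - H_fun hp hm (L t w) + max (w t) 0 * hp (L t w) + max (- w t) 0 * hm (L t w)"

end

theory Submission
  imports Defs
begin

text \<open>
  Put \<open>h = (h\<^sup>+ + h\<^sup>-) / 2\<close> and \<open>k = (h\<^sup>+ - h\<^sup>-) / 2\<close>.  Since \<open>\<bar>X\<bar> - L\<close> is a martingale and \<open>L\<close> grows
  only on the zero set of \<open>X\<close>, sums of increments over fine grids show that \<open>M\<^sub>t exp(i \<theta> X\<^sub>t + \<theta>\<^sup>2 t / 2)\<close>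
  has drift \<open>i \<theta> (h\<^sup>+(L) 1\<^bsub>X>0\<^esub> - h\<^sup>-(L) 1\<^bsub>X<0\<^esub>) exp(i \<theta> X + \<theta>\<^sup>2 t / 2)\<close>; no stochastic integral is needed.

  For the first part, the conditional laws of \<open>L\<^sub>t\<close> and of \<open>(L\<^sub>t, sgn X\<^sub>t)\<close> given the past up to \<open>s\<close> are
  expressed through the reflected process.  Multiplied by \<open>sqrt (2 \<pi> (t - s))\<close>, numerator and
  denominator converge to \<open>2 E[1\<^sub>\<Gamma> M\<^sub>s]\<close> and to \<open>2\<close>.

  For the second part, the drift identity shows that the process minus its compensator has under \<open>Q\<close>
  the conditional characteristic function of Brownian increments.  The compensator is controlled by
  truncating \<open>h\<close> so that \<open>M\<close> stays away from 0, and the truncation is removed by dominated convergence.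
\<close>

section \<open>The canonical filtration and future increments\<close>

text \<open>The weights are merely Borel, whereas every error estimate needs a modulus of
  continuity. Each identity is therefore established for Lipschitz weights and extended to bounded
  Borel weights by a monotone class argument. A by-product is that the law of \<open>L t\<close>
  charges no Lebesgue-null set; this deals with the levels at which the mass of \<open>h\<close> is
  used up. The normalisation is the inverse of the peak of the Gaussian density, and the factor 2
  comes from the two tails of a symmetric increment. Two obstacles concern Q. It is absolutely
  continuous with respect to P on each \<open>Filt t\<close> only, so the regularity of L has to be
  expressed by events of \<open>Filt t\<close>. And M may reach 0, where the drift loses every
  bound. Under Q, however, H(L_t) < 1 almost surely, and since L is increasing this bounds M from
  below on all of [0, t], path by path. The compensated process agrees with a measurable one only
  almost surely, whence the completion of Q.\<close>

lemma space_coord_sigma [simp]: "space (coord_sigma T) = path_space"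
  by (simp add: coord_sigma_def space_measure_of_conv)

lemma space_Filt [simp]: "space (Filt t) = path_space" "space Filt_inf = path_space"
  by (simp_all add: Filt_def Filt_inf_def)

lemma coord_measurable:
  assumes "s \<in> T"
  shows "(\<lambda>w. w s) \<in> borel_measurable (coord_sigma T)"
proof (rule measurableI)
  fix A :: "real set" assume A: "A \<in> sets borel"
  have "(\<lambda>w. w s) -` A \<inter> path_space = {w \<in> path_space. w s \<in> A}" by auto
  also have "\<dots> \<in> sets (coord_sigma T)"
    unfolding coord_sigma_def using assms A by (subst sets_measure_of) auto
  finally show "(\<lambda>w. w s) -` A \<inter> space (coord_sigma T) \<in> sets (coord_sigma T)" by simp
qed simp

lemma measurable_into_coord:
  assumes "\<And>x. x \<in> space N ==> f x \<in> path_space"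
    and "\<And>s. s \<in> T ==> (\<lambda>x. f x s) \<in> borel_measurable N"
  shows "f \<in> measurable N (coord_sigma T)"
  unfolding coord_sigma_def
proof (rule measurable_measure_of)
  fix B assume "B \<in> {{w \<in> path_space. w s \<in> A} |s A. s \<in> T \<and> A \<in> sets (borel :: real measure)}"
  then obtain s A where B: "B = {w \<in> path_space. w s \<in> A}" "s \<in> T" "A \<in> sets borel" by blast
  have "f -` B \<inter> space N = (\<lambda>x. f x s) -` A \<inter> space N" using B assms(1) by auto
  then show "f -` B \<inter> space N \<in> sets N" using measurable_sets[OF assms(2)[OF B(2)] B(3)] by simp
qed (use assms in auto)

lemma sets_coord_sigma_mono: "T \<subseteq> T' ==> sets (coord_sigma T) \<subseteq> sets (coord_sigma T')"
  unfolding coord_sigma_def by (subst (1 2) sets_measure_of) (auto intro!: sigma_sets_mono')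

lemma sets_Filt_mono: "s \<le> t ==> sets (Filt s) \<subseteq> sets (Filt t)"
  unfolding Filt_def by (rule sets_coord_sigma_mono) auto

lemma sets_Filt_le: "sets (Filt t) \<subseteq> sets Filt_inf"
  unfolding Filt_def Filt_inf_def by (rule sets_coord_sigma_mono) auto

lemma measurable_Filt_mono:
  "f \<in> measurable (Filt s) N ==> s \<le> t ==> f \<in> measurable (Filt t) N"
  using sets_Filt_mono[of s t] by (auto simp: measurable_def)

lemma coord_measurable_Filt: "0 \<le> s ==> s \<le> t ==> (\<lambda>w. w s) \<in> borel_measurable (Filt t)"
  unfolding Filt_def by (rule coord_measurable) auto

text \<open>Generators, complements and countable unions cannot separate two paths with the same
  coordinates in \<open>T\<close>.\<close>

lemma coord_sigma_agree:
  assumes A: "A \<in> sets (coord_sigma T)" and "w \<in> path_space" "w' \<in> path_space"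
    and "\<And>s. s \<in> T ==> w s = w' s"
  shows "w \<in> A \<longleftrightarrow> w' \<in> A"
proof -
  have "A \<in> sigma_sets path_space {{w \<in> path_space. w s \<in> A} |s A. s \<in> T \<and> A \<in> sets (borel :: real measure)}"
    using A unfolding coord_sigma_def by (subst (asm) sets_measure_of) auto
  then show ?thesis
    by (induction rule: sigma_sets.induct) (use assms(2-) in auto)
qed

text \<open>The filtration is raw, so an adapted variable is a genuine function of the path up to
  \<open>t\<close>, not just a class modulo null sets. This lets the regularity of \<open>L\<close>
  pass from one path to another that agrees with it on [0, t].\<close>

lemma Filt_agree:
  fixes f :: "path => real"
  assumes f: "f \<in> borel_measurable (Filt t)" and w: "w \<in> path_space" "w' \<in> path_space"
    and "\<And>s. 0 \<le> s ==> s \<le> t ==> w s = w' s"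
  shows "f w = f w'"
proof -
  have "f -` {f w} \<inter> path_space \<in> sets (Filt t)"
    using measurable_sets[OF f, of "{f w}"] by simp
  from coord_sigma_agree[OF this[unfolded Filt_def] w] assms show ?thesis by auto
qed

section \<open>Independence of the past and the future increments\<close>

definition cylinders :: "real set => (real => path => real) => path set set" where
  "cylinders I Y = {{w \<in> path_space. \<forall>i\<in>S. Y i w \<in> A i} |S A.
     finite S \<and> S \<subseteq> I \<and> (\<forall>i. A i \<in> sets (borel :: real measure))}"

lemma Int_stable_cylinders: "Int_stable (cylinders I Y)"
proof (rule Int_stableI)
  fix a b assume "a \<in> cylinders I Y" "b \<in> cylinders I Y"
  then obtain S A S' A' where
    a: "a = {w \<in> path_space. \<forall>i\<in>S. Y i w \<in> A i}" "finite S" "S \<subseteq> I" "\<And>i. A i \<in> sets (borel :: real measure)" and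
    b: "b = {w \<in> path_space. \<forall>i\<in>S'. Y i w \<in> A' i}" "finite S'" "S' \<subseteq> I" "\<And>i. A' i \<in> sets (borel :: real measure)"
    unfolding cylinders_def by blast
  let ?B = "\<lambda>i. (if i \<in> S then A i else UNIV) \<inter> (if i \<in> S' then A' i else UNIV)"
  have "a \<inter> b = {w \<in> path_space. \<forall>i\<in>S \<union> S'. Y i w \<in> ?B i}" unfolding a(1) b(1) by auto
  moreover have "\<forall>i. ?B i \<in> sets borel" using a(4) b(4) by auto
  ultimately show "a \<inter> b \<in> cylinders I Y"
    unfolding cylinders_def using a(2,3) b(2,3) by (intro CollectI exI[of _ "S \<union> S'"] exI[of _ ?B]) auto
qed

text \<open>Finite intersections turn the generators into a \<pi>-system without changing the
  sigma-algebra. \<open>Y\<close> is left open since this is needed both for coordinates and for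
  increments.\<close>

lemma sigma_sets_cylinders:
  "sigma_sets path_space (cylinders I Y) =
   sigma_sets path_space {{w \<in> path_space. Y i w \<in> A} |i A. i \<in> I \<and> A \<in> sets (borel :: real measure)}"
  (is "_ = sigma_sets _ ?G")
proof (rule sigma_sets_eqI)
  fix a assume "a \<in> cylinders I Y"
  then obtain S A where a: "a = {w \<in> path_space. \<forall>i\<in>S. Y i w \<in> A i}" "finite S" "S \<subseteq> I"
      "\<And>i. A i \<in> sets (borel :: real measure)"
    unfolding cylinders_def by blast
  interpret sigma_algebra path_space "sigma_sets path_space ?G"
    by (rule sigma_algebra_sigma_sets) auto
  have "{w \<in> path_space. \<forall>i\<in>S. Y i w \<in> A i} \<in> sigma_sets path_space ?G"
    using a(2) by (intro sets_Collect_finite_All) (use a in \<open>auto intro!: sigma_sets.Basic\<close>)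
  then show "a \<in> sigma_sets path_space ?G" using a(1) by simp
next
  fix b assume "b \<in> ?G"
  then obtain i A where "b = {w \<in> path_space. Y i w \<in> A}" "i \<in> I" "A \<in> sets (borel :: real measure)" by blast
  then have "b \<in> cylinders I Y"
    unfolding cylinders_def by (intro CollectI exI[of _ "{i}"] exI[of _ "\<lambda>_. A"]) auto
  then show "b \<in> sigma_sets path_space (cylinders I Y)" by (rule sigma_sets.Basic)
qed

definition future_sigma :: "real => path measure" where
  "future_sigma t = sigma path_space {{w \<in> path_space. w u - w t \<in> A} |u A. u \<in> {t..} \<and> A \<in> sets (borel :: real measure)}"

lemma space_future [simp]: "space (future_sigma t) = path_space"
  by (simp add: future_sigma_def space_measure_of_conv)

lemma increment_future: "t \<le> u ==> (\<lambda>w. w u - w t) \<in> borel_measurable (future_sigma t)"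
proof (rule measurableI)
  fix A :: "real set" assume A: "A \<in> sets borel" and u: "t \<le> u"
  have "{w \<in> path_space. w u - w t \<in> A} \<in> sets (future_sigma t)"
    unfolding future_sigma_def using A u by (subst sets_measure_of) auto
  moreover have "(\<lambda>w. w u - w t) -` A \<inter> space (future_sigma t) = {w \<in> path_space. w u - w t \<in> A}"
    by (auto simp: future_sigma_def space_measure_of_conv)
  ultimately show "(\<lambda>w. w u - w t) -` A \<inter> space (future_sigma t) \<in> sets (future_sigma t)" by simp
qed simp

lemma sets_Filt_cylinders: "sets (Filt t) = sigma_sets path_space (cylinders {0..t} (\<lambda>u w. w u))"
  unfolding Filt_def coord_sigma_def sigma_sets_cylinders by (subst sets_measure_of) auto

lemma sets_future_cylinders: "sets (future_sigma t) = sigma_sets path_space (cylinders {t..} (\<lambda>u w. w u - w t))"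
  unfolding future_sigma_def sigma_sets_cylinders by (subst sets_measure_of) auto


locale wiener_path =
  fixes P :: "path measure"
  assumes wiener: "wiener_measure P"
begin

lemma sets_P [measurable_cong]: "sets P = sets Filt_inf" using wiener by (simp add: wiener_measure_def)

lemma space_P [simp]: "space P = path_space" using sets_eq_imp_space_eq[OF sets_P] by simp

lemma brownian_P: "brownian_motion P (\<lambda>t w. w t)" using wiener by (simp add: wiener_measure_def)

sublocale prob_space P using brownian_P by (simp add: brownian_motion_def)

lemma subalgebra_Filt: "subalgebra P (Filt t)"
  using sets_Filt_le by (auto simp: subalgebra_def sets_P)

lemma measurable_Filt_P: "f \<in> measurable (Filt s) N ==> f \<in> measurable P N"
  using measurable_from_subalg[OF subalgebra_Filt] .

lemma coord_borel [measurable]: "0 \<le> t ==> (\<lambda>w. w t) \<in> borel_measurable P"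
  using brownian_P by (simp add: brownian_motion_def)

lemma start_zero: "AE w in P. w 0 = 0"
  using brownian_P by (simp add: brownian_motion_def)

lemma increments_indep:
  assumes "0 \<le> \<tau> 0" "\<And>i. i < n ==> \<tau> i \<le> \<tau> (Suc i)"
  shows "indep_vars (\<lambda>_. borel) (\<lambda>i w. w (\<tau> (Suc i)) - w (\<tau> i)) {..<n}"
  using brownian_P assms unfolding brownian_motion_def by blast

lemma future_cylinders_events: "0 \<le> t ==> cylinders {t..} (\<lambda>u w. w u - w t) \<subseteq> events"
proof
  fix b assume t: "0 \<le> t" and "b \<in> cylinders {t..} (\<lambda>u w. w u - w t)"
  then obtain S A where b: "b = {w \<in> path_space. \<forall>i\<in>S. w i - w t \<in> A i}" "finite S" "S \<subseteq> {t..}"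
    "\<And>i. A i \<in> sets (borel :: real measure)"
    unfolding cylinders_def by blast
  have "{w \<in> space P. \<forall>i\<in>S. w i - w t \<in> A i} \<in> events"
  proof (rule sets.sets_Collect_finite_All)
    fix i assume "i \<in> S"
    then have [measurable]: "(\<lambda>w. w i) \<in> borel_measurable P" "(\<lambda>w. w t) \<in> borel_measurable P"
      using b(3) t by (auto intro!: coord_borel)
    have [measurable]: "A i \<in> sets borel" by (rule b(4))
    show "{w \<in> space P. w i - w t \<in> A i} \<in> events" by measurable
  qed (rule b(2))
  then show "b \<in> events" using b(1) by simp
qed

text \<open>Brownian motion is given through independence of successive increments along one finite
  grid. So the past times, the future times, 0 and t are merged into a single sorted grid; past
  coordinates are telescoping sums of the increments before t, future increments are telescoping
  sums of those after t, and the two blocks of increments are independent.\<close>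

lemma cylinders_indep:
  assumes t: "0 \<le> t" and a0: "a \<in> cylinders {0..t} (\<lambda>u w. w u)"
    and b: "b \<in> cylinders {t..} (\<lambda>u w. w u - w t)"
  shows "prob (a \<inter> b) = prob a * prob b"
proof -
  obtain S A where a: "a = {w \<in> path_space. \<forall>u\<in>S. w u \<in> A u}" "finite S" "S \<subseteq> {0..t}"
      "\<And>u. A u \<in> sets (borel :: real measure)" using a0 unfolding cylinders_def by blast
  obtain U B where b: "b = {w \<in> path_space. \<forall>u\<in>U. w u - w t \<in> B u}" "finite U" "U \<subseteq> {t..}"
      "\<And>u. B u \<in> sets (borel :: real measure)" using b unfolding cylinders_def by blast
  have A[measurable]: "A u \<in> sets borel" "B u \<in> sets borel" for u using a(4) b(4) by auto
  define R where "R = insert 0 (insert t (S \<union> U))"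
  define xs where "xs = sorted_list_of_set R"
  have R: "finite R" "\<And>u. u \<in> R ==> 0 \<le> u" unfolding R_def using a b t by force+
  have xs: "sorted xs" "set xs = R" unfolding xs_def using R(1) by auto
  define n where "n = length xs - 1"
  have len: "length xs = Suc n" using xs(2) unfolding n_def R_def by (cases xs) auto
  \<comment> \<open>Constant beyond the last grid point, so that \<open>\<tau>\<close> is total and
    monotone.\<close>
  define \<tau> where "\<tau> i = xs ! min i n" for i
  have mono: "\<tau> i \<le> \<tau> j" if "i \<le> j" for i j
    unfolding \<tau>_def using xs(1) that len by (intro sorted_nth_mono) auto
  have "\<forall>u\<in>R. \<exists>j\<le>n. \<tau> j = u"
    unfolding \<tau>_def using xs(2) len
    by (metis in_set_conv_nth less_Suc_eq_le min.absorb1)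
  then obtain idx where idx: "\<And>u. u \<in> R ==> idx u \<le> n" "\<And>u. u \<in> R ==> \<tau> (idx u) = u" by metis
  have \<tau>R: "\<tau> i \<in> R" for i unfolding \<tau>_def using xs(2) len nth_mem[of "min i n" xs] by auto
  have \<tau>0: "\<tau> 0 = 0" using mono[of 0 "idx 0"] idx(2)[of 0] R(2)[OF \<tau>R] unfolding R_def
    by (metis insertI1 le0 order_antisym)
  define m where "m = idx t"
  have m: "m \<le> n" "\<tau> m = t" unfolding m_def using idx[of t] by (auto simp: R_def)
  \<comment> \<open>\<open>idx\<close> is an arbitrary choice of index. Clamping at \<open>m\<close>
    puts past times into the first block and future times into the second without appealing to
    distinctness of the grid points.\<close>
  define k where "k u = (if u \<le> t then min (idx u) m else max (idx u) m)" for u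
  have kS: "k u \<le> m" "\<tau> (k u) = u" if "u \<in> S" for u
  proof -
    have u: "u \<le> t" "u \<in> R" using that a(3) by (auto simp: R_def)
    then show "k u \<le> m" by (auto simp: k_def)
    show "\<tau> (k u) = u"
    proof (cases "idx u \<le> m")
      case False
      then have "\<tau> m \<le> \<tau> (idx u)" by (intro mono) auto
      then show ?thesis using u False idx(2)[OF u(2)] m by (auto simp: k_def)
    qed (use u idx in \<open>auto simp: k_def\<close>)
  qed
  have kU: "m \<le> k u" "k u \<le> n" "\<tau> (k u) = u" if "u \<in> U" for u
  proof -
    have u: "t \<le> u" "u \<in> R" using that b(3) by (auto simp: R_def)
    have *: "k u = m \<and> u = t \<or> k u = max (idx u) m \<and> u > t"
    proof (cases "u = t")
      case True then show ?thesis by (auto simp: k_def m_def)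
    qed (use u in \<open>auto simp: k_def\<close>)
    then show "m \<le> k u" by auto
    show "k u \<le> n" using * idx(1)[OF u(2)] m by auto
    show "\<tau> (k u) = u"
    proof (cases "m \<le> idx u")
      case False
      then have "\<tau> (idx u) \<le> \<tau> m" by (intro mono) auto
      then show ?thesis using * u False idx(2)[OF u(2)] m by auto
    qed (use * u idx m in auto)
  qed
  define D where "D i w = w (\<tau> (Suc i)) - w (\<tau> i)" for i and w :: path
  have ind: "indep_vars (\<lambda>_. borel) D {..<n}"
    unfolding D_def by (rule increments_indep) (use \<tau>0 mono in auto)
  have telS: "(\<Sum>i<j. D i w) = w (\<tau> j) - w 0" for j w
    unfolding D_def using sum_lessThan_telescope[of "\<lambda>i. w (\<tau> i)" j] \<tau>0 by simp
  have telU: "(\<Sum>i=m..<j. D i w) = w (\<tau> j) - w t" if "m \<le> j" for j w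
    unfolding D_def using sum_Suc_diff'[of m j "\<lambda>i. w (\<tau> i)"] m(2) that by simp
  define X where "X w = restrict (\<lambda>i. D i w) {..<m}" for w
  define Y where "Y w = restrict (\<lambda>i. D i w) {m..<n}" for w
  have XY: "indep_var (PiM {..<m} (\<lambda>_. borel)) X (PiM {m..<n} (\<lambda>_. borel)) Y"
    unfolding X_def Y_def by (rule indep_var_restrict[OF ind]) (use m in auto)
  define CA where "CA = {x \<in> space (PiM {..<m} (\<lambda>_. borel :: real measure)). \<forall>u\<in>S. (\<Sum>i<k u. x i) \<in> A u}"
  define CB where "CB = {x \<in> space (PiM {m..<n} (\<lambda>_. borel :: real measure)). \<forall>u\<in>U. (\<Sum>i=m..<k u. x i) \<in> B u}"
  have CA: "CA \<in> sets (PiM {..<m} (\<lambda>_. borel))" unfolding CA_def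
  proof (rule sets.sets_Collect_finite_All)
    fix u assume u: "u \<in> S"
    have "(\<lambda>x. \<Sum>i<k u. x i) \<in> borel_measurable (PiM {..<m} (\<lambda>_. borel :: real measure))"
      by (rule borel_measurable_sum, rule measurable_component_singleton) (use kS(1)[OF u] in auto)
    then show "{x \<in> space (PiM {..<m} (\<lambda>_. borel)). (\<Sum>i<k u. x i) \<in> A u} \<in> sets (PiM {..<m} (\<lambda>_. borel :: real measure))"
      by measurable
  qed (rule a(2))
  have CB: "CB \<in> sets (PiM {m..<n} (\<lambda>_. borel))" unfolding CB_def
  proof (rule sets.sets_Collect_finite_All)
    fix u assume u: "u \<in> U"
    have "(\<lambda>x. \<Sum>i=m..<k u. x i) \<in> borel_measurable (PiM {m..<n} (\<lambda>_. borel :: real measure))"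
      by (rule borel_measurable_sum, rule measurable_component_singleton) (use kU(2)[OF u] in auto)
    then show "{x \<in> space (PiM {m..<n} (\<lambda>_. borel)). (\<Sum>i=m..<k u. x i) \<in> B u} \<in> sets (PiM {m..<n} (\<lambda>_. borel :: real measure))"
      by measurable
  qed (rule b(2))
  have sumX: "(\<Sum>i<k u. X w i) = w u - w 0" if "u \<in> S" for u w
  proof -
    have "(\<Sum>i<k u. X w i) = (\<Sum>i<k u. D i w)" using kS(1)[OF that] by (auto simp: X_def)
    then show ?thesis using telS kS(2)[OF that] by simp
  qed
  have sumY: "(\<Sum>i=m..<k u. Y w i) = w u - w t" if "u \<in> U" for u w
  proof -
    have "(\<Sum>i=m..<k u. Y w i) = (\<Sum>i=m..<k u. D i w)" using kU(2)[OF that] by (auto simp: Y_def)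
    then show ?thesis using telU[OF kU(1)[OF that]] kU(3)[OF that] by simp
  qed
  have XA: "X w \<in> CA \<longleftrightarrow> (\<forall>u\<in>S. w u - w 0 \<in> A u)" for w
    using sumX[of _ w] by (auto simp: CA_def space_PiM X_def)
  have YB: "Y w \<in> CB \<longleftrightarrow> (\<forall>u\<in>U. w u - w t \<in> B u)" for w
    using sumY[of _ w] by (auto simp: CB_def space_PiM Y_def)
  have X: "X \<in> measurable P (PiM {..<m} (\<lambda>_. borel))" and Y: "Y \<in> measurable P (PiM {m..<n} (\<lambda>_. borel))"
    using indep_var_rv1[OF XY] indep_var_rv2[OF XY] by auto
  have ev: "X -` CA \<inter> path_space \<in> events" "Y -` CB \<inter> path_space \<in> events"
    using measurable_sets[OF X CA] measurable_sets[OF Y CB] by simp_all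
  have bY: "b = Y -` CB \<inter> path_space" unfolding b(1) using YB by auto
  have aev: "a \<in> events"
  proof -
    have "a \<in> sets (Filt t)" unfolding sets_Filt_cylinders
      by (rule sigma_sets.Basic) (rule a0)
    then show ?thesis using sets_Filt_le sets_P by blast
  qed
  \<comment> \<open>Sums of increments yield w u - w 0, while \<open>a\<close> constrains w u; the
    start at 0 makes the two agree almost surely.\<close>
  have ae: "AE w in P. w \<in> a \<longleftrightarrow> w \<in> X -` CA \<inter> path_space"
    using start_zero by eventually_elim (auto simp: a(1) XA)
  have "prob (a \<inter> b) = prob ((X -` CA \<inter> path_space) \<inter> b)"
    by (rule finite_measure_eq_AE) (use ae aev ev bY in auto)
  also have "\<dots> = prob ((\<lambda>x. (X x, Y x)) -` (CA \<times> CB) \<inter> space P)"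
    unfolding bY by (rule arg_cong[where f=prob]) auto
  also have "\<dots> = prob (X -` CA \<inter> space P) * prob (Y -` CB \<inter> space P)"
    by (rule indep_varD[OF XY CA CB])
  also have "prob (X -` CA \<inter> space P) = prob a"
    by (rule finite_measure_eq_AE) (use ae aev ev bY in auto)
  finally show ?thesis unfolding bY by simp
qed

lemma Filt_indep_future:
  assumes t: "0 \<le> t"
  shows "indep_set (sets (Filt t)) (sets (future_sigma t))"
proof -
  have sub: "cylinders {0..t} (\<lambda>u w. w u) \<subseteq> events"
    using sets_Filt_le[of t] sets_P unfolding sets_Filt_cylinders by auto
  have "indep_set (sigma_sets (space P) (cylinders {0..t} (\<lambda>u w. w u)))
        (sigma_sets (space P) (cylinders {t..} (\<lambda>u w. w u - w t)))"
    by (intro indep_set_sigma_sets indep_setI sub future_cylinders_events t cylinders_indep[OF t] Int_stable_cylinders)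
  then show ?thesis by (simp add: sets_Filt_cylinders sets_future_cylinders)
qed

lemma indep_set_mono':
  assumes "indep_set A B" "A' \<subseteq> A" "B' \<subseteq> B"
  shows "indep_set A' B'"
  using assms by (intro indep_setI) (auto dest: indep_setD indep_setD_ev1 indep_setD_ev2)

lemma indep_Filt_future:
  assumes t: "0 \<le> t" and f: "f \<in> measurable (Filt t) M1" and g: "g \<in> measurable (future_sigma t) M2"
  shows "indep_var M1 f M2 g"
  unfolding indep_var_eq
proof (intro conjI)
  show "random_variable M1 f" using measurable_Filt_P[OF f] .
  have "sets (future_sigma t) \<subseteq> events"
    using indep_setD_ev2[OF Filt_indep_future[OF t]] .
  then show "random_variable M2 g"
    using g by (auto simp: measurable_def)
  have 1: "sigma_sets (space P) {f -` A \<inter> space P |A. A \<in> sets M1} \<subseteq> sets (Filt t)"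
    using measurable_sets[OF f] sets.sigma_sets_subset[of "{f -` A \<inter> space P |A. A \<in> sets M1}" "Filt t"] by auto
  have 2: "sigma_sets (space P) {g -` A \<inter> space P |A. A \<in> sets M2} \<subseteq> sets (future_sigma t)"
    using measurable_sets[OF g] sets.sigma_sets_subset[of "{g -` A \<inter> space P |A. A \<in> sets M2}" "future_sigma t"] by auto
  show "indep_set (sigma_sets (space P) {f -` A \<inter> space P |A. A \<in> sets M1})
     (sigma_sets (space P) {g -` A \<inter> space P |A. A \<in> sets M2})"
    by (rule indep_set_mono'[OF Filt_indep_future[OF t] 1 2])
qed

text \<open>Independence in product form, with the whole path as first component. It allows Fubini
  arguments that freeze the past and average over the future.\<close>

lemma distr_Filt_future:
  assumes t: "0 \<le> t" and g: "g \<in> measurable (future_sigma t) N"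
  shows "restr_to_subalg P (Filt t) \<Otimes>\<^sub>M distr P N g = distr P (Filt t \<Otimes>\<^sub>M N) (\<lambda>w. (w, g w))"
proof (rule pair_measure_eqI)
  have fut: "sets (future_sigma t) \<subseteq> events"
    using indep_setD_ev2[OF Filt_indep_future[OF t]] .
  have g': "g \<in> measurable P N" using g fut by (auto simp: measurable_def)
  have id: "(\<lambda>w. w) \<in> measurable P (Filt t)" using measurable_Filt_P[OF measurable_ident_sets[OF refl]] .
  interpret R: prob_space "restr_to_subalg P (Filt t)"
    by (rule prob_space_restr_to_subalg[OF subalgebra_Filt prob_space_axioms])
  interpret D: prob_space "distr P N g" by (rule prob_space_distr[OF g'])
  show "sigma_finite_measure (restr_to_subalg P (Filt t))" "sigma_finite_measure (distr P N g)"
    by unfold_locales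
  show "sets (restr_to_subalg P (Filt t) \<Otimes>\<^sub>M distr P N g) = sets (distr P (Filt t \<Otimes>\<^sub>M N) (\<lambda>w. (w, g w)))"
    by (simp add: sets_restr_to_subalg[OF subalgebra_Filt] cong: sets_pair_measure_cong)
  fix A B assume "A \<in> sets (restr_to_subalg P (Filt t))" and "B \<in> sets (distr P N g)"
  then have A: "A \<in> sets (Filt t)" and B: "B \<in> sets N"
    by (simp_all add: sets_restr_to_subalg[OF subalgebra_Filt])
  have A': "A \<in> events" using A sets_Filt_le sets_P by blast
  have gB: "g -` B \<inter> path_space \<in> sets (future_sigma t)" using measurable_sets[OF g B] by simp
  have [measurable]: "(\<lambda>w. (w, g w)) \<in> measurable P (Filt t \<Otimes>\<^sub>M N)" using id g' by measurable
  have "emeasure (distr P (Filt t \<Otimes>\<^sub>M N) (\<lambda>w. (w, g w))) (A \<times> B) = emeasure P (A \<inter> (g -` B \<inter> path_space))"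
    using A B sets.sets_into_space[OF A]
    by (subst emeasure_distr) (auto intro!: arg_cong[where f="emeasure P"])
  also have "\<dots> = emeasure P A * emeasure P (g -` B \<inter> path_space)"
    using indep_setD[OF Filt_indep_future[OF t] A gB]
    by (simp add: emeasure_eq_measure ennreal_mult'')
  also have "\<dots> = emeasure (restr_to_subalg P (Filt t)) A * emeasure (distr P N g) B"
    using A B g' by (simp add: emeasure_restr_to_subalg[OF subalgebra_Filt] emeasure_distr)
  finally show "emeasure (restr_to_subalg P (Filt t)) A * emeasure (distr P N g) B =
      emeasure (distr P (Filt t \<Otimes>\<^sub>M N) (\<lambda>w. (w, g w))) (A \<times> B)" by simp
qed

end

section \<open>Pasting two paths, and localisation of almost sure statements\<close>

definition splice :: "real => path => path => path" where
  "splice t w v = restrict (\<lambda>s. if s \<le> t then w s else w t + (v s - v t)) {0..}"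

lemma splice_in_path_space:
  assumes "0 \<le> t" "w \<in> path_space" "v \<in> path_space"
  shows "splice t w v \<in> path_space"
proof -
  have w: "continuous_on {0..} w" and v: "continuous_on {0..} v"
    using assms by (auto simp: path_space_def)
  have "continuous_on ({0..t} \<union> {t..}) (\<lambda>s. if s \<le> t then w s else w t + (v s - v t))"
    by (rule continuous_on_If)
      (use assms in \<open>auto intro!: continuous_intros continuous_on_subset[OF w] continuous_on_subset[OF v]\<close>)
  moreover have "{0..t} \<union> {t..} = {0..}" using assms by auto
  ultimately have "continuous_on {0..} (splice t w v)"
    unfolding splice_def by (subst continuous_on_cong[OF refl restrict_apply']) auto
  then show ?thesis by (simp add: path_space_def splice_def)
qed

text \<open>The second path enters through its increments after t only. The pasting is therefore
  measurable for the product of the two sigma-algebras that are independent under P.\<close>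

lemma splice_measurable:
  assumes t: "0 \<le> t"
  shows "(\<lambda>(w, v). splice t w v) \<in> measurable (Filt t \<Otimes>\<^sub>M future_sigma t) Filt_inf"
  unfolding Filt_inf_def
proof (rule measurable_into_coord)
  fix x assume "x \<in> space (Filt t \<Otimes>\<^sub>M future_sigma t)"
  then show "(case x of (w, v) => splice t w v) \<in> path_space"
    using t by (auto simp: space_pair_measure intro!: splice_in_path_space)
next
  fix s :: real assume s: "s \<in> {0..}"
  show "(\<lambda>x. (case x of (w, v) => splice t w v) s) \<in> borel_measurable (Filt t \<Otimes>\<^sub>M future_sigma t)"
  proof (cases "s \<le> t")
    case True
    then have "(\<lambda>x. (case x of (w, v) => splice t w v) s) = (\<lambda>x. fst x s)"
      using s by (auto simp: splice_def)
    then show ?thesis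
      using measurable_compose[OF measurable_fst coord_measurable_Filt[of s t]] s True by simp
  next
    case False
    then have "(\<lambda>x. (case x of (w, v) => splice t w v) s) = (\<lambda>x. fst x t + (snd x s - snd x t))"
      using s by (auto simp: splice_def)
    then show ?thesis
      using measurable_compose[OF measurable_fst coord_measurable_Filt[of t t], of "future_sigma t"]
        measurable_compose[OF measurable_snd increment_future[of t s], of "Filt t"] t False by simp
  qed
qed

context wiener_path
begin

text \<open>A statement that holds almost surely under \<open>P\<close> can be localised to \<open>Filt t\<close>: almost every path
  agrees up to time \<open>t\<close> with a path for which it holds.  Unlike the original statement, the localised
  one is inherited by measures that are absolutely continuous on each \<open>Filt t\<close> only.\<close>

lemma AE_localise:
  assumes t: "0 \<le> t" and A: "A \<in> sets Filt_inf" "AE w in P. w \<in> A"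
  shows "\<exists>G\<in>sets (Filt t). (AE w in P. w \<in> G) \<and> (\<forall>w\<in>G. \<exists>w'\<in>A. \<forall>s\<in>{0..t}. w s = w' s)"
proof -
  let ?R = "restr_to_subalg P (Filt t)" and ?D = "distr P (future_sigma t) (\<lambda>w. w)"
  have fut: "sets (future_sigma t) \<subseteq> events"
    using indep_setD_ev2[OF Filt_indep_future[OF t]] .
  have id: "(\<lambda>w. w) \<in> measurable (future_sigma t) (future_sigma t)" by simp
  have id': "(\<lambda>w. w) \<in> measurable P (future_sigma t)" using fut by (auto simp: measurable_def)
  have id2: "(\<lambda>w. w) \<in> measurable P (Filt t)" using measurable_Filt_P[OF measurable_ident_sets[OF refl]] .
  interpret R: prob_space ?R
    by (rule prob_space_restr_to_subalg[OF subalgebra_Filt prob_space_axioms])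
  interpret D: prob_space ?D by (rule prob_space_distr[OF id'])
  interpret pair_sigma_finite ?R ?D ..
  note eq = distr_Filt_future[OF t id]
  have m: "(\<lambda>w. (w, w)) \<in> measurable P (Filt t \<Otimes>\<^sub>M future_sigma t)" using id' id2 by measurable
  have sm: "{x \<in> space (Filt t \<Otimes>\<^sub>M future_sigma t). (case x of (w, v) => splice t w v) \<in> A} \<in> sets (Filt t \<Otimes>\<^sub>M future_sigma t)"
    using measurable_sets[OF splice_measurable[OF t] A(1)]
    by (rule back_subst[where P="\<lambda>x. x \<in> _"]) auto
  have self: "splice t w w = w" if "w \<in> path_space" for w
    using that by (auto simp: splice_def path_space_def extensional_def fun_eq_iff)
  \<comment> \<open>The pair (w, w) has the product law, and pasting w to itself gives w back. Hence
    a path pasted from two independent ones lies in \<open>A\<close> as surely as w does.\<close>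
  have "AE x in ?R \<Otimes>\<^sub>M ?D. (case x of (w, v) => splice t w v) \<in> A"
    unfolding eq
  proof (subst AE_distr_iff[OF m sm])
    show "AE w in P. (case (w, w) of (w, v) => splice t w v) \<in> A"
      using A(2) AE_space[of P]
    proof eventually_elim
      case (elim w)
      then show ?case by (simp add: self)
    qed
  qed
  from AE_pair[OF this] have "AE w in ?R. AE v in ?D. splice t w v \<in> A" by simp
  then obtain N where N: "\<And>w. w \<in> space ?R - N ==> AE v in ?D. splice t w v \<in> A" "N \<in> null_sets ?R"
    using AE_E3 by blast
  have N': "N \<in> null_sets P" "N \<in> sets (Filt t)"
    using N(2) null_sets_restr_to_subalg[OF subalgebra_Filt] by auto
  show ?thesis
  proof (intro bexI[of _ "path_space - N"] conjI ballI)
    show "path_space - N \<in> sets (Filt t)" using N'(2) sets.compl_sets[of N "Filt t"] by simp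
    show "AE w in P. w \<in> path_space - N"
      using AE_not_in[OF N'(1)] AE_space by eventually_elim simp
    fix w assume w: "w \<in> path_space - N"
    then have "AE v in ?D. splice t w v \<in> A" using N(1)[of w] by (simp add: space_restr_to_subalg)
    \<comment> \<open>A property that holds almost surely for a probability measure holds somewhere;
      a single continuation \<open>v\<close> suffices.\<close>
    then obtain v where "splice t w v \<in> A"
      using D.AE_contr by (metis (mono_tags, lifting) AE_mp AE_I2)
    moreover have "w s = splice t w v s" if "s \<in> {0..t}" for s
      using that by (simp add: splice_def)
    ultimately show "\<exists>w'\<in>A. \<forall>s\<in>{0..t}. w s = w' s" by blast
  qed
qed

section \<open>Gaussian estimates for increments\<close>

lemma increment_normal:
  assumes "0 \<le> s" "s < t"
  shows "distributed P lborel (\<lambda>w. w t - w s) (normal_density 0 (sqrt (t - s)))"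
  using brownian_P assms unfolding brownian_motion_def by blast

lemma integral_increment:
  fixes g :: "real => real"
  assumes "0 \<le> s" "s < t" "g \<in> borel_measurable borel"
  shows "(LINT w|P. g (w t - w s)) = (LINT x|lborel. normal_density 0 (sqrt (t - s)) x * g x)"
  using distributed_integral[OF increment_normal[OF assms(1,2)], of g] assms(3) by simp

lemma integrable_increment:
  fixes g :: "real => real"
  assumes "0 \<le> s" "s < t" "g \<in> borel_measurable borel"
  shows "integrable P (\<lambda>w. g (w t - w s)) \<longleftrightarrow> integrable lborel (\<lambda>x. normal_density 0 (sqrt (t - s)) x * g x)"
  using distributed_integrable[OF increment_normal[OF assms(1,2)], of g] assms(3) by simp

text \<open>The second moment is the quadratic variation over one step. The fourth controls squared
  increments on the event that they are large.\<close>

lemma increment_moments: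
  assumes "0 \<le> s" "s \<le> t"
  shows "integrable P (\<lambda>w. (w t - w s) ^ k)"
    and "(LINT w|P. w t - w s) = 0"
    and "(LINT w|P. (w t - w s)\<^sup>2) = t - s"
    and "(LINT w|P. (w t - w s) ^ 4) = 3 * (t - s)\<^sup>2"
proof -
  have "integrable P (\<lambda>w. (w t - w s) ^ k) \<and> (LINT w|P. w t - w s) = 0 \<and>
    (LINT w|P. (w t - w s)\<^sup>2) = t - s \<and> (LINT w|P. (w t - w s) ^ 4) = 3 * (t - s)\<^sup>2"
  proof (cases "s < t")
    case True
    let ?\<sigma> = "sqrt (t - s)"
    have \<sigma>: "0 < ?\<sigma>" using True by simp
    have 1: "integrable P (\<lambda>w. (w t - w s) ^ k)"
      by (subst integrable_increment[OF assms(1) True]) (use integrable_normal_moment[OF \<sigma>, of 0 k] in simp_all)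
    have 2: "(LINT w|P. w t - w s) = 0"
      by (subst integral_increment[OF assms(1) True]) (use integral_normal_moment_nz_1[OF \<sigma>, of 0] in simp_all)
    have 3: "(LINT w|P. (w t - w s)\<^sup>2) = t - s"
      by (subst integral_increment[OF assms(1) True])
        (use integral_normal_moment_even[OF \<sigma>, of 0 1] True in \<open>simp_all add: fact_numeral\<close>)
    have 4: "(LINT w|P. (w t - w s) ^ 4) = 3 * (t - s)\<^sup>2"
    proof (subst integral_increment[OF assms(1) True])
      have "?\<sigma> ^ 4 = (t - s)\<^sup>2" using True by (metis power2_eq_square power4_eq_xxxx real_sqrt_pow2 less_eq_real_def diff_gt_0_iff_gt mult.assoc)
      moreover have "(fact 4 :: real) = 24" "(fact 2 :: real) = 2" by (simp_all add: fact_numeral)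
      ultimately show "(LINT x|lborel. normal_density 0 (sqrt (t - s)) x * x ^ 4) = 3 * (t - s)\<^sup>2"
        using integral_normal_moment_even[OF \<sigma>, of 0 2] True by (simp add: field_simps)
    qed simp
    from 1 2 3 4 show ?thesis by blast
  next
    case False
    then have "t = s" using assms by simp
    then show ?thesis by (cases k) simp_all
  qed
  then show "integrable P (\<lambda>w. (w t - w s) ^ k)"
    and "(LINT w|P. w t - w s) = 0"
    and "(LINT w|P. (w t - w s)\<^sup>2) = t - s"
    and "(LINT w|P. (w t - w s) ^ 4) = 3 * (t - s)\<^sup>2" by blast+
qed

lemma increment_char:
  assumes "0 \<le> s" "s \<le> t"
  shows "(LINT w|P. iexp (\<theta> * (w t - w s))) = exp (- (of_real (\<theta>\<^sup>2 * (t - s) / 2)))"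
proof (cases "s < t")
  case True
  let ?\<sigma> = "sqrt (t - s)"
  have \<sigma>: "0 < ?\<sigma>" using True by simp
  have [measurable]: "(\<lambda>w. w t) \<in> borel_measurable P" "(\<lambda>w. w s) \<in> borel_measurable P"
    using assms by auto
  have d: "distributed P lborel (\<lambda>w. (w t - w s - 0) / ?\<sigma>) std_normal_density"
    using normal_standard_normal_convert[OF \<sigma>, of "\<lambda>w. w t - w s" 0] increment_normal[OF assms(1) True] by simp
  have "distr P borel (\<lambda>w. (w t - w s) / ?\<sigma>) = std_normal_distribution"
    using distributed_distr_eq_density[OF d] by (simp cong: distr_cong)
  then have "char (distr P borel (\<lambda>w. (w t - w s) / ?\<sigma>)) (\<theta> * ?\<sigma>) = of_real (exp (- (\<theta> * ?\<sigma>)\<^sup>2 / 2))"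
    by (simp add: char_std_normal_distribution)
  also have "char (distr P borel (\<lambda>w. (w t - w s) / ?\<sigma>)) (\<theta> * ?\<sigma>) = (LINT w|P. iexp (\<theta> * (w t - w s)))"
    unfolding char_def by (subst integral_distr) (use \<sigma> in auto)
  finally show ?thesis using True by (simp add: power_mult_distrib exp_of_real[symmetric])
next
  case False
  then have "t = s" using assms by simp
  then show ?thesis using prob_space by simp
qed

lemma indep_product_complex:
  fixes V :: "path => complex" and g :: "real => complex"
  assumes s: "0 \<le> s" "s \<le> t" and V: "V \<in> borel_measurable (Filt s)" "integrable P V"
    and g: "g \<in> borel_measurable borel" "integrable P (\<lambda>w. g (w t - w s))"
  shows "integrable P (\<lambda>w. V w * g (w t - w s))"
    and "(LINT w|P. V w * g (w t - w s)) = (LINT w|P. V w) * (LINT w|P. g (w t - w s))"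
proof -
  have ind: "indep_var borel V borel (\<lambda>w. g (w t - w s))"
    by (rule indep_Filt_future[OF s(1) V(1)]) (rule measurable_compose[OF increment_future[OF s(2)] g(1)])
  show "integrable P (\<lambda>w. V w * g (w t - w s))"
    by (rule indep_var_integrable[OF ind V(2) g(2)])
  show "(LINT w|P. V w * g (w t - w s)) = (LINT w|P. V w) * (LINT w|P. g (w t - w s))"
    by (rule indep_var_lebesgue_integral[OF ind V(2) g(2)])
qed

lemma indep_product_real:
  fixes V :: "path => real" and g :: "real => real"
  assumes s: "0 \<le> s" "s \<le> t" and V: "V \<in> borel_measurable (Filt s)" "integrable P V"
    and g: "g \<in> borel_measurable borel" "integrable P (\<lambda>w. g (w t - w s))"
  shows "integrable P (\<lambda>w. V w * g (w t - w s))"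
    and "(LINT w|P. V w * g (w t - w s)) = (LINT w|P. V w) * (LINT w|P. g (w t - w s))"
proof -
  have ind: "indep_var borel V borel (\<lambda>w. g (w t - w s))"
    by (rule indep_Filt_future[OF s(1) V(1)]) (rule measurable_compose[OF increment_future[OF s(2)] g(1)])
  show "integrable P (\<lambda>w. V w * g (w t - w s))"
    by (rule indep_var_integrable[OF ind V(2) g(2)])
  show "(LINT w|P. V w * g (w t - w s)) = (LINT w|P. V w) * (LINT w|P. g (w t - w s))"
    by (rule indep_var_lebesgue_integral[OF ind V(2) g(2)])
qed

lemma coord_moments:
  assumes "0 \<le> t"
  shows "integrable P (\<lambda>w. w t)" "integrable P (\<lambda>w. (w t)\<^sup>2)" "(LINT w|P. (w t)\<^sup>2) = t"
proof -
  have [measurable]: "(\<lambda>w. w t) \<in> borel_measurable P" "(\<lambda>w. w 0) \<in> borel_measurable P" using assms by auto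
  have ae: "AE w in P. (w t - w 0) ^ k = w t ^ k" for k
    using start_zero by eventually_elim simp
  show "integrable P (\<lambda>w. w t)"
    using integrable_cong_AE[THEN iffD1, OF _ _ ae increment_moments(1)[of 0 t 1]] assms by simp
  show "integrable P (\<lambda>w. (w t)\<^sup>2)"
    by (rule integrable_cong_AE[THEN iffD1, OF _ _ ae increment_moments(1)[of 0 t 2]]) (use assms in auto)
  have "(LINT w|P. (w t)\<^sup>2) = (LINT w|P. (w t - w 0)\<^sup>2)"
    by (rule integral_cong_AE) (use ae[of 2] in auto)
  then show "(LINT w|P. (w t)\<^sup>2) = t" using increment_moments(3)[of 0 t] assms by simp
qed

text \<open>The normal density is at most 1 / sqrt(2 \<pi> (t - s)), the interval has length 2
  \<eta>, and 2 \<le> sqrt(2 \<pi>) absorbs the constant.\<close>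

lemma small_ball_increment:
  assumes s: "0 \<le> s" "s < t" and \<eta>: "0 \<le> \<eta>"
  shows "prob {w \<in> path_space. \<bar>w t - w s\<bar> \<le> \<eta>} \<le> \<eta> / sqrt (t - s)"
proof -
  have [measurable]: "(\<lambda>w. w t) \<in> borel_measurable P" "(\<lambda>w. w s) \<in> borel_measurable P" using s by auto
  have "prob {w \<in> space P. \<bar>w t - w s\<bar> \<le> \<eta>} = (LINT w|P. indicator {-\<eta>..\<eta>} (w t - w s))"
  proof -
    have "(LINT w|P. indicator {-\<eta>..\<eta>} (w t - w s)) = (\<integral>w. indicator {w \<in> space P. \<bar>w t - w s\<bar> \<le> \<eta>} w \<partial>P :: real)"
      by (rule Bochner_Integration.integral_cong) (auto simp: indicator_def abs_le_iff)
    then show ?thesis by (simp add: Int_absorb2)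
  qed
  also have "\<dots> = (LINT x|lborel. normal_density 0 (sqrt (t - s)) x * indicator {-\<eta>..\<eta>} x)"
    by (subst integral_increment) (use s in auto)
  also have "\<dots> \<le> (LINT x|lborel. (1 / sqrt (2 * pi * (t - s))) * indicator {-\<eta>..\<eta>} x)"
  proof (rule integral_mono)
    show "integrable lborel (\<lambda>x. normal_density 0 (sqrt (t - s)) x * indicator {- \<eta>..\<eta>} x)"
      by (rule Bochner_Integration.integrable_bound[OF integrable_normal_density[of "sqrt (t - s)" 0]]) (use s in \<open>auto simp: indicator_def\<close>)
    show "integrable lborel (\<lambda>x. (1 / sqrt (2 * pi * (t - s))) * indicator {-\<eta>..\<eta>} x :: real)"
      by (intro integrable_mult_right integrable_real_indicator) (simp_all add: emeasure_lborel_Icc_eq)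
    fix x show "normal_density 0 (sqrt (t - s)) x * indicator {- \<eta>..\<eta>} x \<le> (1 / sqrt (2 * pi * (t - s))) * indicator {-\<eta>..\<eta>} x"
      using s by (auto simp: normal_density_def indicator_def mult_left_le divide_right_mono)
  qed
  also have "\<dots> = 2 * \<eta> / sqrt (2 * pi * (t - s))" using \<eta> by simp
  also have "\<dots> \<le> \<eta> / sqrt (t - s)"
  proof -
    have "2 = sqrt 4" by simp
    also have "\<dots> \<le> sqrt (2 * pi)" using pi_gt3 by (intro real_sqrt_le_mono) simp
    finally have "2 / sqrt (2 * pi) \<le> 1" by simp
    then have "2 / sqrt (2 * pi) * (\<eta> / sqrt (t - s)) \<le> 1 * (\<eta> / sqrt (t - s))"
      by (rule mult_right_mono) (use \<eta> s in auto)
    then show ?thesis by (simp add: real_sqrt_mult)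
  qed
  finally show ?thesis by simp
qed

lemma small_ball:
  assumes t: "0 < t" and \<eta>: "0 \<le> \<eta>"
  shows "prob {w \<in> path_space. \<bar>w t\<bar> \<le> \<eta>} \<le> \<eta> / sqrt t"
proof -
  have [measurable]: "(\<lambda>w. w t) \<in> borel_measurable P" "(\<lambda>w. w 0) \<in> borel_measurable P" using t by auto
  have "prob {w \<in> space P. \<bar>w t\<bar> \<le> \<eta>} = prob {w \<in> space P. \<bar>w t - w 0\<bar> \<le> \<eta>}"
  proof (rule finite_measure_eq_AE)
    show "AE w in P. (w \<in> {w \<in> space P. \<bar>w t\<bar> \<le> \<eta>}) = (w \<in> {w \<in> space P. \<bar>w t - w 0\<bar> \<le> \<eta>})"
      using start_zero by eventually_elim simp
  qed measurable
  then show ?thesis using small_ball_increment[of 0 t \<eta>] assms by simp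
qed

lemma increment_symmetric:
  fixes g :: "real => real"
  assumes "0 \<le> s" "s \<le> t" and g: "g \<in> borel_measurable borel"
  shows "(LINT w|P. g (- (w t - w s))) = (LINT w|P. g (w t - w s))"
proof (cases "s < t")
  case True
  have "(LINT w|P. g (- (w t - w s))) = (LINT x|lborel. normal_density 0 (sqrt (t - s)) x * g (- x))"
    using g by (subst integral_increment[OF assms(1) True, of "\<lambda>x. g (- x)"]) auto
  also have "\<dots> = (LINT x|lborel. normal_density 0 (sqrt (t - s)) x * g x)"
    by (subst (2) lborel_integral_real_affine[of "-1" _ 0]) (auto simp: normal_density_def)
  also have "\<dots> = (LINT w|P. g (w t - w s))" using g by (subst integral_increment[OF assms(1) True]) auto
  finally show ?thesis .
next
  case False
  then have "t = s" using assms by simp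
  then show ?thesis by simp
qed

lemma coord_nonzero:
  assumes t: "0 < t"
  shows "AE w in P. w t \<noteq> 0"
proof -
  have [measurable]: "(\<lambda>w. w t) \<in> borel_measurable P" using t by auto
  have ev: "{w \<in> space P. w t = 0} \<in> events" by measurable
  have "prob {w \<in> path_space. \<bar>w t\<bar> \<le> 0} \<le> 0" using small_ball[OF t, of 0] by simp
  then have "prob {w \<in> space P. w t = 0} = 0" using measure_nonneg by (simp add: order_antisym)
  then show ?thesis using prob_Collect_eq_0[of "\<lambda>w. w t = 0"] ev by simp
qed

text \<open>If |w s| \<le> \<eta>, independence gives the small ball probability at time s times t -
  s. Otherwise the increment exceeds \<eta> in absolute value, and its square is at most its fourth
  power divided by \<eta>^2. The free parameter \<eta> is optimised when these bounds are summed
  over a grid.\<close>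

lemma crossing_bound:
  assumes s: "0 < s" "s \<le> t" and \<eta>: "0 < \<eta>"
  shows "(LINT w|P. (w t - w s)\<^sup>2 * indicator {w. \<bar>w s\<bar> \<le> \<bar>w t - w s\<bar>} w)
      \<le> (t - s) * (\<eta> / sqrt s) + 3 * (t - s)\<^sup>2 / \<eta>\<^sup>2"
proof -
  have [measurable]: "(\<lambda>w. w t) \<in> borel_measurable P" "(\<lambda>w. w s) \<in> borel_measurable P" using s by auto
  define J where "J w = (indicator {-\<eta>..\<eta>} (w s) :: real)" for w :: path
  have J: "J \<in> borel_measurable (Filt s)"
    unfolding J_def using coord_measurable_Filt[of s s] s by simp
  have [measurable]: "J \<in> borel_measurable P" using measurable_Filt_P[OF J] .
  have Ji: "integrable P J" by (rule integrable_const_bound[of _ 1]) (auto simp: J_def)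
  have J2: "(LINT w|P. J w) \<le> \<eta> / sqrt s"
  proof -
    have "(LINT w|P. J w) = (LINT w|P. indicator {w \<in> space P. \<bar>w s\<bar> \<le> \<eta>} w)"
      by (rule Bochner_Integration.integral_cong) (auto simp: J_def indicator_def abs_le_iff)
    then show ?thesis using small_ball[OF s(1), of \<eta>] \<eta> by (simp add: Int_absorb2)
  qed
  have i2: "integrable P (\<lambda>w. (w t - w s)\<^sup>2)" "integrable P (\<lambda>w. (w t - w s) ^ 4)"
    using increment_moments(1)[of s t] s by auto
  note JX = indep_product_real[of s t J "\<lambda>x. x\<^sup>2"]
  have "(LINT w|P. (w t - w s)\<^sup>2 * indicator {w. \<bar>w s\<bar> \<le> \<bar>w t - w s\<bar>} w)
     \<le> (LINT w|P. J w * (w t - w s)\<^sup>2 + (w t - w s) ^ 4 / \<eta>\<^sup>2)"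
  proof (rule integral_mono)
    show "integrable P (\<lambda>w. (w t - w s)\<^sup>2 * indicator {w. \<bar>w s\<bar> \<le> \<bar>w t - w s\<bar>} w)"
    proof (rule Bochner_Integration.integrable_bound[OF i2(1)])
      have "(\<lambda>w. (w t - w s)\<^sup>2 * (if \<bar>w s\<bar> \<le> \<bar>w t - w s\<bar> then 1 else 0)) \<in> borel_measurable P" by measurable
      then show "(\<lambda>w. (w t - w s)\<^sup>2 * indicator {w. \<bar>w s\<bar> \<le> \<bar>w t - w s\<bar>} w) \<in> borel_measurable P"
        by (simp add: indicator_def of_bool_def)
    qed (auto simp: indicator_def)
    show "integrable P (\<lambda>w. J w * (w t - w s)\<^sup>2 + (w t - w s) ^ 4 / \<eta>\<^sup>2)"
      using JX(1) J Ji s i2 by auto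
    fix w :: path
    show "(w t - w s)\<^sup>2 * indicator {w. \<bar>w s\<bar> \<le> \<bar>w t - w s\<bar>} w \<le> J w * (w t - w s)\<^sup>2 + (w t - w s) ^ 4 / \<eta>\<^sup>2"
    proof (cases "\<bar>w s\<bar> \<le> \<bar>w t - w s\<bar> \<and> \<not> \<bar>w s\<bar> \<le> \<eta>")
      case True
      then have "\<eta> \<le> \<bar>w t - w s\<bar>" by auto
      then have "\<eta>\<^sup>2 \<le> (w t - w s)\<^sup>2" using \<eta> power_mono[of \<eta> "\<bar>w t - w s\<bar>" 2] by simp
      then have "(w t - w s)\<^sup>2 * \<eta>\<^sup>2 \<le> (w t - w s)\<^sup>2 * (w t - w s)\<^sup>2" by (intro mult_left_mono) auto
      then have "(w t - w s)\<^sup>2 \<le> (w t - w s) ^ 4 / \<eta>\<^sup>2" using \<eta>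
        by (simp add: field_simps power4_eq_xxxx power2_eq_square)
      then show ?thesis using True by (auto simp: indicator_def J_def)
    next
      case False
      have "0 \<le> (w t - w s) ^ 4 / \<eta>\<^sup>2" by (intro divide_nonneg_nonneg) (auto simp: zero_le_even_power)
      then show ?thesis using False by (auto simp: indicator_def J_def abs_le_iff)
    qed
  qed
  also have "\<dots> = (LINT w|P. J w * (w t - w s)\<^sup>2) + (LINT w|P. (w t - w s) ^ 4 / \<eta>\<^sup>2)"
    by (rule Bochner_Integration.integral_add) (use JX(1) J Ji s i2 in auto)
  also have "(LINT w|P. J w * (w t - w s)\<^sup>2) = (LINT w|P. J w) * (t - s)"
    using JX(2) J Ji s i2 increment_moments(3)[of s t] by simp
  also have "(LINT w|P. (w t - w s) ^ 4 / \<eta>\<^sup>2) = 3 * (t - s)\<^sup>2 / \<eta>\<^sup>2"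
    using increment_moments(4)[of s t] s by simp
  finally show ?thesis using mult_right_mono[OF J2, of "t - s"] s by (simp add: mult.commute)
qed

end

section \<open>Local time and crossings of the origin\<close>

locale wiener_local_time = wiener_path +
  fixes L :: "real => path => real"
  assumes L_meas: "0 \<le> t ==> L t \<in> borel_measurable (Filt t)"
    and L_nonneg: "0 \<le> t ==> w \<in> path_space ==> 0 \<le> L t w"
    and L_regular: "AE w in P. L 0 w = 0 \<and> continuous_on {0..} (\<lambda>t. L t w) \<and> mono_on {0..} (\<lambda>t. L t w)"
    and tanaka: "path_martingale P (\<lambda>t w. \<bar>w t\<bar> - L t w)"
begin

lemma L_borel [measurable]: "0 \<le> t ==> L t \<in> borel_measurable P"
  using measurable_Filt_P[OF L_meas] .

lemma L_Filt: "0 \<le> s ==> s \<le> t ==> L s \<in> borel_measurable (Filt t)"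
  using measurable_Filt_mono[OF L_meas] .

lemma L_integrable: "0 \<le> t ==> integrable P (L t)"
proof -
  assume t: "0 \<le> t"
  then have "integrable P (\<lambda>w. \<bar>w t\<bar> - L t w)" using tanaka unfolding path_martingale_def by blast
  from Bochner_Integration.integrable_diff[OF integrable_abs[OF coord_moments(1)[OF t]] this]
  show ?thesis by simp
qed

lemma L_mono: "0 \<le> s ==> s \<le> t ==> AE w in P. L s w \<le> L t w"
  using L_regular
proof (eventually_elim)
  case (elim w)
  then show "0 \<le> s ==> s \<le> t ==> L s w \<le> L t w"
    using mono_onD[of "{0..}" "\<lambda>t. L t w" s t] by simp
qed

text \<open>The martingale property in weak form: tested against a bounded weight from the past, |X|
  and L have the same mean increment.\<close>

lemma tanaka_real:
  assumes st: "0 \<le> s" "s \<le> t" and J: "J \<in> borel_measurable (Filt s)" "\<And>w. \<bar>J w\<bar> \<le> B"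
  shows "(LINT w|P. J w * (\<bar>w t\<bar> - \<bar>w s\<bar>)) = (LINT w|P. J w * (L t w - L s w))"
proof -
  have t: "0 \<le> t" using st by simp
  define Y where "Y t w = \<bar>w t\<bar> - L t w" for t and w :: path
  have [measurable]: "J \<in> borel_measurable P" using measurable_Filt_P[OF J(1)] .
  have mult: "integrable P (\<lambda>w. J w * Z w)" if "integrable P Z" for Z :: "path => real"
  proof (rule Bochner_Integration.integrable_bound[OF integrable_mult_right[OF that, of B]])
    show "(\<lambda>w. J w * Z w) \<in> borel_measurable P" using that by measurable
    show "AE w in P. norm (J w * Z w) \<le> norm (B * Z w)"
    proof (rule AE_I2)
      fix w show "norm (J w * Z w) \<le> norm (B * Z w)"
        using mult_right_mono[OF J(2)[of w], of "\<bar>Z w\<bar>"] J(2)[of w] by (simp add: abs_mult)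
    qed
  qed
  have iY: "integrable P (Y u)" if "0 \<le> u" for u
    unfolding Y_def by (intro Bochner_Integration.integrable_diff integrable_abs coord_moments(1) L_integrable that)
  interpret F: finite_measure_subalgebra P "Filt s"
    by unfold_locales (rule subalgebra_Filt)
  have ce: "AE w in P. real_cond_exp P (Filt s) (Y t) w = Y s w"
    using tanaka st unfolding path_martingale_def Y_def by blast
  have "(LINT w|P. J w * Y t w) = (LINT w|P. J w * real_cond_exp P (Filt s) (Y t) w)"
    by (rule F.real_cond_exp_intg(2)[symmetric]) (use mult[OF iY[OF t]] J(1) iY[OF t] in auto)
  also have "\<dots> = (LINT w|P. J w * Y s w)"
    by (rule integral_cong_AE) (use ce iY[OF st(1)] in auto)
  finally have "(LINT w|P. J w * Y t w - J w * Y s w) = 0"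
    using mult[OF iY[OF t]] mult[OF iY[OF st(1)]] by simp
  moreover have "J w * Y t w - J w * Y s w = J w * (\<bar>w t\<bar> - \<bar>w s\<bar>) - J w * (L t w - L s w)" for w
    by (simp add: Y_def algebra_simps)
  moreover have "integrable P (\<lambda>w. J w * (\<bar>w t\<bar> - \<bar>w s\<bar>))" "integrable P (\<lambda>w. J w * (L t w - L s w))"
    by (intro mult Bochner_Integration.integrable_diff integrable_abs coord_moments(1) L_integrable st t)+
  ultimately show ?thesis by simp
qed

end

lemma (in prob_space) integrable_bounded_mult:
  fixes V Z :: "'a => complex"
  assumes "V \<in> borel_measurable M" "\<And>w. w \<in> space M ==> cmod (V w) \<le> B" "integrable M Z"
  shows "integrable M (\<lambda>w. V w * Z w)"
proof (rule Bochner_Integration.integrable_bound[OF integrable_mult_right[OF assms(3), of "complex_of_real B"]])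
  show "(\<lambda>w. V w * Z w) \<in> borel_measurable M" using assms by measurable
  show "AE w in M. cmod (V w * Z w) \<le> cmod (complex_of_real B * Z w)"
  proof (rule AE_I2)
    fix w assume w: "w \<in> space M"
    show "cmod (V w * Z w) \<le> cmod (complex_of_real B * Z w)"
      using mult_right_mono[of "cmod (V w)" "\<bar>B\<bar>" "cmod (Z w)"] assms(2)[OF w] by (simp add: norm_mult)
  qed
qed

lemma integral_complex_split:
  fixes V :: "'a => complex" and Z :: "'a => real"
  assumes "integrable M (\<lambda>w. V w * of_real (Z w))"
  shows "(LINT w|M. V w * of_real (Z w)) = Complex (LINT w|M. Re (V w) * Z w) (LINT w|M. Im (V w) * Z w)"
  using integral_Re[OF assms] integral_Im[OF assms] by (simp add: complex_eq_iff)

context wiener_local_time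
begin

lemma tanaka_complex:
  assumes st: "0 \<le> s" "s \<le> t" and V: "V \<in> borel_measurable (Filt s)" "\<And>w. cmod (V w) \<le> B"
  shows "(LINT w|P. V w * of_real (\<bar>w t\<bar> - \<bar>w s\<bar>)) = (LINT w|P. V w * of_real (L t w - L s w))"
proof -
  have t: "0 \<le> t" using st by simp
  have V': "V \<in> borel_measurable P" using measurable_Filt_P[OF V(1)] .
  have i: "integrable P (\<lambda>w. V w * of_real (\<bar>w t\<bar> - \<bar>w s\<bar>))" "integrable P (\<lambda>w. V w * of_real (L t w - L s w))"
    by (intro integrable_bounded_mult[OF V' V(2)] integrable_of_real Bochner_Integration.integrable_diff
        integrable_abs coord_moments(1) L_integrable st t)+
  have "\<bar>Re (V w)\<bar> \<le> B" "\<bar>Im (V w)\<bar> \<le> B" for w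
    using abs_Re_le_cmod[of "V w"] abs_Im_le_cmod[of "V w"] V(2)[of w] by linarith+
  moreover have "(\<lambda>w. Re (V w)) \<in> borel_measurable (Filt s)" "(\<lambda>w. Im (V w)) \<in> borel_measurable (Filt s)"
    using V(1) by measurable
  ultimately show ?thesis
    using tanaka_real[OF st, of "\<lambda>w. Re (V w)" B] tanaka_real[OF st, of "\<lambda>w. Im (V w)" B]
    unfolding integral_complex_split[OF i(1)] integral_complex_split[OF i(2)] by simp
qed

end

text \<open>The squared increment restricted to an event that contains every change of sign between
  s and t. Summed over a grid, squared increments converge to the length of the interval; these
  restricted ones vanish, because the path is rarely that close to the origin.\<close>

definition crossing :: "real => real => path => real" where
  "crossing s t w = (w t - w s)\<^sup>2 * indicator {w. \<bar>w s\<bar> \<le> \<bar>w t - w s\<bar>} w"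

lemma sgn_change:
  fixes x y :: real
  assumes "sgn x \<noteq> sgn y"
  shows "\<bar>x\<bar> \<le> \<bar>y - x\<bar>" "\<bar>y\<bar> \<le> \<bar>y - x\<bar>"
  using assms by (auto simp: sgn_if split: if_splits)

lemma sgn_diff_le: "\<bar>sgn x - sgn y\<bar> \<le> (2::real)"
  by (auto simp: sgn_if)

text \<open>A discrete Tanaka formula: the first term is a martingale increment, the second differs
  from 0 only when the sign changes and stands for the growth of the local time.\<close>

lemma abs_increment: "\<bar>y\<bar> - \<bar>x\<bar> = sgn x * (y - x) + (sgn y - sgn x) * (y::real)"
  by (auto simp: sgn_if)

context wiener_path
begin

lemma crossing_nonneg: "0 \<le> crossing s t w"
  by (simp add: crossing_def)

lemma crossing_integrable:
  assumes "0 \<le> s" "s \<le> t"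
  shows "integrable P (crossing s t)"
proof (rule Bochner_Integration.integrable_bound[OF increment_moments(1)[OF assms, of 2]])
  have [measurable]: "(\<lambda>w. w t) \<in> borel_measurable P" "(\<lambda>w. w s) \<in> borel_measurable P" using assms by auto
  have "(\<lambda>w. (w t - w s)\<^sup>2 * (if \<bar>w s\<bar> \<le> \<bar>w t - w s\<bar> then 1 else 0)) \<in> borel_measurable P" by measurable
  then show "crossing s t \<in> borel_measurable P"
    by (simp add: crossing_def[abs_def] indicator_def of_bool_def)
qed (auto simp: crossing_def indicator_def)

lemma crossing_le: "0 \<le> s ==> s \<le> t ==> (LINT w|P. crossing s t w) \<le> t - s"
  unfolding increment_moments(3)[symmetric]
  by (rule integral_mono[OF crossing_integrable]) (auto simp: increment_moments(1) crossing_def indicator_def)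

end

section \<open>Equidistant grids and the sum of the crossing terms\<close>

definition grid :: "real => real => nat => nat => real" where
  "grid r t n i = r + real i * ((t - r) / real n)"

lemma grid_0 [simp]: "grid r t n 0 = r" by (simp add: grid_def)

lemma grid_n: "0 < n ==> grid r t n n = t" by (simp add: grid_def)

lemma grid_step: "grid r t n (Suc i) - grid r t n i = (t - r) / real n"
  by (simp add: grid_def algebra_simps add_divide_distrib diff_divide_distrib)

lemma grid_mono: "r \<le> t ==> i \<le> j ==> grid r t n i \<le> grid r t n j"
  unfolding grid_def by (intro add_left_mono mult_right_mono divide_nonneg_nonneg) auto

lemma grid_bounds:
  assumes "r \<le> t" "i \<le> n"
  shows "r \<le> grid r t n i" "grid r t n i \<le> t"
proof -
  show "r \<le> grid r t n i" using grid_mono[OF assms(1), of 0 i n] by simp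
  show "grid r t n i \<le> t"
    using grid_mono[OF assms, of n] grid_n[of n r t] assms by (cases "n = 0") auto
qed

text \<open>Telescoping comparison 1 / sqrt i \<le> 2 (sqrt i - sqrt (i - 1)), which is 2ab \<le>
  a^2 + b^2 for a = sqrt i and b = sqrt (i - 1).\<close>

lemma sum_inverse_sqrt: "(\<Sum>i=1..<n. 1 / sqrt (real i)) \<le> 2 * sqrt (real n)"
proof -
  have gen: "2 * b + 1 / a \<le> 2 * a" if "2 * (a * b) + 1 \<le> 2 * (a * a)" "0 < a" for a b :: real
    using that by (simp add: field_simps)
  have "(\<Sum>i=1..<Suc n. 1 / sqrt (real i)) \<le> 2 * sqrt (real n)" for n
  proof (induction n)
    case (Suc n)
    let ?a = "sqrt (real (Suc n))" and ?b = "sqrt (real n)"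
    have "2 * (?a * ?b) \<le> ?a\<^sup>2 + ?b\<^sup>2" using sum_squares_bound[of ?a ?b] by simp
    also have "?b\<^sup>2 = ?a\<^sup>2 - 1" by simp
    finally have "2 * (?a * ?b) + 1 \<le> 2 * (?a * ?a)" by (simp only: power2_eq_square)
    then have "2 * ?b + 1 / ?a \<le> 2 * ?a" by (rule gen) simp
    then show ?case using Suc by simp
  qed simp
  from this[of n] show ?thesis
    using sum_mono2[of "{1..<Suc n}" "{1..<n}" "\<lambda>i. 1 / sqrt (real i)"] by auto
qed

context wiener_path
begin

text \<open>\<open>crossing_bound\<close> is used with \<eta> = \<delta>^(1/4) for the mesh
  \<delta>. The i-th grid point is at least i \<delta>, so the small ball terms sum to at most 2
  sqrt T \<delta>^(1/4) and the fourth moment terms to at most 3 T sqrt \<delta>. The first interval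
  may start at time 0, where the small ball bound is void; its contribution is bounded by its
  length.\<close>

lemma crossing_sum_tendsto:
  assumes rt: "0 \<le> r" "r \<le> t"
  shows "(\<lambda>n. \<Sum>i<n. \<integral>w. crossing (grid r t n i) (grid r t n (Suc i)) w \<partial>P) \<longlonglongrightarrow> 0"
proof (cases "r = t")
  case True
  have "crossing (grid r t n i) (grid r t n (Suc i)) w = 0" for n i w
    using True by (simp add: grid_def crossing_def)
  then show ?thesis by simp
next
  case False
  define T where "T = t - r"
  have T: "0 < T" using rt False by (simp add: T_def)
  define C where "C n = T / real n + (2 * sqrt T * sqrt (sqrt (T / real n)) + 3 * T * sqrt (T / real n))" for n
  have bound: "(\<Sum>i<n. \<integral>w. crossing (grid r t n i) (grid r t n (Suc i)) w \<partial>P) \<le> C n" if n: "0 < n" for n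
  proof -
    define \<delta> where "\<delta> = T / real n"
    have \<delta>: "0 < \<delta>" using T n by (simp add: \<delta>_def)
    have step: "(LINT w|P. crossing (grid r t n i) (grid r t n (Suc i)) w)
        \<le> \<delta> * (sqrt (sqrt \<delta>)) * (1 / sqrt \<delta>) * (1 / sqrt (real i)) + 3 * \<delta> * sqrt \<delta>" if i: "i \<in> {1..<n}" for i
    proof -
      have "0 < real i * \<delta>" using i \<delta> by simp
      moreover have "grid r t n i = r + real i * \<delta>" by (simp add: grid_def \<delta>_def T_def)
      ultimately have i\<delta>: "real i * \<delta> \<le> grid r t n i" "0 < real i * \<delta>" using rt by auto
      have "(LINT w|P. crossing (grid r t n i) (grid r t n (Suc i)) w)
          \<le> (grid r t n (Suc i) - grid r t n i) * (sqrt (sqrt \<delta>) / sqrt (grid r t n i)) +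
            3 * (grid r t n (Suc i) - grid r t n i)\<^sup>2 / (sqrt (sqrt \<delta>))\<^sup>2"
        unfolding crossing_def
        by (rule crossing_bound) (use i\<delta> \<delta> grid_mono[OF rt(2), of i "Suc i" n] in auto)
      also have "\<dots> = \<delta> * (sqrt (sqrt \<delta>) / sqrt (grid r t n i)) + 3 * \<delta>\<^sup>2 / sqrt \<delta>"
        using \<delta> by (simp add: grid_step \<delta>_def[symmetric] T_def[symmetric])
      also have "\<dots> \<le> \<delta> * (sqrt (sqrt \<delta>) / sqrt (real i * \<delta>)) + 3 * \<delta>\<^sup>2 / sqrt \<delta>"
      proof -
        have "sqrt (sqrt \<delta>) / sqrt (grid r t n i) \<le> sqrt (sqrt \<delta>) / sqrt (real i * \<delta>)"
          by (rule divide_left_mono) (use i\<delta> \<delta> in auto)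
        then show ?thesis using \<delta> by (intro add_right_mono mult_left_mono) auto
      qed
      also have "3 * \<delta>\<^sup>2 / sqrt \<delta> = 3 * \<delta> * sqrt \<delta>"
      proof -
        have "3 * \<delta>\<^sup>2 / sqrt \<delta> = 3 * \<delta> * (\<delta> / sqrt \<delta>)" by (simp add: power2_eq_square)
        then show ?thesis using \<delta> real_div_sqrt[of \<delta>] by simp
      qed
      also have "\<delta> * (sqrt (sqrt \<delta>) / sqrt (real i * \<delta>)) =
          \<delta> * (sqrt (sqrt \<delta>)) * (1 / sqrt \<delta>) * (1 / sqrt (real i))"
        by (simp add: real_sqrt_mult)
      finally show ?thesis .
    qed
    have "(\<Sum>i<n. \<integral>w. crossing (grid r t n i) (grid r t n (Suc i)) w \<partial>P)
       = (LINT w|P. crossing (grid r t n 0) (grid r t n (Suc 0)) w) + (\<Sum>i=1..<n. \<integral>w. crossing (grid r t n i) (grid r t n (Suc i)) w \<partial>P)"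
      using n by (simp add: lessThan_atLeast0 sum.atLeast_Suc_lessThan)
    also have "\<dots> \<le> \<delta> + (\<Sum>i=1..<n. \<delta> * (sqrt (sqrt \<delta>)) * (1 / sqrt \<delta>) * (1 / sqrt (real i)) + 3 * \<delta> * sqrt \<delta>)"
    proof (intro add_mono sum_mono step)
      have "(LINT w|P. crossing (grid r t n 0) (grid r t n (Suc 0)) w) \<le> grid r t n (Suc 0) - grid r t n 0"
        by (rule crossing_le) (use rt grid_mono[OF rt(2), of 0 "Suc 0" n] in auto)
      then show "(LINT w|P. crossing (grid r t n 0) (grid r t n (Suc 0)) w) \<le> \<delta>"
        unfolding grid_step by (simp add: \<delta>_def T_def)
    qed auto
    also have "\<dots> = \<delta> + (\<delta> * (sqrt (sqrt \<delta>)) * (1 / sqrt \<delta>) * (\<Sum>i=1..<n. 1 / sqrt (real i)) + (real n - 1) * (3 * \<delta> * sqrt \<delta>))"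
      using n by (simp add: sum.distrib sum_distrib_left of_nat_diff)
    also have "\<dots> \<le> \<delta> + (\<delta> * (sqrt (sqrt \<delta>)) * (1 / sqrt \<delta>) * (2 * sqrt (real n)) + real n * (3 * \<delta> * sqrt \<delta>))"
      using \<delta> by (intro add_mono mult_left_mono mult_right_mono sum_inverse_sqrt) auto
    also have "\<dots> = C n"
    proof -
      have "\<delta> * (1 / sqrt \<delta>) = sqrt \<delta>" using \<delta> by (simp add: real_div_sqrt)
      moreover have "sqrt \<delta> * sqrt (real n) = sqrt T" using n by (simp add: \<delta>_def real_sqrt_mult[symmetric])
      moreover have "real n * \<delta> = T" using n by (simp add: \<delta>_def)
      moreover have "\<delta> * sqrt (sqrt \<delta>) * (1 / sqrt \<delta>) * (2 * sqrt (real n)) =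
          2 * ((\<delta> * (1 / sqrt \<delta>)) * sqrt (real n)) * sqrt (sqrt \<delta>)" by simp
      moreover have "real n * (3 * \<delta> * sqrt \<delta>) = 3 * (real n * \<delta>) * sqrt \<delta>" by simp
      ultimately show ?thesis unfolding C_def \<delta>_def[symmetric] by simp
    qed
    finally show ?thesis .
  qed
  have "(\<lambda>n. T / real n) \<longlonglongrightarrow> 0" by (rule lim_const_over_n)
  then have "C \<longlonglongrightarrow> 0 + (2 * sqrt T * sqrt (sqrt 0) + 3 * T * sqrt 0)"
    unfolding C_def by (intro tendsto_intros)
  then have C: "C \<longlonglongrightarrow> 0" by simp
  show ?thesis
  proof (rule tendsto_sandwich[OF _ _ tendsto_const C])
    show "\<forall>\<^sub>F n in sequentially. 0 \<le> (\<Sum>i<n. \<integral>w. crossing (grid r t n i) (grid r t n (Suc i)) w \<partial>P)"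
      by (intro always_eventually allI sum_nonneg integral_nonneg) (simp add: crossing_nonneg)
    show "\<forall>\<^sub>F n in sequentially. (\<Sum>i<n. \<integral>w. crossing (grid r t n i) (grid r t n (Suc i)) w \<partial>P) \<le> C n"
      using bound by (auto intro!: eventually_sequentiallyI[of 1])
  qed
qed

end

context wiener_local_time
begin

text \<open>Quantitative form of "L grows only on the zero set of X", extracted from the martingale
  property: tested against |X_s|, the increment of L has the same mean as that of |X|. By
  \<open>abs_increment\<close> the latter is a centred term plus a term on the event of a sign
  change, and there |X_s| is at most the increment, so that twice the crossing term
  dominates.\<close>

lemma dL_abs:
  assumes st: "0 \<le> s" "s \<le> t"
  shows "integrable P (\<lambda>w. (L t w - L s w) * \<bar>w s\<bar>)"
    and "(LINT w|P. (L t w - L s w) * \<bar>w s\<bar>) \<le> 2 * (LINT w|P. crossing s t w)"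
proof -
  have t: "0 \<le> t" using st by simp
  have [measurable]: "(\<lambda>w. w t) \<in> borel_measurable P" "(\<lambda>w. w s) \<in> borel_measurable P"
    "L t \<in> borel_measurable P" "L s \<in> borel_measurable P" using st t by auto
  let ?c = "2 * (LINT w|P. crossing s t w)"
  \<comment> \<open>The martingale property is available for bounded weights; |w s| is truncated at
    k, and k is sent to infinity by monotone convergence.\<close>
  define J where "J k w = min (real k) \<bar>w s\<bar>" for k :: nat and w :: path
  have J: "J k \<in> borel_measurable (Filt s)" "\<bar>J k w\<bar> \<le> real k" "0 \<le> J k w" "J k w \<le> \<bar>w s\<bar>" for k w
    unfolding J_def using coord_measurable_Filt[of s s] st by auto
  have [measurable]: "J k \<in> borel_measurable P" for k using measurable_Filt_P[OF J(1)] .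
  have bnd: "(LINT w|P. (L t w - L s w) * J k w) \<le> ?c" "integrable P (\<lambda>w. (L t w - L s w) * J k w)" for k
  proof -
    define K where "K w = J k w * sgn (w s)" for w
    have K: "K \<in> borel_measurable (Filt s)" unfolding K_def
      using J(1)[of k] coord_measurable_Filt[of s s] st by measurable
    have Kb: "\<bar>K w\<bar> \<le> real k" for w using J(2)[of k w] by (auto simp: K_def sgn_if)
    have iK: "integrable P K"
      by (rule integrable_const_bound[of _ "real k"]) (use Kb measurable_Filt_P[OF K] in auto)
    note KX = indep_product_real[OF st K iK, of "\<lambda>x. x"]
    have i1: "integrable P (\<lambda>w. w t - w s)" using increment_moments(1)[OF st, of 1] by simp
    have zero: "(LINT w|P. K w * (w t - w s)) = 0" using KX(2) i1 increment_moments(2)[OF st] by simp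
    have iJ: "integrable P (\<lambda>w. J k w * Z w)" if "integrable P Z" for Z :: "path => real"
    proof (rule Bochner_Integration.integrable_bound[OF integrable_mult_right[OF that, of "real k"]])
      show "AE w in P. norm (J k w * Z w) \<le> norm (real k * Z w)"
        using J(2)[of k] by (auto simp: abs_mult intro!: mult_right_mono)
    qed (use that in measurable)
    have "(LINT w|P. (L t w - L s w) * J k w) = (LINT w|P. J k w * (\<bar>w t\<bar> - \<bar>w s\<bar>))"
      using tanaka_real[OF st J(1) J(2)] by (simp add: mult.commute)
    also have "\<dots> \<le> (LINT w|P. K w * (w t - w s) + 2 * crossing s t w)"
    proof (rule integral_mono)
      show "integrable P (\<lambda>w. J k w * (\<bar>w t\<bar> - \<bar>w s\<bar>))"
        by (intro iJ Bochner_Integration.integrable_diff integrable_abs coord_moments(1) st t)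
      show "integrable P (\<lambda>w. K w * (w t - w s) + 2 * crossing s t w)"
        using KX(1) i1 crossing_integrable[OF st] by auto
      fix w :: path
      show "J k w * (\<bar>w t\<bar> - \<bar>w s\<bar>) \<le> K w * (w t - w s) + 2 * crossing s t w"
      proof (cases "sgn (w s) = sgn (w t)")
        case True
        then show ?thesis using crossing_nonneg[of s t w]
          by (simp add: abs_increment[of "w t" "w s"] K_def algebra_simps)
      next
        case False
        note sc = sgn_change[OF False]
        have "(sgn (w t) - sgn (w s)) * w t \<le> 2 * \<bar>w t - w s\<bar>"
        proof -
          have "(sgn (w t) - sgn (w s)) * w t \<le> \<bar>sgn (w t) - sgn (w s)\<bar> * \<bar>w t\<bar>"
            by (metis abs_ge_self abs_mult)
          also have "\<dots> \<le> 2 * \<bar>w t - w s\<bar>" by (intro mult_mono sgn_diff_le sc) auto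
          finally show ?thesis .
        qed
        then have "J k w * ((sgn (w t) - sgn (w s)) * w t) \<le> J k w * (2 * \<bar>w t - w s\<bar>)"
          by (rule mult_left_mono) (rule J)
        also have "\<dots> \<le> \<bar>w t - w s\<bar> * (2 * \<bar>w t - w s\<bar>)"
          using J(4)[of k w] sc by (intro mult_right_mono) auto
        also have "\<dots> = 2 * crossing s t w"
          using sc by (simp add: crossing_def power2_eq_square abs_mult[symmetric])
        finally show ?thesis
          by (simp add: abs_increment[of "w t" "w s"] K_def algebra_simps)
      qed
    qed
    also have "\<dots> = ?c"
      using KX(1) i1 crossing_integrable[OF st] zero by simp
    finally show "(LINT w|P. (L t w - L s w) * J k w) \<le> ?c" .
    show "integrable P (\<lambda>w. (L t w - L s w) * J k w)"
      using iJ[of "\<lambda>w. L t w - L s w"] L_integrable[OF t] L_integrable[OF st(1)] by (simp add: mult.commute)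
  qed
  have nn: "AE w in P. 0 \<le> L t w - L s w" using L_mono[OF st] by simp
  have lim: "(\<lambda>k. \<integral>\<^sup>+w. ennreal ((L t w - L s w) * J k w) \<partial>P) \<longlonglongrightarrow> (\<integral>\<^sup>+w. ennreal ((L t w - L s w) * \<bar>w s\<bar>) \<partial>P)"
  proof (rule nn_integral_LIMSEQ)
    show "incseq (\<lambda>k w. ennreal ((L t w - L s w) * J k w))"
    proof (intro incseq_SucI le_funI)
      fix k w
      show "ennreal ((L t w - L s w) * J k w) \<le> ennreal ((L t w - L s w) * J (Suc k) w)"
      proof (cases "0 \<le> L t w - L s w")
        case True then show ?thesis by (intro ennreal_leI mult_left_mono) (auto simp: J_def)
      next
        case False then show ?thesis using J(3)[of k w] by (simp add: ennreal_neg mult_nonpos_nonneg)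
      qed
    qed
    fix w
    have "(\<lambda>k. J k w) \<longlonglongrightarrow> \<bar>w s\<bar>"
    proof (rule tendsto_eventually)
      obtain k where "\<bar>w s\<bar> \<le> real k" using real_arch_simple by blast
      then show "\<forall>\<^sub>F k in sequentially. J k w = \<bar>w s\<bar>"
        by (intro eventually_sequentiallyI[of k]) (auto simp: J_def min_def)
    qed
    then show "(\<lambda>k. ennreal ((L t w - L s w) * J k w)) \<longlonglongrightarrow> ennreal ((L t w - L s w) * \<bar>w s\<bar>)"
      by (intro tendsto_intros)
  qed measurable
  have le: "(\<integral>\<^sup>+w. ennreal ((L t w - L s w) * \<bar>w s\<bar>) \<partial>P) \<le> ennreal ?c"
  proof (rule LIMSEQ_le_const2[OF lim], intro exI[of _ 0] allI impI)
    fix k :: nat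
    have "AE w in P. 0 \<le> (L t w - L s w) * J k w" using nn J(3) by auto
    then have "(\<integral>\<^sup>+w. ennreal ((L t w - L s w) * J k w) \<partial>P) = ennreal (LINT w|P. (L t w - L s w) * J k w)"
      by (intro nn_integral_eq_integral bnd)
    then show "(\<integral>\<^sup>+w. ennreal ((L t w - L s w) * J k w) \<partial>P) \<le> ennreal ?c"
      using bnd(1) by (simp add: ennreal_leI)
  qed
  have ae: "AE w in P. 0 \<le> (L t w - L s w) * \<bar>w s\<bar>" using nn by auto
  show i: "integrable P (\<lambda>w. (L t w - L s w) * \<bar>w s\<bar>)"
    by (rule integrableI_nonneg[OF _ ae]) (use le in \<open>auto intro: le_less_trans\<close>)
  have "0 \<le> ?c" using crossing_nonneg by (simp add: integral_nonneg)
  then show "(LINT w|P. (L t w - L s w) * \<bar>w s\<bar>) \<le> ?c"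
    using le nn_integral_eq_integral[OF i ae] by simp
qed

end

section \<open>Monotone class induction and convergence of left-point sums\<close>

lemma bounded_borel_induct_atMost [consumes 2, case_names atMost one lin lim]:
  fixes f :: "real => real" and Pr :: "(real => real) => bool"
  assumes f: "f \<in> borel_measurable borel" "\<And>x. \<bar>f x\<bar> \<le> B"
    and base: "\<And>a. Pr (indicator {..a})" and one: "Pr (\<lambda>_. 1)"
    and lin: "\<And>f g a b K. f \<in> borel_measurable borel ==> g \<in> borel_measurable borel ==>
        (\<And>x. \<bar>f x\<bar> \<le> K) ==> (\<And>x. \<bar>g x\<bar> \<le> K) ==> Pr f ==> Pr g ==> Pr (\<lambda>x. a * f x + b * g x)"
    and lim: "\<And>F f K. (\<And>n. F n \<in> borel_measurable borel) ==> f \<in> borel_measurable borel ==>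
        (\<And>n x. \<bar>F n x\<bar> \<le> K) ==> (\<And>x. \<bar>f x\<bar> \<le> K) ==> (\<And>x. (\<lambda>n::nat. F n x) \<longlonglongrightarrow> f x) ==> (\<And>n. Pr (F n)) ==> Pr f"
  shows "Pr f"
proof -
  \<comment> \<open>Closed half-lines are a \<pi>-system generating the Borel sets. Complements come
    from \<open>lin\<close> and \<open>one\<close>, disjoint countable unions from
    \<open>lim\<close> with the common bound 1.\<close>
  have ind: "Pr (indicator A)" if "A \<in> sets borel" for A :: "real set"
  proof -
    have gen: "sets borel = sigma_sets (UNIV :: real set) (range atMost)"
      by (subst borel_eq_atMost) (auto intro!: sets_measure_of)
    have "Int_stable (range (atMost :: real => real set))"
    proof (rule Int_stableI)
      fix a b :: "real set" assume "a \<in> range atMost" "b \<in> range atMost"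
      then obtain x y where "a = {..x}" "b = {..y}" by blast
      then have "a \<inter> b = {..min x y}" by simp
      then show "a \<inter> b \<in> range atMost" by simp
    qed
    moreover have "range atMost \<subseteq> Pow (UNIV :: real set)" by simp
    moreover have "A \<in> sigma_sets UNIV (range atMost)" using that gen by simp
    ultimately show ?thesis
    proof (induction rule: sigma_sets_induct_disjoint)
      case (basic A) then show ?case using base by auto
    next
      case empty
      \<comment> \<open>The zero function is obtained as 1 - 1.\<close>
      show ?case using lin[OF _ _ _ _ one one, of 1 1 "-1"] by (simp add: indicator_def)
    next
      case (compl A)
      have "A \<in> sets borel" using compl(1) gen by simp
      then have "Pr (\<lambda>x. 1 * 1 + (-1) * indicator A x)"
        by (intro lin[of _ _ 1] borel_measurable_indicator) (use compl one in auto)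
      then show ?case by (rule back_subst[of Pr]) (auto simp: indicator_def)
    next
      case (union A)
      have A: "A i \<in> sets borel" for i using union gen by auto
      define F where "F n = (\<lambda>x. \<Sum>i<n. indicator (A i) x :: real)" for n :: nat
      have F_eq: "F n = indicator (\<Union>i<n. A i)" for n
        unfolding F_def by (rule ext, rule indicator_UN_disjoint[symmetric])
          (use union(1) in \<open>auto simp: disjoint_family_on_def\<close>)
      have PF: "Pr (F n)" for n
      proof (induction n)
        case 0
        show ?case using lin[OF _ _ _ _ one one, of 1 1 "-1"] by (simp add: F_def)
      next
        case (Suc n)
        have "Pr (\<lambda>x. 1 * F n x + 1 * indicator (A n) x)"
          by (rule lin[of _ _ 1]) (use Suc union A in \<open>auto simp: F_eq indicator_def\<close>)
        then show ?case by (simp add: F_def)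
      qed
      show ?case
      proof (rule lim[of F _ 1])
        fix x show "(\<lambda>n. F n x) \<longlonglongrightarrow> indicator (\<Union>i. A i) x"
          unfolding F_eq by (rule LIMSEQ_indicator_UN)
      qed (use A PF in \<open>auto simp: F_eq indicator_def\<close>)
    qed
  qed
  have simple: "Pr g" if g: "simple_function borel g" for g :: "real => real"
  proof -
    have fin: "finite (range g)" using simple_functionD(1)[OF g] by simp
    have bm: "g -` {y} \<in> sets borel" for y using simple_functionD(2)[OF g, of "{y}"] by simp
    have "Pr (\<lambda>x. \<Sum>y\<in>Y. y * indicator (g -` {y}) x)" if "finite Y" for Y
      using that
    proof (induction Y)
      case empty show ?case using lin[OF _ _ _ _ one one, of 1 1 "-1"] by simp
    next
      case (insert y Y)
      have "Pr (\<lambda>x. y * indicator (g -` {y}) x + 1 * (\<Sum>y\<in>Y. y * indicator (g -` {y}) x))"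
      \<comment> \<open>\<open>lin\<close> wants one bound for both functions: 1 covers the
        indicator, the sum covers the rest.\<close>
      proof (rule lin[of _ _ "1 + (\<Sum>y\<in>Y. \<bar>y\<bar>)"])
        fix x
        have "\<bar>\<Sum>y\<in>Y. y * indicator (g -` {y}) x\<bar> \<le> (\<Sum>y\<in>Y. \<bar>y\<bar>)"
          by (rule order_trans[OF sum_abs sum_mono]) (auto simp: indicator_def)
        then show "\<bar>\<Sum>y\<in>Y. y * indicator (g -` {y}) x\<bar> \<le> 1 + (\<Sum>y\<in>Y. \<bar>y\<bar>)" by simp
        show "\<bar>indicator (g -` {y}) x\<bar> \<le> 1 + (\<Sum>y\<in>Y. \<bar>y\<bar>)"
          by (simp add: indicator_def sum_nonneg)
      qed (use bm ind insert.IH in \<open>auto intro!: borel_measurable_sum borel_measurable_times\<close>)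
      then show ?case
        by (rule back_subst[of Pr]) (simp only: sum.insert[OF insert.hyps] mult_1)
    qed
    from this[OF fin] show ?thesis
    proof (rule back_subst[of Pr])
      show "(\<lambda>x. \<Sum>y\<in>range g. y * indicator (g -` {y}) x) = g"
      proof
        fix x
        have "(\<Sum>y\<in>range g. y * indicator (g -` {y}) x) = (\<Sum>y\<in>{g x}. y)"
          by (rule sum.mono_neutral_cong_right) (use fin in \<open>auto simp: indicator_def\<close>)
        then show "(\<Sum>y\<in>range g. y * indicator (g -` {y}) x) = g x" by simp
      qed
    qed
  qed
  obtain F where F: "\<And>i. simple_function borel (F i)" "\<And>x. (\<lambda>i. F i x) \<longlonglongrightarrow> f x" "\<And>i x. dist (F i x) 0 \<le> 2 * dist (f x) 0"
    using borel_measurable_implies_sequence_metric[OF f(1), of 0] by auto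
  have B: "0 \<le> B" using f(2)[of 0] by linarith
  show ?thesis
  \<comment> \<open>The approximating simple functions stay within twice the size of
    \<open>f\<close>.\<close>
  proof (rule lim[of F f "2 * B"])
    show "\<bar>F n x\<bar> \<le> 2 * B" for n x using F(3)[of n x] f(2)[of x] by simp
    show "\<bar>f x\<bar> \<le> 2 * B" for x using f(2)[of x] B by linarith
    show "F n \<in> borel_measurable borel" for n using borel_measurable_simple_function[OF F(1)] .
  qed (use F f simple in auto)
qed

text \<open>The indicator of a closed half-line is the pointwise limit of ramps that fall from 1 to
  0 to the right of its end point with slope -n. So identities with an error estimate for Lipschitz
  weights extend to all bounded Borel weights.\<close>

lemma bounded_borel_induct_lipschitz [consumes 2, case_names lip lin lim]:
  fixes f :: "real => real" and Pr :: "(real => real) => bool"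
  assumes f: "f \<in> borel_measurable borel" "\<And>x. \<bar>f x\<bar> \<le> B"
    and lip: "\<And>f K. (\<And>x. \<bar>f x\<bar> \<le> K) ==> K-lipschitz_on UNIV f ==> Pr f"
    and lin: "\<And>f g a b K. f \<in> borel_measurable borel ==> g \<in> borel_measurable borel ==>
        (\<And>x. \<bar>f x\<bar> \<le> K) ==> (\<And>x. \<bar>g x\<bar> \<le> K) ==> Pr f ==> Pr g ==> Pr (\<lambda>x. a * f x + b * g x)"
    and lim: "\<And>F f K. (\<And>n. F n \<in> borel_measurable borel) ==> f \<in> borel_measurable borel ==>
        (\<And>n x. \<bar>F n x\<bar> \<le> K) ==> (\<And>x. \<bar>f x\<bar> \<le> K) ==> (\<And>x. (\<lambda>n::nat. F n x) \<longlonglongrightarrow> f x) ==> (\<And>n. Pr (F n)) ==> Pr f"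
  shows "Pr f"
  using f
proof (induction rule: bounded_borel_induct_atMost)
  case (atMost a)
  define F where "F n = (\<lambda>x. max 0 (min 1 (1 - real n * (x - a))))" for n :: nat
  \<comment> \<open>The Lipschitz constant is n; 1 + n bounds the values as well, as the single
    \<open>K\<close> of \<open>lip\<close> demands.\<close>
  have lF: "(1 + real n)-lipschitz_on UNIV (F n)" for n
  proof (rule lipschitz_onI)
    fix x y :: real
    have "\<bar>F n x - F n y\<bar> \<le> \<bar>(1 - real n * (x - a)) - (1 - real n * (y - a))\<bar>" by (simp add: F_def)
    also have "(1 - real n * (x - a)) - (1 - real n * (y - a)) = - (real n * (x - y))" by (simp add: algebra_simps)
    also have "\<bar>\<dots>\<bar> = real n * \<bar>x - y\<bar>" by (simp add: abs_mult)
    also have "\<dots> \<le> (1 + real n) * \<bar>x - y\<bar>" by (simp add: mult_right_mono)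
    finally show "dist (F n x) (F n y) \<le> (1 + real n) * dist x y" by (simp add: dist_real_def)
  qed simp
  show ?case
  proof (rule lim[of F _ 1])
    fix n
    show "Pr (F n)" by (rule lip[OF _ lF]) (auto simp: F_def)
    show "F n \<in> borel_measurable borel" unfolding F_def by measurable
  next
    fix x
    show "(\<lambda>n. F n x) \<longlonglongrightarrow> indicator {..a} x"
    proof (cases "x \<le> a")
      case True
      have "real n * (x - a) \<le> 0" for n using True by (simp add: mult_nonneg_nonpos)
      then show ?thesis using True by (simp add: F_def min_def)
    next
      case False
      obtain N where N: "1 < real N * (x - a)" using reals_Archimedean3[of "x - a"] False by auto
      have "F n x = 0" if "N \<le> n" for n
      proof -
        have "real N * (x - a) \<le> real n * (x - a)" using that False by (intro mult_right_mono) auto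
        then show ?thesis using N by (simp add: F_def)
      qed
      then have "\<forall>\<^sub>F n in sequentially. F n x = indicator {..a} x"
        using False by (intro eventually_sequentiallyI[of N]) auto
      then show ?thesis by (rule tendsto_eventually)
    qed
  qed (auto simp: F_def indicator_def)
next
  case one
  show ?case by (rule lip[of _ 1]) (auto intro!: lipschitz_onI)
qed (use lin lim in blast)+

text \<open>Telescoping over the grid leaves a left-point Riemann sum of \<open>g\<close> plus
  errors that vanish by assumption; dominated convergence identifies the limit. Continuity is asked
  for in the interior only: in the applications r may be 0, where X sits at the origin and sgn(X) is
  discontinuous.\<close>

lemma grid_integral:
  fixes g :: "real => complex" and \<phi> :: "real => complex" and e :: "real => real => real"
  assumes rt: "r \<le> t"
    and cont: "\<And>s \<sigma>. r < s ==> s < t ==> (\<And>n::nat. \<sigma> n \<in> {r..t}) ==> \<sigma> \<longlonglongrightarrow> s ==> (\<lambda>n. g (\<sigma> n)) \<longlonglongrightarrow> g s"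
    and bound: "\<And>s. s \<in> {r..t} ==> cmod (g s) \<le> K"
    and step: "\<And>s u. r \<le> s ==> s \<le> u ==> u \<le> t ==> cmod (\<phi> u - \<phi> s - of_real (u - s) * g s) \<le> e s u"
    and err: "(\<lambda>n. \<Sum>i<n. e (grid r t n i) (grid r t n (Suc i))) \<longlonglongrightarrow> 0"
  shows "set_integrable lborel {r<..<t} g" "\<phi> t - \<phi> r = (LINT s:{r<..<t}|lborel. g s)"
proof -
  define f where "f n s = (\<Sum>i<n. indicator {grid r t n i..<grid r t n (Suc i)} s *\<^sub>R g (grid r t n i))" for n s
  have cg: "continuous_on {r<..<t} g"
    unfolding continuous_on_sequentially
  proof (intro allI ballI impI)
    fix x :: "nat => real" and a assume a: "a \<in> {r<..<t}" and x: "(\<forall>n. x n \<in> {r<..<t}) \<and> x \<longlonglongrightarrow> a"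
    have "x n \<in> {r..t}" for n using x by (auto intro: less_imp_le)
    then show "(g \<circ> x) \<longlonglongrightarrow> g a" using cont[of a x] a x by (simp add: o_def)
  qed
  have meas: "(\<lambda>s. indicator {r<..<t} s *\<^sub>R g s) \<in> borel_measurable borel"
    by (rule borel_measurable_continuous_on_indicator) (use cg in auto)
  have K: "0 \<le> K" by (rule order_trans[OF norm_ge_zero bound[of r]]) (use rt in simp)
  \<comment> \<open>The step function takes at s the value of \<open>g\<close> at the last grid
    point not after s, found by rounding down (s - r) / \<delta>.\<close>
  have pt: "\<exists>i<n. grid r t n i \<le> s \<and> s < grid r t n (Suc i) \<and> f n s = g (grid r t n i)"
    if "0 < n" "r < s" "s < t" for n s
  proof -
    define \<delta> where "\<delta> = (t - r) / real n"
    have \<delta>: "0 < \<delta>" using that by (simp add: \<delta>_def)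
    define i where "i = nat \<lfloor>(s - r) / \<delta>\<rfloor>"
    have fl: "0 \<le> (s - r) / \<delta>" using that \<delta> by simp
    have "real i \<le> (s - r) / \<delta>" "(s - r) / \<delta> < real i + 1" unfolding i_def using fl by linarith+
    then have i: "real i * \<delta> \<le> s - r" "s - r < (real i + 1) * \<delta>" using \<delta> by (simp_all add: field_simps)
    have g: "grid r t n j = r + real j * \<delta>" for j by (simp add: grid_def \<delta>_def)
    have i': "grid r t n i \<le> s" "s < grid r t n (Suc i)" using i unfolding g by (simp_all add: algebra_simps)
    have "i < n"
    proof (rule ccontr)
      assume "\<not> i < n"
      then have "grid r t n n \<le> grid r t n i" using rt by (intro grid_mono) auto
      then show False using i' that grid_n[of n r t] by simp
    qed
    have "f n s = (\<Sum>j\<in>{i}. g (grid r t n i))" unfolding f_def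
    proof (rule sum.mono_neutral_cong_right)
      show "\<forall>j\<in>{..<n} - {i}. indicator {grid r t n j..<grid r t n (Suc j)} s *\<^sub>R g (grid r t n j) = 0"
      proof
        fix j assume j: "j \<in> {..<n} - {i}"
        then have "Suc j \<le> i \<or> Suc i \<le> j" by auto
        then have "grid r t n (Suc j) \<le> s \<or> s < grid r t n j"
          using grid_mono[OF rt, of "Suc j" i n] grid_mono[OF rt, of "Suc i" j n] i' by auto
        then show "indicator {grid r t n j..<grid r t n (Suc j)} s *\<^sub>R g (grid r t n j) = 0" by auto
      qed
    qed (use \<open>i < n\<close> i' in auto)
    then show ?thesis using i' \<open>i < n\<close> by auto
  qed
  have int_f: "(LINT s|lborel. f n s) = (\<Sum>i<n. of_real (grid r t n (Suc i) - grid r t n i) * g (grid r t n i))" for n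
  proof -
    have "(LINT s|lborel. f n s) = (\<Sum>i<n. (LINT s|lborel. indicator {grid r t n i..<grid r t n (Suc i)} s *\<^sub>R g (grid r t n i)))"
      unfolding f_def
    proof (rule Bochner_Integration.integral_sum)
      fix i assume "i \<in> {..<n}"
      show "integrable lborel (\<lambda>s. indicator {grid r t n i..<grid r t n (Suc i)} s *\<^sub>R g (grid r t n i))"
        using grid_mono[OF rt, of i "Suc i" n] by (intro integrable_scaleR_left impI integrable_real_indicator) auto
    qed
    also have "\<dots> = (\<Sum>i<n. of_real (grid r t n (Suc i) - grid r t n i) * g (grid r t n i))"
    proof (rule sum.cong[OF refl])
      fix i
      show "(LINT s|lborel. indicator {grid r t n i..<grid r t n (Suc i)} s *\<^sub>R g (grid r t n i))
          = of_real (grid r t n (Suc i) - grid r t n i) * g (grid r t n i)"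
        using grid_mono[OF rt, of i "Suc i" n] by (subst integral_scaleR_left) (auto simp: scaleR_conv_of_real intro!: integrable_real_indicator)
    qed
    finally show ?thesis .
  qed
  have fm: "f n \<in> borel_measurable borel" for n unfolding f_def by measurable
  have ae_r: "AE s in lborel. s \<noteq> r \<and> s \<noteq> (t :: real)"
    using AE_lborel_singleton[of r] AE_lborel_singleton[of t] by eventually_elim auto
  have out: "f n s = 0" if "s < r \<or> t < s" for n s
  proof (unfold f_def, rule sum.neutral, rule ballI)
    fix i assume i: "i \<in> {..<n}"
    then have "r \<le> grid r t n i" "grid r t n (Suc i) \<le> t" using grid_bounds[OF rt, of i n] grid_bounds[OF rt, of "Suc i" n] by auto
    then show "indicator {grid r t n i..<grid r t n (Suc i)} s *\<^sub>R g (grid r t n i) = 0" using that by auto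
  qed
  \<comment> \<open>\<open>Suc n\<close> avoids the empty grid.\<close>
  have lim_pt: "(\<lambda>n. f (Suc n) s) \<longlonglongrightarrow> indicator {r<..<t} s *\<^sub>R g s" if s: "s \<noteq> r \<and> s \<noteq> t" for s
  proof (cases "r < s \<and> s < t")
    case False
    then have "f n s = 0" for n using s by (intro out) auto
    then show ?thesis using False by auto
  next
    case True
    have "\<forall>n. \<exists>i<Suc n. grid r t (Suc n) i \<le> s \<and> s < grid r t (Suc n) (Suc i) \<and> f (Suc n) s = g (grid r t (Suc n) i)"
      using pt[of "Suc _" s] True by blast
    then obtain I where I: "\<And>n. I n < Suc n" "\<And>n. grid r t (Suc n) (I n) \<le> s" "\<And>n. s < grid r t (Suc n) (Suc (I n))"
      "\<And>n. f (Suc n) s = g (grid r t (Suc n) (I n))" by metis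
    have "(\<lambda>n. s - (t - r) / real (Suc n)) \<longlonglongrightarrow> s - 0"
      by (intro tendsto_diff tendsto_const LIMSEQ_Suc[OF lim_const_over_n])
    then have "(\<lambda>n. s - (t - r) / real (Suc n)) \<longlonglongrightarrow> s" by simp
    then have "(\<lambda>n. grid r t (Suc n) (I n)) \<longlonglongrightarrow> s"
    proof (rule tendsto_sandwich[rotated 2])
      show "\<forall>\<^sub>F n in sequentially. s - (t - r) / real (Suc n) \<le> grid r t (Suc n) (I n)"
      proof (rule always_eventually, rule allI)
        fix n show "s - (t - r) / real (Suc n) \<le> grid r t (Suc n) (I n)"
          using I(3)[of n] grid_step[of r t "Suc n" "I n"] by linarith
      qed
      show "\<forall>\<^sub>F n in sequentially. grid r t (Suc n) (I n) \<le> s" using I by auto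
    qed auto
    moreover have "grid r t (Suc n) (I n) \<in> {r..t}" for n
      using grid_bounds[OF rt, of "I n" "Suc n"] I(1)[of n] by auto
    ultimately show ?thesis using cont[of s "\<lambda>n. grid r t (Suc n) (I n)"] True I(4) by simp
  qed
  have bnd: "norm (f (Suc n) s) \<le> indicator {r..t} s * K" if s: "s \<noteq> r \<and> s \<noteq> t" for n s
  proof (cases "r < s \<and> s < t")
    case True
    then obtain i where "i < Suc n" "f (Suc n) s = g (grid r t (Suc n) i)" using pt[of "Suc n" s] by auto
    then show ?thesis using bound[of "grid r t (Suc n) i"] grid_bounds[OF rt, of i "Suc n"] True by auto
  next
    case False
    then have "f (Suc n) s = 0" using s by (intro out) auto
    then show ?thesis using K by (simp add: indicator_def)
  qed
  have dom: "integrable lborel (\<lambda>s. indicator {r..t} s * K)"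
    using rt by (intro integrable_mult_left impI integrable_real_indicator) auto
  have ae1: "AE s in lborel. (\<lambda>n. f (Suc n) s) \<longlonglongrightarrow> indicator {r<..<t} s *\<^sub>R g s"
    using ae_r by eventually_elim (rule lim_pt)
  have ae2: "AE s in lborel. norm (f (Suc n) s) \<le> indicator {r..t} s * K" for n
    using ae_r by eventually_elim (rule bnd)
  have fm': "f (Suc n) \<in> borel_measurable lborel" for n using fm by simp
  have meas': "(\<lambda>s. indicator {r<..<t} s *\<^sub>R g s) \<in> borel_measurable lborel" using meas by simp
  show "set_integrable lborel {r<..<t} g" unfolding set_integrable_def
    by (rule integrable_dominated_convergence[OF meas' fm' dom ae1 ae2])
  have L1: "(\<lambda>n. \<integral>s. f (Suc n) s \<partial>lborel) \<longlonglongrightarrow> (LINT s:{r<..<t}|lborel. g s)" unfolding set_lebesgue_integral_def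
    by (rule integral_dominated_convergence[OF meas' fm' dom ae1 ae2])
  have "(\<lambda>n. (\<phi> t - \<phi> r) - (LINT s|lborel. f (Suc n) s)) \<longlonglongrightarrow> 0"
  proof (rule Lim_null_comparison[OF _ LIMSEQ_Suc[OF err]], rule always_eventually, rule allI)
    fix m
    define n where "n = Suc m"
    have tel: "\<phi> t - \<phi> r = (\<Sum>i<n. \<phi> (grid r t n (Suc i)) - \<phi> (grid r t n i))"
      using sum_lessThan_telescope[of "\<lambda>i. \<phi> (grid r t n i)" n] grid_n[of n r t] by (simp add: n_def)
    have "norm ((\<phi> t - \<phi> r) - (LINT s|lborel. f n s)) =
      norm (\<Sum>i<n. \<phi> (grid r t n (Suc i)) - \<phi> (grid r t n i) - of_real (grid r t n (Suc i) - grid r t n i) * g (grid r t n i))"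
      unfolding tel int_f by (simp only: sum_subtractf)
    also have "\<dots> \<le> (\<Sum>i<n. e (grid r t n i) (grid r t n (Suc i)))"
    proof (rule sum_norm_le)
      fix i assume i: "i \<in> {..<n}"
      show "norm (\<phi> (grid r t n (Suc i)) - \<phi> (grid r t n i) - of_real (grid r t n (Suc i) - grid r t n i) * g (grid r t n i))
          \<le> e (grid r t n i) (grid r t n (Suc i))"
        by (rule step) (use i grid_bounds[OF rt, of i n] grid_bounds[OF rt, of "Suc i" n] grid_mono[OF rt, of i "Suc i" n] in auto)
    qed
    finally show "norm ((\<phi> t - \<phi> r) - (LINT s|lborel. f (Suc m) s))
       \<le> (\<Sum>i<Suc m. e (grid r t (Suc m) i) (grid r t (Suc m) (Suc i)))" unfolding n_def .
  qed
  from tendsto_add[OF this L1] have "(\<lambda>n. \<phi> t - \<phi> r) \<longlonglongrightarrow> (LINT s:{r<..<t}|lborel. g s)" by simp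
  then show "\<phi> t - \<phi> r = (LINT s:{r<..<t}|lborel. g s)" by (rule LIMSEQ_unique[OF tendsto_const])
qed

text \<open>The errors that one grid step can produce: a sign change of X; growth of L away from the
  origin; variation of the weight while L grows; movement of X while L grows; variation of the
  weight against movement of X. The caps at 1 reflect that the weights are bounded as well as
  Lipschitz, and they keep all terms integrable.\<close>

definition (in wiener_local_time) err :: "real => real => path => real" where
  "err s u w = crossing s u w + (L u w - L s w) * \<bar>w s\<bar>
     + (L u w - L s w) * min 1 \<bar>L u w - L s w\<bar> + (L u w - L s w) * min 1 \<bar>w u - w s\<bar>
     + min 1 \<bar>L u w - L s w\<bar> * \<bar>w u - w s\<bar>"

section \<open>The accumulated errors vanish as the mesh tends to 0\<close>

context wiener_local_time
begin

lemma L_cont: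
  assumes "0 \<le> r"
  shows "AE w in P. continuous_on {r..t} (\<lambda>s. L s w)"
  using L_regular
proof eventually_elim
  case (elim w)
  then show ?case using assms by (auto intro: continuous_on_subset[of "{0..}"])
qed

lemma osc_integrable:
  assumes "0 \<le> s" "s \<le> u" "Z \<in> borel_measurable P"
  shows "integrable P (\<lambda>w. (L u w - L s w) * min 1 \<bar>Z w\<bar>)"
proof (rule Bochner_Integration.integrable_bound[of _ "\<lambda>w. L u w - L s w"])
  have [measurable]: "L u \<in> borel_measurable P" "L s \<in> borel_measurable P" "Z \<in> borel_measurable P" using assms by auto
  show "integrable P (\<lambda>w. L u w - L s w)" using assms by (auto intro!: L_integrable)
  show "(\<lambda>w. (L u w - L s w) * min 1 \<bar>Z w\<bar>) \<in> borel_measurable P" by measurable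
  show "AE w in P. norm ((L u w - L s w) * min 1 \<bar>Z w\<bar>) \<le> norm (L u w - L s w)"
    by (auto simp: abs_mult intro!: mult_left_le)
qed

text \<open>Since L is increasing, the sum is at most L_t times the modulus of continuity of Y along
  the path, which tends to 0 with the mesh. The caps at 1 make the integrable variable L_t a
  dominating function.\<close>

lemma osc_sum_tendsto:
  assumes rt: "0 \<le> r" "r \<le> t" and Y: "\<And>s. s \<in> {r..t} ==> Y s \<in> borel_measurable P"
    and cY: "AE w in P. continuous_on {r..t} (\<lambda>s. Y s w)"
  shows "(\<lambda>n. \<Sum>i<n. \<integral>w. (L (grid r t n (Suc i)) w - L (grid r t n i) w) * min 1 \<bar>Y (grid r t n (Suc i)) w - Y (grid r t n i) w\<bar> \<partial>P) \<longlonglongrightarrow> 0"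
proof -
  define S where "S n w = (\<Sum>i<n. (L (grid r t n (Suc i)) w - L (grid r t n i) w) * min 1 \<bar>Y (grid r t n (Suc i)) w - Y (grid r t n i) w\<bar>)" for n w
  have gb: "r \<le> grid r t n i \<and> grid r t n i \<le> t" if "i \<le> n" for i n using grid_bounds[OF rt(2) that] by simp
  have int: "integrable P (\<lambda>w. (L (grid r t n (Suc i)) w - L (grid r t n i) w) * min 1 \<bar>Y (grid r t n (Suc i)) w - Y (grid r t n i) w\<bar>)" if "i < n" for n i
    by (rule osc_integrable) (use that rt gb[of i n] gb[of "Suc i" n] grid_mono[OF rt(2), of i "Suc i" n] Y in auto)
  have eq: "(LINT w|P. S n w) = (\<Sum>i<n. \<integral>w. (L (grid r t n (Suc i)) w - L (grid r t n i) w) * min 1 \<bar>Y (grid r t n (Suc i)) w - Y (grid r t n i) w\<bar> \<partial>P)" for n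
    unfolding S_def using int by (intro Bochner_Integration.integral_sum) auto
  have ae: "AE w in P. (\<lambda>n. S n w) \<longlonglongrightarrow> 0 \<and> (\<forall>n. norm (S n w) \<le> L t w)"
    using L_regular cY AE_space
  proof eventually_elim
    case (elim w)
    have mono: "mono_on {0..} (\<lambda>t. L t w)" using elim by auto
    have dL: "0 \<le> L (grid r t n (Suc i)) w - L (grid r t n i) w" if "i < n" for n i
      using mono_onD[OF mono, of "grid r t n i" "grid r t n (Suc i)"] that gb[of i n] gb[of "Suc i" n] rt
        grid_mono[OF rt(2), of i "Suc i" n] by auto
    have tel: "(\<Sum>i<n. L (grid r t n (Suc i)) w - L (grid r t n i) w) = L t w - L r w" if "0 < n" for n
      using sum_lessThan_telescope[of "\<lambda>i. L (grid r t n i) w" n] grid_n[OF that, of r t] by simp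
    have Lpos: "0 \<le> L r w" "L r w \<le> L t w" using L_nonneg[of r w] rt elim mono_onD[OF mono, of r t] by auto
    have nonneg: "0 \<le> S n w" for n unfolding S_def using dL by (intro sum_nonneg mult_nonneg_nonneg) auto
    have up: "S n w \<le> \<epsilon> * L t w" if n: "0 < n" and small: "\<And>i. i < n ==> min 1 \<bar>Y (grid r t n (Suc i)) w - Y (grid r t n i) w\<bar> \<le> \<epsilon>" and "0 \<le> \<epsilon>" for n \<epsilon>
    proof -
      have "S n w \<le> (\<Sum>i<n. (L (grid r t n (Suc i)) w - L (grid r t n i) w) * \<epsilon>)"
        unfolding S_def using dL small by (intro sum_mono mult_left_mono) auto
      also have "\<dots> = (L t w - L r w) * \<epsilon>" by (simp only: sum_distrib_right[symmetric] tel[OF n])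
      also have "\<dots> \<le> \<epsilon> * L t w" using Lpos that by (simp add: algebra_simps)
      finally show ?thesis .
    qed
    have b: "norm (S n w) \<le> L t w" for n
    proof (cases "n = 0")
      case True then show ?thesis using Lpos by (simp add: S_def)
    next
      case False then show ?thesis using up[of n 1] nonneg[of n] by simp
    qed
    have uc: "uniformly_continuous_on {r..t} (\<lambda>s. Y s w)"
      using elim by (intro compact_uniformly_continuous) auto
    have "(\<lambda>n. S n w) \<longlonglongrightarrow> 0"
    proof (rule LIMSEQ_I)
      fix \<epsilon> :: real assume \<epsilon>: "0 < \<epsilon>"
      \<comment> \<open>The 1 in the denominator covers L_t = 0.\<close>
      define \<epsilon>' where "\<epsilon>' = \<epsilon> / (L t w + 1)"
      have L1: "0 < L t w + 1" using Lpos by linarith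
      have \<epsilon>': "0 < \<epsilon>'" "\<epsilon>' * L t w < \<epsilon>"
        using \<epsilon> L1 Lpos by (auto simp: \<epsilon>'_def field_simps)
      obtain d where d: "0 < d" "\<And>x x'. x \<in> {r..t} ==> x' \<in> {r..t} ==> dist x' x < d ==> dist (Y x' w) (Y x w) < \<epsilon>'"
        using uc \<epsilon>'(1) unfolding uniformly_continuous_on_def by meson
      have "(\<lambda>n. (t - r) / real n) \<longlonglongrightarrow> 0" by (rule lim_const_over_n)
      then have "\<forall>\<^sub>F n in sequentially. (t - r) / real n < d" using d(1) by (rule order_tendstoD)
      then obtain N where N: "\<And>n. N \<le> n ==> (t - r) / real n < d" unfolding eventually_sequentially by blast
      show "\<exists>no. \<forall>n\<ge>no. norm (S n w - 0) < \<epsilon>"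
      proof (intro exI[of _ "Suc N"] allI impI)
        fix n assume n: "Suc N \<le> n"
        have "S n w \<le> \<epsilon>' * L t w"
        proof (rule up)
          fix i assume i: "i < n"
          have "dist (grid r t n (Suc i)) (grid r t n i) < d"
            using N[of n] n grid_mono[OF rt(2), of i "Suc i" n] rt by (simp add: dist_real_def grid_step[of r t n i])
          then have "dist (Y (grid r t n (Suc i)) w) (Y (grid r t n i) w) < \<epsilon>'"
            using gb[of i n] gb[of "Suc i" n] i by (intro d(2)) auto
          then show "min 1 \<bar>Y (grid r t n (Suc i)) w - Y (grid r t n i) w\<bar> \<le> \<epsilon>'" by (simp add: dist_real_def)
        qed (use n \<epsilon>' in auto)
        then show "norm (S n w - 0) < \<epsilon>" using nonneg[of n] \<epsilon>' by simp
      qed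
    qed
    then show ?case using b by blast
  qed
  have "(\<lambda>n. \<integral>w. S n w \<partial>P) \<longlonglongrightarrow> (LINT w|P. 0)"
  proof (rule integral_dominated_convergence)
    show "integrable P (L t)" using rt by (intro L_integrable) auto
    show "S n \<in> borel_measurable P" for n unfolding S_def using int by (intro borel_measurable_sum) auto
    show "AE w in P. (\<lambda>n. S n w) \<longlonglongrightarrow> 0" using ae by auto
    show "AE w in P. norm (S n w) \<le> L t w" for n using ae by auto
  qed simp
  then show ?thesis unfolding eq by simp
qed

lemma path_continuous: "w \<in> path_space ==> 0 \<le> r ==> continuous_on {r..t} w"
  unfolding path_space_def by (auto intro: continuous_on_subset)

lemma mixed_integrable:
  assumes "0 \<le> s" "s \<le> u"
  shows "integrable P (\<lambda>w. min 1 \<bar>L u w - L s w\<bar> * \<bar>w u - w s\<bar>)"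
proof (rule Bochner_Integration.integrable_bound[OF increment_moments(1)[OF assms, of 1]])
  have [measurable]: "L u \<in> borel_measurable P" "L s \<in> borel_measurable P" "(\<lambda>w. w u) \<in> borel_measurable P" "(\<lambda>w. w s) \<in> borel_measurable P" using assms by auto
  show "(\<lambda>w. min 1 \<bar>L u w - L s w\<bar> * \<bar>w u - w s\<bar>) \<in> borel_measurable P" by measurable
qed (auto simp: abs_mult intro!: AE_I2 mult_left_le_one_le)

text \<open>Young's inequality ab \<le> a^2 / (2 \<eta>) + \<eta> b^2 / 2 with a the capped
  increment of L and b that of X. As a^2 is at most a times the increment of L, the first part is an
  oscillation sum and vanishes; the second has mean \<eta> (t - r) / 2 whatever the mesh.\<close>

lemma mixed_sum_tendsto:
  assumes rt: "0 \<le> r" "r \<le> t"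
  shows "(\<lambda>n. \<Sum>i<n. \<integral>w. min 1 \<bar>L (grid r t n (Suc i)) w - L (grid r t n i) w\<bar> * \<bar>w (grid r t n (Suc i)) - w (grid r t n i)\<bar> \<partial>P) \<longlonglongrightarrow> 0"
proof -
  define S3 where "S3 n = (\<Sum>i<n. \<integral>w. (L (grid r t n (Suc i)) w - L (grid r t n i) w) * min 1 \<bar>L (grid r t n (Suc i)) w - L (grid r t n i) w\<bar> \<partial>P)" for n
  define S5 where "S5 n = (\<Sum>i<n. \<integral>w. min 1 \<bar>L (grid r t n (Suc i)) w - L (grid r t n i) w\<bar> * \<bar>w (grid r t n (Suc i)) - w (grid r t n i)\<bar> \<partial>P)" for n
  have S3: "S3 \<longlonglongrightarrow> 0" unfolding S3_def
  proof (rule osc_sum_tendsto[OF rt])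
    show "AE w in P. continuous_on {r..t} (\<lambda>s. L s w)" by (rule L_cont[OF rt(1)])
  qed (use rt in auto)
  have gb: "r \<le> grid r t n i \<and> grid r t n i \<le> t" if "i \<le> n" for i n using grid_bounds[OF rt(2) that] by simp
  have bound: "S5 n \<le> S3 n / (2 * \<eta>) + \<eta> / 2 * (t - r)" if \<eta>: "0 < \<eta>" for n \<eta>
  proof -
    have "S5 n \<le> (\<Sum>i<n. (LINT w|P. (L (grid r t n (Suc i)) w - L (grid r t n i) w) * min 1 \<bar>L (grid r t n (Suc i)) w - L (grid r t n i) w\<bar>) / (2 * \<eta>) + \<eta> / 2 * ((t - r) / real n))"
      unfolding S5_def
    proof (rule sum_mono)
      fix i assume i: "i \<in> {..<n}"
      define s u where "s = grid r t n i" and "u = grid r t n (Suc i)"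
      have su: "0 \<le> s" "s \<le> u" using rt i gb[of i n] grid_mono[OF rt(2), of i "Suc i" n] by (auto simp: s_def u_def)
      then have u: "0 \<le> u" by simp
      have Z: "(\<lambda>w. L u w - L s w) \<in> borel_measurable P" using su u by auto
      note ii = osc_integrable[OF su Z] increment_moments(1)[OF su, of 2]
      have "(LINT w|P. min 1 \<bar>L u w - L s w\<bar> * \<bar>w u - w s\<bar>) \<le>
        (LINT w|P. (L u w - L s w) * min 1 \<bar>L u w - L s w\<bar> / (2 * \<eta>) + \<eta> / 2 * (w u - w s)\<^sup>2)"
      proof (rule integral_mono_AE)
        show "AE w in P. min 1 \<bar>L u w - L s w\<bar> * \<bar>w u - w s\<bar> \<le> (L u w - L s w) * min 1 \<bar>L u w - L s w\<bar> / (2 * \<eta>) + \<eta> / 2 * (w u - w s)\<^sup>2"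
          using L_mono[OF su]
        proof eventually_elim
          case (elim w)
          define a b where "a = min 1 \<bar>L u w - L s w\<bar>" and "b = \<bar>w u - w s\<bar>"
          have a: "0 \<le> a" "a \<le> L u w - L s w" using elim by (auto simp: a_def)
          have "2 * \<eta> * (a * b) \<le> a\<^sup>2 + (\<eta> * b)\<^sup>2" using sum_squares_bound[of a "\<eta> * b"] by (simp add: algebra_simps)
          also have "a\<^sup>2 \<le> (L u w - L s w) * a" using mult_right_mono[OF a(2) a(1)] by (simp add: power2_eq_square)
          then have "a\<^sup>2 + (\<eta> * b)\<^sup>2 \<le> (L u w - L s w) * a + (\<eta> * b)\<^sup>2" by simp
          finally have "a * b \<le> ((L u w - L s w) * a + (\<eta> * b)\<^sup>2) / (2 * \<eta>)"
            using \<eta> by (simp add: pos_le_divide_eq mult.commute)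
          also have "\<dots> = (L u w - L s w) * a / (2 * \<eta>) + \<eta> / 2 * b\<^sup>2"
            using \<eta> by (simp add: add_divide_distrib power_mult_distrib power2_eq_square)
          finally show ?case by (simp add: a_def b_def)
        qed
      qed (use ii mixed_integrable[OF su] in auto)
      also have "\<dots> = (LINT w|P. (L u w - L s w) * min 1 \<bar>L u w - L s w\<bar>) / (2 * \<eta>) + \<eta> / 2 * (u - s)"
        using ii increment_moments(3)[OF su] by simp
      finally show "(LINT w|P. min 1 \<bar>L (grid r t n (Suc i)) w - L (grid r t n i) w\<bar> * \<bar>w (grid r t n (Suc i)) - w (grid r t n i)\<bar>)
        \<le> (LINT w|P. (L (grid r t n (Suc i)) w - L (grid r t n i) w) * min 1 \<bar>L (grid r t n (Suc i)) w - L (grid r t n i) w\<bar>) / (2 * \<eta>) + \<eta> / 2 * ((t - r) / real n)"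
        by (simp add: s_def u_def grid_step)
    qed
    also have "\<dots> = S3 n / (2 * \<eta>) + real n * (\<eta> / 2 * ((t - r) / real n))"
      by (simp add: sum.distrib S3_def sum_divide_distrib)
    also have "real n * (\<eta> / 2 * ((t - r) / real n)) \<le> \<eta> / 2 * (t - r)"
      using rt \<eta> by (cases "n = 0") auto
    finally show ?thesis by simp
  qed
  have nn: "0 \<le> S5 n" for n unfolding S5_def by (intro sum_nonneg integral_nonneg) auto
  have "S5 \<longlonglongrightarrow> 0"
  proof (rule LIMSEQ_I)
    fix \<epsilon> :: real assume \<epsilon>: "0 < \<epsilon>"
    \<comment> \<open>Makes the quadratic part at most \<epsilon>/2. The other part falls below
      \<epsilon>/2 once the oscillation sum \<open>S3\<close> is less than \<epsilon>
      \<eta>.\<close>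
    define \<eta> where "\<eta> = \<epsilon> / (t - r + 1)"
    have \<eta>: "0 < \<eta>" "\<eta> * (t - r) \<le> \<epsilon>" using \<epsilon> rt by (auto simp: \<eta>_def field_simps)
    have "\<forall>\<^sub>F n in sequentially. S3 n < \<epsilon> * \<eta>" using S3 \<epsilon> \<eta> by (intro order_tendstoD) auto
    then obtain N where N: "\<And>n. N \<le> n ==> S3 n < \<epsilon> * \<eta>" unfolding eventually_sequentially by blast
    show "\<exists>no. \<forall>n\<ge>no. norm (S5 n - 0) < \<epsilon>"
    proof (intro exI[of _ N] allI impI)
      fix n assume "N \<le> n"
      then have "S3 n / (2 * \<eta>) < \<epsilon> / 2" using N[of n] \<eta> by (simp add: field_simps)
      then have "S5 n < \<epsilon> / 2 + \<epsilon> / 2" using bound[OF \<eta>(1), of n] \<eta>(2) by simp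
      then show "norm (S5 n - 0) < \<epsilon>" using nn[of n] by simp
    qed
  qed
  then show ?thesis unfolding S5_def .
qed

lemma err_integrable:
  assumes su: "0 \<le> s" "s \<le> u"
  shows "integrable P (err s u)"
proof -
  have u: "0 \<le> u" using su by simp
  have [measurable]: "(\<lambda>w. L u w - L s w) \<in> borel_measurable P" "(\<lambda>w. w u - w s) \<in> borel_measurable P" using su u by auto
  show ?thesis unfolding err_def[abs_def]
    by (intro Bochner_Integration.integrable_add crossing_integrable dL_abs(1) osc_integrable mixed_integrable su) measurable
qed

text \<open>The crossing sums enter three times: once for themselves, and twice through
  \<open>dL_abs\<close> for the growth of L away from the origin.\<close>

lemma err_sum_tendsto:
  assumes rt: "0 \<le> r" "r \<le> t"
  shows "(\<lambda>n. \<Sum>i<n. \<integral>w. err (grid r t n i) (grid r t n (Suc i)) w \<partial>P) \<longlonglongrightarrow> 0"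
proof -
  define E1 where "E1 n = (\<Sum>i<n. \<integral>w. crossing (grid r t n i) (grid r t n (Suc i)) w \<partial>P)" for n
  define E3 where "E3 n = (\<Sum>i<n. \<integral>w. (L (grid r t n (Suc i)) w - L (grid r t n i) w) * min 1 \<bar>L (grid r t n (Suc i)) w - L (grid r t n i) w\<bar> \<partial>P)" for n
  define E4 where "E4 n = (\<Sum>i<n. \<integral>w. (L (grid r t n (Suc i)) w - L (grid r t n i) w) * min 1 \<bar>w (grid r t n (Suc i)) - w (grid r t n i)\<bar> \<partial>P)" for n
  define E5 where "E5 n = (\<Sum>i<n. \<integral>w. min 1 \<bar>L (grid r t n (Suc i)) w - L (grid r t n i) w\<bar> * \<bar>w (grid r t n (Suc i)) - w (grid r t n i)\<bar> \<partial>P)" for n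
  have E1: "E1 \<longlonglongrightarrow> 0" unfolding E1_def by (rule crossing_sum_tendsto[OF rt])
  have E3: "E3 \<longlonglongrightarrow> 0" unfolding E3_def
  proof (rule osc_sum_tendsto[OF rt])
    show "AE w in P. continuous_on {r..t} (\<lambda>s. L s w)" by (rule L_cont[OF rt(1)])
  qed (use rt in auto)
  have E4: "E4 \<longlonglongrightarrow> 0" unfolding E4_def
  proof (rule osc_sum_tendsto[OF rt])
    show "AE w in P. continuous_on {r..t} (\<lambda>s. w s)"
      using AE_space by eventually_elim (auto intro!: path_continuous rt)
  qed (use rt in auto)
  have E5: "E5 \<longlonglongrightarrow> 0" unfolding E5_def by (rule mixed_sum_tendsto[OF rt])
  have pos: "0 \<le> (\<Sum>i<n. \<integral>w. err (grid r t n i) (grid r t n (Suc i)) w \<partial>P)" and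
    le: "(\<Sum>i<n. \<integral>w. err (grid r t n i) (grid r t n (Suc i)) w \<partial>P) \<le> 3 * E1 n + E3 n + E4 n + E5 n" for n
  proof -
    have *: "0 \<le> (LINT w|P. err s u w) \<and> (LINT w|P. err s u w) \<le> 3 * (LINT w|P. crossing s u w) +
        (LINT w|P. (L u w - L s w) * min 1 \<bar>L u w - L s w\<bar>) + (LINT w|P. (L u w - L s w) * min 1 \<bar>w u - w s\<bar>) +
        (LINT w|P. min 1 \<bar>L u w - L s w\<bar> * \<bar>w u - w s\<bar>)" if su: "0 \<le> s" "s \<le> u" for s u
    proof
      have u: "0 \<le> u" using su by simp
      have [measurable]: "(\<lambda>w. L u w - L s w) \<in> borel_measurable P" "(\<lambda>w. w u - w s) \<in> borel_measurable P" using su u by auto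
      have "AE w in P. 0 \<le> err s u w" using L_mono[OF su]
        by eventually_elim (simp add: err_def crossing_nonneg)
      then show "0 \<le> (LINT w|P. err s u w)" by (rule integral_nonneg_AE)
      have "(LINT w|P. err s u w) = (LINT w|P. crossing s u w) + (LINT w|P. (L u w - L s w) * \<bar>w s\<bar>) +
        (LINT w|P. (L u w - L s w) * min 1 \<bar>L u w - L s w\<bar>) + (LINT w|P. (L u w - L s w) * min 1 \<bar>w u - w s\<bar>) +
        (LINT w|P. min 1 \<bar>L u w - L s w\<bar> * \<bar>w u - w s\<bar>)" unfolding err_def
        using crossing_integrable[OF su] dL_abs(1)[OF su] osc_integrable[OF su, of "\<lambda>w. L u w - L s w"]
          osc_integrable[OF su, of "\<lambda>w. w u - w s"] mixed_integrable[OF su] by simp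
      then show "(LINT w|P. err s u w) \<le> 3 * (LINT w|P. crossing s u w) +
        (LINT w|P. (L u w - L s w) * min 1 \<bar>L u w - L s w\<bar>) + (LINT w|P. (L u w - L s w) * min 1 \<bar>w u - w s\<bar>) +
        (LINT w|P. min 1 \<bar>L u w - L s w\<bar> * \<bar>w u - w s\<bar>)"
        using dL_abs(2)[OF su] by linarith
    qed
    have g: "0 \<le> grid r t n i" "grid r t n i \<le> grid r t n (Suc i)" if "i \<in> {..<n}" for i
      using rt grid_bounds[OF rt(2), of i n] grid_mono[OF rt(2), of i "Suc i" n] that by auto
    show "0 \<le> (\<Sum>i<n. \<integral>w. err (grid r t n i) (grid r t n (Suc i)) w \<partial>P)"
      by (rule sum_nonneg) (use *[OF g] in blast)
    have "(\<Sum>i<n. \<integral>w. err (grid r t n i) (grid r t n (Suc i)) w \<partial>P) \<le>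
      (\<Sum>i<n. 3 * (LINT w|P. crossing (grid r t n i) (grid r t n (Suc i)) w) +
        (LINT w|P. (L (grid r t n (Suc i)) w - L (grid r t n i) w) * min 1 \<bar>L (grid r t n (Suc i)) w - L (grid r t n i) w\<bar>) +
        (LINT w|P. (L (grid r t n (Suc i)) w - L (grid r t n i) w) * min 1 \<bar>w (grid r t n (Suc i)) - w (grid r t n i)\<bar>) +
        (LINT w|P. min 1 \<bar>L (grid r t n (Suc i)) w - L (grid r t n i) w\<bar> * \<bar>w (grid r t n (Suc i)) - w (grid r t n i)\<bar>))"
      by (rule sum_mono) (use *[OF g] in blast)
    then show "(\<Sum>i<n. \<integral>w. err (grid r t n i) (grid r t n (Suc i)) w \<partial>P) \<le> 3 * E1 n + E3 n + E4 n + E5 n"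
      by (simp add: sum.distrib E1_def E3_def E4_def E5_def sum_distrib_left)
  qed
  have "(\<lambda>n. 3 * E1 n + E3 n + E4 n + E5 n) \<longlonglongrightarrow> 3 * 0 + 0 + 0 + 0"
    by (intro tendsto_intros E1 E3 E4 E5)
  then have "(\<lambda>n. 3 * E1 n + E3 n + E4 n + E5 n) \<longlonglongrightarrow> 0" by simp
  then show ?thesis
    by (rule tendsto_sandwich[OF _ _ tendsto_const, rotated 2]) (use pos le in auto)
qed

end

section \<open>Increments of functions of the local time\<close>

text \<open>The primitive that vanishes on the negative half-line. For |h| \<le> K it is K-Lipschitz
  on the whole line, whatever values \<open>h\<close> takes at negative arguments.\<close>

definition Hint :: "(real => real) => real => real" where
  "Hint h l = (LBINT x:{0..l}. h x)"

context
  fixes h :: "real => real" and K :: real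
  assumes h: "h \<in> borel_measurable borel" "\<And>x. \<bar>h x\<bar> \<le> K"
begin

lemma bounded_set_integrable: "A \<in> sets borel ==> emeasure lborel A < \<infinity> ==> set_integrable lborel A h"
proof -
  assume A: "A \<in> sets borel" "emeasure lborel A < \<infinity>"
  show ?thesis unfolding set_integrable_def
  proof (rule Bochner_Integration.integrable_bound)
    show "integrable lborel (\<lambda>x. K * indicator A x)" using A by (intro integrable_mult_right integrable_real_indicator) auto
    show "(\<lambda>x. indicator A x *\<^sub>R h x) \<in> borel_measurable lborel" using A h(1) by measurable
    show "AE x in lborel. norm (indicator A x *\<^sub>R h x) \<le> norm (K * indicator A x)"
      using h(2) by (auto simp: indicator_def intro!: AE_I2) (meson abs_ge_self order_trans)
  qed
qed

lemma Hint_diff: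
  assumes "a \<le> b"
  shows "Hint h b - Hint h a = (LBINT x:{0..b} - {0..a}. h x)"
proof -
  have un: "{0..b} = {0..a} \<union> ({0..b} - {0..a})" using assms by auto
  have i: "set_integrable lborel {0..a} h" "set_integrable lborel ({0..b} - {0..a}) h"
  proof -
    show "set_integrable lborel {0..a} h" by (rule bounded_set_integrable) (auto simp: emeasure_lborel_Icc_eq)
    have "emeasure lborel ({0..b} - {0..a}) \<le> emeasure lborel {0..b}" by (rule emeasure_mono) auto
    also have "\<dots> < \<infinity>" by (simp add: emeasure_lborel_Icc_eq)
    finally show "set_integrable lborel ({0..b} - {0..a}) h" by (intro bounded_set_integrable) auto
  qed
  have "Hint h b = Hint h a + (LBINT x:{0..b} - {0..a}. h x)"
    unfolding Hint_def by (subst un, rule set_integral_Un[OF _ i]) auto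
  then show ?thesis by simp
qed

text \<open>With c = 0 and m = K this is the Lipschitz bound; with c = h a and m the oscillation of
  \<open>h\<close> it is the first-order expansion of the primitive at a.\<close>

lemma Hint_approx:
  assumes ab: "0 \<le> a" "a \<le> b" and m: "\<And>x. a < x ==> x \<le> b ==> \<bar>h x - c\<bar> \<le> m"
  shows "\<bar>Hint h b - Hint h a - c * (b - a)\<bar> \<le> m * (b - a)"
proof -
  have eq: "{0..b} - {0..a} = {a<..b}" using ab by auto
  have i: "set_integrable lborel {a<..b} h" by (rule bounded_set_integrable) (use ab in auto)
  have ic: "set_integrable lborel {a<..b} (\<lambda>x. d)" for d :: real
    unfolding set_integrable_def using ab by (auto intro!: integrable_mult_left integrable_real_indicator)
  have cint: "(LBINT x:{a<..b}. d) = d * (b - a)" for d :: real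
    unfolding set_lebesgue_integral_def using ab by simp
  have 1: "(LBINT x:{a<..b}. h x) \<le> (LBINT x:{a<..b}. c + m)"
    by (rule set_integral_mono[OF i ic]) (use m in force)
  have 2: "(LBINT x:{a<..b}. c - m) \<le> (LBINT x:{a<..b}. h x)"
    by (rule set_integral_mono[OF ic i]) (use m in force)
  show ?thesis using 1 2 unfolding cint Hint_diff[OF ab(2)] eq by (simp add: abs_le_iff algebra_simps)
qed

lemma K_nonneg: "0 \<le> K" using h(2)[of 0] by linarith

lemma Hint_lipschitz: "\<bar>Hint h b - Hint h a\<bar> \<le> K * \<bar>b - a\<bar>"
proof -
  have *: "\<bar>Hint h b - Hint h a\<bar> \<le> K * (b - a)" if "a \<le> b" for a b
  proof (cases "0 \<le> a")
    case True then show ?thesis using Hint_approx[of a b 0 K] that h(2) by simp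
  next
    case False
    have neg: "Hint h x = 0" if "x < 0" for x using that by (simp add: Hint_def set_lebesgue_integral_def)
    have z: "Hint h 0 = 0"
    proof -
      have "Hint h 0 = (LBINT x:{0::real}. h x)" by (simp add: Hint_def)
      also have "\<dots> = 0" unfolding set_lebesgue_integral_def
        by (rule integral_eq_zero_AE) (use AE_lborel_singleton[of "0::real"] in \<open>eventually_elim, auto\<close>)
      finally show ?thesis .
    qed
    show ?thesis
    proof (cases "b < 0")
      case True then show ?thesis using False neg[of a] neg[of b] that K_nonneg by simp
    next
      case b: False
      have "\<bar>Hint h b - Hint h 0\<bar> \<le> K * (b - 0)" using Hint_approx[of 0 b 0 K] b h(2) by simp
      also have "\<dots> \<le> K * (b - a)" using False K_nonneg by (intro mult_left_mono) auto
      finally show ?thesis using neg[of a] z False by simp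
    qed
  qed
  show ?thesis using *[of a b] *[of b a] by (cases "a \<le> b") (auto simp: abs_minus_commute)
qed

lemma Hint_0: "Hint h 0 = 0"
proof -
  have "Hint h (-1) = 0" by (simp add: Hint_def set_lebesgue_integral_def)
  have "Hint h 0 = (LBINT x:{0::real}. h x)" by (simp add: Hint_def)
  also have "\<dots> = 0" unfolding set_lebesgue_integral_def
    by (rule integral_eq_zero_AE) (use AE_lborel_singleton[of "0::real"] in \<open>eventually_elim, auto\<close>)
  finally show ?thesis .
qed

lemma Hint_bound: "\<bar>Hint h l\<bar> \<le> K * \<bar>l\<bar>"
  using Hint_lipschitz[of l 0] by (simp add: Hint_0)

lemma Hint_borel: "Hint h \<in> borel_measurable borel"
proof -
  have "K-lipschitz_on UNIV (Hint h)"
    by (rule lipschitz_onI) (use Hint_lipschitz K_nonneg in \<open>auto simp: dist_real_def abs_minus_commute\<close>)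
  then show ?thesis by (intro borel_measurable_continuous_onI lipschitz_on_continuous_on)
qed

end

lemma Hint_lin:
  assumes "f \<in> borel_measurable borel" "g \<in> borel_measurable borel" "\<And>x. \<bar>f x\<bar> \<le> K" "\<And>x. \<bar>g x\<bar> \<le> K"
  shows "Hint (\<lambda>x. a * f x + b * g x) l = a * Hint f l + b * Hint g l"
proof -
  have i: "set_integrable lborel {0..l} f" "set_integrable lborel {0..l} g"
    using bounded_set_integrable[OF assms(1,3)] bounded_set_integrable[OF assms(2,4)] by (auto simp: emeasure_lborel_Icc_eq)
  then have i': "set_integrable lborel {0..l} (\<lambda>x. a * f x)" "set_integrable lborel {0..l} (\<lambda>x. b * g x)" by auto
  show ?thesis unfolding Hint_def using set_integral_add(2)[OF i'] by simp
qed

lemma Hint_lim: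
  assumes F: "\<And>n. F n \<in> borel_measurable borel" "\<And>n x. \<bar>F n x\<bar> \<le> K"
    and f: "f \<in> borel_measurable borel" "\<And>x. (\<lambda>n::nat. F n x) \<longlonglongrightarrow> f x"
  shows "(\<lambda>n. Hint (F n) l) \<longlonglongrightarrow> Hint f l"
  unfolding Hint_def set_lebesgue_integral_def
proof (rule integral_dominated_convergence)
  show "integrable lborel (\<lambda>x. K * indicator {0..l} x)" by (intro integrable_mult_right integrable_real_indicator) (auto simp: emeasure_lborel_Icc_eq)
  show "AE x in lborel. norm (indicator {0..l} x *\<^sub>R F n x) \<le> K * indicator {0..l} x" for n
    using F(2)[of n] by (auto simp: indicator_def)
  show "AE x in lborel. (\<lambda>n. indicator {0..l} x *\<^sub>R F n x) \<longlonglongrightarrow> indicator {0..l} x *\<^sub>R f x"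
    using f(2) by (auto intro!: tendsto_intros)
  show "(\<lambda>x. indicator {0..l} x *\<^sub>R f x) \<in> borel_measurable lborel" using f(1) by measurable
  show "(\<lambda>x. indicator {0..l} x *\<^sub>R F n x) \<in> borel_measurable lborel" for n using F(1)[of n] by measurable
qed

text \<open>Setting for products of a weight k(L) with \<phi>(s, X_s), where \<phi> vanishes
  linearly at the origin. \<open>\<phi>_mart\<close> says that \<phi>(s, X_s) has drift \<gamma>(s,
  X_s); it is exactly linear in u - s because \<gamma>(s, X_s) is a martingale in each application.
  \<open>V\<close> is the past weight against which conditional statements are tested.\<close>

locale ito_odd = wiener_local_time +
  fixes r t :: real and V :: "path => complex" and B C :: real
    and \<phi> \<gamma> :: "real => real => complex"
  assumes rt: "0 \<le> r" "r \<le> t"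
    and V: "V \<in> borel_measurable (Filt r)" "\<And>w. cmod (V w) \<le> B"
    and \<phi>_meas: "s \<in> {r..t} ==> \<phi> s \<in> borel_measurable borel"
    and \<phi>_lin: "s \<in> {r..t} ==> cmod (\<phi> s x) \<le> C * \<bar>x\<bar>"
    and \<gamma>_bound: "s \<in> {r..t} ==> cmod (\<gamma> s x) \<le> C"
    and \<gamma>_cont: "continuous_on UNIV (\<lambda>(s, x). \<gamma> s x)"
    and \<phi>_mart: "r \<le> s ==> s \<le> u ==> u \<le> t ==> W \<in> borel_measurable (Filt s) ==> (\<And>w. cmod (W w) \<le> K) ==>
      (LINT w|P. W w * \<phi> u (w u)) = (LINT w|P. W w * \<phi> s (w s)) + of_real (u - s) * (LINT w|P. W w * \<gamma> s (w s))"
begin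

lemma B_nonneg: "0 \<le> B" using V(2) norm_ge_zero order_trans by blast

lemma C_nonneg: "0 \<le> C" using \<gamma>_bound[of r 0] rt norm_ge_zero[of "\<gamma> r 0"] by (auto simp del: norm_ge_zero)

lemma V_Filt: "r \<le> s ==> V \<in> borel_measurable (Filt s)" using measurable_Filt_mono[OF V(1)] .

lemma V_borel [measurable]: "V \<in> borel_measurable P" using measurable_Filt_P[OF V(1)] .

lemma \<gamma>_meas [measurable]: "\<gamma> s \<in> borel_measurable borel"
proof -
  have "continuous_on UNIV ((\<lambda>(s, x). \<gamma> s x) \<circ> (\<lambda>x. (s, x)))"
    by (intro continuous_on_compose continuous_on_subset[OF \<gamma>_cont] continuous_intros) auto
  then show ?thesis by (auto simp: o_def intro!: borel_measurable_continuous_onI)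
qed

lemma \<phi>_integrable: "s \<in> {r..t} ==> integrable P (\<lambda>w. \<phi> s (w s))"
proof (rule Bochner_Integration.integrable_bound[of _ "\<lambda>w. C * w s"])
  assume s: "s \<in> {r..t}"
  show "integrable P (\<lambda>w. C * w s)" using coord_moments(1)[of s] s rt by auto
  have [measurable]: "(\<lambda>w. w s) \<in> borel_measurable P" "\<phi> s \<in> borel_measurable borel" using s rt \<phi>_meas by auto
  show "(\<lambda>w. \<phi> s (w s)) \<in> borel_measurable P" by measurable
  show "AE w in P. cmod (\<phi> s (w s)) \<le> norm (C * w s)"
    using \<phi>_lin[OF s] C_nonneg by (auto simp: abs_mult)
qed

lemma \<gamma>_integrable: "s \<in> {r..t} ==> integrable P (\<lambda>w. \<gamma> s (w s))"
proof (rule integrable_const_bound[of _ C])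
  assume s: "s \<in> {r..t}"
  have [measurable]: "(\<lambda>w. w s) \<in> borel_measurable P" using s rt by auto
  show "(\<lambda>w. \<gamma> s (w s)) \<in> borel_measurable P" by measurable
  show "AE w in P. cmod (\<gamma> s (w s)) \<le> C" using \<gamma>_bound[OF s] by auto
qed

lemma L_weight:
  fixes Z :: "path => complex"
  assumes s: "s \<in> {r..t}" and h: "h \<in> borel_measurable borel" "\<And>x. \<bar>h x\<bar> \<le> K"
    and Z: "integrable P Z"
  shows "integrable P (\<lambda>w. V w * of_real (h (L s w)) * Z w)"
    and "cmod (LINT w|P. V w * of_real (h (L s w)) * Z w) \<le> B * K * (LINT w|P. cmod (Z w))"
proof -
  have [measurable]: "L s \<in> borel_measurable P" "h \<in> borel_measurable borel" using s rt h by auto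
  have le: "cmod (V w * of_real (h (L s w))) \<le> B * K" for w
    unfolding norm_mult using V(2)[of w] h(2)[of "L s w"] B_nonneg by (intro mult_mono) auto
  show i: "integrable P (\<lambda>w. V w * of_real (h (L s w)) * Z w)"
    by (rule integrable_bounded_mult[OF _ le Z]) measurable
  have "cmod (LINT w|P. V w * of_real (h (L s w)) * Z w) \<le> (LINT w|P. cmod (V w * of_real (h (L s w)) * Z w))"
    by (rule integral_norm_bound)
  also have "\<dots> \<le> (LINT w|P. B * K * cmod (Z w))"
  proof (rule integral_mono[OF integrable_norm[OF i]])
    fix w show "cmod (V w * of_real (h (L s w)) * Z w) \<le> B * K * cmod (Z w)"
      using mult_right_mono[OF le[of w], of "cmod (Z w)"] by (simp add: norm_mult)
  qed (use Z in auto)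
  finally show "cmod (LINT w|P. V w * of_real (h (L s w)) * Z w) \<le> B * K * (LINT w|P. cmod (Z w))" by simp
qed

lemma L_weight_lin:
  fixes Z :: "path => complex"
  assumes s: "s \<in> {r..t}" and f: "f \<in> borel_measurable borel" "\<And>x. \<bar>f x\<bar> \<le> K"
    and g: "g \<in> borel_measurable borel" "\<And>x. \<bar>g x\<bar> \<le> K" and Z: "integrable P Z"
  shows "(LINT w|P. V w * of_real (a * f (L s w) + b * g (L s w)) * Z w) =
    of_real a * (LINT w|P. V w * of_real (f (L s w)) * Z w) + of_real b * (LINT w|P. V w * of_real (g (L s w)) * Z w)"
proof -
  have "(LINT w|P. V w * of_real (a * f (L s w) + b * g (L s w)) * Z w) =
    (LINT w|P. of_real a * (V w * of_real (f (L s w)) * Z w) + of_real b * (V w * of_real (g (L s w)) * Z w))"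
    by (rule Bochner_Integration.integral_cong) (auto simp: algebra_simps)
  then show ?thesis using L_weight(1)[OF s f Z] L_weight(1)[OF s g Z] by simp
qed

lemma L_weight_lim:
  fixes Z :: "path => complex"
  assumes s: "s \<in> {r..t}" and F: "\<And>n. F n \<in> borel_measurable borel" "\<And>n x. \<bar>F n x\<bar> \<le> K"
    and f: "f \<in> borel_measurable borel" "\<And>x. (\<lambda>n::nat. F n x) \<longlonglongrightarrow> f x"
    and Z: "integrable P Z"
  shows "(\<lambda>n. \<integral>w. V w * of_real (F n (L s w)) * Z w \<partial>P) \<longlonglongrightarrow> (LINT w|P. V w * of_real (f (L s w)) * Z w)"
proof (rule integral_dominated_convergence[where w="\<lambda>w. B * K * cmod (Z w)"])
  have [measurable]: "L s \<in> borel_measurable P" "f \<in> borel_measurable borel" "F n \<in> borel_measurable borel" for n using s rt f F by auto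
  have [measurable]: "Z \<in> borel_measurable P" using Z by auto
  show "(\<lambda>w. V w * of_real (f (L s w)) * Z w) \<in> borel_measurable P" by measurable
  show "(\<lambda>w. V w * of_real (F n (L s w)) * Z w) \<in> borel_measurable P" for n by measurable
  show "integrable P (\<lambda>w. B * K * cmod (Z w))" using Z by auto
  show "AE w in P. (\<lambda>n. V w * of_real (F n (L s w)) * Z w) \<longlonglongrightarrow> V w * of_real (f (L s w)) * Z w"
    using f(2) by (auto intro!: tendsto_intros)
  show "AE w in P. cmod (V w * of_real (F n (L s w)) * Z w) \<le> B * K * cmod (Z w)" for n
  proof (rule AE_I2)
    fix w
    have "cmod (V w * of_real (F n (L s w))) \<le> B * K"
      unfolding norm_mult using V(2)[of w] F(2)[of n "L s w"] B_nonneg by (intro mult_mono) auto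
    from mult_right_mono[OF this, of "cmod (Z w)"]
    show "cmod (V w * of_real (F n (L s w)) * Z w) \<le> B * K * cmod (Z w)" by (simp add: norm_mult)
  qed
qed

text \<open>\<open>K\<close> is at once a bound and a Lipschitz constant; taking the smaller of the
  two estimates produces the cap at 1 that occurs in \<open>err\<close>.\<close>

lemma lip_diff:
  fixes k :: "real => real"
  assumes k: "\<And>x. \<bar>k x\<bar> \<le> K" "K-lipschitz_on UNIV k"
  shows "\<bar>k a - k b\<bar> \<le> 2 * K * min 1 \<bar>a - b\<bar>"
proof -
  have K: "0 \<le> K" using k(1)[of 0] by linarith
  have "\<bar>k a - k b\<bar> \<le> K * \<bar>a - b\<bar>" using lipschitz_onD[OF k(2), of a b] by (simp add: dist_real_def)
  moreover have "\<bar>k a - k b\<bar> \<le> 2 * K" using k(1)[of a] k(1)[of b] by linarith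
  moreover have "K * \<bar>a - b\<bar> \<le> 2 * K * \<bar>a - b\<bar>" using K by (simp add: mult_right_mono)
  ultimately show ?thesis by (auto simp: min_def)
qed

text \<open>Split |X_u| into |X_s| and the increment: the first meets the growth of L away from the
  origin, the second the mixed term of \<open>err\<close>.\<close>

lemma mixed_le_err:
  assumes "L s w \<le> L u w"
  shows "min 1 \<bar>L u w - L s w\<bar> * \<bar>w u\<bar> \<le> err s u w"
proof -
  have "min 1 \<bar>L u w - L s w\<bar> * \<bar>w u\<bar> \<le> min 1 \<bar>L u w - L s w\<bar> * \<bar>w s\<bar> + min 1 \<bar>L u w - L s w\<bar> * \<bar>w u - w s\<bar>"
    unfolding distrib_left[symmetric] by (intro mult_left_mono) auto
  also have "min 1 \<bar>L u w - L s w\<bar> * \<bar>w s\<bar> \<le> (L u w - L s w) * \<bar>w s\<bar>"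
    using assms by (intro mult_right_mono) auto
  then have "min 1 \<bar>L u w - L s w\<bar> * \<bar>w s\<bar> + min 1 \<bar>L u w - L s w\<bar> * \<bar>w u - w s\<bar> \<le>
     (L u w - L s w) * \<bar>w s\<bar> + min 1 \<bar>L u w - L s w\<bar> * \<bar>w u - w s\<bar>" by simp
  also have "\<dots> \<le> err s u w"
    using assms crossing_nonneg[of s u w] by (simp add: err_def)
  finally show ?thesis .
qed

text \<open>With the weight frozen at L_s, \<open>\<phi>_mart\<close> gives the drift exactly.
  Unfreezing costs |k(L_u) - k(L_s)| |\<phi>(u, X_u)|, which is small because \<phi> vanishes at the
  origin while L moves only there.\<close>

lemma odd_step:
  assumes k: "\<And>x. \<bar>k x\<bar> \<le> K" "K-lipschitz_on UNIV k" and su: "r \<le> s" "s \<le> u" "u \<le> t"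
  shows "cmod ((LINT w|P. V w * of_real (k (L u w)) * \<phi> u (w u)) - (LINT w|P. V w * of_real (k (L s w)) * \<phi> s (w s))
      - of_real (u - s) * (LINT w|P. V w * of_real (k (L s w)) * \<gamma> s (w s)))
    \<le> 2 * B * K * C * (LINT w|P. err s u w)"
proof -
  have K: "0 \<le> K" using k(1)[of 0] by linarith
  have ivl: "s \<in> {r..t}" "u \<in> {r..t}" "0 \<le> s" "0 \<le> u" using su rt by auto
  have kb: "k \<in> borel_measurable borel" using k(2) by (intro borel_measurable_continuous_onI lipschitz_on_continuous_on)
  have [measurable]: "L s \<in> borel_measurable P" "L u \<in> borel_measurable P" "k \<in> borel_measurable borel"
     using ivl kb by auto
  define W where "W w = V w * of_real (k (L s w))" for w
  have W: "W \<in> borel_measurable (Filt s)" unfolding W_def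
    using V_Filt[OF su(1)] L_meas[OF ivl(3)] kb by measurable
  have Wb: "cmod (W w) \<le> B * K" for w
    unfolding W_def norm_mult using V(2)[of w] k(1)[of "L s w"] B_nonneg by (intro mult_mono) auto
  note iu = L_weight(1)[OF ivl(2) kb k(1) \<phi>_integrable[OF ivl(2)]]
  have isu: "integrable P (\<lambda>w. W w * \<phi> u (w u))"
    unfolding W_def by (rule L_weight(1)[OF ivl(1) kb k(1) \<phi>_integrable[OF ivl(2)]])
  have "(LINT w|P. V w * of_real (k (L u w)) * \<phi> u (w u)) - (LINT w|P. V w * of_real (k (L s w)) * \<phi> s (w s))
      - of_real (u - s) * (LINT w|P. V w * of_real (k (L s w)) * \<gamma> s (w s))
    = (LINT w|P. V w * of_real (k (L u w)) * \<phi> u (w u)) - (LINT w|P. W w * \<phi> u (w u))"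
    using \<phi>_mart[OF su W Wb] by (simp add: W_def)
  also have "\<dots> = (LINT w|P. V w * of_real (k (L u w)) * \<phi> u (w u) - W w * \<phi> u (w u))"
    using iu isu by simp
  also have "cmod \<dots> \<le> (LINT w|P. cmod (V w * of_real (k (L u w)) * \<phi> u (w u) - W w * \<phi> u (w u)))"
    by (rule integral_norm_bound)
  also have "\<dots> \<le> (LINT w|P. 2 * B * K * C * err s u w)"
  proof (rule integral_mono_AE)
    show "integrable P (\<lambda>w. cmod (V w * of_real (k (L u w)) * \<phi> u (w u) - W w * \<phi> u (w u)))"
      using iu isu by auto
    show "integrable P (\<lambda>w. 2 * B * K * C * err s u w)" using err_integrable[OF ivl(3) su(2)] by auto
    show "AE w in P. cmod (V w * of_real (k (L u w)) * \<phi> u (w u) - W w * \<phi> u (w u)) \<le> 2 * B * K * C * err s u w"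
      using L_mono[OF ivl(3) su(2)]
    proof eventually_elim
      case (elim w)
      have "V w * of_real (k (L u w)) * \<phi> u (w u) - W w * \<phi> u (w u) = V w * of_real (k (L u w) - k (L s w)) * \<phi> u (w u)"
        by (simp add: W_def algebra_simps)
      also have "cmod \<dots> = cmod (V w) * \<bar>k (L u w) - k (L s w)\<bar> * cmod (\<phi> u (w u))" by (simp only: norm_mult norm_of_real)
      also have "\<dots> \<le> B * (2 * K * min 1 \<bar>L u w - L s w\<bar>) * (C * \<bar>w u\<bar>)"
        using V(2) lip_diff[OF k] \<phi>_lin[OF ivl(2)] B_nonneg K by (intro mult_mono mult_nonneg_nonneg) auto
      also have "\<dots> = 2 * B * K * C * (min 1 \<bar>L u w - L s w\<bar> * \<bar>w u\<bar>)" by simp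
      also have "\<dots> \<le> 2 * B * K * C * err s u w"
        using mixed_le_err[OF elim] B_nonneg K C_nonneg by (intro mult_left_mono) auto
      finally show ?case .
    qed
  qed
  finally show ?thesis by simp
qed

text \<open>\<open>Y\<close> is the constant 1 in the odd identity and sgn(X) in the even one. Its
  convergence is demanded almost surely for one sequence and one limit time, which is all that
  sgn(X) can offer.\<close>

lemma weight_continuous:
  fixes Y :: "real => path => real"
  assumes k: "\<And>x. \<bar>k x\<bar> \<le> K" "continuous_on UNIV k"
    and Y: "\<And>s. s \<in> {r..t} ==> Y s \<in> borel_measurable P" "\<And>s w. \<bar>Y s w\<bar> \<le> 1"
      "AE w in P. (\<lambda>n. Y (\<sigma> n) w) \<longlonglongrightarrow> Y s w"
    and \<sigma>: "\<And>n::nat. \<sigma> n \<in> {r..t}" "\<sigma> \<longlonglongrightarrow> s"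
  shows "(\<lambda>n. \<integral>w. V w * of_real (k (L (\<sigma> n) w)) * (of_real (Y (\<sigma> n) w) * \<gamma> (\<sigma> n) (w (\<sigma> n))) \<partial>P)
     \<longlonglongrightarrow> (LINT w|P. V w * of_real (k (L s w)) * (of_real (Y s w) * \<gamma> s (w s)))"
proof (rule integral_dominated_convergence[where w="\<lambda>w. B * K * C"])
  have s: "s \<in> {r..t}" using closed_sequentially[OF closed_atLeastAtMost \<sigma>(1) \<sigma>(2)] by simp
  have kb[measurable]: "k \<in> borel_measurable borel" using k(2) by (rule borel_measurable_continuous_onI)
  have K: "0 \<le> K" using k(1)[of 0] by linarith
  have m: "(\<lambda>w. V w * of_real (k (L s w)) * (of_real (Y s w) * \<gamma> s (w s))) \<in> borel_measurable P" if "s \<in> {r..t}" for s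
  proof -
    have [measurable]: "L s \<in> borel_measurable P" "(\<lambda>w. w s) \<in> borel_measurable P" "Y s \<in> borel_measurable P"
      using that rt Y(1) by auto
    show ?thesis by measurable
  qed
  show "(\<lambda>w. V w * of_real (k (L s w)) * (of_real (Y s w) * \<gamma> s (w s))) \<in> borel_measurable P" by (rule m[OF s])
  show "(\<lambda>w. V w * of_real (k (L (\<sigma> n) w)) * (of_real (Y (\<sigma> n) w) * \<gamma> (\<sigma> n) (w (\<sigma> n)))) \<in> borel_measurable P" for n by (rule m[OF \<sigma>(1)])
  show "integrable P (\<lambda>w. B * K * C)" by simp
  show "AE w in P. (\<lambda>n. V w * of_real (k (L (\<sigma> n) w)) * (of_real (Y (\<sigma> n) w) * \<gamma> (\<sigma> n) (w (\<sigma> n)))) \<longlonglongrightarrow> V w * of_real (k (L s w)) * (of_real (Y s w) * \<gamma> s (w s))"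
    using L_cont[OF rt(1), of t] AE_space Y(3)
  proof eventually_elim
    case (elim w)
    have 1: "(\<lambda>n. L (\<sigma> n) w) \<longlonglongrightarrow> L s w"
      using continuous_on_tendsto_compose[OF elim(1) \<sigma>(2) s] \<sigma>(1) by auto
    have "continuous_on {r..t} w" using elim(2) rt by (intro path_continuous) auto
    then have 2: "(\<lambda>n. w (\<sigma> n)) \<longlonglongrightarrow> w s"
      using continuous_on_tendsto_compose[OF _ \<sigma>(2) s] \<sigma>(1) by auto
    have 3: "(\<lambda>n. k (L (\<sigma> n) w)) \<longlonglongrightarrow> k (L s w)"
      using continuous_on_tendsto_compose[OF k(2) 1] by auto
    have 4: "(\<lambda>n. \<gamma> (\<sigma> n) (w (\<sigma> n))) \<longlonglongrightarrow> \<gamma> s (w s)"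
      using continuous_on_tendsto_compose[OF \<gamma>_cont tendsto_Pair[OF \<sigma>(2) 2]] by auto
    show ?case by (intro tendsto_intros 3 4 elim(3))
  qed
  show "AE w in P. cmod (V w * of_real (k (L (\<sigma> n) w)) * (of_real (Y (\<sigma> n) w) * \<gamma> (\<sigma> n) (w (\<sigma> n)))) \<le> B * K * C" for n
  proof (rule AE_I2)
    fix w
    have "cmod (V w * of_real (k (L (\<sigma> n) w)) * (of_real (Y (\<sigma> n) w) * \<gamma> (\<sigma> n) (w (\<sigma> n)))) =
       cmod (V w) * \<bar>k (L (\<sigma> n) w)\<bar> * (\<bar>Y (\<sigma> n) w\<bar> * cmod (\<gamma> (\<sigma> n) (w (\<sigma> n))))" by (simp only: norm_mult norm_of_real)
    also have "\<dots> \<le> B * K * (1 * C)"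
      using V(2) k(1) Y(2) \<gamma>_bound[OF \<sigma>(1)[of n]] B_nonneg K by (intro mult_mono mult_nonneg_nonneg) auto
    finally show "cmod (V w * of_real (k (L (\<sigma> n) w)) * (of_real (Y (\<sigma> n) w) * \<gamma> (\<sigma> n) (w (\<sigma> n)))) \<le> B * K * C" by simp
  qed
qed

lemma odd_lipschitz:
  assumes k: "\<And>x. \<bar>k x\<bar> \<le> K" "K-lipschitz_on UNIV k"
  shows "set_integrable lborel {r<..<t} (\<lambda>s. \<integral>w. V w * of_real (k (L s w)) * \<gamma> s (w s) \<partial>P)" (is ?I)
    and "(LINT w|P. V w * of_real (k (L t w)) * \<phi> t (w t)) - (LINT w|P. V w * of_real (k (L r w)) * \<phi> r (w r))
      = (LINT s:{r<..<t}|lborel. (LINT w|P. V w * of_real (k (L s w)) * \<gamma> s (w s)))" (is ?E)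
proof -
  have kc: "continuous_on UNIV k" using k(2) by (rule lipschitz_on_continuous_on)
  then have kb: "k \<in> borel_measurable borel" by (rule borel_measurable_continuous_onI)
  let ?\<Phi> = "\<lambda>s. \<integral>w. V w * of_real (k (L s w)) * \<phi> s (w s) \<partial>P"
  let ?g = "\<lambda>s. \<integral>w. V w * of_real (k (L s w)) * \<gamma> s (w s) \<partial>P"
  have "set_integrable lborel {r<..<t} ?g \<and> ?\<Phi> t - ?\<Phi> r = (LINT s:{r<..<t}|lborel. ?g s)"
  \<comment> \<open>Integrability and the identity are separate conclusions of
    \<open>grid_integral\<close>, so each of its premises arises twice.\<close>
  proof (rule conjI; rule grid_integral[where e="\<lambda>s u. 2 * B * K * C * (LINT w|P. err s u w)" and K="B * K * C" and \<phi>="?\<Phi>", OF rt(2)])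
    fix s and \<sigma> :: "nat => real" assume s: "r < s" "s < t" and \<sigma>: "\<And>n. \<sigma> n \<in> {r..t}" "\<sigma> \<longlonglongrightarrow> s"
    show "(\<lambda>n. ?g (\<sigma> n)) \<longlonglongrightarrow> ?g s" "(\<lambda>n. ?g (\<sigma> n)) \<longlonglongrightarrow> ?g s"
      using weight_continuous[OF k(1) kc, of "\<lambda>_ _. 1" \<sigma> s] \<sigma> by simp_all
  next
    fix s assume s: "s \<in> {r..t}"
    have "(LINT w|P. cmod (\<gamma> s (w s))) \<le> (LINT w|P. C)"
      using \<gamma>_bound[OF s] \<gamma>_integrable[OF s] by (intro integral_mono) auto
    then have "(LINT w|P. cmod (\<gamma> s (w s))) \<le> C" using prob_space by simp
    then have "B * K * (LINT w|P. cmod (\<gamma> s (w s))) \<le> B * K * C"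
      using B_nonneg k(1)[of 0] by (intro mult_left_mono) auto
    then show "cmod (?g s) \<le> B * K * C" "cmod (?g s) \<le> B * K * C"
      using L_weight(2)[OF s kb k(1) \<gamma>_integrable[OF s]] by simp_all
  next
    show "(\<lambda>n. \<Sum>i<n. 2 * B * K * C * (LINT w|P. err (grid r t n i) (grid r t n (Suc i)) w)) \<longlonglongrightarrow> 0"
      "(\<lambda>n. \<Sum>i<n. 2 * B * K * C * (LINT w|P. err (grid r t n i) (grid r t n (Suc i)) w)) \<longlonglongrightarrow> 0"
      using tendsto_mult_left[OF err_sum_tendsto[OF rt], of "2 * B * K * C"] by (simp_all add: sum_distrib_left)
  qed (use odd_step[OF k] in auto)
  then show ?I ?E by auto
qed

text \<open>Extension from Lipschitz to bounded Borel weights, shared by the odd and the even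
  identity. \<open>R\<close> is the boundary term; it has to be linear and continuous along
  uniformly bounded pointwise limits, as the time integral on the other side is.\<close>

lemma weight_monotone_class:
  fixes Z :: "real => path => complex" and R :: "(real => real) => complex"
  assumes Z: "\<And>s. s \<in> {r..t} ==> integrable P (Z s)" "\<And>s. s \<in> {r..t} ==> (LINT w|P. cmod (Z s w)) \<le> C"
    and R_lin: "\<And>f g a b K. f \<in> borel_measurable borel ==> g \<in> borel_measurable borel ==>
        (\<And>x. \<bar>f x\<bar> \<le> K) ==> (\<And>x. \<bar>g x\<bar> \<le> K) ==> R (\<lambda>x. a * f x + b * g x) = of_real a * R f + of_real b * R g"
    and R_lim: "\<And>F f K. (\<And>n. F n \<in> borel_measurable borel) ==> f \<in> borel_measurable borel ==>
        (\<And>n x. \<bar>F n x\<bar> \<le> K) ==> (\<And>x. \<bar>f x\<bar> \<le> K) ==> (\<And>x. (\<lambda>n::nat. F n x) \<longlonglongrightarrow> f x) ==> (\<lambda>n. R (F n)) \<longlonglongrightarrow> R f"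
    and R_lip: "\<And>f K. (\<And>x. \<bar>f x\<bar> \<le> K) ==> K-lipschitz_on UNIV f ==>
        set_integrable lborel {r<..<t} (\<lambda>s. \<integral>w. V w * of_real (f (L s w)) * Z s w \<partial>P) \<and>
        R f = (LINT s:{r<..<t}|lborel. (LINT w|P. V w * of_real (f (L s w)) * Z s w))"
    and k: "k \<in> borel_measurable borel" "\<And>x. \<bar>k x\<bar> \<le> K"
  shows "set_integrable lborel {r<..<t} (\<lambda>s. \<integral>w. V w * of_real (k (L s w)) * Z s w \<partial>P) \<and>
     R k = (LINT s:{r<..<t}|lborel. (LINT w|P. V w * of_real (k (L s w)) * Z s w))"
  using k
proof (induction rule: bounded_borel_induct_lipschitz)
  case (lip f K)
  then show ?case by (rule R_lip)
next
  case (lin f g a b K)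
  let ?G = "\<lambda>f s. \<integral>w. V w * of_real (f (L s w)) * Z s w \<partial>P"
  have G: "?G (\<lambda>x. a * f x + b * g x) s = of_real a * ?G f s + of_real b * ?G g s" if "s \<in> {r<..<t}" for s
    by (rule L_weight_lin[OF _ lin(1,3,2,4)]) (use that Z(1) in auto)
  have i: "set_integrable lborel {r<..<t} (\<lambda>s. of_real a * ?G f s)" "set_integrable lborel {r<..<t} (\<lambda>s. of_real b * ?G g s)"
    using lin by auto
  have cong: "set_integrable lborel {r<..<t} (?G (\<lambda>x. a * f x + b * g x)) \<longleftrightarrow>
       set_integrable lborel {r<..<t} (\<lambda>s. of_real a * ?G f s + of_real b * ?G g s)"
    by (rule set_integrable_cong) (use G in auto)
  have ceq: "(LINT s:{r<..<t}|lborel. ?G (\<lambda>x. a * f x + b * g x) s) = (LINT s:{r<..<t}|lborel. of_real a * ?G f s + of_real b * ?G g s)"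
    by (rule set_lebesgue_integral_cong) (use G in auto)
  show ?case unfolding cong ceq set_integral_add(2)[OF i] R_lin[OF lin(1-4)]
    using set_integral_add(1)[OF i] lin(5,6) by simp
next
  case (lim F f K)
  let ?G = "\<lambda>f s. \<integral>w. V w * of_real (f (L s w)) * Z s w \<partial>P"
  have Gm: "(\<lambda>s. indicator {r<..<t} s *\<^sub>R ?G (F n) s) \<in> borel_measurable lborel" for n
    using lim(6)[of n] unfolding set_integrable_def by auto
  have Gl: "(\<lambda>n. indicator {r<..<t} s *\<^sub>R ?G (F n) s) \<longlonglongrightarrow> indicator {r<..<t} s *\<^sub>R ?G f s" for s
  proof (cases "s \<in> {r<..<t}")
    case True
    have "(\<lambda>n. ?G (F n) s) \<longlonglongrightarrow> ?G f s"
      by (rule L_weight_lim[OF _ lim(1,3,2,5)]) (use True Z(1) in auto)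
    then show ?thesis using True by simp
  qed simp
  have K: "0 \<le> K" using lim(4)[of 0] by linarith
  have Gb: "norm (indicator {r<..<t} s *\<^sub>R ?G (F n) s) \<le> indicator {r<..<t} s * (B * K * C)" for n s
  proof (cases "s \<in> {r<..<t}")
    case True
    then have s: "s \<in> {r..t}" by auto
    have "B * K * (LINT w|P. cmod (Z s w)) \<le> B * K * C"
      using B_nonneg K by (intro mult_left_mono Z(2)[OF s]) auto
    then show ?thesis
      using L_weight(2)[OF s lim(1,3) Z(1)[OF s], of n] True by simp
  qed simp
  have dom: "integrable lborel (\<lambda>s. indicator {r<..<t} s * (B * K * C))"
    using rt by (intro integrable_mult_left impI integrable_real_indicator) auto
  have Gfm: "(\<lambda>s. indicator {r<..<t} s *\<^sub>R ?G f s) \<in> borel_measurable lborel"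
    by (rule borel_measurable_LIMSEQ_metric[OF Gm Gl])
  have 1: "set_integrable lborel {r<..<t} (?G f)" unfolding set_integrable_def
    by (rule integrable_dominated_convergence[OF Gfm Gm dom AE_I2[OF Gl] AE_I2[OF Gb]])
  have 2: "(\<lambda>n. LINT s:{r<..<t}|lborel. ?G (F n) s) \<longlonglongrightarrow> (LINT s:{r<..<t}|lborel. ?G f s)"
    unfolding set_lebesgue_integral_def
    by (rule integral_dominated_convergence[OF Gfm Gm dom AE_I2[OF Gl] AE_I2[OF Gb]])
  have 4: "R (F n) = (LINT s:{r<..<t}|lborel. ?G (F n) s)" for n using lim(6)[of n] by blast
  show ?case using 1 LIMSEQ_unique[OF R_lim[OF lim(1-5), unfolded 4] 2] by simp
qed

lemma \<gamma>_mean: "s \<in> {r..t} ==> (LINT w|P. cmod (\<gamma> s (w s))) \<le> C"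
proof -
  assume s: "s \<in> {r..t}"
  have "(LINT w|P. cmod (\<gamma> s (w s))) \<le> (LINT w|P. C)"
    using \<gamma>_bound[OF s] \<gamma>_integrable[OF s] by (intro integral_mono) auto
  then show ?thesis using prob_space by simp
qed

text \<open>No local time term survives: \<phi> vanishes where L grows. Hence the weight k(L)
  behaves as if it were constant in time, even when k is discontinuous.\<close>

lemma odd_identity:
  assumes k: "k \<in> borel_measurable borel" "\<And>x. \<bar>k x\<bar> \<le> K"
  shows "set_integrable lborel {r<..<t} (\<lambda>s. \<integral>w. V w * of_real (k (L s w)) * \<gamma> s (w s) \<partial>P) \<and>
     (LINT w|P. V w * of_real (k (L t w)) * \<phi> t (w t)) - (LINT w|P. V w * of_real (k (L r w)) * \<phi> r (w r))
      = (LINT s:{r<..<t}|lborel. (LINT w|P. V w * of_real (k (L s w)) * \<gamma> s (w s)))"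
proof (rule weight_monotone_class[where R="\<lambda>k. (LINT w|P. V w * of_real (k (L t w)) * \<phi> t (w t)) - (LINT w|P. V w * of_real (k (L r w)) * \<phi> r (w r))", OF \<gamma>_integrable \<gamma>_mean _ _ _ k])
  have ti: "t \<in> {r..t}" "r \<in> {r..t}" using rt by auto
  fix f g :: "real => real" and a b K assume *: "f \<in> borel_measurable borel" "g \<in> borel_measurable borel" "\<And>x. \<bar>f x\<bar> \<le> K" "\<And>x. \<bar>g x\<bar> \<le> K"
  show "(LINT w|P. V w * of_real (a * f (L t w) + b * g (L t w)) * \<phi> t (w t)) - (LINT w|P. V w * of_real (a * f (L r w) + b * g (L r w)) * \<phi> r (w r))
    = of_real a * ((LINT w|P. V w * of_real (f (L t w)) * \<phi> t (w t)) - (LINT w|P. V w * of_real (f (L r w)) * \<phi> r (w r)))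
    + of_real b * ((LINT w|P. V w * of_real (g (L t w)) * \<phi> t (w t)) - (LINT w|P. V w * of_real (g (L r w)) * \<phi> r (w r)))"
    unfolding L_weight_lin[OF ti(1) *(1,3,2,4) \<phi>_integrable[OF ti(1)]] L_weight_lin[OF ti(2) *(1,3,2,4) \<phi>_integrable[OF ti(2)]]
    by (simp add: algebra_simps)
next
  have ti: "t \<in> {r..t}" "r \<in> {r..t}" using rt by auto
  fix F :: "nat => real => real" and f :: "real => real" and K
  assume *: "\<And>n. F n \<in> borel_measurable borel" "f \<in> borel_measurable borel" "\<And>n x. \<bar>F n x\<bar> \<le> K" "\<And>x. \<bar>f x\<bar> \<le> K" "\<And>x. (\<lambda>n. F n x) \<longlonglongrightarrow> f x"
  show "(\<lambda>n. (LINT w|P. V w * of_real (F n (L t w)) * \<phi> t (w t)) - (LINT w|P. V w * of_real (F n (L r w)) * \<phi> r (w r)))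
     \<longlonglongrightarrow> (LINT w|P. V w * of_real (f (L t w)) * \<phi> t (w t)) - (LINT w|P. V w * of_real (f (L r w)) * \<phi> r (w r))"
    by (intro tendsto_diff L_weight_lim[OF _ *(1,3,2,5)] \<phi>_integrable ti)
next
  fix f :: "real => real" and K assume "\<And>x. \<bar>f x\<bar> \<le> K" "K-lipschitz_on UNIV f"
  from odd_lipschitz[OF this] show "set_integrable lborel {r<..<t} (\<lambda>s. \<integral>w. V w * of_real (f (L s w)) * \<gamma> s (w s) \<partial>P) \<and>
     (LINT w|P. V w * of_real (f (L t w)) * \<phi> t (w t)) - (LINT w|P. V w * of_real (f (L r w)) * \<phi> r (w r))
      = (LINT s:{r<..<t}|lborel. (LINT w|P. V w * of_real (f (L s w)) * \<gamma> s (w s)))" by blast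
qed

end

text \<open>Adds a martingale \<psi>(s, X_s) that has the same value c(s) at the origin as the slope
  of \<phi> there. So h(L) sgn(X) \<phi> and H(L) \<psi> receive the same multiple of dL.
  \<open>\<psi>_mart\<close> admits integrable test weights since the primitive H(L) is unbounded in
  general.\<close>

locale ito_even = ito_odd +
  fixes \<psi> :: "real => real => complex" and c :: "real => complex"
  assumes \<psi>_meas: "s \<in> {r..t} ==> \<psi> s \<in> borel_measurable borel"
    and \<psi>_bound: "s \<in> {r..t} ==> cmod (\<psi> s x) \<le> C"
    and \<psi>_lip: "s \<in> {r..t} ==> cmod (\<psi> s x - c s) \<le> C * \<bar>x\<bar>"
    and \<phi>_quad: "s \<in> {r..t} ==> cmod (\<phi> s x - c s * of_real x) \<le> C * x\<^sup>2"
    and \<psi>_mart: "r \<le> s ==> s \<le> u ==> u \<le> t ==> W \<in> borel_measurable (Filt s) ==> integrable P W ==>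
      (LINT w|P. W w * \<psi> u (w u)) = (LINT w|P. W w * \<psi> s (w s))"
begin

lemma c_bound: "s \<in> {r..t} ==> cmod (c s) \<le> C"
proof -
  assume s: "s \<in> {r..t}"
  have "\<psi> s 0 = c s" using \<psi>_lip[OF s, of 0] by simp
  then show ?thesis using \<psi>_bound[OF s, of 0] by simp
qed

lemma \<psi>_c: "s \<in> {r..t} ==> cmod (\<psi> s x - c s) \<le> 2 * C * min 1 \<bar>x\<bar>"
proof -
  assume s: "s \<in> {r..t}"
  have "cmod (\<psi> s x - c s) \<le> cmod (\<psi> s x) + cmod (c s)" by (rule norm_triangle_ineq4)
  then have "cmod (\<psi> s x - c s) \<le> 2 * C" using \<psi>_bound[OF s, of x] c_bound[OF s] by linarith
  moreover have "C * \<bar>x\<bar> \<le> 2 * C * \<bar>x\<bar>" using C_nonneg by (simp add: mult_right_mono)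
  ultimately show ?thesis using \<psi>_lip[OF s, of x] by (auto simp: min_def)
qed

lemma Hint_weight:
  assumes s: "s \<in> {r..t}" and h: "h \<in> borel_measurable borel" "\<And>x. \<bar>h x\<bar> \<le> K"
  shows "integrable P (\<lambda>w. V w * of_real (Hint h (L s w)))"
    and "u \<in> {r..t} ==> integrable P (\<lambda>w. V w * of_real (Hint h (L s w)) * \<psi> u (w u))"
proof -
  have [measurable]: "L s \<in> borel_measurable P" using s rt by auto
  have [measurable]: "Hint h \<in> borel_measurable borel" by (rule Hint_borel[OF h])
  show i: "integrable P (\<lambda>w. V w * of_real (Hint h (L s w)))"
  proof (rule integrable_bounded_mult[OF V_borel V(2)], rule integrable_of_real, rule Bochner_Integration.integrable_bound)
    show "integrable P (\<lambda>w. K * L s w)" using L_integrable[of s] s rt by auto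
    show "AE w in P. norm (Hint h (L s w)) \<le> norm (K * L s w)"
      using Hint_bound[OF h] K_nonneg[OF h] by (auto simp: abs_mult)
  qed measurable
  assume u: "u \<in> {r..t}"
  have [measurable]: "(\<lambda>w. w u) \<in> borel_measurable P" "\<psi> u \<in> borel_measurable borel" using u rt \<psi>_meas by auto
  have "integrable P (\<lambda>w. \<psi> u (w u) * (V w * of_real (Hint h (L s w))))"
    by (rule integrable_bounded_mult[OF _ _ i, of _ C]) (use \<psi>_bound[OF u] in measurable)
  then show "integrable P (\<lambda>w. V w * of_real (Hint h (L s w)) * \<psi> u (w u))" by (simp add: mult.commute)
qed

lemma sgn_borel: "0 \<le> s ==> (\<lambda>w. complex_of_real (sgn (w s))) \<in> borel_measurable P"
  by (rule measurable_compose[OF measurable_compose[OF coord_borel borel_measurable_sgn] borel_measurable_of_real])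

lemma sgn_\<phi>_integrable: "s \<in> {r..t} ==> integrable P (\<lambda>w. of_real (sgn (w s)) * \<phi> s (w s))"
proof -
  assume s: "s \<in> {r..t}"
  show ?thesis
    by (rule integrable_bounded_mult[OF sgn_borel _ \<phi>_integrable[OF s], of _ 1]) (use s rt in \<open>auto simp: abs_sgn_eq\<close>)
qed

lemma sgn_\<gamma>_integrable: "s \<in> {r..t} ==> integrable P (\<lambda>w. of_real (sgn (w s)) * \<gamma> s (w s))"
proof -
  assume s: "s \<in> {r..t}"
  show ?thesis
    by (rule integrable_bounded_mult[OF sgn_borel _ \<gamma>_integrable[OF s], of _ 1]) (use s rt in \<open>auto simp: abs_sgn_eq\<close>)
qed

lemma sgn_\<gamma>_mean: "s \<in> {r..t} ==> (LINT w|P. cmod (of_real (sgn (w s)) * \<gamma> s (w s))) \<le> C"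
proof -
  assume s: "s \<in> {r..t}"
  have "(LINT w|P. cmod (of_real (sgn (w s)) * \<gamma> s (w s))) \<le> (LINT w|P. cmod (\<gamma> s (w s)))"
    by (rule integral_mono[OF integrable_norm[OF sgn_\<gamma>_integrable[OF s]] integrable_norm[OF \<gamma>_integrable[OF s]]])
      (simp add: norm_mult abs_sgn_eq)
  then show ?thesis using \<gamma>_mean[OF s] by simp
qed

text \<open>The process \<open>h(L) sgn(X) \<phi> - H(L) \<psi>\<close> with \<open>H' = h\<close>: on the zero set of \<open>X\<close> the increments
  \<open>h(L) c dL\<close> produced by the kink of \<open>sgn(x) \<phi>(x) \<approx> c \<bar>x\<bar>\<close> cancel those of \<open>H(L) \<psi> \<approx> H(L) c\<close>.\<close>

definition even_mean :: "(real => real) => real => complex" where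
  "even_mean h s = (LINT w|P. V w * of_real (h (L s w)) * (of_real (sgn (w s)) * \<phi> s (w s)))
     - (LINT w|P. V w * of_real (Hint h (L s w)) * \<psi> s (w s))"

text \<open>The four terms are: the deviation of \<phi> from its linearisation across a sign change,
  quadratic and hence a crossing term; the variation of h(L); the second-order remainder of the
  primitive; and the deviation of \<psi> from its value at the origin while L grows.\<close>

lemma even_remainder:
  assumes h: "\<And>x. \<bar>h x\<bar> \<le> K" "K-lipschitz_on UNIV h" and su: "r \<le> s" "s \<le> u" "u \<le> t"
    and L: "0 \<le> L s w" "L s w \<le> L u w"
  shows "cmod (V w * (of_real (h (L s w)) * (of_real (sgn (w u) - sgn (w s)) * (\<phi> u (w u) - c u * of_real (w u)))
     + of_real (h (L u w) - h (L s w)) * (of_real (sgn (w u)) * \<phi> u (w u))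
     - of_real (Hint h (L u w) - Hint h (L s w) - h (L s w) * (L u w - L s w)) * \<psi> u (w u)
     - of_real (h (L s w) * (L u w - L s w)) * (\<psi> u (w u) - c u))) \<le> 4 * B * K * C * err s u w"
proof -
  have K: "0 \<le> K" using h(1)[of 0] by linarith
  have u: "u \<in> {r..t}" using su by auto
  define dl where "dl = L u w - L s w"
  have dl: "0 \<le> dl" using L by (simp add: dl_def)
  have hb: "h \<in> borel_measurable borel" using h(2) by (intro borel_measurable_continuous_onI lipschitz_on_continuous_on)
  have "cmod (of_real (h (L s w)) * (of_real (sgn (w u) - sgn (w s)) * (\<phi> u (w u) - c u * of_real (w u))))
      \<le> K * (2 * C * crossing s u w)"
  proof -
    have "\<bar>sgn (w u) - sgn (w s)\<bar> * cmod (\<phi> u (w u) - c u * of_real (w u)) \<le> 2 * C * crossing s u w"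
    proof (cases "sgn (w s) = sgn (w u)")
      case True then show ?thesis using C_nonneg crossing_nonneg by simp
    next
      case False
      note sc = sgn_change[OF False]
      have "(w u)\<^sup>2 \<le> (w u - w s)\<^sup>2" using sc(2) by (simp only: abs_le_square_iff)
      then have "(w u)\<^sup>2 \<le> crossing s u w" using sc(1) by (simp add: crossing_def)
      then have "C * (w u)\<^sup>2 \<le> C * crossing s u w" by (rule mult_left_mono[OF _ C_nonneg])
      then have "cmod (\<phi> u (w u) - c u * of_real (w u)) \<le> C * crossing s u w" using \<phi>_quad[OF u, of "w u"] by linarith
      then have "\<bar>sgn (w u) - sgn (w s)\<bar> * cmod (\<phi> u (w u) - c u * of_real (w u)) \<le> 2 * (C * crossing s u w)"
        by (intro mult_mono sgn_diff_le) auto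
      then show ?thesis by simp
    qed
    then have "\<bar>h (L s w)\<bar> * (\<bar>sgn (w u) - sgn (w s)\<bar> * cmod (\<phi> u (w u) - c u * of_real (w u))) \<le> K * (2 * C * crossing s u w)"
      by (rule mult_mono[OF h(1)]) (use K in auto)
    then show ?thesis by (simp only: norm_mult norm_of_real)
  qed
  moreover have "cmod (of_real (h (L u w) - h (L s w)) * (of_real (sgn (w u)) * \<phi> u (w u))) \<le> 2 * K * C * (min 1 dl * \<bar>w u\<bar>)"
  proof -
    have "\<bar>sgn (w u)\<bar> * cmod (\<phi> u (w u)) \<le> 1 * (C * \<bar>w u\<bar>)"
      using \<phi>_lin[OF u] by (intro mult_mono) (auto simp: sgn_if)
    from mult_mono[OF lip_diff[OF h, of "L u w" "L s w"] this] K
    have "\<bar>h (L u w) - h (L s w)\<bar> * (\<bar>sgn (w u)\<bar> * cmod (\<phi> u (w u))) \<le> (2 * K * min 1 \<bar>dl\<bar>) * (C * \<bar>w u\<bar>)"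
      by (simp add: dl_def)
    then show ?thesis using dl by (simp only: norm_mult norm_of_real) (simp add: ac_simps)
  qed
  moreover have "cmod (of_real (Hint h (L u w) - Hint h (L s w) - h (L s w) * (L u w - L s w)) * \<psi> u (w u)) \<le> 2 * K * C * (dl * min 1 dl)"
  proof -
    have "\<bar>Hint h (L u w) - Hint h (L s w) - h (L s w) * (L u w - L s w)\<bar> \<le> 2 * K * min 1 dl * (L u w - L s w)"
    proof (rule Hint_approx[OF hb h(1) L])
      fix x assume x: "L s w < x" "x \<le> L u w"
      have "\<bar>h x - h (L s w)\<bar> \<le> 2 * K * min 1 \<bar>x - L s w\<bar>" by (rule lip_diff[OF h])
      also have "\<dots> \<le> 2 * K * min 1 dl" using x K by (intro mult_left_mono) (auto simp: dl_def)
      finally show "\<bar>h x - h (L s w)\<bar> \<le> 2 * K * min 1 dl" .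
    qed
    then have "\<bar>Hint h (L u w) - Hint h (L s w) - h (L s w) * (L u w - L s w)\<bar> * cmod (\<psi> u (w u)) \<le> (2 * K * min 1 dl * (L u w - L s w)) * C"
      using \<psi>_bound[OF u] K dl by (intro mult_mono) (auto simp: dl_def[symmetric])
    then show ?thesis by (simp only: norm_mult norm_of_real dl_def) (simp add: ac_simps)
  qed
  moreover have "cmod (of_real (h (L s w) * (L u w - L s w)) * (\<psi> u (w u) - c u)) \<le> 2 * K * C * (dl * \<bar>w s\<bar> + dl * min 1 \<bar>w u - w s\<bar>)"
  proof -
    \<comment> \<open>Moves the distance from the origin back to time s, where \<open>dL_abs\<close>
      controls its product with the increment of L.\<close>
    have "min 1 \<bar>w u\<bar> \<le> \<bar>w s\<bar> + min 1 \<bar>w u - w s\<bar>" by (auto simp: min_def)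
    then have "2 * C * min 1 \<bar>w u\<bar> \<le> 2 * C * (\<bar>w s\<bar> + min 1 \<bar>w u - w s\<bar>)" using C_nonneg by (intro mult_left_mono) auto
    then have 1: "cmod (\<psi> u (w u) - c u) \<le> 2 * C * (\<bar>w s\<bar> + min 1 \<bar>w u - w s\<bar>)" using \<psi>_c[OF u, of "w u"] by linarith
    have 2: "\<bar>h (L s w) * (L u w - L s w)\<bar> \<le> K * dl" using h(1) dl K by (simp add: abs_mult dl_def[symmetric] mult_right_mono)
    have "\<bar>h (L s w) * (L u w - L s w)\<bar> * cmod (\<psi> u (w u) - c u) \<le> (K * dl) * (2 * C * (\<bar>w s\<bar> + min 1 \<bar>w u - w s\<bar>))"
      by (rule mult_mono[OF 2 1]) (use K dl in auto)
    then show ?thesis by (simp only: norm_mult norm_of_real) (simp add: algebra_simps)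
  qed
  ultimately have "cmod (of_real (h (L s w)) * (of_real (sgn (w u) - sgn (w s)) * (\<phi> u (w u) - c u * of_real (w u)))
     + of_real (h (L u w) - h (L s w)) * (of_real (sgn (w u)) * \<phi> u (w u))
     - of_real (Hint h (L u w) - Hint h (L s w) - h (L s w) * (L u w - L s w)) * \<psi> u (w u)
     - of_real (h (L s w) * (L u w - L s w)) * (\<psi> u (w u) - c u))
     \<le> K * (2 * C * crossing s u w) + 2 * K * C * (min 1 dl * \<bar>w u\<bar>) + 2 * K * C * (dl * min 1 dl) + 2 * K * C * (dl * \<bar>w s\<bar> + dl * min 1 \<bar>w u - w s\<bar>)"
    by (intro order_trans[OF norm_triangle_ineq4 add_mono] order_trans[OF norm_triangle_ineq add_mono]) auto
  also have "\<dots> = 2 * K * C * (crossing s u w + min 1 dl * \<bar>w u\<bar> + dl * min 1 dl + dl * \<bar>w s\<bar> + dl * min 1 \<bar>w u - w s\<bar>)"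
    by (simp add: algebra_simps)
  \<comment> \<open>One copy of \<open>err\<close> absorbs the term with |w u|, by
    \<open>mixed_le_err\<close>; the remaining four terms are summands of a second copy.\<close>
  also have "\<dots> \<le> 2 * K * C * (2 * err s u w)"
  proof (rule mult_left_mono)
    have "min 1 dl * \<bar>w u\<bar> \<le> err s u w" using mixed_le_err[of s w u] L dl by (simp add: dl_def)
    moreover have "crossing s u w + dl * min 1 dl + dl * \<bar>w s\<bar> + dl * min 1 \<bar>w u - w s\<bar> \<le> err s u w"
      using dl by (simp add: err_def dl_def[symmetric])
    ultimately show "crossing s u w + min 1 dl * \<bar>w u\<bar> + dl * min 1 dl + dl * \<bar>w s\<bar> + dl * min 1 \<bar>w u - w s\<bar> \<le> 2 * err s u w"
      by linarith
  qed (use K C_nonneg in auto)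
  finally have *: "cmod (of_real (h (L s w)) * (of_real (sgn (w u) - sgn (w s)) * (\<phi> u (w u) - c u * of_real (w u)))
     + of_real (h (L u w) - h (L s w)) * (of_real (sgn (w u)) * \<phi> u (w u))
     - of_real (Hint h (L u w) - Hint h (L s w) - h (L s w) * (L u w - L s w)) * \<psi> u (w u)
     - of_real (h (L s w) * (L u w - L s w)) * (\<psi> u (w u) - c u)) \<le> 4 * K * C * err s u w" by simp
  have "B * cmod (of_real (h (L s w)) * (of_real (sgn (w u) - sgn (w s)) * (\<phi> u (w u) - c u * of_real (w u)))
     + of_real (h (L u w) - h (L s w)) * (of_real (sgn (w u)) * \<phi> u (w u))
     - of_real (Hint h (L u w) - Hint h (L s w) - h (L s w) * (L u w - L s w)) * \<psi> u (w u)
     - of_real (h (L s w) * (L u w - L s w)) * (\<psi> u (w u) - c u)) \<le> B * (4 * K * C * err s u w)"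
    by (rule mult_left_mono[OF * B_nonneg])
  then show ?thesis unfolding norm_mult[of "V w"]
    by (intro order_trans[OF mult_right_mono[OF V(2) norm_ge_zero]]) (simp add: mult.commute mult.left_commute)
qed

lemma even_step:
  assumes h: "\<And>x. \<bar>h x\<bar> \<le> K" "K-lipschitz_on UNIV h" and su: "r \<le> s" "s \<le> u" "u \<le> t"
  shows "cmod (even_mean h u - even_mean h s
      - of_real (u - s) * (LINT w|P. V w * of_real (h (L s w)) * (of_real (sgn (w s)) * \<gamma> s (w s))))
    \<le> 4 * B * K * C * (LINT w|P. err s u w)"
proof -
  have K: "0 \<le> K" using h(1)[of 0] by linarith
  have ivl: "s \<in> {r..t}" "u \<in> {r..t}" "0 \<le> s" "0 \<le> u" using su rt by auto
  have hb: "h \<in> borel_measurable borel" using h(2) by (intro borel_measurable_continuous_onI lipschitz_on_continuous_on)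
  have [measurable]: "L s \<in> borel_measurable P" "L u \<in> borel_measurable P" "h \<in> borel_measurable borel"
     "(\<lambda>w. w s) \<in> borel_measurable P" "(\<lambda>w. w u) \<in> borel_measurable P"
     using ivl hb by auto
  define W where "W w = V w * of_real (h (L s w))" for w
  define S where "S w = W w * of_real (sgn (w s))" for w
  define H where "H w = V w * of_real (Hint h (L s w))" for w
  have W: "W \<in> borel_measurable (Filt s)" unfolding W_def
    using V_Filt[OF su(1)] L_meas[OF ivl(3)] hb by measurable
  have S: "S \<in> borel_measurable (Filt s)" unfolding S_def
    using W coord_measurable_Filt[OF ivl(3) order_refl] by measurable
  have Hm: "H \<in> borel_measurable (Filt s)" unfolding H_def
    using V_Filt[OF su(1)] measurable_compose[OF L_meas[OF ivl(3)] Hint_borel[OF hb h(1)]] by measurable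
  have Wb: "cmod (W w) \<le> B * K" for w
    unfolding W_def norm_mult using V(2)[of w] h(1)[of "L s w"] B_nonneg by (intro mult_mono) auto
  have Sb: "cmod (S w) \<le> B * K" for w
    unfolding S_def norm_mult using mult_mono[OF Wb[of w], of "\<bar>sgn (w s)\<bar>" 1] B_nonneg K by (simp add: sgn_if)
  have iH: "integrable P H" unfolding H_def by (rule Hint_weight(1)[OF ivl(1) hb h(1)])
  have Si: "integrable P (\<lambda>w. S w * Z w)" if "integrable P Z" for Z
    by (rule integrable_bounded_mult[OF measurable_Filt_P[OF S] Sb that])
  have Wi: "integrable P (\<lambda>w. W w * Z w)" if "integrable P Z" for Z
    by (rule integrable_bounded_mult[OF measurable_Filt_P[OF W] Wb that])
  define R where "R w = V w * (of_real (h (L s w)) * (of_real (sgn (w u) - sgn (w s)) * (\<phi> u (w u) - c u * of_real (w u)))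
     + of_real (h (L u w) - h (L s w)) * (of_real (sgn (w u)) * \<phi> u (w u))
     - of_real (Hint h (L u w) - Hint h (L s w) - h (L s w) * (L u w - L s w)) * \<psi> u (w u)
     - of_real (h (L s w) * (L u w - L s w)) * (\<psi> u (w u) - c u))" for w
  define Nu where "Nu w = V w * of_real (h (L u w)) * (of_real (sgn (w u)) * \<phi> u (w u)) - V w * of_real (Hint h (L u w)) * \<psi> u (w u)" for w
  \<comment> \<open>Exact algebra. The term c (sgn X_u - sgn X_s) X_u is added and subtracted and
    rewritten by \<open>abs_increment\<close>; this brings in the increment of |X|, to be matched
    with that of L.\<close>
  have id: "Nu w = S w * \<phi> u (w u) - H w * \<psi> u (w u)
      + c u * ((W w * of_real (\<bar>w u\<bar> - \<bar>w s\<bar>) - W w * of_real (L u w - L s w)) - S w * of_real (w u - w s)) + R w" for w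
  proof -
    have key: "(of_real (\<bar>w u\<bar> - \<bar>w s\<bar>) :: complex) = of_real (sgn (w s)) * of_real (w u - w s) + of_real (sgn (w u) - sgn (w s)) * of_real (w u)"
      by (subst abs_increment) (simp only: of_real_add of_real_mult)
    show ?thesis unfolding Nu_def S_def W_def H_def R_def key by (simp add: algebra_simps)
  qed
  have i1: "integrable P (\<lambda>w. S w * \<phi> u (w u))" by (rule Si[OF \<phi>_integrable[OF ivl(2)]])
  have i2: "integrable P (\<lambda>w. H w * \<psi> u (w u))" unfolding H_def by (rule Hint_weight(2)[OF ivl(1) hb h(1) ivl(2)])
  have i3: "integrable P (\<lambda>w. W w * of_real (\<bar>w u\<bar> - \<bar>w s\<bar>))" "integrable P (\<lambda>w. W w * of_real (L u w - L s w))"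
    by (intro Wi integrable_of_real Bochner_Integration.integrable_diff integrable_abs coord_moments(1) L_integrable ivl)+
  have i4: "integrable P (\<lambda>w. S w * of_real (w u - w s))"
    by (intro Si integrable_of_real Bochner_Integration.integrable_diff coord_moments(1) ivl)
  have iN: "integrable P Nu" unfolding Nu_def
    by (intro Bochner_Integration.integrable_diff L_weight(1)[OF ivl(2) hb h(1) sgn_\<phi>_integrable[OF ivl(2)]] Hint_weight(2)[OF ivl(2) hb h(1) ivl(2)])
  have iR: "integrable P R"
  proof -
    have "R = (\<lambda>w. Nu w - (S w * \<phi> u (w u) - H w * \<psi> u (w u)
      + c u * ((W w * of_real (\<bar>w u\<bar> - \<bar>w s\<bar>) - W w * of_real (L u w - L s w)) - S w * of_real (w u - w s))))"
      using id by (auto simp: fun_eq_iff)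
    then show ?thesis using iN i1 i2 i3 i4 by auto
  qed
  have eu: "even_mean h u = (LINT w|P. Nu w)"
    unfolding even_mean_def Nu_def
    using L_weight(1)[OF ivl(2) hb h(1) sgn_\<phi>_integrable[OF ivl(2)]] Hint_weight(2)[OF ivl(2) hb h(1) ivl(2)] by simp
  have es: "even_mean h s = (LINT w|P. S w * \<phi> s (w s)) - (LINT w|P. H w * \<psi> s (w s))"
    unfolding even_mean_def S_def W_def H_def by (simp add: mult.assoc)
  have tan: "(LINT w|P. W w * of_real (\<bar>w u\<bar> - \<bar>w s\<bar>)) = (LINT w|P. W w * of_real (L u w - L s w))"
    by (rule tanaka_complex[OF ivl(3) su(2) W Wb])
  have iX: "integrable P (\<lambda>w. w u - w s)"
    using increment_moments(1)[OF ivl(3) su(2), of 1] by simp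
  have ortho: "(LINT w|P. S w * of_real (w u - w s)) = 0"
  proof -
    have "(LINT w|P. S w * of_real (w u - w s)) = (LINT w|P. S w) * (LINT w|P. of_real (w u - w s))"
    proof (rule indep_product_complex(2)[OF ivl(3) su(2) S])
      show "integrable P S" using Si[of "\<lambda>_. 1"] by simp
      show "complex_of_real \<in> borel_measurable borel" by simp
      show "integrable P (\<lambda>w. complex_of_real (w u - w s))" by (rule integrable_of_real[OF iX])
    qed
    also have "(LINT w|P. complex_of_real (w u - w s)) = of_real (LINT w|P. w u - w s)" by (rule integral_of_real[OF iX])
    finally show ?thesis using increment_moments(2)[OF ivl(3) su(2)] by simp
  qed
  have "(LINT w|P. Nu w) = (LINT w|P. S w * \<phi> u (w u)) - (LINT w|P. H w * \<psi> u (w u))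
     + c u * (((LINT w|P. W w * of_real (\<bar>w u\<bar> - \<bar>w s\<bar>)) - (LINT w|P. W w * of_real (L u w - L s w))) - (LINT w|P. S w * of_real (w u - w s))) + (LINT w|P. R w)"
    unfolding id using i1 i2 i3 i4 iR
    by (simp only: Bochner_Integration.integral_add Bochner_Integration.integral_diff Bochner_Integration.integrable_add
        Bochner_Integration.integrable_diff integrable_mult_right integral_mult_right_zero)
  then have r1: "even_mean h u - even_mean h s
      - of_real (u - s) * (LINT w|P. V w * of_real (h (L s w)) * (of_real (sgn (w s)) * \<gamma> s (w s))) = (LINT w|P. R w)"
    using \<phi>_mart[OF su S Sb] \<psi>_mart[OF su Hm iH] tan ortho unfolding eu es by (simp add: S_def W_def mult.assoc)
  have r2: "cmod (LINT w|P. R w) \<le> (LINT w|P. cmod (R w))" by (rule integral_norm_bound)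
  also have "\<dots> \<le> (LINT w|P. 4 * B * K * C * err s u w)"
  proof (rule integral_mono_AE)
    show "AE w in P. cmod (R w) \<le> 4 * B * K * C * err s u w"
      using L_mono[OF ivl(3) su(2)] AE_space
    proof eventually_elim
      case (elim w)
      then show ?case unfolding R_def using L_nonneg[OF ivl(3), of w] by (intro even_remainder[OF h su]) auto
    qed
    show "integrable P (\<lambda>w. 4 * B * K * C * err s u w)" using err_integrable[OF ivl(3) su(2)] by auto
  qed (use iR in auto)
  finally show ?thesis unfolding r1 by simp
qed

text \<open>At a fixed time s > 0 the path is almost surely off the origin, so its sign is locally
  constant. This fails at s = 0.\<close>

lemma sgn_tendsto_AE:
  assumes s: "0 < s" and \<sigma>: "\<And>n::nat. \<sigma> n \<in> {r..t}" "\<sigma> \<longlonglongrightarrow> s"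
  shows "AE w in P. (\<lambda>n. sgn (w (\<sigma> n))) \<longlonglongrightarrow> sgn (w s)"
  using coord_nonzero[OF s] AE_space
proof eventually_elim
  case (elim w)
  have st: "s \<in> {r..t}" using closed_sequentially[OF closed_atLeastAtMost \<sigma>(1) \<sigma>(2)] by simp
  have "continuous_on {r..t} w" using elim(2) rt by (intro path_continuous) auto
  then have "(\<lambda>n. w (\<sigma> n)) \<longlonglongrightarrow> w s"
    using continuous_on_tendsto_compose[OF _ \<sigma>(2) st] \<sigma>(1) by auto
  then show ?case using elim(1) by (rule tendsto_sgn)
qed

lemma even_lipschitz:
  assumes h: "\<And>x. \<bar>h x\<bar> \<le> K" "K-lipschitz_on UNIV h"
  shows "set_integrable lborel {r<..<t} (\<lambda>s. \<integral>w. V w * of_real (h (L s w)) * (of_real (sgn (w s)) * \<gamma> s (w s)) \<partial>P)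
    \<and> even_mean h t - even_mean h r
      = (LINT s:{r<..<t}|lborel. (LINT w|P. V w * of_real (h (L s w)) * (of_real (sgn (w s)) * \<gamma> s (w s))))"
proof -
  have hc: "continuous_on UNIV h" using h(2) by (rule lipschitz_on_continuous_on)
  then have hb: "h \<in> borel_measurable borel" by (rule borel_measurable_continuous_onI)
  let ?g = "\<lambda>s. \<integral>w. V w * of_real (h (L s w)) * (of_real (sgn (w s)) * \<gamma> s (w s)) \<partial>P"
  show ?thesis
  proof (rule conjI; rule grid_integral[where e="\<lambda>s u. 4 * B * K * C * (LINT w|P. err s u w)" and K="B * K * C" and \<phi>="even_mean h", OF rt(2)])
    fix s and \<sigma> :: "nat => real" assume s: "r < s" "s < t" and \<sigma>: "\<And>n. \<sigma> n \<in> {r..t}" "\<sigma> \<longlonglongrightarrow> s"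
    have s0: "0 < s" using s rt by simp
    show "(\<lambda>n. ?g (\<sigma> n)) \<longlonglongrightarrow> ?g s" "(\<lambda>n. ?g (\<sigma> n)) \<longlonglongrightarrow> ?g s"
      by (rule weight_continuous[OF h(1) hc _ _ _ \<sigma>, of "\<lambda>s w. sgn (w s)"];
          use sgn_tendsto_AE[OF s0 \<sigma>] rt in \<open>force simp: sgn_if\<close>)+
  next
    fix s assume s: "s \<in> {r..t}"
    have "B * K * (LINT w|P. cmod (of_real (sgn (w s)) * \<gamma> s (w s))) \<le> B * K * C"
      using B_nonneg h(1)[of 0] by (intro mult_left_mono sgn_\<gamma>_mean[OF s]) auto
    then show "cmod (?g s) \<le> B * K * C" "cmod (?g s) \<le> B * K * C"
      using order_trans[OF L_weight(2)[OF s hb h(1) sgn_\<gamma>_integrable[OF s]]] by blast+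
  next
    show "(\<lambda>n. \<Sum>i<n. 4 * B * K * C * (LINT w|P. err (grid r t n i) (grid r t n (Suc i)) w)) \<longlonglongrightarrow> 0"
      "(\<lambda>n. \<Sum>i<n. 4 * B * K * C * (LINT w|P. err (grid r t n i) (grid r t n (Suc i)) w)) \<longlonglongrightarrow> 0"
      using tendsto_mult_left[OF err_sum_tendsto[OF rt], of "4 * B * K * C"] by (simp_all add: sum_distrib_left)
  qed (use even_step[OF h] in auto)
qed

text \<open>The primitive is not bounded, but at most K L_s, and the integrability of L_s supplies
  the dominating function.\<close>

lemma Hint_weight_lim:
  assumes s: "s \<in> {r..t}" and F: "\<And>n. F n \<in> borel_measurable borel" "\<And>n x. \<bar>F n x\<bar> \<le> K"
    and f: "f \<in> borel_measurable borel" "\<And>x. \<bar>f x\<bar> \<le> K" "\<And>x. (\<lambda>n::nat. F n x) \<longlonglongrightarrow> f x"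
  shows "(\<lambda>n. \<integral>w. V w * of_real (Hint (F n) (L s w)) * \<psi> s (w s) \<partial>P) \<longlonglongrightarrow> (LINT w|P. V w * of_real (Hint f (L s w)) * \<psi> s (w s))"
proof (rule integral_dominated_convergence[where w="\<lambda>w. B * (K * L s w) * C"])
  have K: "0 \<le> K" using f(2)[of 0] by linarith
  show "(\<lambda>w. V w * of_real (Hint f (L s w)) * \<psi> s (w s)) \<in> borel_measurable P" using Hint_weight(2)[OF s f(1,2) s] by auto
  show "(\<lambda>w. V w * of_real (Hint (F n) (L s w)) * \<psi> s (w s)) \<in> borel_measurable P" for n using Hint_weight(2)[OF s F(1) F(2) s] by auto
  show "integrable P (\<lambda>w. B * (K * L s w) * C)" using L_integrable[of s] s rt by auto
  show "AE w in P. (\<lambda>n. V w * of_real (Hint (F n) (L s w)) * \<psi> s (w s)) \<longlonglongrightarrow> V w * of_real (Hint f (L s w)) * \<psi> s (w s)"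
    by (intro AE_I2 tendsto_intros Hint_lim[OF F f(1,3)])
  show "AE w in P. cmod (V w * of_real (Hint (F n) (L s w)) * \<psi> s (w s)) \<le> B * (K * L s w) * C" for n
    using AE_space
  proof eventually_elim
    case (elim w)
    have "0 \<le> L s w" using L_nonneg[of s w] s rt elim by auto
    then have "\<bar>Hint (F n) (L s w)\<bar> \<le> K * L s w" using Hint_bound[OF F(1) F(2), of n "L s w"] by simp
    then show ?case unfolding norm_mult norm_of_real
      using V(2)[of w] \<psi>_bound[OF s, of "w s"] B_nonneg K \<open>0 \<le> L s w\<close> by (intro mult_mono mult_nonneg_nonneg) auto
  qed
qed

lemma even_identity:
  assumes h: "h \<in> borel_measurable borel" "\<And>x. \<bar>h x\<bar> \<le> K"
  shows "set_integrable lborel {r<..<t} (\<lambda>s. \<integral>w. V w * of_real (h (L s w)) * (of_real (sgn (w s)) * \<gamma> s (w s)) \<partial>P)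
    \<and> even_mean h t - even_mean h r
      = (LINT s:{r<..<t}|lborel. (LINT w|P. V w * of_real (h (L s w)) * (of_real (sgn (w s)) * \<gamma> s (w s))))"
proof (rule weight_monotone_class[where R="\<lambda>h. even_mean h t - even_mean h r", OF sgn_\<gamma>_integrable sgn_\<gamma>_mean _ _ _ h])
  have ti: "t \<in> {r..t}" "r \<in> {r..t}" using rt by auto
  fix f g :: "real => real" and a b K
  assume *: "f \<in> borel_measurable borel" "g \<in> borel_measurable borel" "\<And>x. \<bar>f x\<bar> \<le> K" "\<And>x. \<bar>g x\<bar> \<le> K"
  have "even_mean (\<lambda>x. a * f x + b * g x) s = of_real a * even_mean f s + of_real b * even_mean g s" if s: "s \<in> {r..t}" for s
  proof -
    have "(LINT w|P. V w * of_real (Hint (\<lambda>x. a * f x + b * g x) (L s w)) * \<psi> s (w s)) =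
      (LINT w|P. of_real a * (V w * of_real (Hint f (L s w)) * \<psi> s (w s)) + of_real b * (V w * of_real (Hint g (L s w)) * \<psi> s (w s)))"
      by (rule Bochner_Integration.integral_cong) (auto simp: Hint_lin[OF *] algebra_simps)
    also have "\<dots> = of_real a * (LINT w|P. V w * of_real (Hint f (L s w)) * \<psi> s (w s)) + of_real b * (LINT w|P. V w * of_real (Hint g (L s w)) * \<psi> s (w s))"
      using Hint_weight(2)[OF s *(1,3) s] Hint_weight(2)[OF s *(2,4) s] by simp
    finally show ?thesis unfolding even_mean_def L_weight_lin[OF s *(1,3,2,4) sgn_\<phi>_integrable[OF s]]
      by (simp add: algebra_simps)
  qed
  from this[OF ti(1)] this[OF ti(2)]
  show "even_mean (\<lambda>x. a * f x + b * g x) t - even_mean (\<lambda>x. a * f x + b * g x) r =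
    of_real a * (even_mean f t - even_mean f r) + of_real b * (even_mean g t - even_mean g r)" by (simp add: algebra_simps)
next
  have ti: "t \<in> {r..t}" "r \<in> {r..t}" using rt by auto
  fix F :: "nat => real => real" and f :: "real => real" and K
  assume *: "\<And>n. F n \<in> borel_measurable borel" "f \<in> borel_measurable borel" "\<And>n x. \<bar>F n x\<bar> \<le> K" "\<And>x. \<bar>f x\<bar> \<le> K" "\<And>x. (\<lambda>n. F n x) \<longlonglongrightarrow> f x"
  show "(\<lambda>n. even_mean (F n) t - even_mean (F n) r) \<longlonglongrightarrow> even_mean f t - even_mean f r"
    unfolding even_mean_def
    by (intro tendsto_diff L_weight_lim[OF _ *(1,3,2,5)] sgn_\<phi>_integrable ti Hint_weight_lim[OF _ *(1,3,2,4,5)])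
next
  fix f :: "real => real" and K assume "\<And>x. \<bar>f x\<bar> \<le> K" "K-lipschitz_on UNIV f"
  then show "set_integrable lborel {r<..<t} (\<lambda>s. \<integral>w. V w * of_real (f (L s w)) * (of_real (sgn (w s)) * \<gamma> s (w s)) \<partial>P) \<and>
     even_mean f t - even_mean f r
      = (LINT s:{r<..<t}|lborel. (LINT w|P. V w * of_real (f (L s w)) * (of_real (sgn (w s)) * \<gamma> s (w s))))"
    by (rule even_lipschitz)
qed

end

section \<open>Exponential martingales and the reflected process\<close>

context wiener_path
begin

lemma iexp_integrable: "0 \<le> s ==> integrable P (\<lambda>w. iexp (\<theta> * w s))"
  by (rule integrable_iexp) simp_all

lemma iexp_increment_integrable: "0 \<le> s ==> s \<le> u ==> integrable P (\<lambda>w. iexp (\<theta> * (w u - w s)))"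
  by (rule integrable_iexp) simp_all

lemma iexp_weight:
  assumes s: "0 \<le> s" and W: "W \<in> borel_measurable (Filt s)" "integrable P W"
  shows "(\<lambda>w. W w * iexp (\<theta> * w s)) \<in> borel_measurable (Filt s)" "integrable P (\<lambda>w. W w * iexp (\<theta> * w s))"
proof -
  have [measurable]: "(\<lambda>w. w s) \<in> borel_measurable (Filt s)" using coord_measurable_Filt[of s s] s by simp
  show "(\<lambda>w. W w * iexp (\<theta> * w s)) \<in> borel_measurable (Filt s)" using W(1) by measurable
  have "integrable P (\<lambda>w. iexp (\<theta> * w s) * W w)"
    by (rule integrable_bounded_mult[OF _ _ W(2), of _ 1]) (use iexp_integrable[OF s, of \<theta>] in auto)
  then show "integrable P (\<lambda>w. W w * iexp (\<theta> * w s))" by (simp add: mult.commute)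
qed

lemma exponential_martingale:
  assumes su: "0 \<le> s" "s \<le> u" and W: "W \<in> borel_measurable (Filt s)" "integrable P W"
  shows "(LINT w|P. W w * (of_real (exp (\<theta>\<^sup>2 * u / 2)) * iexp (\<theta> * w u))) =
    (LINT w|P. W w * (of_real (exp (\<theta>\<^sup>2 * s / 2)) * iexp (\<theta> * w s)))"
proof -
  note i = iexp_weight[OF su(1) W, of \<theta>]
  have "(LINT w|P. W w * (of_real (exp (\<theta>\<^sup>2 * u / 2)) * iexp (\<theta> * w u)))
      = (LINT w|P. of_real (exp (\<theta>\<^sup>2 * u / 2)) * (W w * iexp (\<theta> * w s) * iexp (\<theta> * (w u - w s))))"
    by (rule Bochner_Integration.integral_cong) (auto simp: exp_add[symmetric] algebra_simps)
  also have "\<dots> = of_real (exp (\<theta>\<^sup>2 * u / 2)) * ((LINT w|P. W w * iexp (\<theta> * w s)) * exp (- (of_real (\<theta>\<^sup>2 * (u - s) / 2))))"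
    using indep_product_complex(2)[OF su i, of "\<lambda>x. iexp (\<theta> * x)"] iexp_increment_integrable[OF su] increment_char[OF su] by simp
  also have "\<dots> = of_real (exp (\<theta>\<^sup>2 * s / 2)) * (LINT w|P. W w * iexp (\<theta> * w s))"
  proof -
    have "\<theta>\<^sup>2 * u / 2 - \<theta>\<^sup>2 * (u - s) / 2 = \<theta>\<^sup>2 * s / 2" by (simp add: field_simps)
    then have "of_real (exp (\<theta>\<^sup>2 * u / 2)) * exp (- (complex_of_real (\<theta>\<^sup>2 * (u - s) / 2))) = of_real (exp (\<theta>\<^sup>2 * s / 2))"
      by (simp only: exp_of_real of_real_minus[symmetric] of_real_mult[symmetric] exp_add[symmetric] add_uminus_conv_diff)
    moreover have "a * (b * d) = (a * d) * b" for a b d :: complex by (simp only: ac_simps)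
    ultimately show ?thesis by (simp only:)
  qed
  also have "\<dots> = (LINT w|P. of_real (exp (\<theta>\<^sup>2 * s / 2)) * (W w * iexp (\<theta> * w s)))"
    by (rule integral_mult_right_zero[symmetric])
  also have "\<dots> = (LINT w|P. W w * (of_real (exp (\<theta>\<^sup>2 * s / 2)) * iexp (\<theta> * w s)))"
    by (rule Bochner_Integration.integral_cong[OF refl]) (simp only: ac_simps)
  finally show ?thesis .
qed

text \<open>Derivative of the characteristic function in \<theta>. The difference quotients are
  dominated by |w u - w s|, because |exp(iy) - 1| \<le> |y|; the closed form is differentiated
  directly.\<close>

lemma increment_char_deriv:
  assumes su: "0 \<le> s" "s \<le> u"
  shows "(LINT w|P. of_real (w u - w s) * iexp (\<theta> * (w u - w s))) = \<i> * of_real (\<theta> * (u - s)) * of_real (exp (- (\<theta>\<^sup>2 * (u - s) / 2)))"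
proof -
  define f where "f \<theta> = complex_of_real (exp (- (\<theta>\<^sup>2 * (u - s) / 2)))" for \<theta>
  have f: "(LINT w|P. iexp (\<theta> * (w u - w s))) = f \<theta>" for \<theta>
    using increment_char[OF su, of \<theta>] by (simp add: f_def exp_of_real[symmetric])
  \<comment> \<open>Difference quotient of step 1 / (n + 1) in the variable \<theta>.\<close>
  define q where "q n x = of_nat (Suc n) * (iexp ((\<theta> + 1 / real (Suc n)) * x) - iexp (\<theta> * x))" for n and x :: real
  have eps: "filterlim (\<lambda>n. 1 / real (Suc n)) (at 0) sequentially"
    unfolding filterlim_at using LIMSEQ_Suc[OF lim_1_over_n] by auto
  have deriv: "(\<lambda>n. (g (\<theta> + 1 / real (Suc n)) - g \<theta>) * of_nat (Suc n)) \<longlonglongrightarrow> D"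
    if "(g has_vector_derivative D) (at \<theta>)" for g :: "real => complex" and D
  proof -
    have "((\<lambda>h. norm (g (\<theta> + h) - g \<theta> - h *\<^sub>R D) / norm h) \<longlongrightarrow> 0) (at 0)"
      using that unfolding has_vector_derivative_def has_derivative_at by simp
    from filterlim_compose[OF this eps]
    have "(\<lambda>n. norm (g (\<theta> + 1 / real (Suc n)) - g \<theta> - (1 / real (Suc n)) *\<^sub>R D) / norm (1 / real (Suc n))) \<longlonglongrightarrow> 0" .
    moreover have "norm (g (\<theta> + 1 / real (Suc n)) - g \<theta> - (1 / real (Suc n)) *\<^sub>R D) / norm (1 / real (Suc n))
        = norm ((g (\<theta> + 1 / real (Suc n)) - g \<theta>) * of_nat (Suc n) - D)" for n
    proof -
      have "(g (\<theta> + 1 / real (Suc n)) - g \<theta>) * of_nat (Suc n) - D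
          = (g (\<theta> + 1 / real (Suc n)) - g \<theta> - (1 / real (Suc n)) *\<^sub>R D) * of_nat (Suc n)"
        by (simp add: left_diff_distrib scaleR_conv_of_real del: of_nat_Suc)
      then show ?thesis by (simp only: norm_mult norm_of_nat) simp
    qed
    ultimately show ?thesis by (simp add: LIM_zero_cancel tendsto_norm_zero_iff)
  qed
  have "(\<lambda>n. \<integral>w. q n (w u - w s) \<partial>P) \<longlonglongrightarrow> (LINT w|P. \<i> * of_real (w u - w s) * iexp (\<theta> * (w u - w s)))"
  proof (rule integral_dominated_convergence[where w="\<lambda>w. \<bar>w u - w s\<bar>"])
    have [measurable]: "(\<lambda>w. w u - w s) \<in> borel_measurable P" using su by auto
    show "(\<lambda>w. \<i> * of_real (w u - w s) * iexp (\<theta> * (w u - w s))) \<in> borel_measurable P" by measurable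
    show "(\<lambda>w. q n (w u - w s)) \<in> borel_measurable P" for n unfolding q_def by measurable
    show "integrable P (\<lambda>w. \<bar>w u - w s\<bar>)" using increment_moments(1)[OF su, of 1] by simp
    show "AE w in P. (\<lambda>n. q n (w u - w s)) \<longlonglongrightarrow> \<i> * of_real (w u - w s) * iexp (\<theta> * (w u - w s))"
    proof (rule AE_I2)
      fix w :: path
      have "((\<lambda>\<theta>. iexp (\<theta> * (w u - w s))) has_vector_derivative (\<i> * of_real (w u - w s) * iexp (\<theta> * (w u - w s)))) (at \<theta>)"
      proof -
        have "((\<lambda>\<theta>. \<theta> * (w u - w s)) has_vector_derivative (w u - w s)) (at \<theta>)"
          unfolding has_real_derivative_iff_has_vector_derivative[symmetric] by (auto intro!: derivative_eq_intros)
        from vector_diff_chain_at[OF this has_vector_derivative_iexp]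
        show ?thesis by (simp only: o_def scaleR_conv_of_real) (simp only: ac_simps)
      qed
      from deriv[OF this] show "(\<lambda>n. q n (w u - w s)) \<longlonglongrightarrow> \<i> * of_real (w u - w s) * iexp (\<theta> * (w u - w s))"
        by (simp add: q_def mult.commute)
    qed
    show "AE w in P. cmod (q n (w u - w s)) \<le> \<bar>w u - w s\<bar>" for n
    proof (rule AE_I2)
      fix w :: path
      define x where "x = w u - w s"
      have "iexp ((\<theta> + 1 / real (Suc n)) * x) - iexp (\<theta> * x) = iexp (\<theta> * x) * (iexp (x / real (Suc n)) - 1)"
        by (simp add: exp_add[symmetric] algebra_simps)
      then have "cmod (q n x) = real (Suc n) * cmod (iexp (x / real (Suc n)) - 1)"
        unfolding q_def norm_mult by (simp only: norm_mult norm_exp_i_times mult_1 norm_of_nat)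
      also have "\<dots> \<le> real (Suc n) * (\<bar>x\<bar> / real (Suc n))"
        using iexp_approx1[of "x / real (Suc n)" 0] by (intro mult_left_mono) (auto simp: abs_divide)
      finally show "cmod (q n (w u - w s)) \<le> \<bar>w u - w s\<bar>" by (simp add: x_def)
    qed
  qed
  moreover have "(LINT w|P. q n (w u - w s)) = (f (\<theta> + 1 / real (Suc n)) - f \<theta>) * of_nat (Suc n)" for n
    unfolding q_def integral_mult_right_zero
      Bochner_Integration.integral_diff[OF iexp_increment_integrable[OF su] iexp_increment_integrable[OF su]] f
    by (simp only: mult.commute)
  moreover have "(f has_vector_derivative (of_real (- (\<theta> * (u - s)) * exp (- (\<theta>\<^sup>2 * (u - s) / 2))))) (at \<theta>)"
    unfolding f_def by (rule has_vector_derivative_of_real) (auto intro!: derivative_eq_intros simp: has_real_derivative_iff_has_vector_derivative[symmetric])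
  ultimately have "(LINT w|P. \<i> * of_real (w u - w s) * iexp (\<theta> * (w u - w s))) = of_real (- (\<theta> * (u - s)) * exp (- (\<theta>\<^sup>2 * (u - s) / 2)))"
    using deriv LIMSEQ_unique by fastforce
  then have "\<i> * (LINT w|P. of_real (w u - w s) * iexp (\<theta> * (w u - w s))) = \<i> * (\<i> * of_real (\<theta> * (u - s)) * of_real (exp (- (\<theta>\<^sup>2 * (u - s) / 2))))"
    by (simp add: mult.assoc)
  then show ?thesis by (simp only: mult_cancel_left) simp
qed

text \<open>Split X_u into X_s and the increment. The first part is an exponential martingale with
  the additional past weight X_s; the second contributes the drift through the derivative of the
  characteristic function.\<close>

lemma coord_exponential_drift:
  assumes su: "0 \<le> s" "s \<le> u" and W: "W \<in> borel_measurable (Filt s)" "\<And>w. cmod (W w) \<le> K"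
  shows "(LINT w|P. W w * (of_real (exp (\<theta>\<^sup>2 * u / 2)) * (of_real (w u) * iexp (\<theta> * w u)))) =
    (LINT w|P. W w * (of_real (exp (\<theta>\<^sup>2 * s / 2)) * (of_real (w s) * iexp (\<theta> * w s))))
    + of_real (u - s) * (LINT w|P. W w * (\<i> * of_real \<theta> * of_real (exp (\<theta>\<^sup>2 * s / 2)) * iexp (\<theta> * w s)))"
proof -
  have W': "W \<in> borel_measurable P" using measurable_Filt_P[OF W(1)] .
  have iW: "integrable P W" by (rule integrable_const_bound[of _ K]) (use W W' in auto)
  note i1 = iexp_weight[OF su(1) W(1) iW, of \<theta>]
  define Y where "Y w = W w * of_real (w s)" for w
  have Ym: "Y \<in> borel_measurable (Filt s)" unfolding Y_def
    using W(1) coord_measurable_Filt[of s s] su by measurable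
  have Yi: "integrable P Y" unfolding Y_def
    by (rule integrable_bounded_mult[OF W' W(2)]) (use coord_moments(1)[OF su(1)] in auto)
  note i2 = iexp_weight[OF su(1) Ym Yi, of \<theta>]
  have iD: "integrable P (\<lambda>w. complex_of_real (w u - w s) * iexp (\<theta> * (w u - w s)))"
  proof -
    have "integrable P (\<lambda>w. iexp (\<theta> * (w u - w s)) * complex_of_real (w u - w s))"
      by (rule integrable_bounded_mult[of _ 1]) (use iexp_increment_integrable[OF su, of \<theta>] increment_moments(1)[OF su, of 1] in \<open>auto simp del: of_real_diff\<close>)
    then show ?thesis by (simp only: mult.commute)
  qed
  let ?e = "complex_of_real (exp (\<theta>\<^sup>2 * u / 2))" and ?d = "complex_of_real (exp (- (\<theta>\<^sup>2 * (u - s) / 2)))"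
  have ed: "?e * ?d = of_real (exp (\<theta>\<^sup>2 * s / 2))"
    by (simp only: of_real_mult[symmetric] exp_add[symmetric]) (simp add: field_simps)
  have "(LINT w|P. W w * (?e * (of_real (w u) * iexp (\<theta> * w u))))
      = (LINT w|P. ?e * (Y w * iexp (\<theta> * w s) * iexp (\<theta> * (w u - w s)) + W w * iexp (\<theta> * w s) * (of_real (w u - w s) * iexp (\<theta> * (w u - w s)))))"
  proof (rule Bochner_Integration.integral_cong[OF refl])
    fix w :: path
    have "iexp (\<theta> * w u) = iexp (\<theta> * w s) * iexp (\<theta> * (w u - w s))" by (simp add: exp_add[symmetric] algebra_simps)
    then show "W w * (?e * (of_real (w u) * iexp (\<theta> * w u))) = ?e * (Y w * iexp (\<theta> * w s) * iexp (\<theta> * (w u - w s)) + W w * iexp (\<theta> * w s) * (of_real (w u - w s) * iexp (\<theta> * (w u - w s))))"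
      unfolding Y_def by (simp only:) (simp add: algebra_simps)
  qed
  also have "\<dots> = ?e * ((LINT w|P. Y w * iexp (\<theta> * w s)) * ?d + (LINT w|P. W w * iexp (\<theta> * w s)) * (\<i> * of_real (\<theta> * (u - s)) * ?d))"
    using indep_product_complex[OF su i2, of "\<lambda>x. iexp (\<theta> * x)"] indep_product_complex[OF su i1, of "\<lambda>x. of_real x * iexp (\<theta> * x)"]
      iexp_increment_integrable[OF su] iD increment_char[OF su, of \<theta>] increment_char_deriv[OF su, of \<theta>] by (simp add: exp_of_real[symmetric])
  also have "\<dots> = (?e * ?d) * (LINT w|P. Y w * iexp (\<theta> * w s)) + of_real (u - s) * (\<i> * of_real \<theta> * (?e * ?d) * (LINT w|P. W w * iexp (\<theta> * w s)))"
    by (simp add: algebra_simps)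
  also have "\<dots> = (LINT w|P. W w * (of_real (exp (\<theta>\<^sup>2 * s / 2)) * (of_real (w s) * iexp (\<theta> * w s))))
    + of_real (u - s) * (LINT w|P. W w * (\<i> * of_real \<theta> * of_real (exp (\<theta>\<^sup>2 * s / 2)) * iexp (\<theta> * w s)))"
    unfolding ed
  proof (intro arg_cong2[where f="(+)"] arg_cong2[where f="(*)"] refl)
    have "(LINT w|P. of_real (exp (\<theta>\<^sup>2 * s / 2)) * (Y w * iexp (\<theta> * w s))) = of_real (exp (\<theta>\<^sup>2 * s / 2)) * (LINT w|P. Y w * iexp (\<theta> * w s))"
      by (rule integral_mult_right_zero)
    moreover have "of_real (exp (\<theta>\<^sup>2 * s / 2)) * (Y w * iexp (\<theta> * w s)) = W w * (of_real (exp (\<theta>\<^sup>2 * s / 2)) * (of_real (w s) * iexp (\<theta> * w s)))" for w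
      by (simp add: Y_def)
    ultimately show "of_real (exp (\<theta>\<^sup>2 * s / 2)) * (LINT w|P. Y w * iexp (\<theta> * w s))
        = (LINT w|P. W w * (of_real (exp (\<theta>\<^sup>2 * s / 2)) * (of_real (w s) * iexp (\<theta> * w s))))" by (simp only:)
    have "(LINT w|P. \<i> * of_real \<theta> * of_real (exp (\<theta>\<^sup>2 * s / 2)) * (W w * iexp (\<theta> * w s))) = \<i> * of_real \<theta> * of_real (exp (\<theta>\<^sup>2 * s / 2)) * (LINT w|P. W w * iexp (\<theta> * w s))"
      by (rule integral_mult_right_zero)
    moreover have "\<i> * of_real \<theta> * of_real (exp (\<theta>\<^sup>2 * s / 2)) * (W w * iexp (\<theta> * w s)) = W w * (\<i> * of_real \<theta> * of_real (exp (\<theta>\<^sup>2 * s / 2)) * iexp (\<theta> * w s))" for w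
      by (simp only: ac_simps)
    ultimately show "\<i> * of_real \<theta> * of_real (exp (\<theta>\<^sup>2 * s / 2)) * (LINT w|P. W w * iexp (\<theta> * w s))
        = (LINT w|P. W w * (\<i> * of_real \<theta> * of_real (exp (\<theta>\<^sup>2 * s / 2)) * iexp (\<theta> * w s)))" by (simp only:)
  qed
  finally show ?thesis .
qed

text \<open>Half sum and half difference of the exponential martingales for \<theta> and -\<theta>,
  which have the same factor exp(\<theta>^2 u / 2). \<open>W\<close> may be complex, so real and
  imaginary parts cannot be taken instead.\<close>

lemma sin_cos_martingale:
  fixes W :: "path => complex"
  assumes su: "0 \<le> s" "s \<le> u" and W: "W \<in> borel_measurable (Filt s)" "integrable P W"
  shows "(LINT w|P. W w * of_real (exp (\<theta>\<^sup>2 * u / 2) * cos (\<theta> * w u))) = (LINT w|P. W w * of_real (exp (\<theta>\<^sup>2 * s / 2) * cos (\<theta> * w s)))"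
    and "(LINT w|P. W w * of_real (exp (\<theta>\<^sup>2 * u / 2) * sin (\<theta> * w u))) = (LINT w|P. W w * of_real (exp (\<theta>\<^sup>2 * s / 2) * sin (\<theta> * w s)))"
proof -
  define E where "E \<theta> v w = W w * (of_real (exp (\<theta>\<^sup>2 * v / 2)) * iexp (\<theta> * w v))" for \<theta> v w
  have u: "0 \<le> u" using su by simp
  have i: "integrable P (E \<theta> v)" if "0 \<le> v" for \<theta> v
  proof -
    have "integrable P (\<lambda>w. (of_real (exp (\<theta>\<^sup>2 * v / 2)) * iexp (\<theta> * w v)) * W w)"
      by (rule integrable_bounded_mult[OF _ _ W(2), of _ "exp (\<theta>\<^sup>2 * v / 2)"]) (use iexp_integrable[OF that, of \<theta>] in \<open>auto simp: norm_mult\<close>)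
    then show ?thesis unfolding E_def by (simp add: mult.commute)
  qed
  have m: "(LINT w|P. E \<theta> u w) = (LINT w|P. E \<theta> s w)" for \<theta> unfolding E_def by (rule exponential_martingale[OF su W])
  have c: "W w * of_real (exp (\<theta>\<^sup>2 * v / 2) * cos (\<theta> * w v)) = (E \<theta> v w + E (- \<theta>) v w) / 2"
    and sn: "W w * of_real (exp (\<theta>\<^sup>2 * v / 2) * sin (\<theta> * w v)) = (E \<theta> v w - E (- \<theta>) v w) / (2 * \<i>)" for v w
  proof -
    have eu: "iexp y = of_real (cos y) + \<i> * of_real (sin y)" for y :: real
      by (simp only: cis_conv_exp[symmetric] cis.ctr Complex_eq)
    have e1: "iexp (\<theta> * w v) = of_real (cos (\<theta> * w v)) + \<i> * of_real (sin (\<theta> * w v))" by (rule eu)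
    have e2: "iexp (- \<theta> * w v) = of_real (cos (\<theta> * w v)) - \<i> * of_real (sin (\<theta> * w v))"
      using eu[of "- \<theta> * w v"] by simp
    have alg: "x * (e * a) = (x * (e * (a + \<i> * b)) + x * (e * (a - \<i> * b))) / 2"
      "x * (e * b) = (x * (e * (a + \<i> * b)) - x * (e * (a - \<i> * b))) / (2 * \<i>)" for x e a b :: complex
      by (simp_all add: field_simps)
    show "W w * of_real (exp (\<theta>\<^sup>2 * v / 2) * cos (\<theta> * w v)) = (E \<theta> v w + E (- \<theta>) v w) / 2"
      unfolding E_def e1 e2 power2_minus unfolding of_real_mult[of "exp _"] by (rule alg(1))
    show "W w * of_real (exp (\<theta>\<^sup>2 * v / 2) * sin (\<theta> * w v)) = (E \<theta> v w - E (- \<theta>) v w) / (2 * \<i>)"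
      unfolding E_def e1 e2 power2_minus unfolding of_real_mult[of "exp _"] by (rule alg(2))
  qed
  show "(LINT w|P. W w * of_real (exp (\<theta>\<^sup>2 * u / 2) * cos (\<theta> * w u))) = (LINT w|P. W w * of_real (exp (\<theta>\<^sup>2 * s / 2) * cos (\<theta> * w s)))"
    unfolding c using i[OF su(1)] i[OF u] m by simp
  show "(LINT w|P. W w * of_real (exp (\<theta>\<^sup>2 * u / 2) * sin (\<theta> * w u))) = (LINT w|P. W w * of_real (exp (\<theta>\<^sup>2 * s / 2) * sin (\<theta> * w s)))"
    unfolding sn using i[OF su(1)] i[OF u] m by simp
qed

end

section \<open>Absolute moments from cosine transforms\<close>

lemma sin_cos_estimates:
  fixes x :: real
  shows "\<bar>cos x - 1\<bar> \<le> \<bar>x\<bar>" "\<bar>sin x - x\<bar> \<le> x\<^sup>2" "\<bar>sin x\<bar> \<le> \<bar>x\<bar>"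
proof -
  have 1: "cmod (iexp x - 1) \<le> \<bar>x\<bar>" using iexp_approx1[of x 0] by simp
  have 2: "cmod (iexp x - (1 + \<i> * x)) \<le> x\<^sup>2 / 2" using iexp_approx1[of x 1] by (simp add: power2_eq_square abs_mult_self_eq)
  show "\<bar>cos x - 1\<bar> \<le> \<bar>x\<bar>" using abs_Re_le_cmod[of "iexp x - 1"] 1 by (simp add: Re_exp)
  show "\<bar>sin x\<bar> \<le> \<bar>x\<bar>" by (rule abs_sin_x_le_abs_x)
  have "\<bar>sin x - x\<bar> \<le> x\<^sup>2 / 2" using abs_Im_le_cmod[of "iexp x - (1 + \<i> * x)"] 2 by (simp add: Im_exp)
  then show "\<bar>sin x - x\<bar> \<le> x\<^sup>2" using zero_le_power2[of x] by linarith
qed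

lemma nn_integral_cos_scaling:
  "(\<integral>\<^sup>+\<theta>. ennreal ((1 - cos (\<theta> * z)) / \<theta>\<^sup>2) \<partial>lborel) = ennreal \<bar>z\<bar> * (\<integral>\<^sup>+\<theta>. ennreal ((1 - cos \<theta>) / \<theta>\<^sup>2) \<partial>lborel)"
proof (cases "z = 0")
  case False
  have "(\<integral>\<^sup>+\<theta>. ennreal ((1 - cos \<theta>) / \<theta>\<^sup>2) \<partial>lborel) = ennreal \<bar>z\<bar> * (\<integral>\<^sup>+\<theta>. ennreal ((1 - cos (0 + z * \<theta>)) / (0 + z * \<theta>)\<^sup>2) \<partial>lborel)"
    by (rule nn_integral_real_affine) (use False in auto)
  also have "\<dots> = ennreal \<bar>z\<bar> * (\<integral>\<^sup>+\<theta>. ennreal (1 / z\<^sup>2) * ennreal ((1 - cos (\<theta> * z)) / \<theta>\<^sup>2) \<partial>lborel)"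
    by (intro arg_cong2[where f="(*)"] refl nn_integral_cong) (auto simp: ennreal_mult'[symmetric] power_mult_distrib mult.commute)
  also have "\<dots> = ennreal \<bar>z\<bar> * (ennreal (1 / z\<^sup>2) * (\<integral>\<^sup>+\<theta>. ennreal ((1 - cos (\<theta> * z)) / \<theta>\<^sup>2) \<partial>lborel))"
    by (subst nn_integral_cmult) auto
  finally have "ennreal \<bar>z\<bar> * (\<integral>\<^sup>+\<theta>. ennreal ((1 - cos \<theta>) / \<theta>\<^sup>2) \<partial>lborel)
      = (ennreal \<bar>z\<bar> * ennreal \<bar>z\<bar> * ennreal (1 / z\<^sup>2)) * (\<integral>\<^sup>+\<theta>. ennreal ((1 - cos (\<theta> * z)) / \<theta>\<^sup>2) \<partial>lborel)"
    by (simp only: mult.assoc)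
  also have "ennreal \<bar>z\<bar> * ennreal \<bar>z\<bar> * ennreal (1 / z\<^sup>2) = 1"
    using False by (simp add: ennreal_mult'[symmetric] power2_eq_square abs_mult_self_eq)
  finally show ?thesis by simp
qed simp

text \<open>Dominated by 4 / (1 + x^2): multiply 1 - cos x by 1 + x^2 and use 1 - cos x \<le> x^2 /
  2 near the origin and 1 - cos x \<le> 2 far away.\<close>

lemma nn_integral_cos_finite: "(\<integral>\<^sup>+\<theta>. ennreal ((1 - cos \<theta>) / \<theta>\<^sup>2) \<partial>lborel) < \<infinity>"
proof -
  have le: "(1 - cos x) / x\<^sup>2 \<le> 4 * inverse (1 + x\<^sup>2)" for x :: real
  proof (cases "x = 0")
    case False
    have 1: "1 - cos x \<le> x\<^sup>2 / 2"
      using abs_Re_le_cmod[of "iexp x - (1 + \<i> * x)"] iexp_approx1[of x 1] by (simp add: Re_exp power2_eq_square abs_mult_self_eq)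
    have 2: "1 - cos x \<le> 2" using cos_ge_minus_one[of x] by linarith
    have "(1 - cos x) * (1 + x\<^sup>2) = (1 - cos x) + (1 - cos x) * x\<^sup>2" by (simp add: algebra_simps)
    also have "\<dots> \<le> x\<^sup>2 / 2 + 2 * x\<^sup>2" using 1 2 by (intro add_mono mult_right_mono) auto
    also have "\<dots> \<le> 4 * x\<^sup>2" by simp
    finally have "(1 - cos x) * (1 + x\<^sup>2) \<le> 4 * x\<^sup>2" .
    moreover have "0 < 1 + x\<^sup>2" by (simp add: add_pos_nonneg)
    ultimately show ?thesis using False by (simp add: divide_simps mult.commute)
  qed simp
  have "integrable lborel (\<lambda>x::real. inverse (1 + x\<^sup>2))"
    using integrable_inverse_1_plus_square by (simp add: set_integrable_def)
  then have "integrable lborel (\<lambda>x::real. 4 * inverse (1 + x\<^sup>2))" by simp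
  then have "(\<integral>\<^sup>+x. ennreal (4 * inverse (1 + x\<^sup>2)) \<partial>lborel) < \<infinity>"
    by (subst nn_integral_eq_integral) (auto simp: add_nonneg_nonneg)
  moreover have "(\<integral>\<^sup>+\<theta>. ennreal ((1 - cos \<theta>) / \<theta>\<^sup>2) \<partial>lborel) \<le> (\<integral>\<^sup>+x. ennreal (4 * inverse (1 + x\<^sup>2)) \<partial>lborel)"
    by (intro nn_integral_mono ennreal_leI le)
  ultimately show ?thesis by (rule le_less_trans[rotated])
qed

lemma nn_integral_cos_pos: "(\<integral>\<^sup>+\<theta>. ennreal ((1 - cos \<theta>) / \<theta>\<^sup>2) \<partial>lborel) \<noteq> 0"
proof
  assume "(\<integral>\<^sup>+\<theta>. ennreal ((1 - cos \<theta>) / \<theta>\<^sup>2) \<partial>lborel) = 0"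
  then have "AE x in lborel. ennreal ((1 - cos x) / x\<^sup>2) = 0" by (subst (asm) nn_integral_0_iff_AE) auto
  then have "AE x in lborel. x \<notin> {1<..<2::real}"
  proof eventually_elim
    case (elim x)
    show ?case
    proof
      assume x: "x \<in> {1<..<2}"
      then have "cos x < cos 0" using pi_gt3 by (intro cos_monotone_0_pi) auto
      then have "0 < (1 - cos x) / x\<^sup>2" using x by simp
      then show False using elim by (simp add: ennreal_eq_0_iff)
    qed
  qed
  then have "emeasure lborel {1<..<2::real} = 0"
    by (subst (asm) AE_iff_null_sets[symmetric]) auto
  then show False by simp
qed

text \<open>Based on \<open>\<integral> (1 - cos (\<theta> z)) / \<theta>\<^sup>2 d\<theta> = \<kappa> \<bar>z\<bar>\<close>.\<close>

lemma (in prob_space) abs_moment_from_cos: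
  fixes U U' :: "'a => real"
  assumes A: "A \<in> events" and U: "U \<in> borel_measurable M" "U' \<in> borel_measurable M"
    and eq: "\<And>\<theta>. (LINT w|M. indicator A w * cos (\<theta> * U w)) = (LINT w|M. indicator A w * cos (\<theta> * U' w))"
  shows "(\<integral>\<^sup>+w. indicator A w * ennreal \<bar>U w\<bar> \<partial>M) = (\<integral>\<^sup>+w. indicator A w * ennreal \<bar>U' w\<bar> \<partial>M)"
proof -
  define \<kappa> where "\<kappa> = (\<integral>\<^sup>+\<theta>. ennreal ((1 - cos \<theta>) / \<theta>\<^sup>2) \<partial>lborel)"
  interpret pair_sigma_finite M "lborel :: real measure" ..
  \<comment> \<open>Tonelli with an integrand that is non-negative; no integrability of
    \<open>U\<close> enters, and the moment may be infinite.\<close>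
  have rep: "(\<integral>\<^sup>+w. indicator A w * ennreal \<bar>U w\<bar> \<partial>M) * \<kappa> =
      (\<integral>\<^sup>+\<theta>. ennreal ((prob A - (LINT w|M. indicator A w * cos (\<theta> * U w))) / \<theta>\<^sup>2) \<partial>lborel)"
    if [measurable]: "U \<in> borel_measurable M" for U :: "'a => real"
  proof -
    note [measurable] = A
    have "(\<integral>\<^sup>+w. indicator A w * ennreal \<bar>U w\<bar> \<partial>M) * \<kappa> = (\<integral>\<^sup>+w. (\<integral>\<^sup>+\<theta>. indicator A w * ennreal ((1 - cos (\<theta> * U w)) / \<theta>\<^sup>2) \<partial>lborel) \<partial>M)"
      by (subst nn_integral_multc[symmetric]) (auto simp: \<kappa>_def nn_integral_cos_scaling[symmetric] nn_integral_cmult mult.assoc)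
    also have "\<dots> = (\<integral>\<^sup>+\<theta>. (\<integral>\<^sup>+w. indicator A w * ennreal ((1 - cos (\<theta> * U w)) / \<theta>\<^sup>2) \<partial>M) \<partial>lborel)"
      by (rule Fubini'[symmetric]) measurable
    also have "\<dots> = (\<integral>\<^sup>+\<theta>. ennreal ((prob A - (LINT w|M. indicator A w * cos (\<theta> * U w))) / \<theta>\<^sup>2) \<partial>lborel)"
    proof (rule nn_integral_cong)
      fix \<theta> :: real
      have i: "integrable M (\<lambda>w. indicator A w * cos (\<theta> * U w))"
        by (rule integrable_const_bound[of _ 1]) (auto simp: indicator_def)
      have iA: "integrable M (indicator A :: 'a => real)" using A by (simp add: less_top[symmetric])
      have "(\<integral>\<^sup>+w. indicator A w * ennreal ((1 - cos (\<theta> * U w)) / \<theta>\<^sup>2) \<partial>M) = (\<integral>\<^sup>+w. ennreal ((indicator A w - indicator A w * cos (\<theta> * U w)) / \<theta>\<^sup>2) \<partial>M)"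
        by (intro nn_integral_cong) (auto simp: indicator_def)
      also have "\<dots> = ennreal (LINT w|M. (indicator A w - indicator A w * cos (\<theta> * U w)) / \<theta>\<^sup>2)"
        by (intro nn_integral_eq_integral integrable_divide Bochner_Integration.integrable_diff i iA) (auto simp: indicator_def)
      also have "(LINT w|M. (indicator A w - indicator A w * cos (\<theta> * U w)) / \<theta>\<^sup>2) = (prob A - (LINT w|M. indicator A w * cos (\<theta> * U w))) / \<theta>\<^sup>2"
        using i iA A sets.sets_into_space[OF A] by (simp add: Int_absorb2)
      finally show "(\<integral>\<^sup>+w. indicator A w * ennreal ((1 - cos (\<theta> * U w)) / \<theta>\<^sup>2) \<partial>M) = ennreal ((prob A - (LINT w|M. indicator A w * cos (\<theta> * U w))) / \<theta>\<^sup>2)" .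
    qed
    finally show ?thesis .
  qed
  have "(\<integral>\<^sup>+w. indicator A w * ennreal \<bar>U w\<bar> \<partial>M) * \<kappa> = (\<integral>\<^sup>+w. indicator A w * ennreal \<bar>U' w\<bar> \<partial>M) * \<kappa>"
    unfolding rep[OF U(1)] rep[OF U(2)] eq ..
  \<comment> \<open>Cancelling \<kappa> among extended non-negative reals is legitimate since it is
    finite and non-zero.\<close>
  then show ?thesis
    using nn_integral_cos_finite nn_integral_cos_pos unfolding \<kappa>_def[symmetric]
    by (auto simp: mult.commute[of _ \<kappa>] ennreal_mult_cancel_left)
qed

text \<open>Fundamental theorem of calculus for l \<mapsto> -cos(\<theta> (y - l)^+) / \<theta>.
  This function is differentiable except possibly at l = y, a single exceptional point. The name
  alludes to (y - l)^+, the payoff of a put option with strike y.\<close>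

lemma Hint_sin_put:
  assumes "0 \<le> y" "0 \<le> l"
  shows "\<theta> * Hint (\<lambda>l. - sin (\<theta> * max (y - l) 0)) l = cos (\<theta> * y) - cos (\<theta> * max (y - l) 0)"
proof (cases "\<theta> = 0")
  case False
  define F where "F l = - cos (\<theta> * max (y - l) 0) / \<theta>" for l
  have cont: "continuous_on {0..l} (\<lambda>l. - sin (\<theta> * max (y - l) 0))" by (intro continuous_intros)
  have "((\<lambda>l. - sin (\<theta> * max (y - l) 0)) has_integral F l - F 0) {0..l}"
  proof (rule fundamental_theorem_of_calculus_strong[of "{y}"])
    show "continuous_on {0..l} F" unfolding F_def using False by (intro continuous_intros) auto
    fix x assume x: "x \<in> {0..l} - {y}"
    show "(F has_vector_derivative - sin (\<theta> * max (y - x) 0)) (at x)"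
    proof (cases "x < y")
      case True
      have "((\<lambda>l. - cos (\<theta> * (y - l)) / \<theta>) has_real_derivative - sin (\<theta> * (y - x))) (at x)"
        using False by (auto intro!: derivative_eq_intros)
      then have "(F has_real_derivative - sin (\<theta> * (y - x))) (at x)"
        by (rule has_field_derivative_transform_within_open[of _ _ _ "{..<y}"]) (use True in \<open>auto simp: F_def\<close>)
      then show ?thesis using True by (simp add: has_real_derivative_iff_has_vector_derivative)
    next
      case False
      have "((\<lambda>l. - 1 / \<theta>) has_real_derivative 0) (at x)" by simp
      then have "(F has_real_derivative 0) (at x)"
        by (rule has_field_derivative_transform_within_open[of _ _ _ "{y<..}"]) (use False x in \<open>auto simp: F_def\<close>)
      then show ?thesis using False by (simp add: has_real_derivative_iff_has_vector_derivative)
    qed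
  qed (use assms in auto)
  then have "integral {0..l} (\<lambda>l. - sin (\<theta> * max (y - l) 0)) = F l - F 0" by (rule integral_unique)
  moreover have "set_integrable lborel {0..l} (\<lambda>l. - sin (\<theta> * max (y - l) 0))"
    by (rule borel_integrable_compact[OF _ cont, unfolded set_integrable_def[symmetric]]) simp
  ultimately have "Hint (\<lambda>l. - sin (\<theta> * max (y - l) 0)) l = F l - F 0"
    unfolding Hint_def by (simp add: set_borel_integral_eq_integral(2))
  then show ?thesis using False assms by (simp add: F_def field_simps)
qed simp

text \<open>For y \<ge> 0 this is reflected Brownian motion started at y: until L reaches y it
  equals y + |X| - L, which is driven by the martingale part of |X|; when L reaches y it is at 0,
  and it continues as |X|. Comparing different starting points y gives access to the law of
  L.\<close>

definition (in wiener_local_time) reflected :: "real => real => path => real" where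
  "reflected y t w = \<bar>w t\<bar> + max (y - L t w) 0"

section \<open>Cosine martingales of the reflected process\<close>

context wiener_local_time
begin

lemma reflected_borel [measurable]: "0 \<le> t ==> reflected y t \<in> borel_measurable P"
  unfolding reflected_def[abs_def] by measurable

lemma reflected_Filt: "0 \<le> t ==> reflected y t \<in> borel_measurable (Filt t)"
  unfolding reflected_def[abs_def] using L_meas[of t] coord_measurable_Filt[of t t] by measurable

lemma reflected_integrable: "0 \<le> t ==> integrable P (reflected y t)"
proof -
  assume t: "0 \<le> t"
  have "integrable P (\<lambda>w. max (y - L t w) 0)"
    by (rule Bochner_Integration.integrable_bound[of _ "\<lambda>w. \<bar>y\<bar> + \<bar>L t w\<bar>"]) (use L_integrable[OF t] t in auto)
  then show ?thesis unfolding reflected_def[abs_def] using coord_moments(1)[OF t] by auto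
qed

text \<open>Reflection does not disturb even functions, so the cosine behaves as for Brownian motion
  itself. By the addition theorem, cos(\<theta> R) is a combination of sin(\<theta> |X|) = sgn(X)
  sin(\<theta> X) and cos(\<theta> X) with weights depending on L. With \<phi> the sine and \<psi> =
  \<theta> times the cosine this is the even identity without drift, plus a multiple of the cosine
  martingale.\<close>

lemma reflected_cos_martingale:
  assumes st: "0 \<le> s" "s \<le> t" and \<Gamma>: "\<Gamma> \<in> sets (Filt s)" and y: "0 \<le> y"
  shows "exp (\<theta>\<^sup>2 * t / 2) * (LINT w|P. indicator \<Gamma> w * cos (\<theta> * reflected y t w))
    = exp (\<theta>\<^sup>2 * s / 2) * (LINT w|P. indicator \<Gamma> w * cos (\<theta> * reflected y s w))"
proof -
  define E where "E = exp (\<theta>\<^sup>2 * t / 2)"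
  \<comment> \<open>One constant for all bounds of \<open>ito_even\<close>: the summand |\<theta>|
    covers the sizes of \<phi> and \<psi>, and \<theta>^2 their deviations from the linearisation at
    the origin.\<close>
  define C where "C = E * (1 + \<bar>\<theta>\<bar> + \<theta>\<^sup>2)"
  define V where "V w = (indicator \<Gamma> w :: complex)" for w
  define \<phi> where "\<phi> v x = complex_of_real (exp (\<theta>\<^sup>2 * v / 2) * sin (\<theta> * x))" for v x
  define \<psi> where "\<psi> v x = complex_of_real (\<theta> * (exp (\<theta>\<^sup>2 * v / 2) * cos (\<theta> * x)))" for v x
  define c where "c v = complex_of_real (\<theta> * exp (\<theta>\<^sup>2 * v / 2))" for v
  have E1: "1 \<le> E" using st by (simp add: E_def)
  have e: "exp (\<theta>\<^sup>2 * v / 2) \<le> E" "0 < exp (\<theta>\<^sup>2 * v / 2)" if "v \<in> {s..t}" for v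
    using that st by (auto simp: E_def mult_left_mono)
  have C: "E * \<bar>\<theta>\<bar> \<le> C" "E * \<theta>\<^sup>2 \<le> C" "0 \<le> C" unfolding C_def using E1 by (auto intro!: mult_left_mono)
  have iV: "integrable P V" and Vm: "V \<in> borel_measurable (Filt s)"
  proof -
    show m: "V \<in> borel_measurable (Filt s)" unfolding V_def using \<Gamma> by measurable
    show "integrable P V" by (rule integrable_const_bound[of _ 1]) (use measurable_Filt_P[OF m] in \<open>auto simp: V_def indicator_def\<close>)
  qed
  interpret I: ito_even P L s t V 1 C \<phi> "\<lambda>_ _. 0" \<psi> c
  proof unfold_locales
    fix v x assume v: "v \<in> {s..t}"
    show "\<phi> v \<in> borel_measurable borel" "\<psi> v \<in> borel_measurable borel" unfolding \<phi>_def \<psi>_def by measurable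
    have "cmod (\<phi> v x) = exp (\<theta>\<^sup>2 * v / 2) * \<bar>sin (\<theta> * x)\<bar>" unfolding \<phi>_def norm_of_real abs_mult by simp
    also have "\<dots> \<le> E * \<bar>\<theta> * x\<bar>" using e[OF v] E1 by (intro mult_mono sin_cos_estimates) auto
    also have "\<dots> = (E * \<bar>\<theta>\<bar>) * \<bar>x\<bar>" by (simp add: abs_mult)
    also have "\<dots> \<le> C * \<bar>x\<bar>" using C by (intro mult_right_mono) auto
    finally show "cmod (\<phi> v x) \<le> C * \<bar>x\<bar>" .
    have "cmod (\<psi> v x) = \<bar>\<theta>\<bar> * (exp (\<theta>\<^sup>2 * v / 2) * \<bar>cos (\<theta> * x)\<bar>)" unfolding \<psi>_def norm_of_real abs_mult by simp
    also have "\<dots> \<le> \<bar>\<theta>\<bar> * (E * 1)" using e[OF v] E1 by (intro mult_left_mono mult_mono) auto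
    finally show "cmod (\<psi> v x) \<le> C" using C by (simp add: mult.commute)
    have "\<psi> v x - c v = of_real (\<theta> * exp (\<theta>\<^sup>2 * v / 2) * (cos (\<theta> * x) - 1))" by (simp add: \<psi>_def c_def algebra_simps)
    then have "cmod (\<psi> v x - c v) = \<bar>\<theta>\<bar> * (exp (\<theta>\<^sup>2 * v / 2) * \<bar>cos (\<theta> * x) - 1\<bar>)" by (simp only: norm_of_real abs_mult) simp
    also have "\<dots> \<le> \<bar>\<theta>\<bar> * (E * \<bar>\<theta> * x\<bar>)" using e[OF v] E1 by (intro mult_left_mono mult_mono sin_cos_estimates) auto
    also have "\<dots> = E * \<theta>\<^sup>2 * \<bar>x\<bar>" by (simp add: abs_mult power2_eq_square)
    also have "\<dots> \<le> C * \<bar>x\<bar>" using C by (intro mult_right_mono) auto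
    finally show "cmod (\<psi> v x - c v) \<le> C * \<bar>x\<bar>" .
    have "\<phi> v x - c v * of_real x = of_real (exp (\<theta>\<^sup>2 * v / 2) * (sin (\<theta> * x) - \<theta> * x))" by (simp add: \<phi>_def c_def algebra_simps)
    then have "cmod (\<phi> v x - c v * of_real x) = exp (\<theta>\<^sup>2 * v / 2) * \<bar>sin (\<theta> * x) - \<theta> * x\<bar>" by (simp only: norm_of_real abs_mult) simp
    also have "\<dots> \<le> E * (\<theta> * x)\<^sup>2" using e[OF v] E1 by (intro mult_mono sin_cos_estimates) auto
    also have "\<dots> = E * \<theta>\<^sup>2 * x\<^sup>2" by (simp add: power_mult_distrib)
    also have "\<dots> \<le> C * x\<^sup>2" using C by (intro mult_right_mono) auto
    finally show "cmod (\<phi> v x - c v * of_real x) \<le> C * x\<^sup>2" .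
  next
    fix v u K :: real and W :: "path => complex" assume vu: "s \<le> v" "v \<le> u" "u \<le> t" and W: "W \<in> borel_measurable (Filt v)" "\<And>w. cmod (W w) \<le> K"
    have "integrable P W" by (rule integrable_const_bound[of _ K]) (use W measurable_Filt_P[OF W(1)] in auto)
    then show "(LINT w|P. W w * \<phi> u (w u)) = (LINT w|P. W w * \<phi> v (w v)) + complex_of_real (u - v) * (LINT w|P. W w * 0)"
      unfolding \<phi>_def using sin_cos_martingale(2)[of v u W \<theta>] vu st W by simp
  next
    fix v u :: real and W :: "path => complex" assume vu: "s \<le> v" "v \<le> u" "u \<le> t" and W: "W \<in> borel_measurable (Filt v)" "integrable P W"
    have "(LINT w|P. W w * \<psi> u (w u)) = of_real \<theta> * (LINT w|P. W w * of_real (exp (\<theta>\<^sup>2 * u / 2) * cos (\<theta> * w u)))" for u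
      unfolding \<psi>_def by (subst integral_mult_right_zero[symmetric]) (rule Bochner_Integration.integral_cong, simp_all)
    then show "(LINT w|P. W w * \<psi> u (w u)) = (LINT w|P. W w * \<psi> v (w v))"
      using sin_cos_martingale(1)[of v u W \<theta>] vu st W by simp
  qed (use st C Vm in \<open>auto simp: V_def indicator_def\<close>)
  \<comment> \<open>The coefficient of sin(\<theta> |X|) in the addition theorem. Its primitive
    times \<theta> is cos(\<theta> y) - cos(\<theta> (y - l)^+), so the coefficient of cos(\<theta>
    X) is the matching one up to the constant cos(\<theta> y).\<close>
  define h where "h l = - sin (\<theta> * max (y - l) 0)" for l
  have h: "h \<in> borel_measurable borel" "\<And>x. \<bar>h x\<bar> \<le> 1"
  proof -
    show "h \<in> borel_measurable borel" unfolding h_def[abs_def] by measurable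
  qed (simp add: h_def)
  have even: "I.even_mean h t = I.even_mean h s" using I.even_identity[OF h] by simp
  have rep: "(LINT w|P. V w * of_real (exp (\<theta>\<^sup>2 * v / 2) * cos (\<theta> * reflected y v w)))
     = I.even_mean h v + of_real (cos (\<theta> * y)) * (LINT w|P. V w * of_real (exp (\<theta>\<^sup>2 * v / 2) * cos (\<theta> * w v)))"
    if v: "v \<in> {s..t}" for v
  proof -
    have v0: "0 \<le> v" using v st by auto
    have i1: "integrable P (\<lambda>w. V w * of_real (h (L v w)) * (of_real (sgn (w v)) * \<phi> v (w v)))"
      by (rule I.L_weight(1)[OF v h I.sgn_\<phi>_integrable[OF v]])
    have i2: "integrable P (\<lambda>w. V w * of_real (Hint h (L v w)) * \<psi> v (w v))"
      by (rule I.Hint_weight(2)[OF v h v])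
    have i3: "integrable P (\<lambda>w. V w * of_real (exp (\<theta>\<^sup>2 * v / 2) * cos (\<theta> * w v)))"
    proof (rule integrable_const_bound[of _ "exp (\<theta>\<^sup>2 * v / 2)"])
      show "(\<lambda>w. V w * of_real (exp (\<theta>\<^sup>2 * v / 2) * cos (\<theta> * w v))) \<in> borel_measurable P"
        using measurable_Filt_P[OF Vm] coord_borel[OF v0] by measurable
    qed (auto simp: V_def indicator_def norm_mult)
    have "(LINT w|P. V w * of_real (exp (\<theta>\<^sup>2 * v / 2) * cos (\<theta> * reflected y v w))) =
      (LINT w|P. V w * of_real (h (L v w)) * (of_real (sgn (w v)) * \<phi> v (w v)) - V w * of_real (Hint h (L v w)) * \<psi> v (w v)
        + of_real (cos (\<theta> * y)) * (V w * of_real (exp (\<theta>\<^sup>2 * v / 2) * cos (\<theta> * w v))))"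
    proof (rule Bochner_Integration.integral_cong[OF refl])
      fix w assume w: "w \<in> space P"
      define m where "m = max (y - L v w) 0"
      have H: "\<theta> * Hint h (L v w) = cos (\<theta> * y) - cos (\<theta> * m)"
        using Hint_sin_put[OF y L_nonneg[OF v0], of w \<theta>] w by (simp add: h_def[abs_def] m_def)
      have sg: "sgn (w v) * sin (\<theta> * w v) = sin (\<theta> * \<bar>w v\<bar>)" "cos (\<theta> * w v) = cos (\<theta> * \<bar>w v\<bar>)"
        by (auto simp: sgn_if abs_if)
      have "cos (\<theta> * reflected y v w) = cos (\<theta> * \<bar>w v\<bar>) * cos (\<theta> * m) - sin (\<theta> * \<bar>w v\<bar>) * sin (\<theta> * m)"
        by (simp add: reflected_def m_def distrib_left cos_add)
      also have "\<dots> = h (L v w) * (sgn (w v) * sin (\<theta> * w v)) - (\<theta> * Hint h (L v w)) * cos (\<theta> * w v) + cos (\<theta> * y) * cos (\<theta> * w v)"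
        unfolding H sg by (simp add: h_def m_def algebra_simps)
      finally have r0: "cos (\<theta> * reflected y v w) = h (L v w) * (sgn (w v) * sin (\<theta> * w v)) - (\<theta> * Hint h (L v w)) * cos (\<theta> * w v) + cos (\<theta> * y) * cos (\<theta> * w v)" .
      have r: "exp (\<theta>\<^sup>2 * v / 2) * cos (\<theta> * reflected y v w) = h (L v w) * (sgn (w v) * (exp (\<theta>\<^sup>2 * v / 2) * sin (\<theta> * w v)))
         - Hint h (L v w) * (\<theta> * (exp (\<theta>\<^sup>2 * v / 2) * cos (\<theta> * w v))) + cos (\<theta> * y) * (exp (\<theta>\<^sup>2 * v / 2) * cos (\<theta> * w v))"
        unfolding r0 by (simp add: algebra_simps)
      show "V w * of_real (exp (\<theta>\<^sup>2 * v / 2) * cos (\<theta> * reflected y v w)) =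
        V w * of_real (h (L v w)) * (of_real (sgn (w v)) * \<phi> v (w v)) - V w * of_real (Hint h (L v w)) * \<psi> v (w v)
        + of_real (cos (\<theta> * y)) * (V w * of_real (exp (\<theta>\<^sup>2 * v / 2) * cos (\<theta> * w v)))"
        unfolding r \<phi>_def \<psi>_def of_real_add of_real_diff of_real_mult by (simp only: algebra_simps)
    qed
    also have "\<dots> = I.even_mean h v + of_real (cos (\<theta> * y)) * (LINT w|P. V w * of_real (exp (\<theta>\<^sup>2 * v / 2) * cos (\<theta> * w v)))"
      unfolding I.even_mean_def using i1 i2 i3
      by (simp only: Bochner_Integration.integral_add Bochner_Integration.integral_diff Bochner_Integration.integrable_diff integrable_mult_right integral_mult_right_zero)
    finally show ?thesis .
  qed
  have re: "(LINT w|P. V w * of_real (exp (\<theta>\<^sup>2 * v / 2) * cos (\<theta> * reflected y v w))) = of_real (exp (\<theta>\<^sup>2 * v / 2) * (LINT w|P. indicator \<Gamma> w * cos (\<theta> * reflected y v w)))"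
    if "0 \<le> v" for v
  proof -
    have i: "integrable P (\<lambda>w. indicator \<Gamma> w * cos (\<theta> * reflected y v w))"
    proof (rule integrable_const_bound[of _ 1])
      have "\<Gamma> \<in> events" using \<Gamma> sets_Filt_le sets_P by blast
      then show "(\<lambda>w. indicator \<Gamma> w * cos (\<theta> * reflected y v w)) \<in> borel_measurable P" using reflected_borel[OF that, of y] by measurable
    qed (auto simp: indicator_def)
    have "V w * of_real (exp (\<theta>\<^sup>2 * v / 2) * cos (\<theta> * reflected y v w)) = of_real (exp (\<theta>\<^sup>2 * v / 2) * (indicator \<Gamma> w * cos (\<theta> * reflected y v w)))" for w
      by (auto simp: V_def indicator_def)
    then have "(LINT w|P. V w * of_real (exp (\<theta>\<^sup>2 * v / 2) * cos (\<theta> * reflected y v w))) = of_real (LINT w|P. exp (\<theta>\<^sup>2 * v / 2) * (indicator \<Gamma> w * cos (\<theta> * reflected y v w)))"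
      by (simp only: integral_of_real[OF integrable_mult_right[OF i]])
    then show ?thesis by (simp only: integral_mult_right_zero)
  qed
  have "(LINT w|P. V w * of_real (exp (\<theta>\<^sup>2 * t / 2) * cos (\<theta> * reflected y t w))) = (LINT w|P. V w * of_real (exp (\<theta>\<^sup>2 * s / 2) * cos (\<theta> * reflected y s w)))"
    using rep[of t] rep[of s] even sin_cos_martingale(1)[OF st Vm iV, of \<theta>] st by simp
  then show ?thesis unfolding re[OF st(1)] re[OF order_trans[OF st]] by (simp only: of_real_eq_iff)
qed

end

section \<open>Asymptotics of the joint law of local time and sign\<close>

context wiener_path
begin

text \<open>The increment after s is replaced by that of an independent copy, the past being
  frozen.\<close>

lemma future_fubini:
  fixes F :: "path => real => 'b :: {banach, second_countable_topology}"
  assumes st: "0 \<le> s" "s \<le> t"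
    and F: "(\<lambda>(w, v). F w v) \<in> borel_measurable (Filt s \<Otimes>\<^sub>M borel)" "\<And>w v. norm (F w v) \<le> K"
  shows "(LINT w|P. F w (w t - w s)) = (LINT w|P. (\<integral>w'. F w (w' t - w' s) \<partial>P))"
proof -
  let ?R = "restr_to_subalg P (Filt s)" and ?D = "distr P borel (\<lambda>w. w t - w s)"
  have g: "(\<lambda>w. w t - w s) \<in> borel_measurable (future_sigma s)" by (rule increment_future[OF st(2)])
  have gP: "(\<lambda>w. w t - w s) \<in> borel_measurable P" using st by auto
  have id: "(\<lambda>w. w) \<in> measurable P (Filt s)" using measurable_Filt_P[OF measurable_ident_sets[OF refl]] .
  have pm: "(\<lambda>w. (w, w t - w s)) \<in> measurable P (Filt s \<Otimes>\<^sub>M borel)" using id gP by measurable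
  interpret R: prob_space ?R by (rule prob_space_restr_to_subalg[OF subalgebra_Filt prob_space_axioms])
  interpret D: prob_space ?D by (rule prob_space_distr[OF gP])
  interpret pair_prob_space ?R ?D ..
  note eq = distr_Filt_future[OF st(1) g]
  have Fm: "(\<lambda>(w, v). F w v) \<in> borel_measurable (?R \<Otimes>\<^sub>M ?D)"
    using F(1) by (simp add: measurable_cong_sets[OF sets_pair_measure_cong[OF sets_restr_to_subalg[OF subalgebra_Filt] sets_distr]])
  have int: "integrable (?R \<Otimes>\<^sub>M ?D) (\<lambda>(w, v). F w v)"
    by (rule P.integrable_const_bound[of _ K]) (use Fm F(2) in auto)
  have "(LINT w|P. F w (w t - w s)) = (\<integral>x. (case x of (w, v) => F w v) \<partial>distr P (Filt s \<Otimes>\<^sub>M borel) (\<lambda>w. (w, w t - w s)))"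
    by (subst integral_distr[OF pm F(1)]) simp
  also have "\<dots> = (\<integral>w. (\<integral>v. F w v \<partial>?D) \<partial>?R)"
    unfolding eq[symmetric] by (rule integral_fst'[symmetric, OF int, simplified])
  also have "\<dots> = (LINT w|P. (\<integral>v. F w v \<partial>?D))"
  proof (rule integral_subalgebra2[OF subalgebra_Filt])
    have "(\<lambda>w. \<integral>v. F w v \<partial>?D) \<in> borel_measurable ?R"
      using D.borel_measurable_lebesgue_integral[OF Fm] by simp
    then show "(\<lambda>w. \<integral>v. F w v \<partial>?D) \<in> borel_measurable (Filt s)"
      by (rule measurable_in_subalg'[OF subalgebra_Filt])
  qed
  also have "\<dots> = (LINT w|P. (\<integral>w'. F w (w' t - w' s) \<partial>P))"
  proof (rule Bochner_Integration.integral_cong[OF refl])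
    fix w assume w: "w \<in> space P"
    have "(\<lambda>v. F w v) \<in> borel_measurable borel"
      using measurable_compose[OF measurable_Pair1'[of w "Filt s" borel] F(1)] w by simp
    then show "(\<integral>v. F w v \<partial>?D) = (\<integral>w'. F w (w' t - w' s) \<partial>P)" using gP by (simp add: integral_distr)
  qed
  finally show ?thesis .
qed

text \<open>The sign of x + v averaged over v and -v. Under a symmetric law of v the mean is
  unchanged, but the average is sgn x for |v| < |x| and 0 for |v| > |x|. Having bounded support in
  v, it is integrable against Lebesgue measure, unlike the sign itself.\<close>

definition sgn_avg :: "real => real => real" where
  "sgn_avg x v = (sgn (x + v) + sgn (x - v)) / 2"

lemma sgn_avg_le: "\<bar>sgn_avg x v\<bar> \<le> indicator {-\<bar>x\<bar>..\<bar>x\<bar>} v"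
  by (auto simp: sgn_avg_def sgn_if indicator_def)

lemma sgn_avg_eq: "\<bar>v\<bar> \<noteq> \<bar>x\<bar> ==> sgn_avg x v = sgn x * indicator {-\<bar>x\<bar>..\<bar>x\<bar>} v"
  by (auto simp: sgn_avg_def sgn_if indicator_def abs_if split: if_splits)

lemma sgn_avg_integral:
  assumes "0 \<le> s" "s \<le> t"
  shows "(LINT w|P. sgn (x + (w t - w s))) = (LINT w|P. sgn_avg x (w t - w s))"
proof -
  have [measurable]: "(\<lambda>w. w t) \<in> borel_measurable P" "(\<lambda>w. w s) \<in> borel_measurable P" using assms by auto
  have i: "integrable P (\<lambda>w. sgn (x + (w t - w s)))" "integrable P (\<lambda>w. sgn (x - (w t - w s)))"
  proof -
    show "integrable P (\<lambda>w. sgn (x + (w t - w s)))"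
      by (rule integrable_const_bound[of _ 1]) (use assms in \<open>auto simp: abs_sgn_eq\<close>)
    show "integrable P (\<lambda>w. sgn (x - (w t - w s)))"
      by (rule integrable_const_bound[of _ 1]) (use assms in \<open>auto simp: abs_sgn_eq\<close>)
  qed
  have "(LINT w|P. sgn (x - (w t - w s))) = (LINT w|P. sgn (x + (w t - w s)))"
    using increment_symmetric[OF assms, of "\<lambda>v. sgn (x + v)"] by (simp only: add_uminus_conv_diff) simp
  then show ?thesis unfolding sgn_avg_def using i by simp
qed

text \<open>After symmetrisation only increments with |v| \<le> |x| contribute, and these have small
  probability. The bound is linear in |x|, as \<open>ito_odd\<close> asks of \<phi>.\<close>

lemma sgn_avg_mean_le:
  assumes "0 \<le> s" "s < t"
  shows "\<bar>\<integral>w. sgn (x + (w t - w s)) \<partial>P\<bar> \<le> \<bar>x\<bar> / sqrt (t - s)"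
proof -
  have [measurable]: "(\<lambda>w. w t) \<in> borel_measurable P" "(\<lambda>w. w s) \<in> borel_measurable P" using assms by auto
  have ev: "{w \<in> space P. \<bar>w t - w s\<bar> \<le> \<bar>x\<bar>} \<in> events" by measurable
  have "\<bar>\<integral>w. sgn_avg x (w t - w s) \<partial>P\<bar> \<le> (LINT w|P. \<bar>sgn_avg x (w t - w s)\<bar>)"
    using integral_norm_bound[of P "\<lambda>w. sgn_avg x (w t - w s)"] by simp
  also have "\<dots> \<le> (LINT w|P. indicator {w \<in> space P. \<bar>w t - w s\<bar> \<le> \<bar>x\<bar>} w)"
  proof (rule integral_mono_AE)
    have "(\<lambda>w. sgn_avg x (w t - w s)) \<in> borel_measurable P" unfolding sgn_avg_def by measurable
    then show "integrable P (\<lambda>w. \<bar>sgn_avg x (w t - w s)\<bar>)"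
      using order_trans[OF sgn_avg_le, of _ _ 1] by (intro integrable_abs integrable_const_bound[of _ 1]) (auto simp: indicator_def)
    show "integrable P (indicat_real {w \<in> space P. \<bar>w t - w s\<bar> \<le> \<bar>x\<bar>})" using ev by (simp add: less_top[symmetric])
    show "AE w in P. \<bar>sgn_avg x (w t - w s)\<bar> \<le> indicator {w \<in> space P. \<bar>w t - w s\<bar> \<le> \<bar>x\<bar>} w"
      using AE_space
    proof eventually_elim
      case (elim w)
      then show ?case using sgn_avg_le[of x "w t - w s"] by (auto simp: indicator_def abs_le_iff split: if_splits)
    qed
  qed
  also have "\<dots> = prob {w \<in> space P. \<bar>w t - w s\<bar> \<le> \<bar>x\<bar>}" using ev by (simp add: Int_absorb2)
  also have "\<dots> \<le> \<bar>x\<bar> / sqrt (t - s)" using small_ball_increment[OF assms, of "\<bar>x\<bar>"] by simp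
  finally show ?thesis using sgn_avg_integral[of s t x] assms by simp
qed

text \<open>Multiplied by sqrt(2 \<pi> (t - s)), the Gaussian density becomes exp(-v^2 / (2 (t -
  s))), which is at most 1 and tends to 1. So the rescaled law of the increment tends to Lebesgue
  measure when tested against integrable functions.\<close>

lemma increment_asymptotic:
  fixes f :: "path => real => real"
  assumes s: "0 \<le> s"
    and f: "(\<lambda>(w, v). f w v) \<in> borel_measurable (Filt s \<Otimes>\<^sub>M borel)" "\<And>w v. \<bar>f w v\<bar> \<le> K"
    and int: "integrable (P \<Otimes>\<^sub>M lborel) (\<lambda>(w, v). f w v)"
  shows "((\<lambda>t. sqrt (2 * pi * (t - s)) * (LINT w|P. f w (w t - w s))) \<longlongrightarrow> (\<integral>x. (case x of (w, v) => f w v) \<partial>(P \<Otimes>\<^sub>M lborel))) at_top"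
proof -
  interpret pair_sigma_finite P "lborel :: real measure" ..
  have fm[measurable]: "(\<lambda>(w, v). f w v) \<in> borel_measurable (P \<Otimes>\<^sub>M lborel)" using int by auto
  have fw: "f w \<in> borel_measurable borel" if "w \<in> path_space" for w
    using measurable_compose[OF measurable_Pair1'[of w "Filt s" borel] f(1)] that by simp
  have eq: "sqrt (2 * pi * (t - s)) * (LINT w|P. f w (w t - w s)) = (\<integral>x. exp (- (snd x)\<^sup>2 / (2 * (t - s))) * (case x of (w, v) => f w v) \<partial>(P \<Otimes>\<^sub>M lborel))"
    if t: "s < t" for t
  proof -
    have ie: "integrable (P \<Otimes>\<^sub>M lborel) (\<lambda>x. exp (- (snd x)\<^sup>2 / (2 * (t - s))) * (case x of (w, v) => f w v))"
    proof (rule Bochner_Integration.integrable_bound[OF int])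
      show "AE x in P \<Otimes>\<^sub>M lborel. norm (exp (- (snd x)\<^sup>2 / (2 * (t - s))) * (case x of (w, v) => f w v)) \<le> norm (case x of (w, v) => f w v)"
        using t by (auto simp: abs_mult intro!: AE_I2 mult_left_le_one_le)
    qed measurable
    have "(LINT w|P. f w (w t - w s)) = (LINT w|P. (\<integral>w'. f w (w' t - w' s) \<partial>P))"
      by (rule future_fubini[OF s _ f(1)]) (use t f(2) in auto)
    also have "\<dots> = (LINT w|P. (LINT v|lborel. normal_density 0 (sqrt (t - s)) v * f w v))"
      by (rule Bochner_Integration.integral_cong[OF refl]) (use fw in \<open>simp add: integral_increment[OF s t]\<close>)
    finally have "sqrt (2 * pi * (t - s)) * (LINT w|P. f w (w t - w s)) = (LINT w|P. (LINT v|lborel. sqrt (2 * pi * (t - s)) * (normal_density 0 (sqrt (t - s)) v * f w v)))"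
      by (simp only: integral_mult_right_zero)
    also have "\<dots> = (LINT w|P. (LINT v|lborel. exp (- v\<^sup>2 / (2 * (t - s))) * f w v))"
      using t by (intro Bochner_Integration.integral_cong refl) (simp add: normal_density_def real_sqrt_mult)
    also have "\<dots> = (\<integral>x. exp (- (snd x)\<^sup>2 / (2 * (t - s))) * (case x of (w, v) => f w v) \<partial>(P \<Otimes>\<^sub>M lborel))"
      using integral_fst'[OF ie] by simp
    finally show ?thesis .
  qed
  have lim: "((\<lambda>t. \<integral>x. exp (- (snd x)\<^sup>2 / (2 * (t - s))) * (case x of (w, v) => f w v) \<partial>(P \<Otimes>\<^sub>M lborel)) \<longlongrightarrow> (\<integral>x. (case x of (w, v) => f w v) \<partial>(P \<Otimes>\<^sub>M lborel))) at_top"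
  proof (rule integral_dominated_convergence_at_top[where w="\<lambda>x. norm (case x of (w, v) => f w v)"])
    show "integrable (P \<Otimes>\<^sub>M lborel) (\<lambda>x. norm (case x of (w, v) => f w v))" using int by (rule integrable_norm)
    show "\<forall>\<^sub>F t in at_top. AE x in P \<Otimes>\<^sub>M lborel. norm (exp (- (snd x)\<^sup>2 / (2 * (t - s))) * (case x of (w, v) => f w v)) \<le> norm (case x of (w, v) => f w v)"
      using eventually_gt_at_top[of s]
      by eventually_elim (auto simp: abs_mult intro!: AE_I2 mult_left_le_one_le)
    show "AE x in P \<Otimes>\<^sub>M lborel. ((\<lambda>t. exp (- (snd x)\<^sup>2 / (2 * (t - s))) * (case x of (w, v) => f w v)) \<longlongrightarrow> (case x of (w, v) => f w v)) at_top"
    proof (rule AE_I2)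
      fix x :: "path \<times> real"
      have "((\<lambda>t. exp (- (snd x)\<^sup>2 / (2 * (t - s)))) \<longlongrightarrow> 1) at_top" by real_asymp
      from tendsto_mult[OF this tendsto_const]
      show "((\<lambda>t. exp (- (snd x)\<^sup>2 / (2 * (t - s))) * (case x of (w, v) => f w v)) \<longlongrightarrow> (case x of (w, v) => f w v)) at_top" by simp
    qed
  qed measurable
  show ?thesis
    by (rule Lim_transform_eventually[OF lim]) (use eventually_gt_at_top[of s] in \<open>eventually_elim, simp add: eq\<close>)
qed

end

section \<open>The conditional law of the local time\<close>

context wiener_local_time
begin

text \<open>Both sides have the same cosine transform on \<Gamma>: on the left by the cosine
  martingale, on the right because the increment is independent of the past with a Gaussian
  characteristic function. Cosine transforms determine absolute moments. Both signs \<sigma> are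
  provided since their average is what is used later.\<close>

lemma reflected_abs_moment:
  assumes st: "0 \<le> s" "s \<le> t" and \<Gamma>: "\<Gamma> \<in> sets (Filt s)" and y: "0 \<le> y" and \<sigma>: "\<sigma> = 1 \<or> \<sigma> = -1"
  shows "(LINT w|P. indicator \<Gamma> w * reflected y t w) = (LINT w|P. indicator \<Gamma> w * \<bar>reflected y s w + \<sigma> * (w t - w s)\<bar>)"
proof -
  have t: "0 \<le> t" using st by simp
  have \<Gamma>P: "\<Gamma> \<in> events" using \<Gamma> sets_Filt_le sets_P by blast
  note [measurable] = \<Gamma>P reflected_borel[OF t, of y] reflected_borel[OF st(1), of y]
  have [measurable]: "(\<lambda>w. w t - w s) \<in> borel_measurable P" using st t by auto
  have cos: "(LINT w|P. indicator \<Gamma> w * cos (\<theta> * reflected y t w)) = (LINT w|P. indicator \<Gamma> w * cos (\<theta> * (reflected y s w + \<sigma> * (w t - w s))))" for \<theta>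
  proof -
    define V where "V w = indicator \<Gamma> w * iexp (\<theta> * reflected y s w)" for w
    have Vm: "V \<in> borel_measurable (Filt s)" unfolding V_def using \<Gamma> reflected_Filt[OF st(1), of y] by measurable
    have iV: "integrable P V"
      by (rule integrable_const_bound[of _ 1]) (use measurable_Filt_P[OF Vm] in \<open>auto simp: V_def indicator_def\<close>)
    have pr: "integrable P (\<lambda>w. V w * iexp (\<theta> * \<sigma> * (w t - w s)))"
      "(LINT w|P. V w * iexp (\<theta> * \<sigma> * (w t - w s))) = (LINT w|P. V w) * exp (- (of_real ((\<theta> * \<sigma>)\<^sup>2 * (t - s) / 2)))"
      using indep_product_complex[OF st Vm iV, of "\<lambda>x. iexp (\<theta> * \<sigma> * x)"] iexp_increment_integrable[OF st, of "\<theta> * \<sigma>"] increment_char[OF st, of "\<theta> * \<sigma>"]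
      by simp_all
    have ReV: "Re (V w * iexp (\<theta> * \<sigma> * (w t - w s))) = indicator \<Gamma> w * cos (\<theta> * (reflected y s w + \<sigma> * (w t - w s)))" for w
    proof -
      have "V w * iexp (\<theta> * \<sigma> * (w t - w s)) = indicator \<Gamma> w * iexp (\<theta> * (reflected y s w + \<sigma> * (w t - w s)))"
        unfolding V_def mult.assoc exp_add[symmetric] by (simp add: algebra_simps)
      also have "Re \<dots> = indicator \<Gamma> w * cos (\<theta> * (reflected y s w + \<sigma> * (w t - w s)))"
        by (auto simp: indicator_def cis_conv_exp[symmetric] simp del: of_real_add of_real_mult)
      finally show ?thesis .
    qed
    have ReV': "Re (V w) = indicator \<Gamma> w * cos (\<theta> * reflected y s w)" for w
      by (auto simp: V_def indicator_def cis_conv_exp[symmetric] simp del: of_real_mult)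
    have sq: "(\<theta> * \<sigma>)\<^sup>2 = \<theta>\<^sup>2" using \<sigma> by auto
    have "(LINT w|P. indicator \<Gamma> w * cos (\<theta> * (reflected y s w + \<sigma> * (w t - w s)))) = Re (LINT w|P. V w * iexp (\<theta> * \<sigma> * (w t - w s)))"
      unfolding ReV[symmetric] by (rule integral_Re[OF pr(1)])
    also have "\<dots> = Re (LINT w|P. V w) * exp (- (\<theta>\<^sup>2 * (t - s) / 2))"
      unfolding pr(2) sq by (simp only: of_real_minus[symmetric] exp_of_real times_complex.sel Re_complex_of_real Im_complex_of_real mult_zero_right diff_zero)
    also have "Re (LINT w|P. V w) = (LINT w|P. indicator \<Gamma> w * cos (\<theta> * reflected y s w))"
      unfolding ReV'[symmetric] by (rule integral_Re[OF iV, symmetric])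
    also have "\<dots> * exp (- (\<theta>\<^sup>2 * (t - s) / 2)) = exp (- (\<theta>\<^sup>2 * t / 2)) * (exp (\<theta>\<^sup>2 * s / 2) * (LINT w|P. indicator \<Gamma> w * cos (\<theta> * reflected y s w)))"
    proof -
      have "exp (- (\<theta>\<^sup>2 * (t - s) / 2)) = exp (- (\<theta>\<^sup>2 * t / 2)) * exp (\<theta>\<^sup>2 * s / 2)"
        unfolding exp_add[symmetric] by (simp add: field_simps)
      then show ?thesis by simp
    qed
    also have "\<dots> = exp (- (\<theta>\<^sup>2 * t / 2)) * (exp (\<theta>\<^sup>2 * t / 2) * (LINT w|P. indicator \<Gamma> w * cos (\<theta> * reflected y t w)))"
      using reflected_cos_martingale[OF st \<Gamma> y, of \<theta>] by simp
    also have "\<dots> = (LINT w|P. indicator \<Gamma> w * cos (\<theta> * reflected y t w))" by (simp add: mult.assoc[symmetric] exp_add[symmetric])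
    finally show ?thesis by simp
  qed
  have "(\<integral>\<^sup>+w. indicator \<Gamma> w * ennreal \<bar>reflected y t w\<bar> \<partial>P) = (\<integral>\<^sup>+w. indicator \<Gamma> w * ennreal \<bar>reflected y s w + \<sigma> * (w t - w s)\<bar> \<partial>P)"
    by (rule abs_moment_from_cos[OF \<Gamma>P _ _ cos]) measurable
  moreover have i: "(LINT w|P. indicator \<Gamma> w * \<bar>U w\<bar>) = enn2real (\<integral>\<^sup>+w. indicator \<Gamma> w * ennreal \<bar>U w\<bar> \<partial>P)"
    if [measurable]: "U \<in> borel_measurable P" for U :: "path => real"
    by (subst integral_eq_nn_integral) (auto intro!: arg_cong[where f=enn2real] nn_integral_cong simp: indicator_def)
  moreover have "(\<lambda>w. reflected y s w + \<sigma> * (w t - w s)) \<in> borel_measurable P" by measurable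
  ultimately have "(LINT w|P. indicator \<Gamma> w * \<bar>reflected y t w\<bar>) = (LINT w|P. indicator \<Gamma> w * \<bar>reflected y s w + \<sigma> * (w t - w s)\<bar>)"
    using reflected_borel[OF t, of y] by (simp only: i)
  moreover have "\<bar>reflected y t w\<bar> = reflected y t w" for w by (simp add: reflected_def)
  ultimately show ?thesis by simp
qed

text \<open>For v the increment of X from s to t this has the conditional law of L_t. Heuristically,
  by Levy's theorem, L grows after s by the excess of a running maximum of Brownian motion over
  |X_s|, and such a maximum is distributed like the modulus of an increment.\<close>

definition L_law :: "real => path => real => real" where
  "L_law s w v = L s w + max (\<bar>v\<bar> - \<bar>w s\<bar>) 0"

text \<open>(y - L)^+ is the difference of the reflected processes started from y and from 0.
  Averaging \<open>reflected_abs_moment\<close> over both signs uses (|x + v| + |x - v|) / 2 = max x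
  |v| for x \<ge> 0, and the difference of two such maxima is again of put form.\<close>

lemma L_put:
  assumes st: "0 \<le> s" "s \<le> t" and \<Gamma>: "\<Gamma> \<in> sets (Filt s)"
  shows "(LINT w|P. indicator \<Gamma> w * max (y - L t w) 0) = (LINT w|P. indicator \<Gamma> w * max (y - L_law s w (w t - w s)) 0)"
proof (cases "0 \<le> y")
  case False
  have t: "0 \<le> t" using st by simp
  have "(LINT w|P. indicator \<Gamma> w * max (y - L t w) 0) = (LINT w|P. 0)"
    using False L_nonneg[OF t] by (intro Bochner_Integration.integral_cong refl) (fastforce simp: max_def)
  also have "\<dots> = (LINT w|P. indicator \<Gamma> w * max (y - L_law s w (w t - w s)) 0)"
    using False L_nonneg[OF st(1)] by (intro Bochner_Integration.integral_cong refl) (fastforce simp: max_def L_law_def)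
  finally show ?thesis .
next
  case y: True
  have t: "0 \<le> t" using st by simp
  have \<Gamma>P: "\<Gamma> \<in> events" using \<Gamma> sets_Filt_le sets_P by blast
  have iX: "integrable P (\<lambda>w. w t - w s)" using increment_moments(1)[OF st, of 1] by simp
  have mult: "integrable P (\<lambda>w. indicator \<Gamma> w * Z w)" if "integrable P Z" for Z :: "path => real"
    by (rule integrable_real_mult_indicator[OF \<Gamma>P that, unfolded mult.commute[of _ "indicator \<Gamma> _"]])
  have ir: "integrable P (\<lambda>w. indicator \<Gamma> w * \<bar>reflected y s w + \<sigma> * (w t - w s)\<bar>)" for y \<sigma>
    using reflected_integrable[OF st(1), of y] iX by (intro mult) auto
  have mx: "(LINT w|P. indicator \<Gamma> w * reflected y t w) = (LINT w|P. indicator \<Gamma> w * max (reflected y s w) \<bar>w t - w s\<bar>)" if "0 \<le> y" for y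
  proof -
    have "(LINT w|P. indicator \<Gamma> w * reflected y t w) = ((LINT w|P. indicator \<Gamma> w * \<bar>reflected y s w + 1 * (w t - w s)\<bar>)
        + (LINT w|P. indicator \<Gamma> w * \<bar>reflected y s w + (-1) * (w t - w s)\<bar>)) / 2"
      using reflected_abs_moment[OF st \<Gamma> that, of 1] reflected_abs_moment[OF st \<Gamma> that, of "-1"] by simp
    also have "\<dots> = (LINT w|P. (indicator \<Gamma> w * \<bar>reflected y s w + 1 * (w t - w s)\<bar> + indicator \<Gamma> w * \<bar>reflected y s w + (-1) * (w t - w s)\<bar>) / 2)"
      using ir[of y 1] ir[of y "-1"] by simp
    also have "\<dots> = (LINT w|P. indicator \<Gamma> w * max (reflected y s w) \<bar>w t - w s\<bar>)"
    proof (rule Bochner_Integration.integral_cong[OF refl])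
      fix w
      have "0 \<le> reflected y s w" by (simp add: reflected_def)
      then show "(indicator \<Gamma> w * \<bar>reflected y s w + 1 * (w t - w s)\<bar> + indicator \<Gamma> w * \<bar>reflected y s w + (-1) * (w t - w s)\<bar>) / 2 = indicator \<Gamma> w * max (reflected y s w) \<bar>w t - w s\<bar>"
        by (auto simp: indicator_def max_def abs_if)
    qed
    finally show ?thesis .
  qed
  have im: "integrable P (\<lambda>w. indicator \<Gamma> w * max (reflected y s w) \<bar>w t - w s\<bar>)" for y
    using reflected_integrable[OF st(1), of y] iX by (intro mult integrable_max) auto
  have r0: "reflected 0 v w = \<bar>w v\<bar>" if "0 \<le> v" "w \<in> space P" for v w
    using L_nonneg[OF that(1), of w] that(2) by (simp add: reflected_def)
  have "(LINT w|P. indicator \<Gamma> w * max (y - L t w) 0) = (LINT w|P. indicator \<Gamma> w * reflected y t w - indicator \<Gamma> w * reflected 0 t w)"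
    by (rule Bochner_Integration.integral_cong[OF refl]) (use r0[OF t] in \<open>simp add: reflected_def algebra_simps\<close>)
  also have "\<dots> = (LINT w|P. indicator \<Gamma> w * max (reflected y s w) \<bar>w t - w s\<bar>) - (LINT w|P. indicator \<Gamma> w * max (reflected 0 s w) \<bar>w t - w s\<bar>)"
    using mult[OF reflected_integrable[OF t, of y]] mult[OF reflected_integrable[OF t, of 0]] mx[OF y] mx[of 0] by simp
  also have "\<dots> = (LINT w|P. indicator \<Gamma> w * max (reflected y s w) \<bar>w t - w s\<bar> - indicator \<Gamma> w * max (reflected 0 s w) \<bar>w t - w s\<bar>)"
    using im[of y] im[of 0] by simp
  also have "\<dots> = (LINT w|P. indicator \<Gamma> w * max (y - L_law s w (w t - w s)) 0)"
  proof (rule Bochner_Integration.integral_cong[OF refl])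
    fix w assume w: "w \<in> space P"
    have "max (reflected y s w) \<bar>w t - w s\<bar> - max \<bar>w s\<bar> \<bar>w t - w s\<bar> = max (y - L_law s w (w t - w s)) 0"
      by (auto simp: reflected_def L_law_def max_def)
    then show "indicator \<Gamma> w * max (reflected y s w) \<bar>w t - w s\<bar> - indicator \<Gamma> w * max (reflected 0 s w) \<bar>w t - w s\<bar> = indicator \<Gamma> w * max (y - L_law s w (w t - w s)) 0"
      using r0[OF st(1) w] by (simp add: right_diff_distrib[symmetric])
  qed
  finally show ?thesis .
qed

lemma L_law_borel: "0 \<le> s ==> 0 \<le> t ==> (\<lambda>w. L_law s w (w t - w s)) \<in> borel_measurable P"
  unfolding L_law_def by measurable

text \<open>Put payoffs determine the law: difference quotients in the strike converge boundedly to
  the indicator of a half-line, from which the monotone class argument reaches all bounded Borel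
  functions.\<close>

lemma L_law_identity:
  fixes h :: "real => real"
  assumes st: "0 \<le> s" "s \<le> t" and \<Gamma>: "\<Gamma> \<in> sets (Filt s)"
    and h: "h \<in> borel_measurable borel" "\<And>x. \<bar>h x\<bar> \<le> B"
  shows "(LINT w|P. indicator \<Gamma> w * h (L t w)) = (LINT w|P. indicator \<Gamma> w * h (L_law s w (w t - w s)))"
proof -
  have t: "0 \<le> t" using st by simp
  have \<Gamma>P[measurable]: "\<Gamma> \<in> events" using \<Gamma> sets_Filt_le sets_P by blast
  define Y where "Y w = L_law s w (w t - w s)" for w
  have Y[measurable]: "Y \<in> borel_measurable P" unfolding Y_def[abs_def] by (rule L_law_borel[OF st(1) t])
  have Lt[measurable]: "L t \<in> borel_measurable P" using t by simp
  have int: "integrable P (\<lambda>w. indicator \<Gamma> w * f (Z w))" if "f \<in> borel_measurable borel" "\<And>x. \<bar>f x\<bar> \<le> K" "Z \<in> borel_measurable P" for f :: "real => real" and K Z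
  proof (rule integrable_const_bound[of _ K])
    show "(\<lambda>w. indicator \<Gamma> w * f (Z w)) \<in> borel_measurable P" using that by measurable
    show "AE w in P. norm (indicator \<Gamma> w * f (Z w)) \<le> K"
      using that(2) order_trans[OF abs_ge_zero that(2)] by (auto simp: indicator_def)
  qed
  have lims: "(\<lambda>n. \<integral>w. indicator \<Gamma> w * F n (Z w) \<partial>P) \<longlonglongrightarrow> (LINT w|P. indicator \<Gamma> w * f (Z w))"
    if "\<And>n. F n \<in> borel_measurable borel" "f \<in> borel_measurable borel" "\<And>n x. \<bar>F n x\<bar> \<le> K" "\<And>x. (\<lambda>n. F n x) \<longlonglongrightarrow> f x" "Z \<in> borel_measurable P"
    for F :: "nat => real => real" and f K Z
  proof (rule integral_dominated_convergence[where w="\<lambda>_. K"])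
    show "(\<lambda>w. indicator \<Gamma> w * f (Z w)) \<in> borel_measurable P" using that by measurable
    show "(\<lambda>w. indicator \<Gamma> w * F n (Z w)) \<in> borel_measurable P" for n using that(1)[of n] that(5) by measurable
    show "AE w in P. (\<lambda>n. indicator \<Gamma> w * F n (Z w)) \<longlonglongrightarrow> indicator \<Gamma> w * f (Z w)"
      using that(4) by (auto intro!: tendsto_intros)
    show "AE w in P. norm (indicator \<Gamma> w * F n (Z w)) \<le> K" for n
      using that(3)[of n] order_trans[OF abs_ge_zero that(3)] by (auto simp: indicator_def)
  qed simp
  have "(LINT w|P. indicator \<Gamma> w * h (L t w)) = (LINT w|P. indicator \<Gamma> w * h (Y w))"
    using h
  proof (induction rule: bounded_borel_induct_atMost)
    case (atMost a)
    define F where "F n x = real (Suc n) * (max (a + 1 / real (Suc n) - x) 0 - max (a - x) 0)" for n x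
    have Fm: "F n \<in> borel_measurable borel" for n unfolding F_def[abs_def] by measurable
    have Fb: "\<bar>F n x\<bar> \<le> 1" for n x
    proof -
      have "\<bar>max (a + e - x) 0 - max (a - x) 0\<bar> \<le> e" if "0 \<le> e" for e :: real using that by (auto simp: max_def)
      from this[of "1 / real (Suc n)"]
      have "\<bar>max (a + 1 / real (Suc n) - x) 0 - max (a - x) 0\<bar> \<le> 1 / real (Suc n)" by simp
      then have "real (Suc n) * \<bar>max (a + 1 / real (Suc n) - x) 0 - max (a - x) 0\<bar> \<le> real (Suc n) * (1 / real (Suc n))"
        by (rule mult_left_mono) simp
      then show ?thesis by (simp add: F_def abs_mult)
    qed
    have Fl: "(\<lambda>n. F n x) \<longlonglongrightarrow> indicator {..a} x" for x
    proof (cases "x \<le> a")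
      case True
      have "F n x = 1" for n
      proof -
        have "0 \<le> 1 / real (Suc n)" by simp
        then have "max (a + 1 / real (Suc n) - x) 0 = a + 1 / real (Suc n) - x" "max (a - x) 0 = a - x" using True by linarith+
        then show ?thesis by (simp add: F_def del: of_nat_Suc)
      qed
      then show ?thesis using True by simp
    next
      case False
      have "(\<lambda>n. a + 1 / real (Suc n)) \<longlonglongrightarrow> a + 0" by (intro tendsto_intros LIMSEQ_Suc[OF lim_1_over_n])
      then have "\<forall>\<^sub>F n in sequentially. a + 1 / real (Suc n) < x" by (rule order_tendstoD) (use False in simp)
      then have "\<forall>\<^sub>F n in sequentially. F n x = indicator {..a} x"
        by eventually_elim (use False in \<open>simp add: F_def max_def\<close>)
      then show ?thesis by (rule tendsto_eventually)
    qed
    have eq: "(LINT w|P. indicator \<Gamma> w * F n (L t w)) = (LINT w|P. indicator \<Gamma> w * F n (Y w))" for n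
    proof -
      have ip: "integrable P (\<lambda>w. indicator \<Gamma> w * max (c - Z w) 0)" if "\<And>w. w \<in> space P ==> 0 \<le> Z w" "Z \<in> borel_measurable P" for c and Z :: "path => real"
      proof (rule integrable_const_bound[of _ "\<bar>c\<bar>"])
        show "AE w in P. norm (indicator \<Gamma> w * max (c - Z w) 0) \<le> \<bar>c\<bar>"
        proof (rule AE_I2)
          fix w assume "w \<in> space P"
          then show "norm (indicator \<Gamma> w * max (c - Z w) 0) \<le> \<bar>c\<bar>" using that(1)[of w] by (auto simp: indicator_def max_def)
        qed
      qed (use that(2) in measurable)
      have Ypos: "0 \<le> Y w" if "w \<in> space P" for w using L_nonneg[OF st(1), of w] that by (simp add: Y_def L_law_def)
      have Lpos: "0 \<le> L t w" if "w \<in> space P" for w using L_nonneg[OF t, of w] that by simp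
      have split: "(LINT w|P. indicator \<Gamma> w * F n (Z w)) = real (Suc n) * ((LINT w|P. indicator \<Gamma> w * max (a + 1 / real (Suc n) - Z w) 0) - (LINT w|P. indicator \<Gamma> w * max (a - Z w) 0))"
        if "\<And>w. w \<in> space P ==> 0 \<le> Z w" "Z \<in> borel_measurable P" for Z
      proof -
        have "(LINT w|P. indicator \<Gamma> w * F n (Z w)) = (LINT w|P. real (Suc n) * (indicator \<Gamma> w * max (a + 1 / real (Suc n) - Z w) 0 - indicator \<Gamma> w * max (a - Z w) 0))"
          by (rule Bochner_Integration.integral_cong[OF refl]) (simp add: F_def algebra_simps)
        then show ?thesis using ip[OF that, of "a + 1 / real (Suc n)"] ip[OF that, of a]
          by (simp only: integral_mult_right_zero Bochner_Integration.integral_diff)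
      qed
      have "(LINT w|P. indicator \<Gamma> w * max (c - L t w) 0) = (LINT w|P. indicator \<Gamma> w * max (c - Y w) 0)" for c
        using L_put[OF st \<Gamma>, of c] by (simp only: Y_def)
      then show ?thesis using split[OF Lpos Lt] split[OF Ypos Y] by (simp only:)
    qed
    show ?case
      using LIMSEQ_unique[OF lims[OF Fm _ Fb Fl Lt, unfolded eq] lims[OF Fm _ Fb Fl Y]] by simp
  next
    case (lin f g a b K)
    have "(LINT w|P. indicator \<Gamma> w * (a * f (Z w) + b * g (Z w))) = a * (LINT w|P. indicator \<Gamma> w * f (Z w)) + b * (LINT w|P. indicator \<Gamma> w * g (Z w))"
      if Z: "Z \<in> borel_measurable P" for Z
    proof -
      have "(LINT w|P. indicator \<Gamma> w * (a * f (Z w) + b * g (Z w))) = (LINT w|P. a * (indicator \<Gamma> w * f (Z w)) + b * (indicator \<Gamma> w * g (Z w)))"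
        by (rule Bochner_Integration.integral_cong[OF refl]) (simp add: algebra_simps)
      then show ?thesis using int[OF lin(1,3) Z] int[OF lin(2,4) Z] by simp
    qed
    then show ?case using lin(5,6) by simp
  next
    case (lim F f K)
    show ?case
      using LIMSEQ_unique[OF lims[OF lim(1,2,3,5) Lt, unfolded lim(6)] lims[OF lim(1,2,3,5) Y]] .
  qed simp
  then show ?thesis by (simp add: Y_def)
qed

text \<open>A change of \<open>k(L)\<close> requires a visit of \<open>X\<close> to the origin, after which both signs are equally likely.\<close>

lemma L_sgn_identity:
  assumes st: "0 \<le> s" "s < t" and \<Gamma>: "\<Gamma> \<in> sets (Filt s)"
    and k: "k \<in> borel_measurable borel" "\<And>x. \<bar>k x\<bar> \<le> K"
  shows "(LINT w|P. indicator \<Gamma> w * k (L t w) * sgn (w t)) = (LINT w|P. indicator \<Gamma> w * k (L s w) * sgn (w t))"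
proof -
  have t: "0 < t" using st by simp
  define V where "V w = (indicator \<Gamma> w :: complex)" for w
  have Vm: "V \<in> borel_measurable (Filt s)" unfolding V_def using \<Gamma> by measurable
  have \<Gamma>P[measurable]: "\<Gamma> \<in> events" using \<Gamma> sets_Filt_le sets_P by blast
  \<comment> \<open>The sign is observed a little later than t. Then its mean given X_u = x is at
    most |x| / sqrt(t' - t) for all u \<le> t, a bound that would be lost for t' = t.\<close>
  have shifted: "(LINT w|P. indicator \<Gamma> w * k (L t w) * sgn (w t')) = (LINT w|P. indicator \<Gamma> w * k (L s w) * sgn (w t'))"
    if t': "t < t'" for t'
  proof -
    define \<phi> where "\<phi> u x = complex_of_real (LINT w|P. sgn (x + (w t' - w u)))" for u x
    define C where "C = 1 / sqrt (t' - t)"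
    have C: "0 \<le> C" using t' by (simp add: C_def)
    have \<phi>m: "\<phi> u \<in> borel_measurable borel" if "u \<in> {s..t}" for u
    proof -
      have u: "0 \<le> u" "0 \<le> t'" using that st t' by auto
      have [measurable]: "(\<lambda>w. w t') \<in> borel_measurable P" "(\<lambda>w. w u) \<in> borel_measurable P" using u by auto
      have "(\<lambda>(x, w). sgn (x + (w t' - w u))) \<in> borel_measurable (borel \<Otimes>\<^sub>M P)"
      proof -
        have "(\<lambda>p. snd p t') \<in> borel_measurable (borel \<Otimes>\<^sub>M P)" "(\<lambda>p. snd p u) \<in> borel_measurable (borel \<Otimes>\<^sub>M P)"
          using u by (auto intro!: measurable_compose[OF measurable_snd] coord_borel)
        then show ?thesis by (simp add: split_beta')
      qed
      from borel_measurable_lebesgue_integral[OF this]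
      show ?thesis unfolding \<phi>_def[abs_def] by simp
    qed
    \<comment> \<open>Conditioning at time u. It follows that \<phi>(u, X_u) is a martingale, so
      that \<gamma> = 0 in the odd identity.\<close>
    have tower: "(LINT w|P. W w * of_real (sgn (w t'))) = (LINT w|P. W w * \<phi> u (w u))"
      if u: "u \<in> {s..t}" and W: "W \<in> borel_measurable (Filt u)" "\<And>w. cmod (W w) \<le> B" for u W B
    proof -
      have u0: "0 \<le> u" "u \<le> t'" using u st t' by auto
      have Fm: "(\<lambda>(w, v). W w * of_real (sgn (w u + v))) \<in> borel_measurable (Filt u \<Otimes>\<^sub>M borel)"
      proof -
        have "(\<lambda>p. fst p u) \<in> borel_measurable (Filt u \<Otimes>\<^sub>M borel)"
          using u0 by (intro measurable_compose[OF measurable_fst] coord_measurable_Filt) auto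
        from measurable_compose[OF borel_measurable_add[OF this measurable_snd] borel_measurable_sgn]
        have "(\<lambda>p. complex_of_real (sgn (fst p u + snd p))) \<in> borel_measurable (Filt u \<Otimes>\<^sub>M borel)"
          by (rule measurable_compose[OF _ borel_measurable_of_real])
        from borel_measurable_times[OF measurable_compose[OF measurable_fst W(1)] this]
        show ?thesis by (simp add: split_beta')
      qed
      have Fb: "cmod (W w * of_real (sgn (w u + v))) \<le> B" for w v
        using W(2)[of w] order_trans[OF norm_ge_zero W(2)] by (auto simp: norm_mult abs_sgn_eq)
      have "(LINT w|P. W w * of_real (sgn (w t'))) = (LINT w|P. W w * of_real (sgn (w u + (w t' - w u))))" by simp
      also have "\<dots> = (LINT w|P. (\<integral>w'. W w * of_real (sgn (w u + (w' t' - w' u))) \<partial>P))"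
        by (rule future_fubini[OF u0 Fm Fb])
      also have "\<dots> = (LINT w|P. W w * \<phi> u (w u))"
      proof (rule Bochner_Integration.integral_cong[OF refl])
        fix w
        have "integrable P (\<lambda>w'. sgn (w u + (w' t' - w' u)))"
          by (rule integrable_const_bound[of _ 1]) (use u0 st t' in \<open>auto simp: abs_sgn_eq\<close>)
        then show "(\<integral>w'. W w * of_real (sgn (w u + (w' t' - w' u))) \<partial>P) = W w * \<phi> u (w u)"
          unfolding \<phi>_def by (simp only: integral_mult_right_zero integral_of_real)
      qed
      finally show ?thesis .
    qed
    interpret I: ito_odd P L s t V 1 C \<phi> "\<lambda>_ _. 0"
    proof unfold_locales
      fix u x assume u: "u \<in> {s..t}"
      show "\<phi> u \<in> borel_measurable borel" by (rule \<phi>m[OF u])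
      have "cmod (\<phi> u x) \<le> \<bar>x\<bar> / sqrt (t' - u)"
        unfolding \<phi>_def norm_of_real by (rule sgn_avg_mean_le) (use u st t' in auto)
      also have "\<dots> \<le> \<bar>x\<bar> / sqrt (t' - t)" using u t' by (intro divide_left_mono) auto
      finally show "cmod (\<phi> u x) \<le> C * \<bar>x\<bar>" by (simp add: C_def)
    next
      fix v u K :: real and W :: "path => complex"
      assume vu: "s \<le> v" "v \<le> u" "u \<le> t" and W: "W \<in> borel_measurable (Filt v)" "\<And>w. cmod (W w) \<le> K"
      have Wu: "W \<in> borel_measurable (Filt u)" by (rule measurable_Filt_mono[OF W(1) vu(2)])
      show "(LINT w|P. W w * \<phi> u (w u)) = (LINT w|P. W w * \<phi> v (w v)) + complex_of_real (u - v) * (LINT w|P. W w * 0)"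
        using tower[of u, OF _ Wu W(2)] tower[of v, OF _ W] vu by simp
    qed (use st C Vm in \<open>auto simp: V_def indicator_def\<close>)
    have W: "(\<lambda>w. V w * of_real (k (L v w))) \<in> borel_measurable (Filt u)" "\<And>w. cmod (V w * of_real (k (L v w))) \<le> K"
      if "s \<le> v" "v \<le> u" for v u
    proof -
      have [measurable]: "L v \<in> borel_measurable (Filt u)" "V \<in> borel_measurable (Filt u)" "k \<in> borel_measurable borel"
        using that st measurable_Filt_mono[OF Vm, of u] k by (auto intro!: L_Filt)
      show "(\<lambda>w. V w * of_real (k (L v w))) \<in> borel_measurable (Filt u)" by measurable
      show "\<And>w. cmod (V w * of_real (k (L v w))) \<le> K"
        using k(2) order_trans[OF abs_ge_zero k(2)] by (auto simp: V_def indicator_def)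
    qed
    have "(LINT w|P. V w * of_real (k (L t w)) * of_real (sgn (w t'))) = (LINT w|P. V w * of_real (k (L s w)) * of_real (sgn (w t')))"
    proof -
      have "(LINT w|P. V w * of_real (k (L v w)) * of_real (sgn (w t'))) = (LINT w|P. V w * of_real (k (L v w)) * \<phi> v (w v))"
        if "v \<in> {s..t}" for v
        by (rule tower[OF that W]) (use that in auto)
      then show ?thesis using I.odd_identity[OF k] st by simp
    qed
    moreover have "(LINT w|P. V w * of_real (k (L v w)) * of_real (sgn (w t'))) = of_real (LINT w|P. indicator \<Gamma> w * k (L v w) * sgn (w t'))" if "0 \<le> v" for v
    proof -
      have [measurable]: "L v \<in> borel_measurable P" "k \<in> borel_measurable borel" "(\<lambda>w. sgn (w t')) \<in> borel_measurable P"
        using that k st t' by (auto intro!: measurable_compose[OF coord_borel borel_measurable_sgn])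
      have "integrable P (\<lambda>w. indicator \<Gamma> w * k (L v w) * sgn (w t'))"
      proof (rule integrable_const_bound[of _ K])
        show "AE w in P. norm (indicator \<Gamma> w * k (L v w) * sgn (w t')) \<le> K"
          using k(2) order_trans[OF abs_ge_zero k(2)] by (auto simp: abs_mult abs_sgn_eq indicator_def)
      qed measurable
      from integral_of_real[OF this]
      have "(LINT w|P. complex_of_real (indicator \<Gamma> w * k (L v w) * sgn (w t'))) = of_real (LINT w|P. indicator \<Gamma> w * k (L v w) * sgn (w t'))" .
      moreover have "V w * of_real (k (L v w)) * of_real (sgn (w t')) = complex_of_real (indicator \<Gamma> w * k (L v w) * sgn (w t'))" for w
        by (auto simp: V_def indicator_def)
      ultimately show ?thesis by (simp only:)
    qed
    ultimately show ?thesis using st by (simp only: of_real_eq_iff less_imp_le[OF t] st(1))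
  qed
  \<comment> \<open>Now t' decreases to t; since X_t is almost surely non-zero, its sign is the
    limit of the signs shortly afterwards.\<close>
  have lim: "(\<lambda>n. \<integral>w. indicator \<Gamma> w * k (L v w) * sgn (w (t + 1 / real (Suc n))) \<partial>P) \<longlonglongrightarrow> (LINT w|P. indicator \<Gamma> w * k (L v w) * sgn (w t))" if v: "0 \<le> v" for v
  proof (rule integral_dominated_convergence[where w="\<lambda>_. K"])
    have [measurable]: "L v \<in> borel_measurable P" "k \<in> borel_measurable borel" using v k by auto
    have m: "(\<lambda>w. indicator \<Gamma> w * k (L v w) * sgn (w u)) \<in> borel_measurable P" if "0 \<le> u" for u using that by measurable
    show "(\<lambda>w. indicator \<Gamma> w * k (L v w) * sgn (w t)) \<in> borel_measurable P" using m t by simp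
    show "(\<lambda>w. indicator \<Gamma> w * k (L v w) * sgn (w (t + 1 / real (Suc n)))) \<in> borel_measurable P" for n using m t by simp
    show "AE w in P. norm (indicator \<Gamma> w * k (L v w) * sgn (w (t + 1 / real (Suc n)))) \<le> K" for n
      using k(2) order_trans[OF abs_ge_zero k(2)] by (auto simp: abs_mult abs_sgn_eq indicator_def)
    show "AE w in P. (\<lambda>n. indicator \<Gamma> w * k (L v w) * sgn (w (t + 1 / real (Suc n)))) \<longlonglongrightarrow> indicator \<Gamma> w * k (L v w) * sgn (w t)"
      using coord_nonzero[OF t] AE_space
    proof eventually_elim
      case (elim w)
      have c: "continuous_on {0..} w" using elim(2) by (simp add: path_space_def)
      have "(\<lambda>n. t + 1 / real (Suc n)) \<longlonglongrightarrow> t + 0" by (intro tendsto_intros LIMSEQ_Suc[OF lim_1_over_n])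
      then have "(\<lambda>n. w (t + 1 / real (Suc n))) \<longlonglongrightarrow> w t"
        using continuous_on_tendsto_compose[OF c, of "\<lambda>n. t + 1 / real (Suc n)" t] t by simp
      then show ?case using elim(1) by (intro tendsto_intros tendsto_sgn)
    qed
  qed simp
  have "(LINT w|P. indicator \<Gamma> w * k (L t w) * sgn (w (t + 1 / real (Suc n)))) = (LINT w|P. indicator \<Gamma> w * k (L s w) * sgn (w (t + 1 / real (Suc n))))" for n
    by (rule shifted) simp
  from LIMSEQ_unique[OF lim[of t, unfolded this] lim[of s]] show ?thesis using st t by simp
qed

end

section \<open>Long-time asymptotics of the weighted expectations\<close>

context wiener_local_time
begin

text \<open>On |v| \<le> a the integrand is constantly h l, which gives 2 a h(l). Each of the two
  tails contributes the mass of h beyond l, that is, the total mass minus \<open>Hint h l\<close>.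
  Both factors 2 are inherited by the limits.\<close>

lemma tail_integral:
  fixes h :: "real => real"
  assumes int: "integrable lborel h" and neg: "\<And>x. x < 0 ==> h x = 0" and l: "0 \<le> l" and a: "0 \<le> a"
  shows "integrable lborel (\<lambda>v. h (l + max (\<bar>v\<bar> - a) 0))"
    and "(LINT v|lborel. h (l + max (\<bar>v\<bar> - a) 0)) = 2 * a * h l + 2 * ((LINT v|lborel. h v) - Hint h l)"
proof -
  define g where "g u = indicator {l<..} u * h u" for u
  have g: "integrable lborel g" unfolding g_def
    using integrable_real_mult_indicator[OF _ int, of "{l<..}"] by (simp add: mult.commute)
  have g0: "integrable lborel (\<lambda>u. indicator {0..l} u * h u)"
    using integrable_real_mult_indicator[OF _ int, of "{0..l}"] by (simp add: mult.commute)
  have "(LINT v|lborel. h v) = (LINT v|lborel. indicator {0..l} v * h v + g v)"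
    by (rule Bochner_Integration.integral_cong[OF refl]) (use neg in \<open>auto simp: g_def indicator_def\<close>)
  also have "\<dots> = Hint h l + (LINT v|lborel. g v)"
    using g g0 by (simp add: Hint_def set_lebesgue_integral_def)
  finally have gi: "(LINT v|lborel. g v) = (LINT v|lborel. h v) - Hint h l" by simp
  \<comment> \<open>\<open>g\<close> is cut off at arguments not exceeding l, so the central
    interval and the two tails are disjoint; each tail is an affine image of
    \<open>g\<close>.\<close>
  have eq: "h (l + max (\<bar>v\<bar> - a) 0) = indicator {-a..a} v * h l + g ((l - a) + 1 * v) + g ((l - a) + (-1) * v)" for v
    using a by (auto simp: g_def indicator_def max_def abs_if intro!: arg_cong[where f=h])
  have i1: "integrable lborel (\<lambda>v. g ((l - a) + 1 * v))" "integrable lborel (\<lambda>v. g ((l - a) + (-1) * v))"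
    using lborel_integrable_real_affine[OF g, of 1 "l - a"] lborel_integrable_real_affine[OF g, of "-1" "l - a"] by auto
  have i2: "(LINT v|lborel. g ((l - a) + 1 * v)) = (LINT v|lborel. g v)" "(LINT v|lborel. g ((l - a) + (-1) * v)) = (LINT v|lborel. g v)"
    using lborel_integral_real_affine[of 1 g "l - a"] lborel_integral_real_affine[of "-1" g "l - a"] by auto
  have i3: "integrable lborel (\<lambda>v. indicator {-a..a} v * h l)"
    by (intro integrable_mult_left integrable_real_indicator) (simp_all add: emeasure_lborel_Icc_eq)
  show "integrable lborel (\<lambda>v. h (l + max (\<bar>v\<bar> - a) 0))" unfolding eq
    by (intro Bochner_Integration.integrable_add i1 i3)
  show "(LINT v|lborel. h (l + max (\<bar>v\<bar> - a) 0)) = 2 * a * h l + 2 * ((LINT v|lborel. h v) - Hint h l)"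
    unfolding eq using i1 i2 i3 a gi by simp
qed

text \<open>The conditional law makes the expectation a function of the past and one Gaussian
  increment, to which \<open>increment_asymptotic\<close> applies. \<open>tail_integral\<close>
  evaluates the Lebesgue integral in v.\<close>

lemma L_law_asymptotic:
  fixes h :: "real => real"
  assumes s: "0 \<le> s" and \<Gamma>: "\<Gamma> \<in> sets (Filt s)"
    and h: "h \<in> borel_measurable borel" "\<And>x. 0 \<le> h x" "\<And>x. h x \<le> K"
      "integrable lborel h" "\<And>x. x < 0 ==> h x = 0"
  shows "((\<lambda>t. sqrt (2 * pi * (t - s)) * (LINT w|P. indicator \<Gamma> w * h (L t w))) \<longlongrightarrow>
      2 * (LINT w|P. indicator \<Gamma> w * (\<bar>w s\<bar> * h (L s w) + ((LINT v|lborel. h v) - Hint h (L s w))))) at_top"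
proof -
  interpret pair_sigma_finite P "lborel :: real measure" ..
  have K: "\<bar>h x\<bar> \<le> K" for x using h(2,3)[of x] by simp
  have \<Gamma>P[measurable]: "\<Gamma> \<in> events" using \<Gamma> sets_Filt_le sets_P by blast
  define f where "f w v = indicator \<Gamma> w * h (L_law s w v)" for w v
  have fm: "(\<lambda>(w, v). f w v) \<in> borel_measurable (Filt s \<Otimes>\<^sub>M borel)"
  proof -
    have [measurable]: "(\<lambda>p. L s (fst p)) \<in> borel_measurable (Filt s \<Otimes>\<^sub>M borel)" "(\<lambda>p. fst p s) \<in> borel_measurable (Filt s \<Otimes>\<^sub>M borel)"
      "(\<lambda>p. indicator \<Gamma> (fst p) :: real) \<in> borel_measurable (Filt s \<Otimes>\<^sub>M borel)"
      using s \<Gamma> by (auto intro!: measurable_compose[OF measurable_fst] L_meas coord_measurable_Filt)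
    have [measurable]: "h \<in> borel_measurable borel" by (rule h)
    show ?thesis unfolding f_def L_law_def split_beta' by measurable
  qed
  have id: "(\<lambda>w. w) \<in> measurable P (Filt s)" using measurable_Filt_P[OF measurable_ident_sets[OF refl]] .
  have fmP: "(\<lambda>(w, v). f w v) \<in> borel_measurable (P \<Otimes>\<^sub>M lborel)"
  proof -
    have "(\<lambda>x. (fst x, snd x)) \<in> measurable (P \<Otimes>\<^sub>M lborel) (Filt s \<Otimes>\<^sub>M borel)"
      using measurable_compose[OF measurable_fst id] by (intro measurable_Pair) auto
    from measurable_compose[OF this fm] show ?thesis by simp
  qed
  have fb: "\<bar>f w v\<bar> \<le> K" for w v using K[of "L_law s w v"] order_trans[OF abs_ge_zero K] by (auto simp: f_def indicator_def)
  define A where "A w = indicator \<Gamma> w * (2 * \<bar>w s\<bar> * h (L s w) + 2 * ((LINT v|lborel. h v) - Hint h (L s w)))" for w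
  have inner: "integrable lborel (f w)" "(LINT v|lborel. f w v) = A w" if w: "w \<in> space P" for w
    using tail_integral[OF h(4,5) L_nonneg[OF s, of w], of "\<bar>w s\<bar>"] w unfolding f_def A_def L_law_def by auto
  have iA: "integrable P A"
  proof -
    have [measurable]: "L s \<in> borel_measurable P" "(\<lambda>w. w s) \<in> borel_measurable P" "h \<in> borel_measurable borel" using s h by auto
    have [measurable]: "Hint h \<in> borel_measurable borel" by (rule Hint_borel[OF h(1) K])
    have "integrable P (\<lambda>w. \<bar>w s\<bar> * h (L s w))"
    proof (rule Bochner_Integration.integrable_bound[of _ "\<lambda>w. K * w s"])
      show "integrable P (\<lambda>w. K * w s)" using coord_moments(1)[OF s] by simp
      show "AE w in P. norm (\<bar>w s\<bar> * h (L s w)) \<le> norm (K * w s)"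
      proof (rule AE_I2)
        fix w
        show "norm (\<bar>w s\<bar> * h (L s w)) \<le> norm (K * w s)"
          using mult_left_mono[OF h(3)[of "L s w"], of "\<bar>w s\<bar>"] h(2)[of "L s w"] order_trans[OF h(2,3)]
          by (simp add: abs_mult mult.commute)
      qed
    qed measurable
    moreover have "integrable P (\<lambda>w. Hint h (L s w))"
    proof (rule Bochner_Integration.integrable_bound[of _ "\<lambda>w. K * L s w"])
      show "integrable P (\<lambda>w. K * L s w)" using L_integrable[OF s] by simp
      show "AE w in P. norm (Hint h (L s w)) \<le> norm (K * L s w)"
        using Hint_bound[OF h(1) K] K_nonneg[OF h(1) K] by (auto simp: abs_mult)
    qed measurable
    ultimately have "integrable P (\<lambda>w. 2 * \<bar>w s\<bar> * h (L s w) + 2 * ((LINT v|lborel. h v) - Hint h (L s w)))"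
      by (auto simp: mult.assoc)
    from integrable_real_mult_indicator[OF \<Gamma>P this] show ?thesis unfolding A_def by (simp add: mult.commute)
  qed
  have int: "integrable (P \<Otimes>\<^sub>M lborel) (\<lambda>(w, v). f w v)"
  proof (rule Fubini_integrable[OF fmP])
    have "integrable P (\<lambda>w. \<integral>v. norm (f w v) \<partial>lborel) \<longleftrightarrow> integrable P A"
      by (rule Bochner_Integration.integrable_cong[OF refl]) (use inner h(2) in \<open>simp add: f_def\<close>)
    then show "integrable P (\<lambda>w. \<integral>v. norm (case (w, v) of (w, v) => f w v) \<partial>lborel)" using iA by simp
    show "AE w in P. integrable lborel (\<lambda>v. case (w, v) of (w, v) => f w v)" using inner by auto
  qed
  have "(\<integral>x. (case x of (w, v) => f w v) \<partial>(P \<Otimes>\<^sub>M lborel)) = (LINT w|P. (LINT v|lborel. f w v))"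
    using integral_fst'[OF int] by simp
  also have "\<dots> = (LINT w|P. A w)" by (rule Bochner_Integration.integral_cong[OF refl]) (use inner in simp)
  also have "\<dots> = (LINT w|P. 2 * (indicator \<Gamma> w * (\<bar>w s\<bar> * h (L s w) + ((LINT v|lborel. h v) - Hint h (L s w)))))"
    by (rule Bochner_Integration.integral_cong[OF refl]) (simp add: A_def algebra_simps)
  also have "\<dots> = 2 * (LINT w|P. indicator \<Gamma> w * (\<bar>w s\<bar> * h (L s w) + ((LINT v|lborel. h v) - Hint h (L s w))))"
    by (rule integral_mult_right_zero)
  finally have lim: "(\<integral>x. (case x of (w, v) => f w v) \<partial>(P \<Otimes>\<^sub>M lborel)) = \<dots>" .
  show ?thesis
  proof (rule Lim_transform_eventually[OF increment_asymptotic[OF s fm fb int, unfolded lim]])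
    show "\<forall>\<^sub>F t in at_top. sqrt (2 * pi * (t - s)) * (LINT w|P. f w (w t - w s)) = sqrt (2 * pi * (t - s)) * (LINT w|P. indicator \<Gamma> w * h (L t w))"
      using eventually_ge_at_top[of s]
      by eventually_elim (use L_law_identity[OF s _ \<Gamma> h(1) K] in \<open>simp add: f_def\<close>)
  qed
qed

text \<open>L_t may be replaced by L_s in front of the sign. What remains is the sign of X_s plus an
  increment; its symmetrised version integrates over v to 2 X_s.\<close>

lemma L_sgn_asymptotic:
  fixes k :: "real => real"
  assumes s: "0 \<le> s" and \<Gamma>: "\<Gamma> \<in> sets (Filt s)"
    and k: "k \<in> borel_measurable borel" "\<And>x. \<bar>k x\<bar> \<le> K"
  shows "((\<lambda>t. sqrt (2 * pi * (t - s)) * (LINT w|P. indicator \<Gamma> w * k (L t w) * sgn (w t))) \<longlongrightarrow>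
      2 * (LINT w|P. indicator \<Gamma> w * (k (L s w) * w s))) at_top"
proof -
  interpret pair_sigma_finite P "lborel :: real measure" ..
  have K0: "0 \<le> K" using k(2)[of 0] by linarith
  have \<Gamma>P[measurable]: "\<Gamma> \<in> events" using \<Gamma> sets_Filt_le sets_P by blast
  define f where "f w v = indicator \<Gamma> w * k (L s w) * sgn_avg (w s) v" for w v
  have cm: "(\<lambda>p. L s (fst p)) \<in> borel_measurable (Filt s \<Otimes>\<^sub>M borel)" "(\<lambda>p. fst p s) \<in> borel_measurable (Filt s \<Otimes>\<^sub>M borel)"
      "(\<lambda>p. indicator \<Gamma> (fst p) :: real) \<in> borel_measurable (Filt s \<Otimes>\<^sub>M borel)"
    using s \<Gamma> by (auto intro!: measurable_compose[OF measurable_fst] L_meas coord_measurable_Filt)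
  have fm: "(\<lambda>(w, v). f w v) \<in> borel_measurable (Filt s \<Otimes>\<^sub>M borel)"
  proof -
    note [measurable] = cm k(1)
    show ?thesis unfolding f_def sgn_avg_def split_beta' by measurable
  qed
  have id: "(\<lambda>w. w) \<in> measurable P (Filt s)" using measurable_Filt_P[OF measurable_ident_sets[OF refl]] .
  have fmP: "(\<lambda>(w, v). f w v) \<in> borel_measurable (P \<Otimes>\<^sub>M lborel)"
  proof -
    have "(\<lambda>x. (fst x, snd x)) \<in> measurable (P \<Otimes>\<^sub>M lborel) (Filt s \<Otimes>\<^sub>M borel)"
      using measurable_compose[OF measurable_fst id] by (intro measurable_Pair) auto
    from measurable_compose[OF this fm] show ?thesis by simp
  qed
  have sb: "\<bar>sgn_avg x v\<bar> \<le> 1" for x v using order_trans[OF sgn_avg_le, of x v 1] by (auto simp: indicator_def)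
  have fb: "\<bar>f w v\<bar> \<le> K" for w v
  proof -
    have "\<bar>k (L s w)\<bar> * \<bar>sgn_avg (w s) v\<bar> \<le> K * 1" using k(2) sb K0 by (intro mult_mono) auto
    then show ?thesis using K0 by (auto simp: f_def indicator_def abs_mult)
  qed
  have ae: "AE v in lborel. f w v = indicator \<Gamma> w * k (L s w) * sgn (w s) * indicator {-\<bar>w s\<bar>..\<bar>w s\<bar>} v" for w
    using AE_lborel_singleton[of "w s"] AE_lborel_singleton[of "- w s"]
  proof eventually_elim
    case (elim v)
    then have "\<bar>v\<bar> \<noteq> \<bar>w s\<bar>" by (auto simp: abs_eq_iff)
    then show ?case by (simp add: f_def sgn_avg_eq)
  qed
  have bi: "integrable lborel (\<lambda>v. c * indicator {-\<bar>x\<bar>..\<bar>x\<bar>} v)" for c x :: real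
    by (intro integrable_mult_right integrable_real_indicator) (auto simp: emeasure_lborel_Icc_eq)
  have fwm: "f w \<in> borel_measurable borel" if "w \<in> path_space" for w
    unfolding f_def[abs_def] sgn_avg_def by measurable
  have inner: "integrable lborel (f w)" "(LINT v|lborel. f w v) = 2 * (indicator \<Gamma> w * (k (L s w) * w s))"
    "(LINT v|lborel. norm (f w v)) = 2 * (indicator \<Gamma> w * (\<bar>k (L s w)\<bar> * \<bar>w s\<bar>))" if w: "w \<in> space P" for w
  proof -
    have m: "f w \<in> borel_measurable lborel" using fwm[of w] w by simp
    show "integrable lborel (f w)"
      using integrable_cong_AE[OF m _ ae[of w]] bi by auto
    have "(LINT v|lborel. f w v) = (LINT v|lborel. indicator \<Gamma> w * k (L s w) * sgn (w s) * indicator {-\<bar>w s\<bar>..\<bar>w s\<bar>} v)"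
      by (rule integral_cong_AE[OF m _ ae]) simp
    then show "(LINT v|lborel. f w v) = 2 * (indicator \<Gamma> w * (k (L s w) * w s))"
      by (simp add: sgn_if abs_if)
    have "(LINT v|lborel. norm (f w v)) = (LINT v|lborel. (indicator \<Gamma> w * \<bar>k (L s w)\<bar> * \<bar>sgn (w s)\<bar>) * indicator {-\<bar>w s\<bar>..\<bar>w s\<bar>} v)"
      by (rule integral_cong_AE) (use m ae[of w] in \<open>auto simp: abs_mult elim!: eventually_mono\<close>)
    then show "(LINT v|lborel. norm (f w v)) = 2 * (indicator \<Gamma> w * (\<bar>k (L s w)\<bar> * \<bar>w s\<bar>))"
      by (simp add: abs_sgn_eq)
  qed
  have [measurable]: "L s \<in> borel_measurable P" "(\<lambda>w. w s) \<in> borel_measurable P" "k \<in> borel_measurable borel" using s k by auto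
  have iA: "integrable P (\<lambda>w. 2 * (indicator \<Gamma> w * (\<bar>k (L s w)\<bar> * \<bar>w s\<bar>)))"
  proof (rule Bochner_Integration.integrable_bound[of _ "\<lambda>w. 2 * (K * w s)"])
    show "integrable P (\<lambda>w. 2 * (K * w s))" using coord_moments(1)[OF s] by simp
    show "AE w in P. norm (2 * (indicator \<Gamma> w * (\<bar>k (L s w)\<bar> * \<bar>w s\<bar>))) \<le> norm (2 * (K * w s))"
      using k(2) K0 by (auto simp: abs_mult indicator_def intro!: mult_right_mono)
  qed measurable
  have int: "integrable (P \<Otimes>\<^sub>M lborel) (\<lambda>(w, v). f w v)"
  proof (rule Fubini_integrable[OF fmP])
    have "integrable P (\<lambda>w. \<integral>v. norm (f w v) \<partial>lborel) \<longleftrightarrow> integrable P (\<lambda>w. 2 * (indicator \<Gamma> w * (\<bar>k (L s w)\<bar> * \<bar>w s\<bar>)))"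
      by (rule Bochner_Integration.integrable_cong[OF refl]) (use inner in simp)
    then show "integrable P (\<lambda>w. \<integral>v. norm (case (w, v) of (w, v) => f w v) \<partial>lborel)" using iA by simp
    show "AE w in P. integrable lborel (\<lambda>v. case (w, v) of (w, v) => f w v)" using inner(1) by auto
  qed
  have "(\<integral>x. (case x of (w, v) => f w v) \<partial>(P \<Otimes>\<^sub>M lborel)) = (LINT w|P. (LINT v|lborel. f w v))"
    using integral_fst'[OF int] by simp
  also have "\<dots> = (LINT w|P. 2 * (indicator \<Gamma> w * (k (L s w) * w s)))" by (rule Bochner_Integration.integral_cong[OF refl]) (use inner in simp)
  also have "\<dots> = 2 * (LINT w|P. indicator \<Gamma> w * (k (L s w) * w s))"
    by (rule integral_mult_right_zero)
  finally have lim: "(\<integral>x. (case x of (w, v) => f w v) \<partial>(P \<Otimes>\<^sub>M lborel)) = \<dots>" .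
  \<comment> \<open>Symmetrisation keeps the mean for each frozen past; only the symmetrised
    integrand \<open>f\<close> is integrable over the product with Lebesgue measure.\<close>
  have eq: "(LINT w|P. f w (w t - w s)) = (LINT w|P. indicator \<Gamma> w * k (L t w) * sgn (w t))" if t: "s < t" for t
  proof -
    define G where "G w v = indicator \<Gamma> w * k (L s w) * sgn (w s + v)" for w v
    have Gm: "(\<lambda>(w, v). G w v) \<in> borel_measurable (Filt s \<Otimes>\<^sub>M borel)"
    proof -
      note [measurable] = cm k(1)
      show ?thesis unfolding G_def split_beta' by measurable
    qed
    have Gb: "norm (G w v) \<le> K" for w v using k(2) K0 by (auto simp: G_def abs_mult abs_sgn_eq indicator_def)
    have "(LINT w|P. indicator \<Gamma> w * k (L t w) * sgn (w t)) = (LINT w|P. G w (w t - w s))"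
      using L_sgn_identity[OF s t \<Gamma> k] by (simp add: G_def)
    also have "\<dots> = (LINT w|P. (\<integral>w'. G w (w' t - w' s) \<partial>P))" by (rule future_fubini[OF s _ Gm Gb]) (use t in simp)
    also have "\<dots> = (LINT w|P. (\<integral>w'. f w (w' t - w' s) \<partial>P))"
      using t s by (simp add: G_def f_def sgn_avg_integral[of s t])
    also have "\<dots> = (LINT w|P. f w (w t - w s))" by (rule future_fubini[OF s _ fm, symmetric]) (use t fb in auto)
    finally show ?thesis by simp
  qed
  show ?thesis
  proof (rule Lim_transform_eventually[OF increment_asymptotic[OF s fm fb int, unfolded lim]])
    show "\<forall>\<^sub>F t in at_top. sqrt (2 * pi * (t - s)) * (LINT w|P. f w (w t - w s)) = sqrt (2 * pi * (t - s)) * (LINT w|P. indicator \<Gamma> w * k (L t w) * sgn (w t))"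
      using eventually_gt_at_top[of s] by eventually_elim (simp add: eq)
  qed
qed

end

text \<open>Total mass at most 1, instead of exactly 1, so that truncated weights and auxiliary
  weights with null primitive are instances too.\<close>

locale excursion_weights = wiener_local_time +
  fixes a b :: "real => real" and K :: real
  assumes a_borel: "a \<in> borel_measurable borel" and b_borel: "b \<in> borel_measurable borel"
    and a_nonneg: "0 \<le> a x" and b_nonneg: "0 \<le> b x" and a_le: "a x \<le> K" and b_le: "b x \<le> K"
    and mass_le: "Hint (\<lambda>x. (a x + b x) / 2) l \<le> 1"
begin

definition h :: "real => real" where "h x = (a x + b x) / 2"
definition k :: "real => real" where "k x = (a x - b x) / 2"

text \<open>The terms X^+ a(L) + X^- b(L) are written as |X| h(L) + X k(L). The first part falls
  under the even identity together with H(L), the second under the odd one.\<close>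

definition Mart :: "real => path => real" where
  "Mart t w = 1 - Hint h (L t w) + (\<bar>w t\<bar> * h (L t w) + w t * k (L t w))"

lemma h_borel [measurable]: "h \<in> borel_measurable borel" unfolding h_def[abs_def] using a_borel b_borel by measurable

lemma k_borel [measurable]: "k \<in> borel_measurable borel" unfolding k_def[abs_def] using a_borel b_borel by measurable

lemma h_bounds: "0 \<le> h x" "h x \<le> K" "\<bar>h x\<bar> \<le> K" "\<bar>k x\<bar> \<le> K" "\<bar>k x\<bar> \<le> h x"
  using a_nonneg[of x] b_nonneg[of x] a_le[of x] b_le[of x] by (auto simp: h_def k_def abs_le_iff field_simps)

lemma K_pos: "0 \<le> K" using h_bounds(1,2)[of 0] by linarith

lemma Hint_h_bounds: "0 \<le> Hint h l" "Hint h l \<le> 1"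
  using mass_le[of l] by (auto simp: h_def[abs_def] Hint_def set_lebesgue_integral_def a_nonneg b_nonneg
      intro!: Bochner_Integration.integral_nonneg)

lemma Mart_nonneg: "0 \<le> Mart t w"
proof -
  have "- (w t * k (L t w)) \<le> \<bar>w t\<bar> * \<bar>k (L t w)\<bar>" by (metis abs_ge_minus_self abs_mult)
  also have "\<dots> \<le> \<bar>w t\<bar> * h (L t w)" by (intro mult_left_mono h_bounds) simp
  finally show ?thesis using Hint_h_bounds(2)[of "L t w"] by (simp add: Mart_def)
qed

text \<open>The term |X| h + X k is non-negative because |k| \<le> h. This is the lower bound from
  which every bound on the drift is derived.\<close>

lemma Mart_ge: "1 - Hint h (L t w) \<le> Mart t w"
proof -
  have "- (w t * k (L t w)) \<le> \<bar>w t\<bar> * \<bar>k (L t w)\<bar>" by (metis abs_ge_minus_self abs_mult)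
  also have "\<dots> \<le> \<bar>w t\<bar> * h (L t w)" by (intro mult_left_mono h_bounds) simp
  finally show ?thesis by (simp add: Mart_def)
qed

lemma Mart_le: "Mart t w \<le> 1 + 2 * K * \<bar>w t\<bar>"
proof -
  have "w t * k (L t w) \<le> \<bar>w t\<bar> * \<bar>k (L t w)\<bar>" by (metis abs_ge_self abs_mult)
  also have "\<dots> \<le> \<bar>w t\<bar> * K" by (intro mult_left_mono h_bounds) simp
  finally have "w t * k (L t w) \<le> \<bar>w t\<bar> * K" .
  moreover have "\<bar>w t\<bar> * h (L t w) \<le> \<bar>w t\<bar> * K" by (intro mult_left_mono h_bounds) simp
  ultimately show ?thesis using Hint_h_bounds(1)[of "L t w"] by (simp add: Mart_def algebra_simps)
qed

lemma Mart_Filt: "0 \<le> t ==> Mart t \<in> borel_measurable (Filt t)"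
proof -
  assume t: "0 \<le> t"
  have [measurable]: "L t \<in> borel_measurable (Filt t)" "(\<lambda>w. w t) \<in> borel_measurable (Filt t)"
    "Hint h \<in> borel_measurable borel"
    using t by (auto intro!: L_meas coord_measurable_Filt Hint_borel[OF h_borel h_bounds(3)])
  show ?thesis unfolding Mart_def[abs_def] by measurable
qed

lemma Mart_borel [measurable]: "0 \<le> t ==> Mart t \<in> borel_measurable P"
  by (rule measurable_Filt_P[OF Mart_Filt])

lemma Mart_integrable: "0 \<le> t ==> integrable P (Mart t)"
proof (rule Bochner_Integration.integrable_bound)
  assume t: "0 \<le> t"
  show "integrable P (\<lambda>w. 1 + 2 * K * \<bar>w t\<bar>)" using coord_moments(1)[OF t] by auto
  show "Mart t \<in> borel_measurable P" using t by measurable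
  show "AE w in P. norm (Mart t w) \<le> norm (1 + 2 * K * \<bar>w t\<bar>)"
    using Mart_nonneg Mart_le K_pos by (auto simp: abs_of_nonneg)
qed

lemma Mart_0: "AE w in P. Mart 0 w = 1"
  using L_regular start_zero by eventually_elim (simp add: Mart_def Hint_0[OF h_borel h_bounds(3)])

end

text \<open>The weights live on the whole line and vanish at negative arguments, so that half-line
  integrals become integrals over the line. The mass is exactly 1, which makes the mass of
  \<open>h\<close> beyond l equal to 1 - H(l).\<close>

locale penalisation = wiener_local_time +
  fixes a b :: "real => real" and K :: real
  assumes ab_borel: "a \<in> borel_measurable borel" "b \<in> borel_measurable borel"
    and ab_nonneg: "0 \<le> a x" "0 \<le> b x" and ab_le: "a x \<le> K" "b x \<le> K"
    and ab_neg: "x < 0 ==> a x = 0" "x < 0 ==> b x = 0"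
    and ab_int: "integrable lborel (\<lambda>x. (a x + b x) / 2)"
    and ab_one: "(LINT x|lborel. (a x + b x) / 2) = 1"

sublocale penalisation \<subseteq> excursion_weights
proof
  fix l
  have i: "integrable lborel (\<lambda>x. indicator {0..l} x *\<^sub>R ((a x + b x) / 2))"
    using integrable_real_mult_indicator[OF _ ab_int, of "{0..l}"] by (simp add: mult.commute)
  have "Hint (\<lambda>x. (a x + b x) / 2) l \<le> (LINT x|lborel. (a x + b x) / 2)" unfolding Hint_def set_lebesgue_integral_def
    by (rule integral_mono[OF i ab_int]) (simp add: ab_nonneg indicator_def)
  then show "Hint (\<lambda>x. (a x + b x) / 2) l \<le> 1" by (simp only: ab_one)
qed (use ab_borel ab_nonneg ab_le in auto)

section \<open>The penalisation limit\<close>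

context penalisation
begin

lemma h_int: "integrable lborel h" "(LINT x|lborel. h x) = 1"
  using ab_int ab_one by (simp_all add: h_def[abs_def])

lemma h_neg: "x < 0 ==> h x = 0" using ab_neg by (simp add: h_def)

text \<open>Off the origin, a 1_{X>0} + b 1_{X<0} equals h + k sgn(X). The two asymptotics add up to
  twice |X_s| h + 1 - H + X_s k, evaluated at L_s, that is, twice \<open>Mart s\<close>.\<close>

lemma weight_asymptotic:
  assumes s: "0 \<le> s" and \<Gamma>: "\<Gamma> \<in> sets (Filt s)"
  shows "((\<lambda>t. sqrt (2 * pi * (t - s)) * (LINT w|P. indicator \<Gamma> w * (a (L t w) * indicator {0<..} (w t) + b (L t w) * indicator {..<0} (w t))))
     \<longlongrightarrow> 2 * (LINT w|P. indicator \<Gamma> w * Mart s w)) at_top"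
proof -
  have \<Gamma>P[measurable]: "\<Gamma> \<in> events" using \<Gamma> sets_Filt_le sets_P by blast
  note l1 = L_law_asymptotic[OF s \<Gamma> h_borel h_bounds(1,2) h_int(1) h_neg]
  note l2 = L_sgn_asymptotic[OF s \<Gamma> k_borel h_bounds(4)]
  have [measurable]: "L s \<in> borel_measurable P" "(\<lambda>w. w s) \<in> borel_measurable P" using s by auto
  have [measurable]: "Hint h \<in> borel_measurable borel" by (rule Hint_borel[OF h_borel h_bounds(3)])
  have i2: "integrable P (\<lambda>w. indicator \<Gamma> w * (k (L s w) * w s))"
  proof (rule Bochner_Integration.integrable_bound[of _ "\<lambda>w. K * w s"])
    show "integrable P (\<lambda>w. K * w s)" using coord_moments(1)[OF s] by simp
    show "AE w in P. norm (indicator \<Gamma> w * (k (L s w) * w s)) \<le> norm (K * w s)"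
      using h_bounds(4) K_pos by (auto simp: abs_mult indicator_def intro!: mult_right_mono)
  qed measurable
  have i3: "integrable P (\<lambda>w. indicator \<Gamma> w * Mart s w)"
    using integrable_real_mult_indicator[OF \<Gamma>P Mart_integrable[OF s]] by (simp add: mult.commute)
  have eq: "indicator \<Gamma> w * (\<bar>w s\<bar> * h (L s w) + ((LINT v|lborel. h v) - Hint h (L s w))) = indicator \<Gamma> w * Mart s w - indicator \<Gamma> w * (k (L s w) * w s)" for w
    by (simp add: Mart_def h_int algebra_simps)
  have lim: "2 * (LINT w|P. indicator \<Gamma> w * (\<bar>w s\<bar> * h (L s w) + ((LINT v|lborel. h v) - Hint h (L s w)))) + 2 * (LINT w|P. indicator \<Gamma> w * (k (L s w) * w s)) = 2 * (LINT w|P. indicator \<Gamma> w * Mart s w)"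
    unfolding eq using i2 i3 by simp
  show ?thesis
  proof (rule Lim_transform_eventually[OF tendsto_add[OF l1 l2, unfolded lim]])
    show "\<forall>\<^sub>F t in at_top. sqrt (2 * pi * (t - s)) * (LINT w|P. indicator \<Gamma> w * h (L t w)) + sqrt (2 * pi * (t - s)) * (LINT w|P. indicator \<Gamma> w * k (L t w) * sgn (w t))
      = sqrt (2 * pi * (t - s)) * (LINT w|P. indicator \<Gamma> w * (a (L t w) * indicator {0<..} (w t) + b (L t w) * indicator {..<0} (w t)))"
      using eventually_gt_at_top[of s]
    proof eventually_elim
      case (elim t)
      then have t: "0 < t" using s by simp
      have [measurable]: "L t \<in> borel_measurable P" "(\<lambda>w. w t) \<in> borel_measurable P" "a \<in> borel_measurable borel" "b \<in> borel_measurable borel"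
        using t a_borel b_borel by auto
      have j1: "integrable P (\<lambda>w. indicator \<Gamma> w * h (L t w))"
        by (rule integrable_const_bound[of _ K]) (measurable, use h_bounds(3) K_pos in \<open>auto simp: indicator_def\<close>)
      have j2: "integrable P (\<lambda>w. indicator \<Gamma> w * k (L t w) * sgn (w t))"
        by (rule integrable_const_bound[of _ K]) (use h_bounds(4) K_pos in \<open>auto simp: abs_mult abs_sgn_eq indicator_def\<close>)
      have "(LINT w|P. indicator \<Gamma> w * (a (L t w) * indicator {0<..} (w t) + b (L t w) * indicator {..<0} (w t)))
        = (LINT w|P. indicator \<Gamma> w * h (L t w) + indicator \<Gamma> w * k (L t w) * sgn (w t))"
      proof (rule integral_cong_AE)
        show "AE w in P. indicator \<Gamma> w * (a (L t w) * indicator {0<..} (w t) + b (L t w) * indicator {..<0} (w t)) = indicator \<Gamma> w * h (L t w) + indicator \<Gamma> w * k (L t w) * sgn (w t)"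
          using coord_nonzero[OF t] by eventually_elim (auto simp: indicator_def sgn_if h_def k_def field_simps)
        show "(\<lambda>w. indicator \<Gamma> w * (a (L t w) * indicator {0<..} (w t) + b (L t w) * indicator {..<0} (w t))) \<in> borel_measurable P"
          by measurable
      qed (use j1 j2 in auto)
      then show ?case using j1 j2 by (simp add: distrib_left)
    qed
  qed
qed

text \<open>The denominator is the case s = 0 with the full space as event, where Mart 0 = 1 almost
  surely. Numerator and denominator carry different normalisations, sqrt(t - s) and sqrt t, whose
  quotient tends to 1.\<close>

lemma penalisation_limit:
  assumes s: "0 \<le> s" and \<Gamma>: "\<Gamma> \<in> sets (Filt s)"
  shows "((\<lambda>t. (LINT w|P. indicator \<Gamma> w * (a (L t w) * indicator {0<..} (w t) + b (L t w) * indicator {..<0} (w t)))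
       / (LINT w|P. a (L t w) * indicator {0<..} (w t) + b (L t w) * indicator {..<0} (w t)))
     \<longlongrightarrow> (LINT w|P. indicator \<Gamma> w * Mart s w)) at_top"
proof -
  define N where "N t = (LINT w|P. indicator \<Gamma> w * (a (L t w) * indicator {0<..} (w t) + b (L t w) * indicator {..<0} (w t)))" for t
  define D where "D t = (LINT w|P. a (L t w) * indicator {0<..} (w t) + b (L t w) * indicator {..<0} (w t))" for t
  have N: "((\<lambda>t. sqrt (2 * pi * (t - s)) * N t) \<longlongrightarrow> 2 * (LINT w|P. indicator \<Gamma> w * Mart s w)) at_top"
    unfolding N_def by (rule weight_asymptotic[OF s \<Gamma>])
  have top: "path_space \<in> sets (Filt 0)" using sets.top[of "Filt 0"] by simp
  have "(LINT w|P. indicator path_space w * Mart 0 w) = (LINT w|P. Mart 0 w)"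
    by (rule Bochner_Integration.integral_cong) auto
  also have "\<dots> = (LINT w|P. 1)"
    by (rule integral_cong_AE) (use Mart_0 in auto)
  finally have M0: "(LINT w|P. indicator path_space w * Mart 0 w) = 1" using prob_space by simp
  have D_eq: "(LINT w|P. indicator path_space w * (a (L t w) * indicator {0<..} (w t) + b (L t w) * indicator {..<0} (w t))) = D t" for t
    unfolding D_def by (rule Bochner_Integration.integral_cong[OF refl]) simp
  have D: "((\<lambda>t. sqrt (2 * pi * t) * D t) \<longlongrightarrow> 2) at_top"
    using weight_asymptotic[OF order_refl top] unfolding M0 D_eq by simp
  have r: "((\<lambda>t. sqrt (2 * pi * t) / sqrt (2 * pi * (t - s))) \<longlongrightarrow> 1) at_top"
  proof -
    have "((\<lambda>t. sqrt (t / (t - s))) \<longlongrightarrow> sqrt 1) at_top" by (intro tendsto_real_sqrt) real_asymp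
    moreover have "sqrt (2 * pi * t) / sqrt (2 * pi * (t - s)) = sqrt (t / (t - s))" for t
      by (simp add: real_sqrt_divide[symmetric])
    ultimately show ?thesis by simp
  qed
  have "((\<lambda>t. (sqrt (2 * pi * (t - s)) * N t) / (sqrt (2 * pi * t) * D t) * (sqrt (2 * pi * t) / sqrt (2 * pi * (t - s)))) \<longlongrightarrow> (2 * (LINT w|P. indicator \<Gamma> w * Mart s w)) / 2 * 1) at_top"
    by (intro tendsto_mult tendsto_divide N D r) simp
  then have "((\<lambda>t. (sqrt (2 * pi * (t - s)) * N t) / (sqrt (2 * pi * t) * D t) * (sqrt (2 * pi * t) / sqrt (2 * pi * (t - s)))) \<longlongrightarrow> (LINT w|P. indicator \<Gamma> w * Mart s w)) at_top"
    by simp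
  then have "((\<lambda>t. N t / D t) \<longlongrightarrow> (LINT w|P. indicator \<Gamma> w * Mart s w)) at_top"
  proof (rule Lim_transform_eventually)
    show "\<forall>\<^sub>F t in at_top. (sqrt (2 * pi * (t - s)) * N t) / (sqrt (2 * pi * t) * D t) * (sqrt (2 * pi * t) / sqrt (2 * pi * (t - s))) = N t / D t"
      using eventually_gt_at_top[of s]
      by eventually_elim (use s in \<open>simp add: field_simps\<close>)
  qed
  then show ?thesis unfolding N_def D_def .
qed

end

section \<open>Exponential identities and the drift\<close>

context excursion_weights
begin

definition expo :: "real => real => path => complex" where
  "expo \<theta> s w = of_real (exp (\<theta>\<^sup>2 * s / 2)) * iexp (\<theta> * w s)"

definition bb :: "real => path => real" where
  "bb s w = a (L s w) * indicator {0<..} (w s) - b (L s w) * indicator {..<0} (w s)"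

lemma bb_le: "\<bar>bb s w\<bar> \<le> K"
  using a_nonneg[of "L s w"] b_nonneg[of "L s w"] a_le[of "L s w"] b_le[of "L s w"] K_pos by (auto simp: bb_def indicator_def)

lemma bb_eq: "w s \<noteq> 0 ==> bb s w = k (L s w) + h (L s w) * sgn (w s)"
  by (auto simp: bb_def h_def k_def indicator_def sgn_if field_simps)

lemma bb_Filt: "0 \<le> s ==> bb s \<in> borel_measurable (Filt s)"
proof -
  assume s: "0 \<le> s"
  have [measurable]: "L s \<in> borel_measurable (Filt s)" "(\<lambda>w. w s) \<in> borel_measurable (Filt s)" "a \<in> borel_measurable borel" "b \<in> borel_measurable borel"
    using s a_borel b_borel by (auto intro!: L_meas coord_measurable_Filt)
  show ?thesis unfolding bb_def[abs_def] by measurable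
qed

lemma expo_norm: "cmod (expo \<theta> s w) = exp (\<theta>\<^sup>2 * s / 2)"
  by (simp add: expo_def norm_mult)

lemma expo_Filt: "0 \<le> s ==> expo \<theta> s \<in> borel_measurable (Filt s)"
proof -
  assume s: "0 \<le> s"
  have [measurable]: "(\<lambda>w. w s) \<in> borel_measurable (Filt s)" using s by (auto intro!: coord_measurable_Filt)
  show ?thesis unfolding expo_def[abs_def] by measurable
qed

lemma Mart_expo_integrable:
  assumes "0 \<le> s" "V \<in> borel_measurable P" "\<And>w. cmod (V w) \<le> B"
  shows "integrable P (\<lambda>w. V w * (of_real (Mart s w) * expo \<theta> s w))"
proof (rule integrable_bounded_mult[OF assms(2,3)])
  have "integrable P (\<lambda>w. expo \<theta> s w * of_real (Mart s w))"
    by (rule integrable_bounded_mult[OF measurable_Filt_P[OF expo_Filt[OF assms(1)]], of _ "exp (\<theta>\<^sup>2 * s / 2)"])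
      (use Mart_integrable[OF assms(1)] in \<open>auto simp: expo_norm\<close>)
  then show "integrable P (\<lambda>w. of_real (Mart s w) * expo \<theta> s w)" by (simp only: mult.commute)
qed

text \<open>With e = exp(\<theta>^2 s / 2), the product of \<open>Mart\<close> and
  \<open>expo\<close> splits into a martingale \<psi> = e exp(i\<theta>x), the even process of h
  with \<phi> = x \<psi>, and the odd process of k with the same \<phi>. The drifts h sgn(X)
  \<gamma> and k \<gamma> with \<gamma> = i\<theta> \<psi> combine to i\<theta> \<open>bb\<close>
  \<open>expo\<close>.\<close>

lemma Mart_expo_identity:
  assumes rt: "0 \<le> r" "r \<le> t" and V: "V \<in> borel_measurable (Filt r)" "\<And>w. cmod (V w) \<le> B"
  shows "set_integrable lborel {r<..<t} (\<lambda>s. \<integral>w. V w * (\<i> * of_real \<theta> * of_real (bb s w) * expo \<theta> s w) \<partial>P)" (is ?I)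
    and "(LINT w|P. V w * (of_real (Mart t w) * expo \<theta> t w)) - (LINT w|P. V w * (of_real (Mart r w) * expo \<theta> r w))
      = (LINT s:{r<..<t}|lborel. (LINT w|P. V w * (\<i> * of_real \<theta> * of_real (bb s w) * expo \<theta> s w)))" (is ?E)
proof -
  have t: "0 \<le> t" using rt by simp
  define E where "E = exp (\<theta>\<^sup>2 * t / 2)"
  define C where "C = E * (1 + \<bar>\<theta>\<bar>)"
  define e where "e s = complex_of_real (exp (\<theta>\<^sup>2 * s / 2))" for s
  define \<phi> where "\<phi> s x = e s * (of_real x * iexp (\<theta> * x))" for s x
  define \<psi> where "\<psi> s x = e s * iexp (\<theta> * x)" for s x
  define \<gamma> where "\<gamma> s x = \<i> * of_real \<theta> * e s * iexp (\<theta> * x)" for s x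
  have ee: "cmod (e s) \<le> E" if "s \<in> {r..t}" for s
  proof -
    have "\<theta>\<^sup>2 * s \<le> \<theta>\<^sup>2 * t" using that by (intro mult_left_mono) auto
    then show ?thesis by (simp add: E_def e_def)
  qed
  have E1: "1 \<le> E" using t by (simp add: E_def)
  have C: "E \<le> C" "E * \<bar>\<theta>\<bar> \<le> C" "0 \<le> C" unfolding C_def using E1 by (auto simp: distrib_left)
  interpret I: ito_even P L r t V B C \<phi> \<gamma> \<psi> e
  proof unfold_locales
    fix s x assume s: "s \<in> {r..t}"
    show "\<phi> s \<in> borel_measurable borel" "\<psi> s \<in> borel_measurable borel" unfolding \<phi>_def \<psi>_def by measurable
    have "cmod (\<phi> s x) = cmod (e s) * \<bar>x\<bar>" unfolding \<phi>_def norm_mult by simp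
    also have "\<dots> \<le> C * \<bar>x\<bar>" using ee[OF s] C by (intro mult_right_mono) auto
    finally show "cmod (\<phi> s x) \<le> C * \<bar>x\<bar>" .
    have "cmod (\<psi> s x) = cmod (e s)" unfolding \<psi>_def norm_mult by simp
    then show "cmod (\<psi> s x) \<le> C" using ee[OF s] C by simp
    have "cmod (\<gamma> s x) = \<bar>\<theta>\<bar> * cmod (e s)" unfolding \<gamma>_def norm_mult by simp
    also have "\<dots> \<le> \<bar>\<theta>\<bar> * E" using ee[OF s] by (intro mult_left_mono) auto
    finally show "cmod (\<gamma> s x) \<le> C" using C by (simp add: mult.commute)
    have ix: "cmod (iexp (\<theta> * x) - 1) \<le> \<bar>\<theta>\<bar> * \<bar>x\<bar>" using iexp_approx1[of "\<theta> * x" 0] by (simp add: abs_mult)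
    have "\<psi> s x - e s = e s * (iexp (\<theta> * x) - 1)" by (simp add: \<psi>_def algebra_simps)
    then have "cmod (\<psi> s x - e s) = cmod (e s) * cmod (iexp (\<theta> * x) - 1)" by (simp only: norm_mult)
    also have "\<dots> \<le> E * (\<bar>\<theta>\<bar> * \<bar>x\<bar>)" using ee[OF s] ix E1 by (intro mult_mono) auto
    also have "\<dots> \<le> C * \<bar>x\<bar>" using C by (simp add: mult.assoc[symmetric] mult_right_mono)
    finally show "cmod (\<psi> s x - e s) \<le> C * \<bar>x\<bar>" .
    \<comment> \<open>As \<phi> is x times \<psi>, the linear bound for \<psi> - e yields the
      quadratic one for \<phi>.\<close>
    have "\<phi> s x - e s * of_real x = of_real x * (\<psi> s x - e s)" by (simp add: \<phi>_def \<psi>_def algebra_simps)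
    then have "cmod (\<phi> s x - e s * of_real x) = \<bar>x\<bar> * cmod (\<psi> s x - e s)" by (simp only: norm_mult norm_of_real)
    also have "\<dots> \<le> \<bar>x\<bar> * (C * \<bar>x\<bar>)" using \<open>cmod (\<psi> s x - e s) \<le> C * \<bar>x\<bar>\<close> by (intro mult_left_mono) auto
    also have "\<dots> = C * x\<^sup>2" by (simp add: power2_eq_square)
    finally show "cmod (\<phi> s x - e s * of_real x) \<le> C * x\<^sup>2" .
  next
    show "continuous_on UNIV (\<lambda>(s, x). \<gamma> s x)"
      unfolding \<gamma>_def e_def split_beta' by (intro continuous_intros) auto
  next
    fix s u K :: real and W :: "path => complex"
    assume su: "r \<le> s" "s \<le> u" "u \<le> t" and W: "W \<in> borel_measurable (Filt s)" "\<And>w. cmod (W w) \<le> K"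
    have s0: "0 \<le> s" using su rt by simp
    show "(LINT w|P. W w * \<phi> u (w u)) = (LINT w|P. W w * \<phi> s (w s)) + complex_of_real (u - s) * (LINT w|P. W w * \<gamma> s (w s))"
      unfolding \<phi>_def \<gamma>_def e_def by (rule coord_exponential_drift[OF s0 su(2) W])
  next
    fix s u :: real and W :: "path => complex"
    assume su: "r \<le> s" "s \<le> u" "u \<le> t" and W: "W \<in> borel_measurable (Filt s)" "integrable P W"
    have s0: "0 \<le> s" using su rt by simp
    show "(LINT w|P. W w * \<psi> u (w u)) = (LINT w|P. W w * \<psi> s (w s))"
      unfolding \<psi>_def e_def by (rule exponential_martingale[OF s0 su(2) W])
  qed (use rt V in auto)
  let ?Gk = "\<lambda>s. \<integral>w. V w * of_real (k (L s w)) * \<gamma> s (w s) \<partial>P"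
  let ?Gh = "\<lambda>s. \<integral>w. V w * of_real (h (L s w)) * (of_real (sgn (w s)) * \<gamma> s (w s)) \<partial>P"
  let ?G = "\<lambda>s. \<integral>w. V w * (\<i> * of_real \<theta> * of_real (bb s w) * expo \<theta> s w) \<partial>P"
  note kk = I.odd_identity[OF k_borel h_bounds(4)] and hh = I.even_identity[OF h_borel h_bounds(3)]
  have Vm: "V \<in> borel_measurable P" using measurable_Filt_P[OF V(1)] .
  have iV: "integrable P V" by (rule integrable_const_bound[of _ B]) (use V Vm in auto)
  \<comment> \<open>\<open>bb\<close> and k + h sgn(X) differ at the origin only, which is not
    charged at a time s > 0.\<close>
  have G: "?G s = ?Gk s + ?Gh s" if s: "s \<in> {r<..<t}" for s
  proof -
    have s': "s \<in> {r..t}" "0 < s" "0 \<le> s" using s rt by auto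
    have i1: "integrable P (\<lambda>w. V w * of_real (k (L s w)) * \<gamma> s (w s))" by (rule I.L_weight(1)[OF s'(1) k_borel h_bounds(4) I.\<gamma>_integrable[OF s'(1)]])
    have i2: "integrable P (\<lambda>w. V w * of_real (h (L s w)) * (of_real (sgn (w s)) * \<gamma> s (w s)))" by (rule I.L_weight(1)[OF s'(1) h_borel h_bounds(3) I.sgn_\<gamma>_integrable[OF s'(1)]])
    have "?G s = (LINT w|P. V w * of_real (k (L s w)) * \<gamma> s (w s) + V w * of_real (h (L s w)) * (of_real (sgn (w s)) * \<gamma> s (w s)))"
    proof (rule integral_cong_AE)
      show "AE w in P. V w * (\<i> * of_real \<theta> * of_real (bb s w) * expo \<theta> s w) = V w * of_real (k (L s w)) * \<gamma> s (w s) + V w * of_real (h (L s w)) * (of_real (sgn (w s)) * \<gamma> s (w s))"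
        using coord_nonzero[OF s'(2)]
        by eventually_elim (simp add: bb_eq \<gamma>_def expo_def e_def algebra_simps)
      show "(\<lambda>w. V w * (\<i> * of_real \<theta> * of_real (bb s w) * expo \<theta> s w)) \<in> borel_measurable P"
        using Vm measurable_Filt_P[OF bb_Filt[OF s'(3)]] measurable_Filt_P[OF expo_Filt[OF s'(3), of \<theta>]] by measurable
    qed (use i1 i2 in auto)
    then show ?thesis using i1 i2 by simp
  qed
  have ikh: "set_integrable lborel {r<..<t} ?Gk" "set_integrable lborel {r<..<t} ?Gh" using kk hh by auto
  have cong: "set_integrable lborel {r<..<t} ?G \<longleftrightarrow> set_integrable lborel {r<..<t} (\<lambda>s. ?Gk s + ?Gh s)"
    by (rule set_integrable_cong) (use G in auto)
  have ceq: "(LINT s:{r<..<t}|lborel. ?G s) = (LINT s:{r<..<t}|lborel. ?Gk s + ?Gh s)"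
    by (rule set_lebesgue_integral_cong) (use G in auto)
  show ?I unfolding cong by (rule set_integral_add(1)[OF ikh])
  have rep: "(LINT w|P. V w * (of_real (Mart s w) * expo \<theta> s w)) = (LINT w|P. V w * \<psi> s (w s)) + I.even_mean h s + (LINT w|P. V w * of_real (k (L s w)) * \<phi> s (w s))"
    if s: "s \<in> {r..t}" for s
  proof -
    have i1: "integrable P (\<lambda>w. V w * of_real (h (L s w)) * (of_real (sgn (w s)) * \<phi> s (w s)))" by (rule I.L_weight(1)[OF s h_borel h_bounds(3) I.sgn_\<phi>_integrable[OF s]])
    have i2: "integrable P (\<lambda>w. V w * of_real (Hint h (L s w)) * \<psi> s (w s))" by (rule I.Hint_weight(2)[OF s h_borel h_bounds(3) s])
    have i3: "integrable P (\<lambda>w. V w * of_real (k (L s w)) * \<phi> s (w s))" by (rule I.L_weight(1)[OF s k_borel h_bounds(4) I.\<phi>_integrable[OF s]])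
    have i4: "integrable P (\<lambda>w. V w * \<psi> s (w s))"
      by (rule integrable_bounded_mult[OF Vm V(2)], rule integrable_const_bound[of _ C])
        (use I.\<psi>_bound[OF s] I.\<psi>_meas[OF s] s rt in auto)
    have "(LINT w|P. V w * (of_real (Mart s w) * expo \<theta> s w)) = (LINT w|P. V w * \<psi> s (w s)
       + (V w * of_real (h (L s w)) * (of_real (sgn (w s)) * \<phi> s (w s)) - V w * of_real (Hint h (L s w)) * \<psi> s (w s))
       + V w * of_real (k (L s w)) * \<phi> s (w s))"
    proof (rule Bochner_Integration.integral_cong[OF refl])
      fix w :: path
      have "\<bar>w s\<bar> = sgn (w s) * w s" by (subst mult.commute) (rule abs_sgn)
      then have M: "Mart s w = 1 - Hint h (L s w) + (sgn (w s) * w s * h (L s w) + w s * k (L s w))" by (simp only: Mart_def)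
      show "V w * (of_real (Mart s w) * expo \<theta> s w) = V w * \<psi> s (w s)
       + (V w * of_real (h (L s w)) * (of_real (sgn (w s)) * \<phi> s (w s)) - V w * of_real (Hint h (L s w)) * \<psi> s (w s))
       + V w * of_real (k (L s w)) * \<phi> s (w s)"
        unfolding M \<phi>_def \<psi>_def expo_def e_def of_real_add of_real_diff of_real_mult of_real_1 by (simp only: algebra_simps mult_1_left)
    qed
    also have "\<dots> = (LINT w|P. V w * \<psi> s (w s)) + I.even_mean h s + (LINT w|P. V w * of_real (k (L s w)) * \<phi> s (w s))"
      unfolding I.even_mean_def using i1 i2 i3 i4
      by (simp only: Bochner_Integration.integral_add Bochner_Integration.integral_diff Bochner_Integration.integrable_add Bochner_Integration.integrable_diff)
    finally show ?thesis .
  qed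
  have psi: "(LINT w|P. V w * \<psi> t (w t)) = (LINT w|P. V w * \<psi> r (w r))"
    unfolding \<psi>_def e_def by (rule exponential_martingale[OF rt V(1) iV])
  show ?E unfolding ceq set_integral_add(2)[OF ikh] using rep[of t] rep[of r] psi kk hh rt by (simp add: algebra_simps)
qed

text \<open>The case \<theta> = 0, in which the drift disappears.\<close>

lemma Mart_martingale:
  assumes rt: "0 \<le> r" "r \<le> t" and V: "V \<in> borel_measurable (Filt r)" "\<And>w. cmod (V w) \<le> B"
  shows "(LINT w|P. V w * of_real (Mart t w)) = (LINT w|P. V w * of_real (Mart r w))"
  using Mart_expo_identity(2)[OF rt V, of 0] by (simp add: expo_def)

text \<open>Take both weights equal to \<open>f\<close>. The primitive vanishes, so the martingale
  is 1 + |X| f(L); having mean 1, it forces |X_t| f(L_t) = 0, while X_t is almost surely non-zero.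
  Consequently the law of L_t charges no Lebesgue-null set.\<close>

lemma L_null:
  assumes t: "0 < t" and f: "f \<in> borel_measurable borel" "\<And>x. 0 \<le> f x" "\<And>x. f x \<le> B" and null: "\<And>l. Hint f l = 0"
  shows "AE w in P. f (L t w) = 0"
proof -
  define c where "c = 1 / (B + 1)"
  have B: "0 \<le> B" using f(2,3)[of 0] by linarith
  interpret N: excursion_weights P L f f B
    by unfold_locales (use f null in \<open>auto simp: field_simps\<close>)
  have hN: "N.h = f" and kN: "N.k = (\<lambda>_. 0)" by (auto simp: N.h_def N.k_def fun_eq_iff)
  have M: "N.Mart s w = 1 + \<bar>w s\<bar> * f (L s w)" for s w by (simp add: N.Mart_def hN kN null)
  have "(LINT w|P. complex_of_real (N.Mart t w)) = (LINT w|P. complex_of_real (N.Mart 0 w))"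
    using N.Mart_martingale[of 0 t "\<lambda>_. 1" 1] t by simp
  then have "(LINT w|P. N.Mart t w) = (LINT w|P. N.Mart 0 w)"
    using N.Mart_integrable[of t] N.Mart_integrable[of 0] t by (simp only: integral_of_real of_real_eq_iff less_imp_le order_refl)
  also have "\<dots> = (LINT w|P. 1)" by (rule integral_cong_AE) (use N.Mart_0 in auto)
  finally have e: "(LINT w|P. N.Mart t w) = 1" using prob_space by simp
  have i: "integrable P (\<lambda>w. \<bar>w t\<bar> * f (L t w))"
    using Bochner_Integration.integrable_diff[OF N.Mart_integrable[of t] integrable_const[of 1]] t by (simp add: M)
  then have "(LINT w|P. \<bar>w t\<bar> * f (L t w)) = 0" using e prob_space unfolding M by simp
  then have "AE w in P. \<bar>w t\<bar> * f (L t w) = 0"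
    by (subst (asm) integral_nonneg_eq_0_iff_AE[OF i]) (use f(2) in auto)
  then show ?thesis using coord_nonzero[OF t] by eventually_elim auto
qed

end

section \<open>Joint measurability, and regular paths at each time horizon\<close>

lemma caratheodory_measurable:
  fixes f :: "real => 'a => real"
  assumes t: "0 \<le> t" and f: "\<And>s. s \<in> {0..t} ==> f s \<in> borel_measurable M"
    and cont: "\<And>x. x \<in> space M ==> continuous_on {0..t} (\<lambda>s. f s x)"
  shows "(\<lambda>(s, x). f (max 0 (min t s)) x) \<in> borel_measurable (borel \<Otimes>\<^sub>M M)"
proof -
  define cl where "cl s = max 0 (min t s)" for s
  have cl: "cl s \<in> {0..t}" for s using t by (auto simp: cl_def)
  \<comment> \<open>Time is rounded down to a multiple of 1 / (n + 1), so that it takes countably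
    many values; continuity in time recovers \<open>f\<close> in the limit. \<open>cl\<close> clamps
    time to [0, t], where \<open>f\<close> is known to be measurable.\<close>
  define g where "g n p = f (cl (real_of_int \<lfloor>real (Suc n) * fst p\<rfloor> / real (Suc n))) (snd p)" for n and p :: "real \<times> 'a"
  have gm: "g n \<in> borel_measurable (borel \<Otimes>\<^sub>M M)" for n
  proof -
    have "(\<lambda>p. (\<lambda>i p. f (cl (real_of_int i / real (Suc n))) (snd p)) \<lfloor>real (Suc n) * fst p\<rfloor> p) \<in> borel_measurable (borel \<Otimes>\<^sub>M M)"
    proof (rule measurable_compose_countable'[where I=UNIV and f="\<lambda>i p. f (cl (real_of_int i / real (Suc n))) (snd p)" and g="\<lambda>p. \<lfloor>real (Suc n) * fst p\<rfloor>"])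
      show "(\<lambda>p. f (cl (real_of_int i / real (Suc n))) (snd p)) \<in> borel_measurable (borel \<Otimes>\<^sub>M M)" for i
        by (rule measurable_compose[OF measurable_snd f[OF cl]])
      show "(\<lambda>p. \<lfloor>real (Suc n) * fst p\<rfloor>) \<in> measurable (borel \<Otimes>\<^sub>M M) (count_space UNIV)" by measurable
    qed auto
    then show ?thesis by (simp add: g_def[abs_def])
  qed
  have "(\<lambda>p. f (cl (fst p)) (snd p)) \<in> borel_measurable (borel \<Otimes>\<^sub>M M)"
  proof (rule borel_measurable_LIMSEQ_real[OF _ gm])
    fix p :: "real \<times> 'a" assume p: "p \<in> space (borel \<Otimes>\<^sub>M M)"
    have "(\<lambda>n. real_of_int \<lfloor>real (Suc n) * fst p\<rfloor> / real (Suc n)) \<longlonglongrightarrow> fst p"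
    proof (rule tendsto_sandwich)
      have "(\<lambda>n. fst p - 1 / real (Suc n)) \<longlonglongrightarrow> fst p - 0" by (intro tendsto_intros LIMSEQ_Suc[OF lim_1_over_n])
      then show "(\<lambda>n. fst p - 1 / real (Suc n)) \<longlonglongrightarrow> fst p" by simp
      show "(\<lambda>n. fst p) \<longlonglongrightarrow> fst p" by simp
      show "\<forall>\<^sub>F n in sequentially. fst p - 1 / real (Suc n) \<le> real_of_int \<lfloor>real (Suc n) * fst p\<rfloor> / real (Suc n)"
      proof (rule always_eventually, rule allI)
        fix n
        have "(real (Suc n) * fst p - 1) / real (Suc n) \<le> real_of_int \<lfloor>real (Suc n) * fst p\<rfloor> / real (Suc n)"
          by (intro divide_right_mono) linarith+
        then show "fst p - 1 / real (Suc n) \<le> real_of_int \<lfloor>real (Suc n) * fst p\<rfloor> / real (Suc n)"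
          by (simp add: diff_divide_distrib del: of_nat_Suc)
      qed
      show "\<forall>\<^sub>F n in sequentially. real_of_int \<lfloor>real (Suc n) * fst p\<rfloor> / real (Suc n) \<le> fst p"
      proof (rule always_eventually, rule allI)
        fix n
        have "real_of_int \<lfloor>real (Suc n) * fst p\<rfloor> / real (Suc n) \<le> real (Suc n) * fst p / real (Suc n)"
          by (intro divide_right_mono) linarith+
        then show "real_of_int \<lfloor>real (Suc n) * fst p\<rfloor> / real (Suc n) \<le> fst p" by simp
      qed
    qed
    then have "(\<lambda>n. cl (real_of_int \<lfloor>real (Suc n) * fst p\<rfloor> / real (Suc n))) \<longlonglongrightarrow> cl (fst p)"
      unfolding cl_def by (intro tendsto_intros)
    then show "(\<lambda>n. g n p) \<longlonglongrightarrow> f (cl (fst p)) (snd p)"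
      unfolding g_def using p by (intro continuous_on_tendsto_compose[OF cont] cl always_eventually allI) (auto simp: space_pair_measure)
  qed
  then show ?thesis by (simp add: cl_def split_beta')
qed

text \<open>\<open>grid_integral\<close> with drift 0: n steps, each with an error of order
  1/n^2.\<close>

lemma quadratic_increments_const:
  fixes \<phi> :: "real => complex"
  assumes rt: "r \<le> t" and step: "\<And>s u. r \<le> s ==> s \<le> u ==> u \<le> t ==> cmod (\<phi> u - \<phi> s) \<le> C * (u - s)\<^sup>2"
  shows "\<phi> t = \<phi> r"
proof -
  have "\<phi> t - \<phi> r = (LINT s:{r<..<t}|lborel. 0)"
  proof (rule grid_integral(2)[OF rt, where e="\<lambda>s u. C * (u - s)\<^sup>2" and K=0])
    have "(\<lambda>n. \<Sum>i<n. C * (grid r t n (Suc i) - grid r t n i)\<^sup>2) = (\<lambda>n. C * (t - r)\<^sup>2 / real n)"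
    proof
      fix n show "(\<Sum>i<n. C * (grid r t n (Suc i) - grid r t n i)\<^sup>2) = C * (t - r)\<^sup>2 / real n"
        by (cases "n = 0") (simp_all add: grid_step power_divide power2_eq_square)
    qed
    moreover have "(\<lambda>n. C * (t - r)\<^sup>2 / real n) \<longlonglongrightarrow> 0" by (rule lim_const_over_n)
    ultimately show "(\<lambda>n. \<Sum>i<n. C * (grid r t n (Suc i) - grid r t n i)\<^sup>2) \<longlonglongrightarrow> 0" by simp
  qed (use step in auto)
  then show ?thesis by simp
qed

context wiener_local_time
begin

text \<open>By \<open>AE_localise\<close>, almost every path agrees up to t with a path along which
  L is regular. Since each \<open>L s\<close> with s \<le> t depends on the path up to t only,
  regularity on [0, t] is inherited.\<close>

lemma good_sets_exist:
  "\<exists>G. \<forall>t\<ge>0. G t \<in> sets (Filt t) \<and> (AE w in P. w \<in> G t) \<and>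
     (\<forall>w\<in>G t. L 0 w = 0 \<and> continuous_on {0..t} (\<lambda>s. L s w) \<and> mono_on {0..t} (\<lambda>s. L s w))"
proof -
  obtain N where N: "\<And>w. w \<in> space P - N ==> L 0 w = 0 \<and> continuous_on {0..} (\<lambda>t. L t w) \<and> mono_on {0..} (\<lambda>t. L t w)" "N \<in> null_sets P"
    using AE_E3[OF L_regular] by blast
  define A where "A = path_space - N"
  have A: "A \<in> sets Filt_inf" using N(2) sets.compl_sets[of N P] by (auto simp: A_def sets_P)
  have AE: "AE w in P. w \<in> A" using AE_not_in[OF N(2)] AE_space[of P] by eventually_elim (simp add: A_def)
  have "\<exists>G. G \<in> sets (Filt t) \<and> (AE w in P. w \<in> G) \<and>
     (\<forall>w\<in>G. L 0 w = 0 \<and> continuous_on {0..t} (\<lambda>s. L s w) \<and> mono_on {0..t} (\<lambda>s. L s w))" if t: "0 \<le> t" for t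
  proof -
    obtain G where G: "G \<in> sets (Filt t)" "AE w in P. w \<in> G" "\<And>w. w \<in> G ==> \<exists>w'\<in>A. \<forall>s\<in>{0..t}. w s = w' s"
      using AE_localise[OF t A AE] by blast
    have "L 0 w = 0 \<and> continuous_on {0..t} (\<lambda>s. L s w) \<and> mono_on {0..t} (\<lambda>s. L s w)" if w: "w \<in> G" for w
    proof -
      obtain w' where w': "w' \<in> A" "\<And>s. s \<in> {0..t} ==> w s = w' s" using G(3)[OF w] by blast
      have ps: "w \<in> path_space" "w' \<in> path_space" using sets.sets_into_space[OF G(1)] w w'(1) by (auto simp: A_def)
      have eq: "L s w = L s w'" if "s \<in> {0..t}" for s
        by (rule Filt_agree[OF L_meas ps]) (use that w'(2) in auto)
      have reg: "L 0 w' = 0" "continuous_on {0..} (\<lambda>t. L t w')" "mono_on {0..} (\<lambda>t. L t w')"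
        using N(1)[of w'] w'(1) by (auto simp: A_def)
      have "continuous_on {0..t} (\<lambda>s. L s w')" by (rule continuous_on_subset[OF reg(2)]) auto
      then have "continuous_on {0..t} (\<lambda>s. L s w)" by (rule continuous_on_eq) (simp add: eq)
      moreover have "mono_on {0..t} (\<lambda>s. L s w)"
        by (rule mono_onI) (use eq mono_onD[OF reg(3)] in auto)
      ultimately show ?thesis using reg(1) eq[of 0] t by auto
    qed
    then show ?thesis using G by blast
  qed
  then show ?thesis by metis
qed

text \<open>One set for each horizon, lying in \<open>Filt t\<close>, so that fullness under P
  carries over to measures with a density on \<open>Filt t\<close>. Sets for different horizons are
  not nested; statements about two times ask for membership in both.\<close>

definition good :: "real => path set" where
  "good = (SOME G. \<forall>t\<ge>0. G t \<in> sets (Filt t) \<and> (AE w in P. w \<in> G t) \<and>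
     (\<forall>w\<in>G t. L 0 w = 0 \<and> continuous_on {0..t} (\<lambda>s. L s w) \<and> mono_on {0..t} (\<lambda>s. L s w)))"

lemma good:
  assumes "0 \<le> t"
  shows "good t \<in> sets (Filt t)" "AE w in P. w \<in> good t"
    "w \<in> good t ==> L 0 w = 0" "w \<in> good t ==> continuous_on {0..t} (\<lambda>s. L s w)" "w \<in> good t ==> mono_on {0..t} (\<lambda>s. L s w)"
proof -
  have "\<forall>t\<ge>0. good t \<in> sets (Filt t) \<and> (AE w in P. w \<in> good t) \<and>
     (\<forall>w\<in>good t. L 0 w = 0 \<and> continuous_on {0..t} (\<lambda>s. L s w) \<and> mono_on {0..t} (\<lambda>s. L s w))"
    unfolding good_def by (rule someI_ex[OF good_sets_exist])
  with assms have *: "good t \<in> sets (Filt t) \<and> (AE w in P. w \<in> good t) \<and>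
     (\<forall>w\<in>good t. L 0 w = 0 \<and> continuous_on {0..t} (\<lambda>s. L s w) \<and> mono_on {0..t} (\<lambda>s. L s w))" by simp
  show "good t \<in> sets (Filt t)" "AE w in P. w \<in> good t" using * by simp_all
  show "w \<in> good t ==> L 0 w = 0" "w \<in> good t ==> continuous_on {0..t} (\<lambda>s. L s w)" "w \<in> good t ==> mono_on {0..t} (\<lambda>s. L s w)"
    using * by simp_all
qed

lemma good_path: "0 \<le> t ==> w \<in> good t ==> w \<in> path_space"
  using sets.sets_into_space[OF good(1)] by auto

end

section \<open>The drift and its accumulated integral\<close>

context excursion_weights
begin

text \<open>Where \<open>Mart\<close> vanishes the quotient is 0 by the convention for
  division.\<close>

definition drift :: "real => path => real" where
  "drift s w = bb s w / Mart s w"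

text \<open>L is continuous in time on \<open>good t\<close> only, hence the indicator; clamping the
  time makes the function total while using coordinates up to t only. What remains is a Borel
  function of the jointly measurable pair (L, X).\<close>

lemma drift_joint:
  assumes t: "0 \<le> t"
  shows "(\<lambda>(s, w). indicator (good t) w * drift (max 0 (min t s)) w) \<in> borel_measurable (borel \<Otimes>\<^sub>M Filt t)"
proof -
  define cl where "cl s = max 0 (min t s)" for s
  define L' where "L' s w = indicator (good t) w * L s w" for s w
  have gm[measurable]: "good t \<in> sets (Filt t)" by (rule good(1)[OF t])
  have 1: "(\<lambda>(s, w). L' (max 0 (min t s)) w) \<in> borel_measurable (borel \<Otimes>\<^sub>M Filt t)"
  proof (rule caratheodory_measurable[OF t])
    show "L' s \<in> borel_measurable (Filt t)" if "s \<in> {0..t}" for s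
      unfolding L'_def[abs_def] using borel_measurable_times[OF borel_measurable_indicator[OF gm] L_Filt[of s t]] that by auto
    show "continuous_on {0..t} (\<lambda>s. L' s w)" for w
      using good(4)[OF t, of w] by (cases "w \<in> good t") (auto simp: L'_def)
  qed
  have 2: "(\<lambda>(s, w). w (max 0 (min t s))) \<in> borel_measurable (borel \<Otimes>\<^sub>M Filt t)"
    by (rule caratheodory_measurable[OF t, where f="\<lambda>s w. w s"])
      (auto intro!: coord_measurable_Filt intro: continuous_on_subset simp: path_space_def)
  define d where "d l x = (a l * indicator {0<..} x - b l * indicator {..<0} x) / (1 - Hint h l + (\<bar>x\<bar> * h l + x * k l))" for l x :: real
  have [measurable]: "a \<in> borel_measurable borel" "b \<in> borel_measurable borel" "Hint h \<in> borel_measurable borel"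
    using a_borel b_borel by (auto intro!: Hint_borel[OF h_borel h_bounds(3)])
  have d: "(\<lambda>p. d (fst p) (snd p)) \<in> borel_measurable (borel \<Otimes>\<^sub>M borel)" unfolding d_def by measurable
  have "(\<lambda>p. (L' (cl (fst p)) (snd p), (snd p) (cl (fst p)))) \<in> measurable (borel \<Otimes>\<^sub>M Filt t) (borel \<Otimes>\<^sub>M borel)"
    using 1 2 unfolding cl_def split_beta' by (rule measurable_Pair)
  from measurable_compose[OF this d]
  have 3: "(\<lambda>p. d (L' (cl (fst p)) (snd p)) ((snd p) (cl (fst p)))) \<in> borel_measurable (borel \<Otimes>\<^sub>M Filt t)" by simp
  have 4: "(\<lambda>p. indicator (good t) (snd p) :: real) \<in> borel_measurable (borel \<Otimes>\<^sub>M Filt t)"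
    by (rule measurable_compose[OF measurable_snd]) measurable
  have "indicator (good t) w * drift (cl s) w = indicator (good t) w * d (L' (cl s) w) (w (cl s))" for s w
    by (auto simp: L'_def d_def drift_def bb_def Mart_def indicator_def)
  then have "(\<lambda>(s, w). indicator (good t) w * drift (max 0 (min t s)) w) = (\<lambda>p. indicator (good t) (snd p) * d (L' (cl (fst p)) (snd p)) ((snd p) (cl (fst p))))"
    unfolding cl_def by (simp only: split_beta')
  then show ?thesis using borel_measurable_times[OF 4 3] by (simp only:)
qed

lemma drift_section:
  assumes t: "0 \<le> t" and w: "w \<in> good t"
  shows "(\<lambda>s. indicator {0..t} s * drift s w) \<in> borel_measurable borel"
proof -
  have wp: "w \<in> space (Filt t)" using good_path[OF t w] by simp
  have "(\<lambda>s. indicator (good t) w * drift (max 0 (min t s)) w) \<in> borel_measurable borel"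
    using measurable_compose[OF measurable_Pair2'[OF wp] drift_joint[OF t]] by (simp only: prod.case)
  then have "(\<lambda>s. indicator {0..t} s * (indicator (good t) w * drift (max 0 (min t s)) w)) \<in> borel_measurable borel"
    by (rule borel_measurable_times[rotated]) auto
  moreover have "(\<lambda>s. indicator {0..t} s * (indicator (good t) w * drift (max 0 (min t s)) w)) = (\<lambda>s. indicator {0..t} s * drift s w)"
  proof
    fix s show "indicator {0..t} s * (indicator (good t) w * drift (max 0 (min t s)) w) = indicator {0..t} s * drift s w"
      using w by (cases "s \<in> {0..t}") (simp_all add: max_absorb2 min_absorb2)
  qed
  ultimately show ?thesis by (simp only:)
qed

lemma drift_set_integrable:
  assumes t: "0 \<le> t" and w: "w \<in> good t" and A: "A \<in> sets borel" "A \<subseteq> {0..t}"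
    and bound: "\<And>s. s \<in> {0..t} ==> \<bar>drift s w\<bar> \<le> \<beta>"
  shows "set_integrable lborel A (\<lambda>s. drift s w)"
  unfolding set_integrable_def
proof (rule Bochner_Integration.integrable_bound)
  show "integrable lborel (\<lambda>s. \<beta> * indicator {0..t} s)"
    by (intro integrable_mult_right integrable_real_indicator) (auto simp: emeasure_lborel_Icc_eq)
  have "(\<lambda>s. indicator A s * (indicator {0..t} s * drift s w)) \<in> borel_measurable borel"
    using A drift_section[OF t w] by measurable
  moreover have "indicator A s * (indicator {0..t} s * drift s w) = indicator A s *\<^sub>R drift s w" for s
    using A(2) by (auto simp: indicator_def)
  ultimately show "(\<lambda>s. indicator A s *\<^sub>R drift s w) \<in> borel_measurable lborel" by simp
  show "AE s in lborel. norm (indicator A s *\<^sub>R drift s w) \<le> norm (\<beta> * indicator {0..t} s)"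
  proof (rule AE_I2)
    fix s show "norm (indicator A s *\<^sub>R drift s w) \<le> norm (\<beta> * indicator {0..t} s)"
      using bound[of s] A(2) by (auto simp: indicator_def)
  qed
qed

text \<open>Cut off outside \<open>good t\<close>: the uncut integral need not be measurable,
  whereas this version is measurable for \<open>Filt t\<close>.\<close>

definition acc :: "real => real => path => real" where
  "acc r t w = indicator (good t) w * (LBINT s:{r..t}. drift s w)"

lemma acc_Filt:
  assumes rt: "0 \<le> r" "r \<le> t"
  shows "acc r t \<in> borel_measurable (Filt t)"
proof -
  have t: "0 \<le> t" using rt by simp
  have "(\<lambda>(w, s). indicator {r..t} s * (indicator (good t) w * drift (max 0 (min t s)) w)) \<in> borel_measurable (Filt t \<Otimes>\<^sub>M lborel)"
  proof -
    have "(\<lambda>p. (snd p, fst p)) \<in> measurable (Filt t \<Otimes>\<^sub>M lborel) (borel \<Otimes>\<^sub>M Filt t)"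
      by (rule measurable_Pair) (auto simp: measurable_lborel2)
    from measurable_compose[OF this drift_joint[OF t]]
    have "(\<lambda>p. indicator (good t) (fst p) * drift (max 0 (min t (snd p))) (fst p)) \<in> borel_measurable (Filt t \<Otimes>\<^sub>M lborel)"
      by (simp add: split_beta')
    from borel_measurable_times[OF _ this, of "\<lambda>p. indicator {r..t} (snd p)"]
    show ?thesis by (simp add: split_beta' measurable_compose[OF measurable_snd])
  qed
  from lborel.borel_measurable_lebesgue_integral[OF this]
  have "(\<lambda>w. \<integral>s. indicator {r..t} s * (indicator (good t) w * drift (max 0 (min t s)) w) \<partial>lborel) \<in> borel_measurable (Filt t)" by simp
  moreover have "(LINT s|lborel. indicator {r..t} s * (indicator (good t) w * drift (max 0 (min t s)) w)) = acc r t w" for w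
  proof -
    have "(LINT s|lborel. indicator {r..t} s * (indicator (good t) w * drift (max 0 (min t s)) w))
      = (LINT s|lborel. indicator (good t) w * (indicator {r..t} s * drift s w))"
      by (rule Bochner_Integration.integral_cong[OF refl]) (use rt in \<open>auto simp: indicator_def max_def min_def\<close>)
    then show ?thesis unfolding acc_def set_lebesgue_integral_def by simp
  qed
  ultimately show ?thesis by simp
qed

lemma acc_refl: "acc r r w = 0"
proof -
  have "(LBINT s:{r..r}. drift s w) = 0" unfolding set_lebesgue_integral_def
    by (rule integral_eq_zero_AE) (use AE_lborel_singleton[of r] in \<open>eventually_elim, auto\<close>)
  then show ?thesis by (simp add: acc_def)
qed

text \<open>The second piece is taken over the open interval, the form in which time integrals occur
  in the drift identities.\<close>

lemma drift_split:
  assumes t: "0 \<le> t" and w: "w \<in> good t" and rsu: "0 \<le> r" "r \<le> s" "s \<le> u" "u \<le> t"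
    and bound: "\<And>v. v \<in> {0..t} ==> \<bar>drift v w\<bar> \<le> \<beta>"
  shows "(LBINT v:{r..u}. drift v w) = (LBINT v:{r..s}. drift v w) + (LBINT v:{s<..<u}. drift v w)"
    and "\<bar>LBINT v:{s<..<u}. drift v w\<bar> \<le> \<beta> * (u - s)"
proof -
  have i: "set_integrable lborel A (\<lambda>v. drift v w)" if "A \<in> sets borel" "A \<subseteq> {0..t}" for A
    by (rule drift_set_integrable[OF t w that bound])
  have "(LBINT v:{r..u}. drift v w) = (LBINT v:{r..s} \<union> {s<..u}. drift v w)"
    using rsu by (intro arg_cong[where f="\<lambda>A. (LBINT v:A. drift v w)"]) auto
  also have "\<dots> = (LBINT v:{r..s}. drift v w) + (LBINT v:{s<..u}. drift v w)"
    by (rule set_integral_Un) (use rsu in \<open>auto intro!: i\<close>)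
  also have "(LBINT v:{s<..u}. drift v w) = (LBINT v:{s<..<u}. drift v w)"
  proof -
    have m: "set_integrable lborel {s<..u} (\<lambda>v. drift v w)" "set_integrable lborel {s<..<u} (\<lambda>v. drift v w)"
      by (rule i; use rsu in auto)+
    show ?thesis unfolding set_lebesgue_integral_def
  proof (rule integral_cong_AE)
    show "AE v in lborel. indicator {s<..u} v *\<^sub>R drift v w = indicator {s<..<u} v *\<^sub>R drift v w"
      using AE_lborel_singleton[of u] by eventually_elim (auto simp: indicator_def)
  qed (use m in \<open>auto simp: set_integrable_def\<close>)
  qed
  finally show "(LBINT v:{r..u}. drift v w) = (LBINT v:{r..s}. drift v w) + (LBINT v:{s<..<u}. drift v w)" .
  have ii: "set_integrable lborel {s<..<u} (\<lambda>v. drift v w)" by (rule i) (use rsu in auto)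
  have "\<bar>LBINT v:{s<..<u}. drift v w\<bar> \<le> (LINT v|lborel. norm (indicator {s<..<u} v *\<^sub>R drift v w))"
    unfolding set_lebesgue_integral_def using integral_norm_bound[of lborel "\<lambda>v. indicator {s<..<u} v *\<^sub>R drift v w"] by simp
  also have "\<dots> \<le> (LINT v|lborel. \<beta> * indicator {s<..<u} v)"
  proof (rule integral_mono)
    show "integrable lborel (\<lambda>v. norm (indicator {s<..<u} v *\<^sub>R drift v w))" using ii by (auto simp: set_integrable_def)
    show "integrable lborel (\<lambda>v. \<beta> * indicator {s<..<u} v)" using rsu by (intro integrable_mult_right integrable_real_indicator) auto
    fix v show "norm (indicator {s<..<u} v *\<^sub>R drift v w) \<le> \<beta> * indicator {s<..<u} v"
      using bound[of v] rsu by (auto simp: indicator_def)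
  qed
  also have "\<dots> = \<beta> * (u - s)" using rsu by simp
  finally show "\<bar>LBINT v:{s<..<u}. drift v w\<bar> \<le> \<beta> * (u - s)" .
qed

lemma acc_split:
  assumes rsu: "0 \<le> r" "r \<le> s" "s \<le> u" and w: "w \<in> good s" "w \<in> good u"
    and bound: "\<And>v. v \<in> {0..u} ==> \<bar>drift v w\<bar> \<le> \<beta>"
  shows "acc r u w = acc r s w + (LBINT v:{s<..<u}. drift v w)" "\<bar>LBINT v:{s<..<u}. drift v w\<bar> \<le> \<beta> * (u - s)"
  using drift_split[OF _ w(2) rsu order_refl bound] rsu w by (simp_all add: acc_def)

end

lemma set_integral_Ioo_bound:
  fixes f :: "real => complex"
  assumes "s \<le> u" "set_integrable lborel {s<..<u} f" "\<And>x. x \<in> {s<..<u} ==> cmod (f x) \<le> C"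
  shows "cmod (LINT x:{s<..<u}|lborel. f x) \<le> C * (u - s)"
proof -
  have "cmod (LINT x:{s<..<u}|lborel. f x) \<le> (LINT x|lborel. norm (indicator {s<..<u} x *\<^sub>R f x))"
    unfolding set_lebesgue_integral_def by (rule integral_norm_bound)
  also have "\<dots> \<le> (LINT x|lborel. C * indicator {s<..<u} x)"
  proof (rule integral_mono)
    show "integrable lborel (\<lambda>x. norm (indicator {s<..<u} x *\<^sub>R f x))" by (rule integrable_norm[OF assms(2)[unfolded set_integrable_def]])
    show "integrable lborel (\<lambda>x. C * indicator {s<..<u} x)" using assms(1) by (intro integrable_mult_right integrable_real_indicator) auto
  qed (use assms(3) in \<open>auto simp: indicator_def\<close>)
  also have "\<dots> = C * (u - s)" using assms(1) by simp
  finally show ?thesis .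
qed

section \<open>The Girsanov identity for a martingale bounded away from 0\<close>

context excursion_weights
begin

lemma drift_Filt: "0 \<le> s ==> drift s \<in> borel_measurable (Filt s)"
  unfolding drift_def[abs_def] using bb_Filt[of s] Mart_Filt[of s] by measurable

lemma Mart_mean: "0 \<le> t ==> (LINT w|P. Mart t w) = 1"
proof -
  assume t: "0 \<le> t"
  have "(LINT w|P. complex_of_real (Mart t w)) = (LINT w|P. complex_of_real (Mart 0 w))"
    using Mart_martingale[of 0 t "\<lambda>_. 1" 1] t by simp
  then have "(LINT w|P. Mart t w) = (LINT w|P. Mart 0 w)"
    using Mart_integrable[of t] Mart_integrable[of 0] t by (simp only: integral_of_real of_real_eq_iff order_refl)
  also have "\<dots> = (LINT w|P. 1)" by (rule integral_cong_AE) (use Mart_0 in auto)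
  finally show ?thesis using prob_space by simp
qed

text \<open>\<open>Mart\<close> is non-negative with mean 1, so integrating against it does not
  enlarge the bound on \<open>Z\<close>, although \<open>Mart\<close> itself is unbounded.\<close>

lemma Mart_expo_bound:
  assumes s: "0 \<le> s" and Z: "Z \<in> borel_measurable P" "AE w in P. cmod (Z w) \<le> B"
  shows "integrable P (\<lambda>w. Z w * (of_real (Mart s w) * expo \<theta> s w))"
    and "cmod (LINT w|P. Z w * (of_real (Mart s w) * expo \<theta> s w)) \<le> B * exp (\<theta>\<^sup>2 * s / 2)"
proof -
  have m: "(\<lambda>w. Z w * (of_real (Mart s w) * expo \<theta> s w)) \<in> borel_measurable P"
    using Z(1) Mart_borel[OF s] measurable_Filt_P[OF expo_Filt[OF s, of \<theta>]] by measurable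
  have le: "AE w in P. cmod (Z w * (of_real (Mart s w) * expo \<theta> s w)) \<le> B * exp (\<theta>\<^sup>2 * s / 2) * Mart s w"
    using Z(2)
  proof eventually_elim
    case (elim w)
    have "cmod (Z w * (of_real (Mart s w) * expo \<theta> s w)) = cmod (Z w) * (Mart s w * exp (\<theta>\<^sup>2 * s / 2))"
      unfolding norm_mult expo_norm norm_of_real using Mart_nonneg[of s w] by simp
    also have "\<dots> \<le> B * (Mart s w * exp (\<theta>\<^sup>2 * s / 2))" using elim Mart_nonneg[of s w] by (intro mult_right_mono) auto
    finally show ?case by (simp add: mult.commute mult.left_commute)
  qed
  have iM: "integrable P (\<lambda>w. B * exp (\<theta>\<^sup>2 * s / 2) * Mart s w)" using Mart_integrable[OF s] by simp
  show i: "integrable P (\<lambda>w. Z w * (of_real (Mart s w) * expo \<theta> s w))"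
    by (rule Bochner_Integration.integrable_bound[OF iM m]) (use le in \<open>auto elim!: eventually_mono\<close>)
  have "cmod (LINT w|P. Z w * (of_real (Mart s w) * expo \<theta> s w)) \<le> (LINT w|P. cmod (Z w * (of_real (Mart s w) * expo \<theta> s w)))"
    by (rule integral_norm_bound)
  also have "\<dots> \<le> (LINT w|P. B * exp (\<theta>\<^sup>2 * s / 2) * Mart s w)"
    by (rule integral_mono_AE[OF integrable_norm[OF i] iM le])
  also have "\<dots> = B * exp (\<theta>\<^sup>2 * s / 2)" using Mart_mean[OF s] by simp
  finally show "cmod (LINT w|P. Z w * (of_real (Mart s w) * expo \<theta> s w)) \<le> B * exp (\<theta>\<^sup>2 * s / 2)" .
qed

lemma bb_expo_bound:
  assumes s: "0 \<le> s" and Z: "Z \<in> borel_measurable P" "\<And>w. cmod (Z w) \<le> B"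
  shows "cmod (LINT w|P. Z w * (\<i> * of_real \<theta> * of_real (bb s w) * expo \<theta> s w)) \<le> B * (\<bar>\<theta>\<bar> * K * exp (\<theta>\<^sup>2 * s / 2))"
proof -
  have B: "0 \<le> B" using Z(2) norm_ge_zero order_trans by blast
  have le: "cmod (Z w * (\<i> * of_real \<theta> * of_real (bb s w) * expo \<theta> s w)) \<le> B * (\<bar>\<theta>\<bar> * K * exp (\<theta>\<^sup>2 * s / 2))" for w
    unfolding norm_mult expo_norm norm_of_real norm_ii mult_1_left
    using Z(2)[of w] bb_le[of s w] B K_pos by (intro mult_mono mult_nonneg_nonneg) auto
  have m: "(\<lambda>w. Z w * (\<i> * of_real \<theta> * of_real (bb s w) * expo \<theta> s w)) \<in> borel_measurable P"
    using Z(1) measurable_Filt_P[OF bb_Filt[OF s]] measurable_Filt_P[OF expo_Filt[OF s, of \<theta>]] by measurable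
  have i: "integrable P (\<lambda>w. Z w * (\<i> * of_real \<theta> * of_real (bb s w) * expo \<theta> s w))"
    by (rule integrable_const_bound[OF _ m]) (use le in auto)
  have "cmod (LINT w|P. Z w * (\<i> * of_real \<theta> * of_real (bb s w) * expo \<theta> s w)) \<le> (LINT w|P. cmod (Z w * (\<i> * of_real \<theta> * of_real (bb s w) * expo \<theta> s w)))"
    by (rule integral_norm_bound)
  also have "\<dots> \<le> (LINT w|P. B * (\<bar>\<theta>\<bar> * K * exp (\<theta>\<^sup>2 * s / 2)))"
    by (rule integral_mono[OF integrable_norm[OF i]]) (use le in auto)
  finally show ?thesis using prob_space by simp
qed

context
  fixes c :: real
  assumes c: "0 < c" and away: "\<And>l. Hint h l \<le> 1 - c"
begin

lemma Mart_ge_c: "c \<le> Mart s w"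
  using Mart_ge[of s w] away[of "L s w"] by linarith

lemma drift_bound: "\<bar>drift s w\<bar> \<le> K / c"
  unfolding drift_def abs_divide using Mart_ge_c[of s w] bb_le[of s w] c K_pos by (intro frac_le) auto

lemma drift_Mart: "drift s w * Mart s w = bb s w"
  using Mart_ge_c[of s w] c by (simp add: drift_def)

text \<open>Exchange of time integral and expectation. The clamped and cut version of the drift is
  jointly measurable and bounded by K / c; on the good sets it coincides with the drift.\<close>

lemma drift_fubini:
  fixes Z :: "path => complex"
  assumes su: "0 \<le> s" "s \<le> u" and Z: "integrable P Z"
  shows "set_integrable lborel {s<..<u} (\<lambda>v. \<integral>w. of_real (drift v w) * Z w \<partial>P)"
    and "(LINT w|P. of_real (acc s u w) * Z w) = (LINT v:{s<..<u}|lborel. (LINT w|P. of_real (drift v w) * Z w))"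
proof -
  have u: "0 \<le> u" using su by simp
  interpret pair_sigma_finite P "lborel :: real measure" ..
  define \<beta> where "\<beta> = K / c"
  have \<beta>: "0 \<le> \<beta>" using K_pos c by (simp add: \<beta>_def)
  define D where "D w v = indicator (good u) w * drift (max 0 (min u v)) w" for w v
  have Db: "\<bar>D w v\<bar> \<le> \<beta>" for w v using drift_bound[of "max 0 (min u v)" w] \<beta> by (auto simp: D_def \<beta>_def indicator_def)
  define F where "F w v = (indicator {s<..<u} v * D w v) *\<^sub>R Z w" for w v
  have id: "(\<lambda>w. w) \<in> measurable P (Filt u)" using measurable_Filt_P[OF measurable_ident_sets[OF refl]] .
  have Dm: "(\<lambda>p. D (fst p) (snd p)) \<in> borel_measurable (P \<Otimes>\<^sub>M lborel)"
  proof -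
    have "(\<lambda>p. (snd p, fst p)) \<in> measurable (P \<Otimes>\<^sub>M lborel) (borel \<Otimes>\<^sub>M Filt u)"
      by (rule measurable_Pair) (use measurable_compose[OF measurable_fst id] in \<open>auto simp: measurable_lborel2\<close>)
    from measurable_compose[OF this drift_joint[OF u]] show ?thesis by (simp add: D_def split_beta')
  qed
  have Zm[measurable]: "Z \<in> borel_measurable P" using Z by auto
  have Fm: "(\<lambda>(w, v). F w v) \<in> borel_measurable (P \<Otimes>\<^sub>M lborel)"
  proof -
    have "(\<lambda>p. indicator {s<..<u} (snd p) :: real) \<in> borel_measurable (P \<Otimes>\<^sub>M lborel)"
      by (rule measurable_compose[OF measurable_snd]) simp
    from borel_measurable_scaleR[OF borel_measurable_times[OF this Dm] measurable_compose[OF measurable_fst Zm]]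
    show ?thesis by (simp add: F_def split_beta')
  qed
  have Fb: "cmod (F w v) \<le> \<beta> * cmod (Z w) * indicator {s<..<u} v" for w v
    using mult_right_mono[OF Db[of w v], of "cmod (Z w)"] by (auto simp: F_def indicator_def)
  have bi: "integrable lborel (\<lambda>v. x * indicator {s<..<u} v)" for x :: real
    using su by (intro integrable_mult_right integrable_real_indicator) auto
  have sec: "F w \<in> borel_measurable borel" if "w \<in> space P" for w
    using measurable_compose[OF measurable_Pair1'[OF that, of lborel] Fm] by simp
  have inner: "integrable lborel (F w)" if "w \<in> space P" for w
    by (rule Bochner_Integration.integrable_bound[OF bi[of "\<beta> * cmod (Z w)"]])
      (use sec[OF that] Fb \<beta> in \<open>auto simp: abs_mult\<close>)
  have int: "integrable (P \<Otimes>\<^sub>M lborel) (\<lambda>(w, v). F w v)"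
  proof (rule Fubini_integrable[OF Fm])
    show "integrable P (\<lambda>w. \<integral>v. norm (case (w, v) of (w, v) => F w v) \<partial>lborel)"
    proof (rule Bochner_Integration.integrable_bound[of _ "\<lambda>w. \<beta> * (u - s) * cmod (Z w)"])
      show "integrable P (\<lambda>w. \<beta> * (u - s) * cmod (Z w))" using Z by auto
      show "(\<lambda>w. \<integral>v. norm (case (w, v) of (w, v) => F w v) \<partial>lborel) \<in> borel_measurable P"
        by (rule lborel.borel_measurable_lebesgue_integral) (use measurable_compose[OF Fm borel_measurable_continuous_onI[OF continuous_on_norm_id]] in \<open>simp add: split_beta'\<close>)
      show "AE w in P. norm (LINT v|lborel. norm (case (w, v) of (w, v) => F w v)) \<le> norm (\<beta> * (u - s) * cmod (Z w))"
        using AE_space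
      proof eventually_elim
        case (elim w)
        have "(LINT v|lborel. norm (F w v)) \<le> (LINT v|lborel. \<beta> * cmod (Z w) * indicator {s<..<u} v)"
          by (rule integral_mono[OF integrable_norm[OF inner[OF elim]] bi]) (rule Fb)
        also have "\<dots> = \<beta> * (u - s) * cmod (Z w)" using su by simp
        finally show ?case using \<beta> su by (simp add: abs_mult)
      qed
    qed
    show "AE w in P. integrable lborel (\<lambda>v. case (w, v) of (w, v) => F w v)" using inner by auto
  qed
  have eqv: "(LINT w|P. F w v) = indicator {s<..<u} v *\<^sub>R (LINT w|P. of_real (drift v w) * Z w)" for v
  proof (cases "v \<in> {s<..<u}")
    case True
    then have v: "0 \<le> v" "v \<le> u" using su by auto
    have [measurable]: "drift v \<in> borel_measurable P" by (rule measurable_Filt_P[OF drift_Filt[OF v(1)]])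
    have [measurable]: "good u \<in> events" using good(1)[OF u] sets_Filt_le sets_P by blast
    have "(LINT w|P. F w v) = (LINT w|P. of_real (drift v w) * Z w)"
    proof (rule integral_cong_AE)
      show "AE w in P. F w v = of_real (drift v w) * Z w"
        using good(2)[OF u] by eventually_elim (use True v in \<open>simp add: F_def D_def scaleR_conv_of_real\<close>)
      show "(\<lambda>w. F w v) \<in> borel_measurable P" unfolding F_def D_def using v by (simp add: max_absorb2 min_absorb2)
    qed measurable
    then show ?thesis using True by simp
  qed (simp add: F_def)
  have eqw: "(LINT v|lborel. F w v) = of_real (acc s u w) * Z w" if w: "w \<in> good u" and ws: "w \<in> good s" for w
  proof -
    have "set_integrable lborel {s<..<u} (\<lambda>v. drift v w)"
      by (rule drift_set_integrable[OF u w _ _ drift_bound]) (use su in auto)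
    then have i: "integrable lborel (\<lambda>v. indicator {s<..<u} v *\<^sub>R drift v w)" by (simp add: set_integrable_def)
    have "F w v = (indicator {s<..<u} v *\<^sub>R drift v w) *\<^sub>R Z w" for v
      using w su by (auto simp: F_def D_def indicator_def)
    then have "(LINT v|lborel. F w v) = (LINT v|lborel. indicator {s<..<u} v *\<^sub>R drift v w) *\<^sub>R Z w"
      using integral_scaleR_left[of "Z w" lborel "\<lambda>v. indicator {s<..<u} v *\<^sub>R drift v w"] i by (simp only:)
    moreover have "acc s u w = (LBINT v:{s<..<u}. drift v w)"
      using acc_split(1)[OF su(1) order_refl su(2) ws w drift_bound] by (simp add: acc_refl)
    ultimately show ?thesis by (simp add: set_lebesgue_integral_def scaleR_conv_of_real)
  qed
  show "set_integrable lborel {s<..<u} (\<lambda>v. \<integral>w. of_real (drift v w) * Z w \<partial>P)"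
    unfolding set_integrable_def eqv[symmetric] using integrable_snd[OF int] by simp
  have "(LINT v:{s<..<u}|lborel. (LINT w|P. of_real (drift v w) * Z w)) = (LINT v|lborel. (LINT w|P. F w v))"
    unfolding set_lebesgue_integral_def eqv ..
  also have "\<dots> = (LINT w|P. (LINT v|lborel. F w v))" by (rule Fubini_integral[OF int])
  also have "\<dots> = (LINT w|P. of_real (acc s u w) * Z w)"
  proof (rule integral_cong_AE)
    show "AE w in P. (LINT v|lborel. F w v) = of_real (acc s u w) * Z w"
      using good(2)[OF u] good(2)[OF su(1)] by eventually_elim (rule eqw)
    show "(\<lambda>w. \<integral>v. F w v \<partial>lborel) \<in> borel_measurable P"
      using lborel.borel_measurable_lebesgue_integral[OF Fm] by simp
    show "(\<lambda>w. of_real (acc s u w) * Z w) \<in> borel_measurable P"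
      using measurable_Filt_P[OF acc_Filt[OF su]] by measurable
  qed
  finally show "(LINT w|P. of_real (acc s u w) * Z w) = (LINT v:{s<..<u}|lborel. (LINT w|P. of_real (drift v w) * Z w))" by simp
qed

text \<open>The first-order terms of the increments of
  \<open>s \<mapsto> E[V exp(-i \<theta> A\<^sub>s) M\<^sub>s exp(i \<theta> X\<^sub>s + \<theta>\<^sup>2 s / 2)]\<close> cancel, where \<open>A = acc\<close>,
  so that these increments are of second order.\<close>

lemma girsanov_bounded:
  assumes rt: "0 \<le> r" "r \<le> t" and V: "V \<in> borel_measurable (Filt r)" "\<And>w. cmod (V w) \<le> B"
  shows "(LINT w|P. V w * iexp (- \<theta> * acc r t w) * (of_real (Mart t w) * expo \<theta> t w))
    = (LINT w|P. V w * (of_real (Mart r w) * expo \<theta> r w))"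
proof -
  define \<beta> where "\<beta> = K / c"
  define E where "E = exp (\<theta>\<^sup>2 * t / 2)"
  have \<beta>: "0 \<le> \<beta>" using K_pos c by (simp add: \<beta>_def)
  have E: "0 \<le> E" by (simp add: E_def)
  have B: "0 \<le> B" using V(2) norm_ge_zero order_trans by blast
  have ebound: "exp (\<theta>\<^sup>2 * s / 2) \<le> E" if "s \<le> t" for s using that by (simp add: E_def mult_left_mono)
  define N where "N s w = of_real (Mart s w) * expo \<theta> s w" for s w
  \<comment> \<open>The past weight with the compensating phase included; it is known at time s, so
    the drift identity from s onwards applies with it.\<close>
  define U where "U s w = V w * iexp (- \<theta> * acc r s w)" for s w
  have Ub: "cmod (U s w) \<le> B" for s w using V(2)[of w] norm_exp_i_times[of "- \<theta> * acc r s w"] by (simp add: U_def norm_mult)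
  have Um: "U s \<in> borel_measurable (Filt s)" if "r \<le> s" for s
  proof -
    have [measurable]: "V \<in> borel_measurable (Filt s)" "acc r s \<in> borel_measurable (Filt s)"
      using measurable_Filt_mono[OF V(1) that] acc_Filt[OF rt(1) that] by simp_all
    show ?thesis unfolding U_def[abs_def] by measurable
  qed
  define \<Phi> where "\<Phi> s = (LINT w|P. U s w * N s w)" for s
  define C where "C = (B * (\<theta>\<^sup>2 * \<beta>\<^sup>2 / 2)) * E + \<bar>\<theta>\<bar> * (B * \<beta> * (\<bar>\<theta>\<bar> * K * E))"
  have step: "cmod (\<Phi> u - \<Phi> s) \<le> C * (u - s)\<^sup>2" if su: "r \<le> s" "s \<le> u" "u \<le> t" for s u
  proof -
    have s0: "0 \<le> s" and u0: "0 \<le> u" using su rt by auto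
    have UmP: "U s \<in> borel_measurable P" "U u \<in> borel_measurable P" using measurable_Filt_P[OF Um] su by auto
    have iN: "integrable P (\<lambda>w. Y w * N u w)" if "Y \<in> borel_measurable P" "\<And>w. cmod (Y w) \<le> B'" for Y B'
      unfolding N_def by (rule Mart_expo_integrable[OF u0 that])
    define G where "G v = (LINT w|P. U s w * (\<i> * of_real \<theta> * of_real (bb v w) * expo \<theta> v w))" for v
    define D where "D v = (LINT w|P. of_real (drift v w) * (U s w * N u w))" for v
    note A1 = Mart_expo_identity[OF s0 su(2) Um[OF su(1)] Ub, of \<theta>, folded N_def G_def]
    have iUN: "integrable P (\<lambda>w. U s w * N u w)" by (rule iN[OF UmP(1) Ub])
    note A2 = drift_fubini[OF s0 su(2) iUN, folded D_def]
    \<comment> \<open>Remainder of the first-order expansion of the phase. It is quadratic in u - s,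
      as the drift is bounded and hence \<open>acc s u\<close> is of order u - s.\<close>
    define R where "R w = U u w - U s w + \<i> * of_real \<theta> * of_real (acc s u w) * U s w" for w
    have accm: "acc s u \<in> borel_measurable P" by (rule measurable_Filt_P[OF acc_Filt[OF s0 su(2)]])
    have Rm: "R \<in> borel_measurable P" unfolding R_def[abs_def] using UmP accm by measurable
    have split: "acc r u w = acc r s w + acc s u w" "\<bar>acc s u w\<bar> \<le> \<beta> * (u - s)" if "w \<in> good s" "w \<in> good u" for w
      using acc_split[OF rt(1) su(1,2) that drift_bound] acc_split[OF s0 order_refl su(2) that drift_bound]
      by (simp_all add: acc_refl \<beta>_def)
    have R: "AE w in P. cmod (R w) \<le> B * (\<theta>\<^sup>2 * \<beta>\<^sup>2 / 2) * (u - s)\<^sup>2"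
      using good(2)[OF s0] good(2)[OF u0]
    proof eventually_elim
      case (elim w)
      define x where "x = - \<theta> * acc s u w"
      have "iexp (- \<theta> * acc r u w) = iexp (- \<theta> * acc r s w) * iexp x"
        unfolding split(1)[OF elim] x_def by (simp add: exp_add[symmetric] algebra_simps)
      then have "R w = U s w * (iexp x - (1 + \<i> * of_real x))" by (simp add: R_def U_def x_def algebra_simps)
      moreover have "cmod (iexp x - (1 + \<i> * of_real x)) \<le> x\<^sup>2 / 2"
        using iexp_approx1[of x 1] by (simp add: power2_eq_square)
      ultimately have "cmod (R w) \<le> B * (x\<^sup>2 / 2)" using mult_mono[OF Ub[of s w] _ B norm_ge_zero] by (simp only: norm_mult)
      also have "x\<^sup>2 \<le> \<theta>\<^sup>2 * (\<beta> * (u - s))\<^sup>2"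
        unfolding x_def power_mult_distrib using abs_le_square_iff[of "acc s u w" "\<beta> * (u - s)"] split(2)[OF elim] \<beta> su
        by (simp add: mult_left_mono power_mult_distrib abs_mult)
      finally show ?case using B by (simp add: power_mult_distrib mult_left_mono mult.assoc)
    qed
    have iR: "integrable P (\<lambda>w. R w * N u w)" and nR: "cmod (LINT w|P. R w * N u w) \<le> B * (\<theta>\<^sup>2 * \<beta>\<^sup>2 / 2) * (u - s)\<^sup>2 * exp (\<theta>\<^sup>2 * u / 2)"
      using Mart_expo_bound[OF u0 Rm R, of \<theta>] by (simp_all add: N_def)
    have iUu: "integrable P (\<lambda>w. U u w * N u w)" by (rule iN[OF UmP(2) Ub])
    have "\<i> * of_real \<theta> * (of_real (acc s u w) * (U s w * N u w)) = R w * N u w - U u w * N u w + U s w * N u w" for w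
      by (simp add: R_def algebra_simps)
    then have "\<i> * of_real \<theta> * (LINT w|P. of_real (acc s u w) * (U s w * N u w)) = (LINT w|P. R w * N u w - U u w * N u w + U s w * N u w)"
      by (simp only: integral_mult_right_zero[symmetric])
    also have "\<dots> = (LINT w|P. R w * N u w) - \<Phi> u + (LINT w|P. U s w * N u w)"
      unfolding \<Phi>_def using iR iUu iUN by simp
    finally have eq: "\<Phi> u - \<Phi> s = (LINT w|P. R w * N u w) + ((LINT v:{s<..<u}|lborel. G v) - \<i> * of_real \<theta> * (LINT v:{s<..<u}|lborel. D v))"
      using A1(2) A2(2) by (simp add: \<Phi>_def algebra_simps)
    have iD: "set_integrable lborel {s<..<u} (\<lambda>v. \<i> * of_real \<theta> * D v)" by (rule set_integrable_mult_right) (use A2(1) in simp)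
    have eq': "(LINT v:{s<..<u}|lborel. G v) - \<i> * of_real \<theta> * (LINT v:{s<..<u}|lborel. D v) = (LINT v:{s<..<u}|lborel. G v - \<i> * of_real \<theta> * D v)"
      by (subst set_integral_diff(2)[OF A1(1) iD]) simp
    define e where "e = \<bar>\<theta>\<bar> * (B * \<beta> * (\<bar>\<theta>\<bar> * K * E)) * (u - s)"
    \<comment> \<open>Because drift times \<open>Mart\<close> is \<open>bb\<close>,
      \<open>G v\<close> is i\<theta> times the mean of \<open>W\<close> against N at time v, while
      \<open>D v\<close> is the mean against N at time u. The difference is again an increment
      governed by the drift identity, hence of order u - v, and integrating over v gives a quadratic
      error.\<close>
    have point: "cmod (G v - \<i> * of_real \<theta> * D v) \<le> e" if v: "v \<in> {s<..<u}" for v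
    proof -
      have v0: "0 \<le> v" and sv: "s \<le> v" and vu: "v \<le> u" using v s0 by auto
      define W where "W w = of_real (drift v w) * U s w" for w
      have Wm: "W \<in> borel_measurable (Filt v)" unfolding W_def[abs_def]
        using drift_Filt[OF v0] measurable_Filt_mono[OF Um[OF su(1)] sv] by measurable
      have Wb: "cmod (W w) \<le> B * \<beta>" for w
        using mult_mono[OF drift_bound[of v w] Ub[of s w]] \<beta> by (simp add: W_def norm_mult \<beta>_def mult.commute)
      note I = Mart_expo_identity[OF v0 vu Wm Wb, of \<theta>, folded N_def]
      have "D v = (LINT w|P. W w * N u w)" by (simp add: D_def W_def mult.assoc)
      moreover have "G v = \<i> * of_real \<theta> * (LINT w|P. W w * N v w)"
      proof -
        have "\<i> * of_real \<theta> * (W w * N v w) = U s w * (\<i> * of_real \<theta> * of_real (bb v w) * expo \<theta> v w)" for w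
          by (simp add: W_def N_def drift_Mart[symmetric])
        then show ?thesis unfolding G_def by (simp only: integral_mult_right_zero[symmetric])
      qed
      ultimately have "G v - \<i> * of_real \<theta> * D v = - (\<i> * of_real \<theta>) * ((LINT w|P. W w * N u w) - (LINT w|P. W w * N v w))"
        by (simp add: algebra_simps)
      then have n: "cmod (G v - \<i> * of_real \<theta> * D v) = \<bar>\<theta>\<bar> * cmod (LINT x:{v<..<u}|lborel. (LINT w|P. W w * (\<i> * of_real \<theta> * of_real (bb x w) * expo \<theta> x w)))"
        unfolding I(2) by (simp add: norm_mult)
      have "cmod (LINT x:{v<..<u}|lborel. (LINT w|P. W w * (\<i> * of_real \<theta> * of_real (bb x w) * expo \<theta> x w))) \<le> B * \<beta> * (\<bar>\<theta>\<bar> * K * E) * (u - v)"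
      proof (rule set_integral_Ioo_bound[OF vu I(1)])
        fix x assume x: "x \<in> {v<..<u}"
        have "cmod (LINT w|P. W w * (\<i> * of_real \<theta> * of_real (bb x w) * expo \<theta> x w)) \<le> B * \<beta> * (\<bar>\<theta>\<bar> * K * exp (\<theta>\<^sup>2 * x / 2))"
          by (rule bb_expo_bound[OF _ measurable_Filt_P[OF Wm] Wb]) (use x v0 in auto)
        also have "\<dots> \<le> B * \<beta> * (\<bar>\<theta>\<bar> * K * E)"
          using ebound[of x] x su B \<beta> K_pos by (intro mult_left_mono) auto
        finally show "cmod (LINT w|P. W w * (\<i> * of_real \<theta> * of_real (bb x w) * expo \<theta> x w)) \<le> B * \<beta> * (\<bar>\<theta>\<bar> * K * E)" .
      qed
      also have "\<dots> \<le> B * \<beta> * (\<bar>\<theta>\<bar> * K * E) * (u - s)"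
        using B \<beta> K_pos E sv by (intro mult_left_mono) auto
      finally have "\<bar>\<theta>\<bar> * cmod (LINT x:{v<..<u}|lborel. (LINT w|P. W w * (\<i> * of_real \<theta> * of_real (bb x w) * expo \<theta> x w))) \<le> \<bar>\<theta>\<bar> * (B * \<beta> * (\<bar>\<theta>\<bar> * K * E) * (u - s))"
        by (rule mult_left_mono) simp
      then show ?thesis unfolding n e_def by (simp only: mult.assoc)
    qed
    have "cmod (LINT v:{s<..<u}|lborel. G v - \<i> * of_real \<theta> * D v) \<le> e * (u - s)"
      by (rule set_integral_Ioo_bound[OF su(2) set_integral_diff(1)[OF A1(1) iD] point])
    moreover have "cmod (LINT w|P. R w * N u w) \<le> B * (\<theta>\<^sup>2 * \<beta>\<^sup>2 / 2) * (u - s)\<^sup>2 * E"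
      by (rule order_trans[OF nR]) (use ebound[OF su(3)] B in \<open>intro mult_left_mono, auto\<close>)
    ultimately have "cmod (\<Phi> u - \<Phi> s) \<le> B * (\<theta>\<^sup>2 * \<beta>\<^sup>2 / 2) * (u - s)\<^sup>2 * E + e * (u - s)"
      unfolding eq eq' by (intro norm_triangle_mono)
    also have "\<dots> = C * (u - s)\<^sup>2" by (simp add: C_def e_def power2_eq_square field_simps)
    finally show ?thesis .
  qed
  have "\<Phi> t = \<Phi> r" by (rule quadratic_increments_const[OF rt(2) step])
  then show ?thesis by (simp add: \<Phi>_def U_def N_def acc_refl)
qed

end

end

section \<open>Removing the lower bound on the martingale\<close>

lemma Hint_mono:
  assumes h: "h \<in> borel_measurable borel" "\<And>x. \<bar>h x\<bar> \<le> K" "\<And>x. 0 \<le> h x" and le: "x \<le> y"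
  shows "Hint h x \<le> Hint h y"
proof -
  have "0 \<le> (LBINT z:{0..y} - {0..x}. h z)" unfolding set_lebesgue_integral_def
    by (rule Bochner_Integration.integral_nonneg) (simp add: h(3))
  then show ?thesis using Hint_diff[OF h(1,2) le] by linarith
qed

text \<open>The primitive is increasing and continuous, so in [0, l] the set {H \<le> q} is an
  initial interval {0..m}. Cutting \<open>h\<close> off outside it stops the primitive at H(m),
  which is q unless l comes first.\<close>

lemma Hint_truncate:
  assumes h: "h \<in> borel_measurable borel" "\<And>x. \<bar>h x\<bar> \<le> K" "\<And>x. 0 \<le> h x" and q: "0 \<le> q"
  shows "Hint (\<lambda>x. h x * indicator {x. Hint h x \<le> q} x) l = min q (Hint h l)"
proof (cases "0 \<le> l")
  case False
  then have e: "{0..l} = {}" by simp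
  show ?thesis using q unfolding Hint_def e by (simp add: set_lebesgue_integral_def)
next
  case l: True
  let ?A = "{x. Hint h x \<le> q}"
  have cont: "continuous_on A (Hint h)" for A
  proof (rule lipschitz_on_continuous_on[of K])
    show "K-lipschitz_on A (Hint h)"
      using Hint_lipschitz[OF h(1,2)] h(2)[of 0] by (intro lipschitz_onI) (auto simp: dist_real_def abs_minus_commute)
  qed
  have mono: "Hint h x \<le> Hint h y" if "x \<le> y" for x y by (rule Hint_mono[OF h that])
  have "\<exists>m\<in>{0..l}. {0..l} \<inter> ?A = {0..m} \<and> Hint h m = min q (Hint h l)"
  proof (cases "Hint h l \<le> q")
    case True
    have "Hint h x \<le> q" if "x \<le> l" for x using mono[OF that] True by linarith
    then show ?thesis using l True by (intro bexI[of _ l]) auto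
  next
    case False
    have "closed {x \<in> {0..l}. Hint h x \<le> q}"
      by (rule continuous_on_closed_Collect_le[OF cont continuous_on_const]) simp
    moreover have "{x \<in> {0..l}. Hint h x \<le> q} = {0..l} \<inter> ?A" by blast
    ultimately have "compact ({0..l} \<inter> ({0..l} \<inter> ?A))" by (intro compact_Int_closed compact_Icc) (simp only:)
    then have cp: "compact ({0..l} \<inter> ?A)" by (simp only: Int_left_absorb)
    have "0 \<in> {0..l} \<inter> ?A" using l q Hint_0[OF h(1,2)] by simp
    then have ne: "{0..l} \<inter> ?A \<noteq> {}" by blast
    \<comment> \<open>The largest point with H \<le> q, attained by compactness. By the intermediate
      value theorem H equals q there, for otherwise a larger point would qualify.\<close>
    obtain m where m: "m \<in> {0..l} \<inter> ?A" and m': "\<forall>x\<in>{0..l} \<inter> ?A. x \<le> m"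
      using compact_attains_sup[OF cp ne] by (rule bexE)
    note m = m m'[rule_format]
    have "Hint h m = q"
    proof (rule ccontr)
      assume "Hint h m \<noteq> q"
      then have lt: "Hint h m < q" using m(1) by auto
      have m0: "0 \<le> m" "m \<le> l" using m(1) by simp_all
      have "\<exists>x\<ge>m. x \<le> l \<and> Hint h x = q"
        by (rule IVT'[OF less_imp_le[OF lt] _ m0(2) cont]) (use False in linarith)
      then obtain x where x: "m \<le> x" "x \<le> l" "Hint h x = q" by blast
      have "x \<le> m" by (rule m(2)) (use x m0 in simp)
      then have "Hint h x \<le> Hint h m" by (rule mono)
      then show False using x(3) lt by linarith
    qed
    moreover have "{0..l} \<inter> ?A = {0..m}"
    proof (intro equalityI subsetI)
      fix x assume "x \<in> {0..l} \<inter> ?A" then show "x \<in> {0..m}" using m(2)[of x] by simp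
    next
      fix x assume x: "x \<in> {0..m}"
      then have "Hint h x \<le> Hint h m" by (intro mono) simp
      then show "x \<in> {0..l} \<inter> ?A" using x m(1) by simp
    qed
    moreover have "m \<in> {0..l}" "min q (Hint h l) = q" using m(1) False by simp_all
    ultimately show ?thesis by metis
  qed
  then obtain m where m: "{0..l} \<inter> ?A = {0..m}" "Hint h m = min q (Hint h l)" by blast
  have "Hint (\<lambda>x. h x * indicator ?A x) l = Hint h m"
    unfolding Hint_def m(1)[symmetric] set_lebesgue_integral_def
    by (rule Bochner_Integration.integral_cong) (auto simp: indicator_def)
  then show ?thesis using m(2) by simp
qed

definition level :: "nat => real" where "level n = 1 - 1 / real (n + 2)"

lemma level: "0 \<le> level n" "level n < 1" "level \<longlonglongrightarrow> 1"
proof -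
  show "0 \<le> level n" "level n < 1" by (simp_all add: level_def)
  have "(\<lambda>n. 1 - 1 / real (n + 2)) \<longlonglongrightarrow> 1" by real_asymp
  then show "level \<longlonglongrightarrow> 1" by (simp add: level_def[abs_def])
qed

lemma below_level: "x < 1 ==> \<forall>\<^sub>F n in sequentially. x \<le> level n"
  using order_tendstoD(1)[OF level(3), of x] by (auto elim: eventually_mono)

lemma not_below_level: "1 \<le> x ==> \<not> x \<le> level n"
  using level(2)[of n] by linarith

context excursion_weights
begin

text \<open>Cutting the weights off where \<open>H\<close> exceeds \<open>level n < 1\<close> bounds the martingale away from 0.
  Nothing is lost in the limit, since almost surely \<open>h(L\<^sub>t) = 0\<close> wherever \<open>H(L\<^sub>t) = 1\<close>.\<close>

definition cut :: "nat => real => real" where "cut n x = indicator {x. Hint h x \<le> level n} x"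

lemma Hint_h_borel [measurable]: "Hint h \<in> borel_measurable borel"
  by (rule Hint_borel[OF h_borel h_bounds(3)])

lemma cut_borel [measurable]: "cut n \<in> borel_measurable borel"
  unfolding cut_def[abs_def] by measurable

lemma cut_limit: "(\<lambda>n. cut n x) \<longlonglongrightarrow> indicator {x. Hint h x < 1} x"
proof (cases "Hint h x < 1")
  case True
  have "\<forall>\<^sub>F n in sequentially. cut n x = indicator {x. Hint h x < 1} x"
    using below_level[OF True] by eventually_elim (simp add: cut_def True)
  then show ?thesis by (rule tendsto_eventually)
next
  case False
  then have "cut n x = indicator {x. Hint h x < 1} x" for n using not_below_level[of "Hint h x" n] by (simp add: cut_def)
  then show ?thesis by simp
qed

lemma Hint_cut: "Hint (\<lambda>x. h x * cut n x) l = min (level n) (Hint h l)"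
  unfolding cut_def by (rule Hint_truncate[OF h_borel h_bounds(3,1) level(1)])

text \<open>No mass is left beyond H = 1. The integral of \<open>h\<close> above the n-th level is H
  - min (level n) H, which tends to 0, while the integrands converge boundedly to \<open>h\<close>
  on {H \<ge> 1}.\<close>

lemma Hint_exhausted: "Hint (\<lambda>x. h x * indicator {x. 1 \<le> Hint h x} x) l = 0"
proof -
  let ?f = "\<lambda>x. h x * indicator {x. 1 \<le> Hint h x} x"
  have "(\<lambda>n. Hint (\<lambda>x. h x - h x * cut n x) l) \<longlonglongrightarrow> Hint ?f l"
  proof (rule Hint_lim[of _ K])
    show "\<bar>h x - h x * cut n x\<bar> \<le> K" for n x
      using h_bounds(1,2)[of x] K_pos by (simp add: cut_def indicator_def)
    show "(\<lambda>n. h x - h x * cut n x) \<longlonglongrightarrow> ?f x" for x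
    proof -
      have "(\<lambda>n. h x - h x * cut n x) \<longlonglongrightarrow> h x - h x * indicator {x. Hint h x < 1} x"
        by (intro tendsto_intros cut_limit)
      moreover have "h x - h x * indicator {x. Hint h x < 1} x = ?f x" by (simp add: indicator_def)
      ultimately show ?thesis by simp
    qed
  qed measurable
  moreover have "(\<lambda>n. Hint (\<lambda>x. h x - h x * cut n x) l) \<longlonglongrightarrow> 0"
  proof -
    have i: "set_integrable lborel {0..l} h" by (rule bounded_set_integrable[OF h_borel h_bounds(3)]) (auto simp: emeasure_lborel_Icc_eq)
    have i': "set_integrable lborel {0..l} (\<lambda>x. h x * cut n x)" for n
      by (rule bounded_set_integrable[of _ K]) (use h_bounds(1,2) K_pos in \<open>auto simp: cut_def indicator_def emeasure_lborel_Icc_eq\<close>)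
    have "Hint (\<lambda>x. h x - h x * cut n x) l = Hint h l - min (level n) (Hint h l)" for n
      unfolding Hint_cut[symmetric] unfolding Hint_def by (rule set_integral_diff(2)[OF i i'])
    moreover have "(\<lambda>n. Hint h l - min (level n) (Hint h l)) \<longlonglongrightarrow> Hint h l - min 1 (Hint h l)"
      by (intro tendsto_intros level(3))
    moreover have "Hint h l - min 1 (Hint h l) = 0" using Hint_h_bounds(2)[of l] by simp
    ultimately show ?thesis by simp
  qed
  ultimately show ?thesis by (rule LIMSEQ_unique)
qed

text \<open>On {H \<ge> 1} the function \<open>h\<close> is almost everywhere zero, and
  \<open>L_null\<close> turns this into an almost sure statement at L_t.\<close>

lemma exhausted_weight:
  assumes t: "0 < t"
  shows "AE w in P. 1 \<le> Hint h (L t w) \<longrightarrow> h (L t w) = 0"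
proof -
  have "AE w in P. (\<lambda>x. h x * indicator {x. 1 \<le> Hint h x} x) (L t w) = 0"
    by (rule L_null[OF t, of _ K]) (use h_bounds(1,2) K_pos Hint_exhausted in \<open>auto simp: indicator_def\<close>)
  then show ?thesis by eventually_elim (auto simp: indicator_def)
qed

lemma exhausted_Mart:
  assumes t: "0 < t"
  shows "AE w in P. 1 \<le> Hint h (L t w) \<longrightarrow> Mart t w = 0"
  using exhausted_weight[OF t]
proof eventually_elim
  case (elim w)
  show ?case
  proof
    assume 1: "1 \<le> Hint h (L t w)"
    then have "h (L t w) = 0" "Hint h (L t w) = 1" using elim Hint_h_bounds(2)[of "L t w"] by auto
    then show "Mart t w = 0" using h_bounds(5)[of "L t w"] by (simp add: Mart_def)
  qed
qed

text \<open>For s \<le> t, Mart_s \<ge> 1 - H(L_s) \<ge> 1 - H(L_t) because L is increasing along a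
  good path. The bound depends on the path but is uniform over [0, t].\<close>

lemma drift_bounded_below_one:
  assumes t: "0 \<le> t" and w: "w \<in> good t" "Hint h (L t w) < 1" and s: "s \<in> {0..t}"
  shows "\<bar>drift s w\<bar> \<le> K / (1 - Hint h (L t w))"
proof -
  have "L s w \<le> L t w" using mono_onD[OF good(5)[OF t w(1)], of s t] s by auto
  then have "Hint h (L s w) \<le> Hint h (L t w)" by (rule Hint_mono[OF h_borel h_bounds(3,1)])
  then have "1 - Hint h (L t w) \<le> Mart s w" using Mart_ge[of s w] by linarith
  then show ?thesis unfolding drift_def abs_divide using bb_le[of s w] w(2) K_pos by (intro frac_le) auto
qed

text \<open>The truncated weights satisfy the bounded version for each n. In the limit both sides
  converge by domination: where H(L_t) < 1 the truncation is eventually not felt, and where H(L_t) =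
  1 the martingale at time t vanishes.\<close>

lemma girsanov:
  assumes rt: "0 \<le> r" "r \<le> t" and V: "V \<in> borel_measurable (Filt r)" "\<And>w. cmod (V w) \<le> B"
  shows "(LINT w|P. V w * iexp (- \<theta> * acc r t w) * (of_real (Mart t w) * expo \<theta> t w))
    = (LINT w|P. V w * (of_real (Mart r w) * expo \<theta> r w))"
proof -
  have t: "0 \<le> t" using rt by simp
  have B: "0 \<le> B" using V(2) norm_ge_zero order_trans by blast
  interpret T: excursion_weights P L "\<lambda>x. a x * cut n x" "\<lambda>x. b x * cut n x" K for n
  proof unfold_locales
    show "(\<lambda>x. a x * cut n x) \<in> borel_measurable borel" "(\<lambda>x. b x * cut n x) \<in> borel_measurable borel"
      using a_borel b_borel by measurable
    show "0 \<le> a x * cut n x" "0 \<le> b x * cut n x" "a x * cut n x \<le> K" "b x * cut n x \<le> K" for x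
      using a_nonneg[of x] b_nonneg[of x] a_le[of x] b_le[of x] K_pos by (simp_all add: cut_def indicator_def)
    have "Hint (\<lambda>x. (a x * cut n x + b x * cut n x) / 2) l = min (level n) (Hint h l)" for l
      unfolding Hint_cut[symmetric] by (simp add: h_def algebra_simps)
    then show "Hint (\<lambda>x. (a x * cut n x + b x * cut n x) / 2) l \<le> 1" for l using Hint_h_bounds(2)[of l] by simp
  qed
  have Th: "T.h n = (\<lambda>x. h x * cut n x)" and Tk: "T.k n = (\<lambda>x. k x * cut n x)" for n
    by (auto simp: T.h_def T.k_def h_def k_def fun_eq_iff algebra_simps)
  have TM: "T.Mart n s w = 1 - min (level n) (Hint h (L s w)) + (\<bar>w s\<bar> * h (L s w) + w s * k (L s w)) * cut n (L s w)" for n s w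
    by (simp add: T.Mart_def Th Tk Hint_cut algebra_simps)
  have Tbb: "T.bb n s w = bb s w * cut n (L s w)" for n s w by (simp add: T.bb_def bb_def algebra_simps)
  \<comment> \<open>In the shape required by the bounded version, with c = 1 - level n.\<close>
  have away: "Hint (T.h n) l \<le> 1 - (1 - level n)" for n l by (simp add: Th Hint_cut)
  have Tdrift: "T.drift n s w = drift s w" if "Hint h (L s w) \<le> level n" for n s w
    unfolding T.drift_def drift_def Tbb TM Mart_def using that by (simp add: cut_def)
  have Mlim: "AE w in P. (\<lambda>n. T.Mart n s w) \<longlonglongrightarrow> Mart s w" if s: "0 \<le> s" for s
  proof (cases "s = 0")
    case True
    have "AE w in P. \<forall>n. T.Mart n 0 w = 1" using T.Mart_0 by (simp add: AE_all_countable)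
    then show ?thesis using Mart_0 unfolding True by eventually_elim simp
  next
    case False
    then have "0 < s" using s by simp
    from exhausted_weight[OF this] show ?thesis
    proof eventually_elim
      case (elim w)
      let ?x = "\<bar>w s\<bar> * h (L s w) + w s * k (L s w)"
      have "(\<lambda>n. T.Mart n s w) \<longlonglongrightarrow> 1 - min 1 (Hint h (L s w)) + ?x * indicator {x. Hint h x < 1} (L s w)"
        unfolding TM by (intro tendsto_intros level(3) cut_limit)
      moreover have "1 - min 1 (Hint h (L s w)) + ?x * indicator {x. Hint h x < 1} (L s w) = Mart s w"
      proof (cases "Hint h (L s w) < 1")
        case False
        then have "h (L s w) = 0" using elim by simp
        then show ?thesis using False Hint_h_bounds(2)[of "L s w"] h_bounds(5)[of "L s w"] by (simp add: Mart_def)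
      qed (simp add: Mart_def)
      ultimately show ?case by simp
    qed
  qed
  \<comment> \<open>The bound 1 + 2 K |X_s| holds for every truncated martingale with the same K;
    the lower bound, which degenerates as n grows, plays no part in it.\<close>
  have dom: "AE w in P. cmod (Y w * (of_real (T.Mart n s w) * expo \<theta> s w)) \<le> B * exp (\<theta>\<^sup>2 * s / 2) * (1 + 2 * K * \<bar>w s\<bar>)"
    if "\<And>w. cmod (Y w) \<le> B" for Y n s
  proof (rule AE_I2)
    fix w :: path
    have "cmod (Y w * (of_real (T.Mart n s w) * expo \<theta> s w)) = cmod (Y w) * (T.Mart n s w * exp (\<theta>\<^sup>2 * s / 2))"
      unfolding norm_mult expo_norm norm_of_real using T.Mart_nonneg[of n s w] by simp
    also have "\<dots> \<le> B * ((1 + 2 * K * \<bar>w s\<bar>) * exp (\<theta>\<^sup>2 * s / 2))"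
      by (intro mult_mono that mult_right_mono T.Mart_le) (use B T.Mart_nonneg in auto)
    finally show "cmod (Y w * (of_real (T.Mart n s w) * expo \<theta> s w)) \<le> B * exp (\<theta>\<^sup>2 * s / 2) * (1 + 2 * K * \<bar>w s\<bar>)" by (simp only: mult_ac)
  qed
  have domi: "integrable P (\<lambda>w. B * exp (\<theta>\<^sup>2 * s / 2) * (1 + 2 * K * \<bar>w s\<bar>))" if "0 \<le> s" for s
    using coord_moments(1)[OF that] by auto
  have Vm: "V \<in> borel_measurable P" by (rule measurable_Filt_P[OF V(1)])
  have eb: "cmod (V w * iexp x) \<le> B" for w x using V(2)[of w] by (simp add: norm_mult)
  have ex: "expo \<theta> s \<in> borel_measurable P" if "0 \<le> s" for s by (rule measurable_Filt_P[OF expo_Filt[OF that]])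
  have R: "(\<lambda>n. \<integral>w. V w * (of_real (T.Mart n r w) * expo \<theta> r w) \<partial>P) \<longlonglongrightarrow> (LINT w|P. V w * (of_real (Mart r w) * expo \<theta> r w))"
  proof (rule integral_dominated_convergence[OF _ _ domi[OF rt(1)] _ dom[OF V(2)]])
    show "(\<lambda>w. V w * (of_real (Mart r w) * expo \<theta> r w)) \<in> borel_measurable P"
      using Vm ex[OF rt(1)] Mart_borel[OF rt(1)] by measurable
    show "(\<lambda>w. V w * (of_real (T.Mart n r w) * expo \<theta> r w)) \<in> borel_measurable P" for n
      using Vm ex[OF rt(1)] T.Mart_borel[OF rt(1), of n] by measurable
    show "AE w in P. (\<lambda>n. V w * (of_real (T.Mart n r w) * expo \<theta> r w)) \<longlonglongrightarrow> V w * (of_real (Mart r w) * expo \<theta> r w)"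
      using Mlim[OF rt(1)] by eventually_elim (intro tendsto_intros)
  qed
  have S: "(\<lambda>n. \<integral>w. V w * iexp (- \<theta> * T.acc n r t w) * (of_real (T.Mart n t w) * expo \<theta> t w) \<partial>P)
      \<longlonglongrightarrow> (LINT w|P. V w * iexp (- \<theta> * acc r t w) * (of_real (Mart t w) * expo \<theta> t w))"
  proof (rule integral_dominated_convergence[OF _ _ domi[OF t] _ dom[OF eb]])
    have am: "acc r t \<in> borel_measurable P" "T.acc n r t \<in> borel_measurable P" for n
      using measurable_Filt_P[OF acc_Filt[OF rt]] measurable_Filt_P[OF T.acc_Filt[OF rt]] by auto
    show "(\<lambda>w. V w * iexp (- \<theta> * acc r t w) * (of_real (Mart t w) * expo \<theta> t w)) \<in> borel_measurable P"
      using Vm ex[OF t] Mart_borel[OF t] am(1) by measurable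
    show "(\<lambda>w. V w * iexp (- \<theta> * T.acc n r t w) * (of_real (T.Mart n t w) * expo \<theta> t w)) \<in> borel_measurable P" for n
      using Vm ex[OF t] T.Mart_borel[OF t, of n] am(2)[of n] by measurable
    have zero: "AE w in P. 1 \<le> Hint h (L t w) \<longrightarrow> Mart t w = 0"
    proof (cases "t = 0")
      case True
      show ?thesis using L_regular unfolding True by eventually_elim (simp add: Hint_0[OF h_borel h_bounds(3)])
    qed (use exhausted_Mart t in auto)
    show "AE w in P. (\<lambda>n. V w * iexp (- \<theta> * T.acc n r t w) * (of_real (T.Mart n t w) * expo \<theta> t w))
       \<longlonglongrightarrow> V w * iexp (- \<theta> * acc r t w) * (of_real (Mart t w) * expo \<theta> t w)"
      using Mlim[OF t] good(2)[OF t] zero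
    proof eventually_elim
      case (elim w)
      show ?case
      proof (cases "Hint h (L t w) < 1")
        case True
        \<comment> \<open>Once level n is at least H(L_t) it is at least H(L_s) for all s \<le> t,
          so the truncated drift coincides with the drift on [r, t].\<close>
        have "\<forall>\<^sub>F n in sequentially. T.acc n r t w = acc r t w"
          using below_level[OF True]
        proof eventually_elim
          case (elim n)
          have "T.drift n s w = drift s w" if s: "s \<in> {r..t}" for s
          proof (rule Tdrift)
            have "L s w \<le> L t w" using mono_onD[OF good(5)[OF t \<open>w \<in> good t\<close>], of s t] s rt by auto
            then show "Hint h (L s w) \<le> level n" using Hint_mono[OF h_borel h_bounds(3,1)] elim order_trans by blast
          qed
          then have "(LBINT s:{r..t}. T.drift n s w) = (LBINT s:{r..t}. drift s w)"
            by (intro set_lebesgue_integral_cong) auto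
          then show ?case by (simp add: T.acc_def acc_def)
        qed
        then have "(\<lambda>n. T.acc n r t w) \<longlonglongrightarrow> acc r t w" by (rule tendsto_eventually)
        then show ?thesis using elim(1) by (intro tendsto_intros)
      next
        case False
        then have M0: "Mart t w = 0" using elim(3) by simp
        \<comment> \<open>Nothing is known about the convergence of the truncated integrals here,
          but they enter through a phase of modulus 1, multiplied by martingales that tend to
          0.\<close>
        have "(\<lambda>n. V w * iexp (- \<theta> * T.acc n r t w) * (of_real (T.Mart n t w) * expo \<theta> t w)) \<longlonglongrightarrow> 0"
        proof (rule Lim_null_comparison)
          show "\<forall>\<^sub>F n in sequentially. cmod (V w * iexp (- \<theta> * T.acc n r t w) * (of_real (T.Mart n t w) * expo \<theta> t w))
             \<le> B * (\<bar>T.Mart n t w\<bar> * exp (\<theta>\<^sup>2 * t / 2))"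
          proof (rule always_eventually, rule allI)
            fix n
            show "cmod (V w * iexp (- \<theta> * T.acc n r t w) * (of_real (T.Mart n t w) * expo \<theta> t w)) \<le> B * (\<bar>T.Mart n t w\<bar> * exp (\<theta>\<^sup>2 * t / 2))"
              unfolding norm_mult[of _ "of_real (T.Mart n t w) * expo \<theta> t w"] using eb[of w "- \<theta> * T.acc n r t w"]
              by (simp only: norm_mult norm_of_real expo_norm) (intro mult_right_mono, auto)
          qed
          have "(\<lambda>n. B * (\<bar>T.Mart n t w\<bar> * exp (\<theta>\<^sup>2 * t / 2))) \<longlonglongrightarrow> B * (\<bar>0\<bar> * exp (\<theta>\<^sup>2 * t / 2))"
            using elim(1) unfolding M0 by (intro tendsto_intros)
          then show "(\<lambda>n. B * (\<bar>T.Mart n t w\<bar> * exp (\<theta>\<^sup>2 * t / 2))) \<longlonglongrightarrow> 0" by simp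
        qed
        then show ?thesis unfolding M0 by simp
      qed
    qed
  qed
  have fin: "(LINT w|P. V w * iexp (- \<theta> * T.acc n r t w) * (of_real (T.Mart n t w) * expo \<theta> t w))
     = (LINT w|P. V w * (of_real (T.Mart n r w) * expo \<theta> r w))" for n
    by (rule T.girsanov_bounded[OF _ away rt V]) (use level(2)[of n] in simp)
  show ?thesis by (rule LIMSEQ_unique[OF S[unfolded fin] R])
qed

end

section \<open>The transformed measure\<close>

locale h_transform = excursion_weights +
  fixes Q :: "path measure"
  assumes Q_prob: "prob_space Q" and sets_Q [measurable_cong]: "sets Q = sets Filt_inf"
    and Q_Filt: "0 \<le> s ==> \<Gamma> \<in> sets (Filt s) ==> measure Q \<Gamma> = (LINT w|P. indicator \<Gamma> w * Mart s w)"

sublocale h_transform \<subseteq> Q: prob_space Q by (rule Q_prob)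

context h_transform
begin

lemma space_Q [simp]: "space Q = path_space" using sets_eq_imp_space_eq[OF sets_Q] by simp

lemma subalgebra_Q: "subalgebra Q (Filt t)"
  using sets_Filt_le by (auto simp: subalgebra_def sets_Q)

lemma measurable_Filt_Q: "f \<in> measurable (Filt s) N ==> f \<in> measurable Q N"
  using measurable_from_subalg[OF subalgebra_Q] .

lemma Q_restr:
  assumes t: "0 \<le> t"
  shows "restr_to_subalg Q (Filt t) = density (restr_to_subalg P (Filt t)) (\<lambda>w. ennreal (Mart t w))"
proof (rule measure_eqI)
  show "sets (restr_to_subalg Q (Filt t)) = sets (density (restr_to_subalg P (Filt t)) (\<lambda>w. ennreal (Mart t w)))"
    by (simp add: sets_restr_to_subalg[OF subalgebra_Q] sets_restr_to_subalg[OF subalgebra_Filt])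
  fix A assume "A \<in> sets (restr_to_subalg Q (Filt t))"
  then have A[measurable]: "A \<in> sets (Filt t)" by (simp add: sets_restr_to_subalg[OF subalgebra_Q])
  then have AP: "A \<in> events" using sets_Filt_le sets_P by blast
  have [measurable]: "Mart t \<in> borel_measurable (Filt t)" by (rule Mart_Filt[OF t])
  have m: "(\<lambda>w. ennreal (Mart t w)) \<in> borel_measurable (Filt t)" "(\<lambda>w. ennreal (Mart t w) * indicator A w) \<in> borel_measurable (Filt t)"
    by measurable
  have i: "integrable P (\<lambda>w. indicator A w * Mart t w)"
    using integrable_real_mult_indicator[OF AP Mart_integrable[OF t]] by (simp add: mult.commute)
  have "emeasure (density (restr_to_subalg P (Filt t)) (\<lambda>w. ennreal (Mart t w))) A
    = (\<integral>\<^sup>+ w. ennreal (Mart t w) * indicator A w \<partial>restr_to_subalg P (Filt t))"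
    using m(1) A by (intro emeasure_density) (simp_all add: sets_restr_to_subalg[OF subalgebra_Filt] measurable_cong_sets[OF sets_restr_to_subalg[OF subalgebra_Filt] refl])
  also have "\<dots> = (\<integral>\<^sup>+ w. ennreal (Mart t w) * indicator A w \<partial>P)"
    by (rule nn_integral_subalgebra2[OF subalgebra_Filt m(2)])
  also have "\<dots> = (\<integral>\<^sup>+ w. ennreal (indicator A w * Mart t w) \<partial>P)"
    by (rule nn_integral_cong) (simp add: indicator_def)
  also have "\<dots> = ennreal (LINT w|P. indicator A w * Mart t w)"
    by (rule nn_integral_eq_integral[OF i]) (simp add: Mart_nonneg)
  also have "\<dots> = emeasure Q A" using Q_Filt[OF t A] by (simp add: Q.emeasure_eq_measure)
  finally show "emeasure (restr_to_subalg Q (Filt t)) A = emeasure (density (restr_to_subalg P (Filt t)) (\<lambda>w. ennreal (Mart t w))) A"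
    by (simp add: emeasure_restr_to_subalg[OF subalgebra_Q A])
qed

lemma Q_integral:
  fixes Y :: "path => complex"
  assumes t: "0 \<le> t" and Y: "Y \<in> borel_measurable (Filt t)"
  shows "(LINT w|Q. Y w) = (LINT w|P. Y w * of_real (Mart t w))"
proof -
  have [measurable]: "Mart t \<in> borel_measurable (Filt t)" "Y \<in> borel_measurable (Filt t)" by (rule Mart_Filt[OF t], rule Y)
  note mc = measurable_cong_sets[OF sets_restr_to_subalg[OF subalgebra_Filt] refl]
  have "(LINT w|Q. Y w) = (\<integral>w. Y w \<partial>restr_to_subalg Q (Filt t))" by (rule integral_subalgebra2[OF subalgebra_Q Y, symmetric])
  also have "\<dots> = (\<integral>w. Mart t w *\<^sub>R Y w \<partial>restr_to_subalg P (Filt t))"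
    unfolding Q_restr[OF t] by (rule integral_density) (auto simp: mc Mart_nonneg)
  also have "\<dots> = (LINT w|P. Mart t w *\<^sub>R Y w)" by (rule integral_subalgebra2[OF subalgebra_Filt]) measurable
  finally show ?thesis by (simp add: scaleR_conv_of_real mult.commute)
qed

text \<open>P may charge the exceptional set as long as \<open>Mart t\<close> vanishes on it. The
  event has to lie in \<open>Filt t\<close>, where Q has the density \<open>Mart t\<close>.\<close>

lemma Q_AE:
  assumes t: "0 \<le> t" and A: "A \<in> sets (Filt t)" and AE: "AE w in P. w \<in> A \<or> Mart t w = 0"
  shows "AE w in Q. w \<in> A"
proof -
  have AP: "A \<in> events" "A \<in> Q.events" using A sets_Filt_le sets_P sets_Q by blast+
  have "measure Q A = (LINT w|P. indicator A w * Mart t w)" by (rule Q_Filt[OF t A])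
  also have "\<dots> = (LINT w|P. Mart t w)"
    by (rule integral_cong_AE) (use AE AP(1) Mart_borel[OF t] in \<open>auto elim!: eventually_mono simp: indicator_def\<close>)
  also have "\<dots> = 1" by (rule Mart_mean[OF t])
  finally show ?thesis using Q.prob_eq_1[OF AP(2)] by simp
qed

text \<open>Where H(L_t) reaches 1 the density vanishes, so Q does not see it. Together with
  \<open>drift_bounded_below_one\<close> this bounds the drift on [0, t] along Q-almost every
  path.\<close>

lemma Q_nice:
  assumes t: "0 \<le> t"
  shows "AE w in Q. w \<in> good t \<and> Hint h (L t w) < 1"
proof -
  let ?A = "{w \<in> space (Filt t). Hint h (L t w) < 1}"
  have [measurable]: "L t \<in> borel_measurable (Filt t)" by (rule L_meas[OF t])
  have zero: "AE w in P. 1 \<le> Hint h (L t w) \<longrightarrow> Mart t w = 0"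
  proof (cases "t = 0")
    case True
    show ?thesis using L_regular unfolding True by eventually_elim (simp add: Hint_0[OF h_borel h_bounds(3)])
  qed (use exhausted_Mart t in auto)
  have "AE w in Q. w \<in> ?A"
  proof (rule Q_AE[OF t])
    show "?A \<in> sets (Filt t)" by measurable
    show "AE w in P. w \<in> ?A \<or> Mart t w = 0" using zero AE_space[of P] by eventually_elim auto
  qed
  moreover have "AE w in Q. w \<in> good t" by (rule Q_AE[OF t good(1)[OF t]]) (use good(2)[OF t] in auto)
  ultimately show ?thesis by eventually_elim simp
qed

text \<open>An adapted version of the compensated process: at each fixed time it agrees Q-almost
  surely with X minus the integral of the drift, and it is measurable without completion.\<close>

definition innovation :: "real => path => real" where
  "innovation t w = w t - acc 0 t w"

lemma innovation_Filt: "0 \<le> s ==> s \<le> t ==> innovation s \<in> borel_measurable (Filt t)"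
proof -
  assume st: "0 \<le> s" "s \<le> t"
  have [measurable]: "(\<lambda>w. w s) \<in> borel_measurable (Filt t)" "acc 0 s \<in> borel_measurable (Filt t)"
    using st measurable_Filt_mono[OF acc_Filt] by (auto intro: coord_measurable_Filt)
  show ?thesis unfolding innovation_def[abs_def] by measurable
qed

lemma innovation_AE: "0 \<le> t ==> AE w in Q. w t - (LBINT s:{0..t}. drift s w) = innovation t w"
  by (drule Q_nice, erule eventually_mono) (simp add: innovation_def acc_def)

lemma innovation_increment:
  assumes st: "0 \<le> s" "s \<le> t"
  shows "AE w in Q. innovation t w - innovation s w = w t - w s - acc s t w"
proof -
  have t: "0 \<le> t" using st by simp
  show ?thesis using Q_nice[OF t] Q_nice[OF st(1)]
  proof eventually_elim
    case (elim w)
    have g: "w \<in> good s" "w \<in> good t" using elim by auto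
    have b: "\<bar>drift v w\<bar> \<le> K / (1 - Hint h (L t w))" if "v \<in> {0..t}" for v
      using drift_bounded_below_one[OF t _ _ that] elim by auto
    have "acc 0 t w = acc 0 s w + (LBINT v:{s<..<t}. drift v w)"
      by (rule acc_split(1)[OF order_refl st g b])
    moreover have "acc s t w = acc s s w + (LBINT v:{s<..<t}. drift v w)"
      by (rule acc_split(1)[OF st(1) order_refl st(2) g b])
    ultimately show ?case by (simp add: innovation_def acc_refl)
  qed
qed

text \<open>The Girsanov identity read under Q. Given the past up to s, the increment has the
  characteristic function exp(-\<theta>^2 (t - s) / 2), tested against an arbitrary bounded past
  weight.\<close>

lemma innovation_char:
  assumes st: "0 \<le> s" "s \<le> t" and V: "V \<in> borel_measurable (Filt s)" "\<And>w. cmod (V w) \<le> B"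
  shows "(LINT w|Q. V w * iexp (\<theta> * (innovation t w - innovation s w))) = exp (- of_real (\<theta>\<^sup>2 * (t - s) / 2)) * (LINT w|Q. V w)"
proof -
  have t: "0 \<le> t" using st by simp
  have cs: "(\<lambda>w. w s) \<in> borel_measurable (Filt s)" "(\<lambda>w. w s) \<in> borel_measurable (Filt t)" "(\<lambda>w. w t) \<in> borel_measurable (Filt t)"
    using st by (auto intro: coord_measurable_Filt)
  note [measurable] = cs acc_Filt[OF st] V(1) measurable_Filt_mono[OF V(1) st(2)] innovation_Filt[OF st] innovation_Filt[OF t order_refl]
  \<comment> \<open>\<open>expo\<close> contains X_t instead of X_t - X_s; the surplus factor is
    known at time s and is absorbed into the weight.\<close>
  define V' where "V' w = V w * iexp (- \<theta> * w s)" for w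
  have V'm: "V' \<in> borel_measurable (Filt s)" unfolding V'_def[abs_def] by measurable
  have V'b: "cmod (V' w) \<le> B" for w using V(2)[of w] by (simp add: V'_def norm_mult)
  have m1: "(\<lambda>w. V w * iexp (\<theta> * (innovation t w - innovation s w))) \<in> borel_measurable (Filt t)"
    and m2: "(\<lambda>w. V w * iexp (\<theta> * (w t - w s - acc s t w))) \<in> borel_measurable (Filt t)" by measurable
  have ie: "iexp (x + y) = iexp x * iexp y" for x y by (simp add: exp_add distrib_left)
  have "(LINT w|Q. V w * iexp (\<theta> * (innovation t w - innovation s w))) = (LINT w|Q. V w * iexp (\<theta> * (w t - w s - acc s t w)))"
    by (rule integral_cong_AE[OF measurable_Filt_Q[OF m1] measurable_Filt_Q[OF m2]])
      (rule eventually_mono[OF innovation_increment[OF st]], simp only:)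
  also have "\<dots> = (LINT w|P. V w * iexp (\<theta> * (w t - w s - acc s t w)) * of_real (Mart t w))" by (rule Q_integral[OF t m2])
  also have "\<dots> = (LINT w|P. of_real (exp (- (\<theta>\<^sup>2 * t / 2))) * (V' w * iexp (- \<theta> * acc s t w) * (of_real (Mart t w) * expo \<theta> t w)))"
  proof (rule Bochner_Integration.integral_cong[OF refl])
    fix w :: path
    have "\<theta> * (w t - w s - acc s t w) = (- \<theta> * w s + - \<theta> * acc s t w) + \<theta> * w t" by (simp add: algebra_simps)
    then have "iexp (\<theta> * (w t - w s - acc s t w)) = iexp (- \<theta> * w s) * iexp (- \<theta> * acc s t w) * iexp (\<theta> * w t)" by (simp only: ie)
    moreover have "complex_of_real (exp (- (\<theta>\<^sup>2 * t / 2))) * of_real (exp (\<theta>\<^sup>2 * t / 2)) = 1"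
      by (simp only: of_real_mult[symmetric] exp_add[symmetric]) simp
    ultimately show "V w * iexp (\<theta> * (w t - w s - acc s t w)) * of_real (Mart t w) = of_real (exp (- (\<theta>\<^sup>2 * t / 2))) * (V' w * iexp (- \<theta> * acc s t w) * (of_real (Mart t w) * expo \<theta> t w))"
      by (simp only: V'_def expo_def mult_ac) (simp only: mult.assoc[symmetric] mult_1_left mult_1_right)
  qed
  also have "\<dots> = of_real (exp (- (\<theta>\<^sup>2 * t / 2))) * (LINT w|P. V' w * (of_real (Mart s w) * expo \<theta> s w))"
    by (simp only: integral_mult_right_zero girsanov[OF st V'm V'b])
  also have "(LINT w|P. V' w * (of_real (Mart s w) * expo \<theta> s w)) = (LINT w|P. of_real (exp (\<theta>\<^sup>2 * s / 2)) * (V w * of_real (Mart s w)))"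
  proof (rule Bochner_Integration.integral_cong[OF refl])
    fix w :: path
    have "iexp (- \<theta> * w s) * iexp (\<theta> * w s) = 1" by (simp only: ie[symmetric]) simp
    then show "V' w * (of_real (Mart s w) * expo \<theta> s w) = of_real (exp (\<theta>\<^sup>2 * s / 2)) * (V w * of_real (Mart s w))"
      by (simp add: V'_def expo_def)
  qed
  also have "\<dots> = of_real (exp (\<theta>\<^sup>2 * s / 2)) * (LINT w|Q. V w)"
    by (simp only: integral_mult_right_zero Q_integral[OF st(1) V(1)])
  also have "of_real (exp (- (\<theta>\<^sup>2 * t / 2))) * (of_real (exp (\<theta>\<^sup>2 * s / 2)) * (LINT w|Q. V w)) = exp (- of_real (\<theta>\<^sup>2 * (t - s) / 2)) * (LINT w|Q. V w)"
  proof -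
    have "exp (- (\<theta>\<^sup>2 * t / 2)) * exp (\<theta>\<^sup>2 * s / 2) = exp (- (\<theta>\<^sup>2 * (t - s) / 2))"
      unfolding exp_add[symmetric] by (simp add: field_simps)
    then have "complex_of_real (exp (- (\<theta>\<^sup>2 * t / 2))) * of_real (exp (\<theta>\<^sup>2 * s / 2)) = exp (- of_real (\<theta>\<^sup>2 * (t - s) / 2))"
      by (simp only: of_real_mult[symmetric]) (simp only: exp_of_real[symmetric] of_real_minus[symmetric])
    then show ?thesis by (simp only: mult.assoc[symmetric])
  qed
  finally show ?thesis .
qed

text \<open>Conditionally on any past event of positive probability, the increment has under Q the
  same characteristic function as a Brownian increment under P; Levy's uniqueness theorem identifies
  the laws. Expressing the law through P avoids a Gaussian computation.\<close>

lemma innovation_law: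
  assumes st: "0 \<le> s" "s \<le> t" and \<Gamma>: "\<Gamma> \<in> sets (Filt s)" and A: "A \<in> sets borel"
  shows "measure Q (\<Gamma> \<inter> {w \<in> path_space. innovation t w - innovation s w \<in> A})
    = measure Q \<Gamma> * measure P {w \<in> path_space. w t - w s \<in> A}"
proof (cases "measure Q \<Gamma> = 0")
  case True
  have \<Gamma>Q: "\<Gamma> \<in> Q.events" using \<Gamma> sets_Filt_le sets_Q by blast
  have "measure Q (\<Gamma> \<inter> {w \<in> path_space. innovation t w - innovation s w \<in> A}) \<le> measure Q \<Gamma>"
    by (rule Q.finite_measure_mono[OF _ \<Gamma>Q]) auto
  then show ?thesis using True measure_nonneg[of Q "\<Gamma> \<inter> {w \<in> path_space. innovation t w - innovation s w \<in> A}"] by simp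
next
  case False
  have t: "0 \<le> t" using st by simp
  define q where "q = measure Q \<Gamma>"
  have q: "0 < q" using False by (simp add: q_def zero_less_measure_iff)
  have \<Gamma>Q[measurable]: "\<Gamma> \<in> Q.events" using \<Gamma> sets_Filt_le sets_Q by blast
  define D where "D w = innovation t w - innovation s w" for w
  have Dm[measurable]: "D \<in> borel_measurable Q" unfolding D_def[abs_def]
    using measurable_Filt_Q[OF innovation_Filt[OF st]] measurable_Filt_Q[OF innovation_Filt[OF t order_refl]] by measurable
  have inc[measurable]: "(\<lambda>w. w t - w s) \<in> borel_measurable P" using coord_borel[OF t] coord_borel[OF st(1)] by measurable
  \<comment> \<open>Q conditioned on \<Gamma>, whose measure is positive in this case.\<close>
  let ?U = "uniform_measure Q \<Gamma>"
  interpret U: prob_space ?U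
    by (rule prob_space_uniform_measure) (use q in \<open>auto simp: q_def Q.emeasure_eq_measure\<close>)
  have DU: "D \<in> borel_measurable ?U" using Dm by (simp add: measurable_cong_sets[OF sets_uniform_measure refl])
  have Udens: "?U = density Q (\<lambda>w. ennreal (indicator \<Gamma> w / q))"
    unfolding uniform_measure_def
    by (rule density_cong) (use q in \<open>auto simp: Q.emeasure_eq_measure q_def[symmetric] indicator_def divide_ennreal[symmetric] intro!: AE_I2\<close>)
  have "distr ?U borel D = distr P borel (\<lambda>w. w t - w s)"
  proof (rule Levy_uniqueness)
    show "real_distribution (distr ?U borel D)" by (rule U.real_distribution_distr[OF DU])
    show "real_distribution (distr P borel (\<lambda>w. w t - w s))" by (rule real_distribution_distr[OF inc])
    show "char (distr ?U borel D) = char (distr P borel (\<lambda>w. w t - w s))"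
    proof
      fix \<theta>
      have gm: "(\<lambda>x. iexp (\<theta> * x)) \<in> borel_measurable borel" by measurable
      have "char (distr ?U borel D) \<theta> = (\<integral>w. iexp (\<theta> * D w) \<partial>?U)"
        unfolding char_def by (rule integral_distr[OF DU gm])
      also have "\<dots> = (LINT w|Q. (indicator \<Gamma> w / q) *\<^sub>R iexp (\<theta> * D w))"
        unfolding Udens by (rule integral_density) (use q in \<open>auto\<close>)
      also have "\<dots> = (LINT w|Q. complex_of_real (1 / q) * (indicator \<Gamma> w * iexp (\<theta> * D w)))"
        by (rule Bochner_Integration.integral_cong) (auto simp: indicator_def scaleR_conv_of_real)
      also have "\<dots> = complex_of_real (1 / q) * (LINT w|Q. indicator \<Gamma> w * iexp (\<theta> * D w))"
        by (simp only: integral_mult_right_zero)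
      also have "(LINT w|Q. indicator \<Gamma> w * iexp (\<theta> * D w)) = exp (- of_real (\<theta>\<^sup>2 * (t - s) / 2)) * (LINT w|Q. indicator \<Gamma> w)"
        unfolding D_def by (rule innovation_char[OF st, of _ 1]) (use \<Gamma> in \<open>auto simp: indicator_def intro!: borel_measurable_indicator\<close>)
      also have "(LINT w|Q. indicator \<Gamma> w) = complex_of_real q"
      proof -
        have "(LINT w|Q. indicator \<Gamma> w) = (LINT w|Q. complex_of_real (indicator \<Gamma> w))"
          by (rule Bochner_Integration.integral_cong) (auto simp: indicator_def)
        also have "\<dots> = of_real (LINT w|Q. indicator \<Gamma> w)" by (rule integral_of_real) (auto intro!: integrable_real_indicator simp: Q.emeasure_eq_measure)
        finally show ?thesis using sets.sets_into_space[OF \<Gamma>] by (simp add: q_def Int_absorb2)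
      qed
      also have "complex_of_real (1 / q) * (exp (- of_real (\<theta>\<^sup>2 * (t - s) / 2)) * complex_of_real q) = (LINT w|P. iexp (\<theta> * (w t - w s)))"
        unfolding increment_char[OF st] using q by simp
      also have "\<dots> = char (distr P borel (\<lambda>w. w t - w s)) \<theta>"
        unfolding char_def by (rule integral_distr[OF inc gm, symmetric])
      finally show "char (distr ?U borel D) \<theta> = char (distr P borel (\<lambda>w. w t - w s)) \<theta>" .
    qed
  qed
  then have "measure (distr ?U borel D) A = measure (distr P borel (\<lambda>w. w t - w s)) A" by simp
  then have "measure ?U (D -` A \<inter> path_space) = measure P ((\<lambda>w. w t - w s) -` A \<inter> path_space)"
    using measure_distr[OF DU A] measure_distr[OF inc A] by simp
  moreover have "measure ?U (D -` A \<inter> path_space) = measure Q (\<Gamma> \<inter> (D -` A \<inter> path_space)) / q"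
    unfolding q_def by (rule measure_uniform_measure) (use q measurable_sets[OF Dm A] in \<open>auto simp: q_def Q.emeasure_eq_measure\<close>)
  moreover have "D -` A \<inter> path_space = {w \<in> path_space. innovation t w - innovation s w \<in> A}"
    "(\<lambda>w. w t - w s) -` A \<inter> path_space = {w \<in> path_space. w t - w s \<in> A}" by (auto simp: D_def)
  ultimately show ?thesis using q by (simp add: q_def field_simps)
qed

text \<open>Induction on the number of increments: the constraints on the first n of them form an
  event of \<open>Filt (\<tau> n)\<close>, which serves as the past event for the next one.
  Membership in this sigma-algebra is therefore part of the induction.\<close>

lemma innovation_joint_law:
  fixes \<tau> :: "nat => real" and A :: "nat => real set"
  assumes "0 \<le> \<tau> 0" "\<And>i. i < n ==> \<tau> i \<le> \<tau> (Suc i)" "\<And>i. i < n ==> A i \<in> sets borel"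
  shows "0 \<le> \<tau> n \<and> {w \<in> path_space. \<forall>i<n. innovation (\<tau> (Suc i)) w - innovation (\<tau> i) w \<in> A i} \<in> sets (Filt (\<tau> n))
    \<and> measure Q {w \<in> path_space. \<forall>i<n. innovation (\<tau> (Suc i)) w - innovation (\<tau> i) w \<in> A i}
      = (\<Prod>i<n. measure P {w \<in> path_space. w (\<tau> (Suc i)) - w (\<tau> i) \<in> A i})"
  using assms(2,3)
proof (induction n)
  case 0
  show ?case using assms(1) sets.top[of "Filt (\<tau> 0)"] Q.prob_space by simp
next
  case (Suc n)
  define E where "E n = {w \<in> path_space. \<forall>i<n. innovation (\<tau> (Suc i)) w - innovation (\<tau> i) w \<in> A i}" for n
  define F where "F = {w \<in> path_space. innovation (\<tau> (Suc n)) w - innovation (\<tau> n) w \<in> A n}"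
  have split: "E (Suc n) = E n \<inter> F"
    by (auto simp: E_def F_def less_Suc_eq)
  have "0 \<le> \<tau> n \<and> E n \<in> sets (Filt (\<tau> n)) \<and> measure Q (E n) = (\<Prod>i<n. measure P {w \<in> path_space. w (\<tau> (Suc i)) - w (\<tau> i) \<in> A i})"
    unfolding E_def by (rule Suc.IH) (simp_all add: Suc.prems)
  then have n: "0 \<le> \<tau> n" "E n \<in> sets (Filt (\<tau> n))"
    and IH: "measure Q (E n) = (\<Prod>i<n. measure P {w \<in> path_space. w (\<tau> (Suc i)) - w (\<tau> i) \<in> A i})" by simp_all
  have le: "\<tau> n \<le> \<tau> (Suc n)" and An: "A n \<in> sets borel" by (simp_all add: Suc.prems)
  have n': "0 \<le> \<tau> (Suc n)" using n(1) le by (rule order_trans)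
  have [measurable]: "innovation (\<tau> n) \<in> borel_measurable (Filt (\<tau> (Suc n)))" "innovation (\<tau> (Suc n)) \<in> borel_measurable (Filt (\<tau> (Suc n)))"
    by (rule innovation_Filt[OF n(1) le], rule innovation_Filt[OF n' order_refl])
  have "{w \<in> space (Filt (\<tau> (Suc n))). innovation (\<tau> (Suc n)) w - innovation (\<tau> n) w \<in> A n} \<in> sets (Filt (\<tau> (Suc n)))" using An by measurable
  then have "F \<in> sets (Filt (\<tau> (Suc n)))" by (simp only: F_def space_Filt)
  moreover have "E n \<in> sets (Filt (\<tau> (Suc n)))" using n(2) sets_Filt_mono[OF le] by (rule rev_subsetD)
  ultimately have "E n \<inter> F \<in> sets (Filt (\<tau> (Suc n)))" by (rule sets.Int[rotated])
  moreover have "measure Q (E n \<inter> F) = (\<Prod>i<Suc n. measure P {w \<in> path_space. w (\<tau> (Suc i)) - w (\<tau> i) \<in> A i})"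
    unfolding F_def innovation_law[OF n(1) le n(2) An] IH by simp
  ultimately show ?case using n' unfolding split[symmetric] unfolding E_def by blast
qed

lemma drift_path_continuous:
  assumes t: "0 \<le> t" and w: "w \<in> good t" "Hint h (L t w) < 1"
  shows "continuous_on {0..t} (\<lambda>u. LBINT s:{0..u}. drift s w)"
proof (rule lipschitz_on_continuous_on)
  define \<beta> where "\<beta> = K / (1 - Hint h (L t w))"
  have \<beta>: "0 \<le> \<beta>" using K_pos w by (simp add: \<beta>_def)
  have le: "\<bar>(LBINT s:{0..u}. drift s w) - (LBINT s:{0..v}. drift s w)\<bar> \<le> \<beta> * (u - v)" if "0 \<le> v" "v \<le> u" "u \<le> t" for u v
    using drift_split[OF t w(1) order_refl that drift_bounded_below_one[OF t w]] by (simp add: \<beta>_def)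
  show "\<beta>-lipschitz_on {0..t} (\<lambda>u. LBINT s:{0..u}. drift s w)"
  proof (rule lipschitz_onI[OF _ \<beta>])
    fix x y assume xy: "x \<in> {0..t}" "y \<in> {0..t}"
    show "dist (LBINT s:{0..x}. drift s w) (LBINT s:{0..y}. drift s w) \<le> \<beta> * dist x y"
    proof (cases "x \<le> y")
      case True then show ?thesis using le[of x y] xy by (simp add: dist_real_def abs_minus_commute)
    next
      case False then show ?thesis using le[of y x] xy by (simp add: dist_real_def)
    qed
  qed
qed

end

section \<open>Brownian motion under the completed measure\<close>

lemma measurable_completion_AE:
  assumes f: "f \<in> measurable M N" and eq: "AE x in M. g x = f x" and g: "\<And>x. x \<in> space M ==> g x \<in> space N"
  shows "g \<in> measurable (completion M) N"
proof (rule measurableI)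
  show "g x \<in> space N" if "x \<in> space (completion M)" for x using that g by simp
  fix A assume A: "A \<in> sets N"
  show "g -` A \<inter> space (completion M) \<in> sets (completion M)"
  proof (rule completion.in_sets_AE)
    show "f -` A \<inter> space M \<in> sets (completion M)" using measurable_sets[OF f A] by simp
    show "AE x in completion M. (x \<in> f -` A \<inter> space M) = (x \<in> g -` A \<inter> space (completion M))"
      using AE_completion[OF eq] by eventually_elim simp
  qed simp
qed

lemma distr_completion_AE:
  assumes f: "f \<in> measurable M N" and eq: "AE x in M. g x = f x" and g: "\<And>x. x \<in> space M ==> g x \<in> space N"
  shows "distr (completion M) N g = distr M N f"
proof -
  have "distr (completion M) N g = distr (completion M) N f"
    by (rule distr_cong_AE[OF refl refl AE_completion[OF eq] measurable_completion_AE[OF f eq g] measurable_completion[OF f]])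
  then show ?thesis using distr_completion[OF f] by simp
qed

context h_transform
begin

lemma innovation_increment_law:
  assumes st: "0 \<le> s" "s \<le> t" and A: "A \<in> sets borel"
  shows "measure Q {w \<in> path_space. innovation t w - innovation s w \<in> A} = measure P {w \<in> path_space. w t - w s \<in> A}"
proof -
  have top: "path_space \<in> sets (Filt s)" using sets.top[of "Filt s"] by simp
  have "path_space \<inter> {w \<in> path_space. innovation t w - innovation s w \<in> A} = {w \<in> path_space. innovation t w - innovation s w \<in> A}" by blast
  then show ?thesis using innovation_law[OF st top A] Q.prob_space by simp
qed

text \<open>Laws and independence are taken from \<open>innovation\<close>, with which B agrees
  almost surely at each fixed time; the completion makes B measurable. Path continuity concerns all
  times at once and comes from the path-wise bound on the drift instead.\<close>

lemma innovation_brownian: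
  assumes B: "\<And>t w. 0 \<le> t ==> w \<in> path_space ==> B t w = w t - (LBINT s:{0..t}. drift s w)"
  shows "brownian_motion (completion Q) B"
proof -
  let ?C = "completion Q"
  interpret C: prob_space ?C by (rule Q.prob_space_completion)
  have BI: "AE w in Q. B t w = innovation t w" if t: "0 \<le> t" for t
    using innovation_AE[OF t] AE_space[of Q] by eventually_elim (use B[OF t] in simp)
  have im: "innovation t \<in> borel_measurable Q" if "0 \<le> t" for t
    by (rule measurable_Filt_Q[OF innovation_Filt[OF that order_refl]])
  have Bm: "B t \<in> borel_measurable ?C" if t: "0 \<le> t" for t
    by (rule measurable_completion_AE[OF im[OF t] BI[OF t]]) simp
  have incm: "(\<lambda>w. innovation t w - innovation s w) \<in> borel_measurable Q" if "0 \<le> s" "0 \<le> t" for s t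
    using im[OF that(1)] im[OF that(2)] by measurable
  have incAE: "AE w in Q. B t w - B s w = innovation t w - innovation s w" if "0 \<le> s" "0 \<le> t" for s t
    using BI[OF that(1)] BI[OF that(2)] by eventually_elim simp
  have start: "AE w in ?C. B 0 w = 0"
  proof (rule AE_completion)
    have A: "{w \<in> space (Filt 0). w 0 = 0} \<in> sets (Filt 0)"
      using coord_measurable_Filt[of 0 0] by measurable
    have "AE w in Q. w \<in> {w \<in> space (Filt 0). w 0 = 0}"
      by (rule Q_AE[OF order_refl A]) (use start_zero AE_space[of P] in \<open>eventually_elim, auto\<close>)
    then show "AE w in Q. B 0 w = 0"
    proof eventually_elim
      case (elim w)
      have "(LBINT s:{0..0}. drift s w) = 0" unfolding set_lebesgue_integral_def
        by (rule integral_eq_zero_AE) (use AE_lborel_singleton[of 0] in \<open>eventually_elim, auto\<close>)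
      then show ?case using elim B[of 0 w] by simp
    qed
  qed
  have cont: "AE w in ?C. continuous_on {0..} (\<lambda>t. B t w)"
  proof (rule AE_completion)
    \<comment> \<open>Integer horizons exhaust the half-line, and countably many almost sure
      statements hold simultaneously.\<close>
    have "AE w in Q. \<forall>n::nat. w \<in> good (real n) \<and> Hint h (L (real n) w) < 1"
      unfolding AE_all_countable using Q_nice by simp
    then show "AE w in Q. continuous_on {0..} (\<lambda>t. B t w)" using AE_space[of Q]
    proof eventually_elim
      case (elim w)
      then have w: "w \<in> path_space" by simp
      have c: "continuous_on {0..real n} (\<lambda>t. B t w)" for n
      proof -
        have "continuous_on {0..real n} (\<lambda>t. w t - (LBINT s:{0..t}. drift s w))"
          using elim(1) w by (intro continuous_on_diff drift_path_continuous) (auto simp: path_space_def intro: continuous_on_subset)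
        then show ?thesis by (rule continuous_on_eq) (use B[OF _ w] in simp)
      qed
      show ?case unfolding continuous_on_eq_continuous_within
      proof
        fix t :: real assume t: "t \<in> {0..}"
        obtain n where n: "t < real n" using reals_Archimedean2 by blast
        have "continuous (at t within {0..real n}) (\<lambda>t. B t w)"
          using c[of n] t n unfolding continuous_on_eq_continuous_within by simp
        moreover have "at t within {0..real n} = at t within {0..}"
          by (rule at_within_nhd[of _ "{..<real n}"]) (use n in auto)
        ultimately show "continuous (at t within {0..}) (\<lambda>t. B t w)" by (simp only: continuous_within)
      qed
    qed
  qed
  have law: "distr ?C borel (\<lambda>w. B t w - B s w) = distr P borel (\<lambda>w. w t - w s)" if st: "0 \<le> s" "s \<le> t" for s t
  proof -
    have t: "0 \<le> t" using st by simp
    have pm: "(\<lambda>w. w t - w s) \<in> borel_measurable P" using coord_borel[OF t] coord_borel[OF st(1)] by measurable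
    have "distr ?C borel (\<lambda>w. B t w - B s w) = distr Q borel (\<lambda>w. innovation t w - innovation s w)"
      by (rule distr_completion_AE[OF incm[OF st(1) t] incAE[OF st(1) t]]) simp
    also have "\<dots> = distr P borel (\<lambda>w. w t - w s)"
    proof (rule measure_eqI)
      fix A assume "A \<in> sets (distr Q borel (\<lambda>w. innovation t w - innovation s w))"
      then have A: "A \<in> sets borel" by simp
      have e: "f -` A \<inter> path_space = {w \<in> path_space. f w \<in> A}" for f :: "path => real" by auto
      show "emeasure (distr Q borel (\<lambda>w. innovation t w - innovation s w)) A = emeasure (distr P borel (\<lambda>w. w t - w s)) A"
        unfolding emeasure_distr[OF incm[OF st(1) t] A] emeasure_distr[OF pm A] space_Q space_P e
        by (simp only: Q.emeasure_eq_measure emeasure_eq_measure innovation_increment_law[OF st A])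
    qed simp
    finally show ?thesis .
  qed
  have normal: "distributed ?C lborel (\<lambda>w. B t w - B s w) (\<lambda>x. ennreal (normal_density 0 (sqrt (t - s)) x))"
    if st: "0 \<le> s" "s < t" for s t
  proof -
    have "distr ?C lborel (\<lambda>w. B t w - B s w) = distr ?C borel (\<lambda>w. B t w - B s w)" by (rule distr_cong) simp_all
    also have "\<dots> = distr P borel (\<lambda>w. w t - w s)" using law st by simp
    also have "\<dots> = distr P lborel (\<lambda>w. w t - w s)" by (rule distr_cong) simp_all
    finally show ?thesis using increment_normal[OF st] Bm[of t] Bm[of s] st unfolding distributed_def by simp
  qed
  have indep: "C.indep_vars (\<lambda>_. borel) (\<lambda>i w. B (\<tau> (Suc i)) w - B (\<tau> i) w) {..<n}"
    if \<tau>: "0 \<le> \<tau> 0" "\<forall>i<n. \<tau> i \<le> \<tau> (Suc i)" for n :: nat and \<tau>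
  \<comment> \<open>The product criterion for independence refers to a non-empty index set.\<close>
  proof (cases "n = 0")
    case True
    then show ?thesis by (simp add: C.indep_vars_def C.indep_sets_def)
  next
    case False
    define X where "X i w = B (\<tau> (Suc i)) w - B (\<tau> i) w" for i w
    define Y where "Y i w = innovation (\<tau> (Suc i)) w - innovation (\<tau> i) w" for i w
    have \<tau>0: "0 \<le> \<tau> i" if "i \<le> n" for i
      using innovation_joint_law[of \<tau> i "\<lambda>_. UNIV"] \<tau> that by simp
    have Xm: "X i \<in> borel_measurable ?C" if "i < n" for i
      unfolding X_def[abs_def] using Bm[OF \<tau>0[of i]] Bm[OF \<tau>0[of "Suc i"]] that by simp
    have Ym: "Y i \<in> borel_measurable Q" if "i < n" for i
      unfolding Y_def[abs_def] using incm[OF \<tau>0[of i] \<tau>0[of "Suc i"]] that by simp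
    have XY: "AE w in Q. \<forall>i\<in>{..<n}. X i w = Y i w"
      unfolding X_def Y_def by (rule AE_finite_allI) (use incAE[OF \<tau>0 \<tau>0] in auto)
    have "C.indep_vars (\<lambda>_. borel) X {..<n} \<longleftrightarrow>
      (\<forall>A\<in>(\<Pi> i\<in>{..<n}. sets borel). C.prob (\<Inter>j\<in>{..<n}. X j -` A j \<inter> space ?C) = (\<Prod>j\<in>{..<n}. C.prob (X j -` A j \<inter> space ?C)))"
    proof (rule C.indep_vars_finite)
      show "{..<n} \<noteq> {}" "finite {..<n}" using False by auto
      show "sets borel = sigma_sets (space borel) (sets (borel :: real measure))" by (rule sets.sigma_sets_eq[symmetric])
      show "X i \<in> borel_measurable ?C" if "i \<in> {..<n}" for i using Xm that by (simp only: lessThan_iff)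
      show "Int_stable (sets (borel :: real measure))" by (rule sets.Int_stable)
      show "space borel \<in> sets (borel :: real measure)" by (rule sets.top)
      show "sets (borel :: real measure) \<subseteq> Pow (space borel)" by (rule sets.space_closed)
    qed
    moreover have "C.prob (\<Inter>j\<in>{..<n}. X j -` A j \<inter> space ?C) = (\<Prod>j\<in>{..<n}. C.prob (X j -` A j \<inter> space ?C))"
      if A: "A \<in> (\<Pi> i\<in>{..<n}. sets borel)" for A
    proof -
      have Ai: "A i \<in> sets borel" if "i < n" for i using Pi_mem[OF A, of i] that by simp
      have XA: "X i -` A i \<inter> space ?C \<in> sets ?C" if "i < n" for i by (rule measurable_sets[OF Xm[OF that] Ai[OF that]])
      have J: "0 \<le> \<tau> n \<and> {w \<in> path_space. \<forall>i<n. Y i w \<in> A i} \<in> sets (Filt (\<tau> n))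
          \<and> measure Q {w \<in> path_space. \<forall>i<n. Y i w \<in> A i} = (\<Prod>i<n. measure P {w \<in> path_space. w (\<tau> (Suc i)) - w (\<tau> i) \<in> A i})"
        unfolding Y_def
      proof (rule innovation_joint_law[of \<tau> n A])
        show "0 \<le> \<tau> 0" by (rule \<tau>(1))
        show "\<tau> i \<le> \<tau> (Suc i)" if "i < n" for i using \<tau>(2) that by simp
      qed (rule Ai)
      have joint: "{w \<in> path_space. \<forall>i<n. Y i w \<in> A i} \<in> sets (Filt (\<tau> n))"
          "measure Q {w \<in> path_space. \<forall>i<n. Y i w \<in> A i} = (\<Prod>i<n. measure P {w \<in> path_space. w (\<tau> (Suc i)) - w (\<tau> i) \<in> A i})"
        by (rule J[THEN conjunct2, THEN conjunct1], rule J[THEN conjunct2, THEN conjunct2])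
      have jQ: "{w \<in> path_space. \<forall>i<n. Y i w \<in> A i} \<in> Q.events" unfolding sets_Q by (rule subsetD[OF sets_Filt_le joint(1)])
      have "C.prob (\<Inter>j\<in>{..<n}. X j -` A j \<inter> space ?C) = C.prob {w \<in> path_space. \<forall>i<n. Y i w \<in> A i}"
      proof (rule measure_eq_AE)
        show "AE w in ?C. (w \<in> (\<Inter>j\<in>{..<n}. X j -` A j \<inter> space ?C)) = (w \<in> {w \<in> path_space. \<forall>i<n. Y i w \<in> A i})"
          using AE_completion[OF XY]
        proof eventually_elim
          case (elim w)
          then have e: "X i w = Y i w" if "i < n" for i using that by blast
          have "w \<in> (\<Inter>j\<in>{..<n}. X j -` A j \<inter> space ?C) \<longleftrightarrow> w \<in> path_space \<and> (\<forall>i<n. X i w \<in> A i)"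
            unfolding space_completion space_Q using False by blast
          also have "(\<forall>i<n. X i w \<in> A i) = (\<forall>i<n. Y i w \<in> A i)" using e by metis
          finally show ?case by blast
        qed
        show "(\<Inter>j\<in>{..<n}. X j -` A j \<inter> space ?C) \<in> sets ?C"
          by (intro sets.finite_INT XA) (use False in \<open>auto simp: lessThan_empty_iff\<close>)
        show "{w \<in> path_space. \<forall>i<n. Y i w \<in> A i} \<in> sets ?C" by (rule sets_completionI_sets[OF jQ])
      qed
      also have "\<dots> = (\<Prod>i<n. measure P {w \<in> path_space. w (\<tau> (Suc i)) - w (\<tau> i) \<in> A i})" unfolding measure_completion[OF jQ] by (rule joint(2))
      also have "\<dots> = (\<Prod>j\<in>{..<n}. C.prob (X j -` A j \<inter> space ?C))"
      proof (rule prod.cong[OF refl])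
        fix i assume "i \<in> {..<n}"
        then have i: "i < n" by simp
        have iQ: "{w \<in> path_space. Y i w \<in> A i} \<in> Q.events"
        proof -
          have "{w \<in> path_space. Y i w \<in> A i} = Y i -` A i \<inter> space Q" unfolding space_Q by blast
          then show ?thesis using measurable_sets[OF Ym[OF i] Ai[OF i]] by (simp only:)
        qed
        have "C.prob (X i -` A i \<inter> space ?C) = C.prob {w \<in> path_space. Y i w \<in> A i}"
        proof (rule measure_eq_AE)
          show "AE w in ?C. (w \<in> X i -` A i \<inter> space ?C) = (w \<in> {w \<in> path_space. Y i w \<in> A i})"
            using AE_completion[OF XY] by eventually_elim (use i in \<open>simp add: conj_commute\<close>)
        qed (rule XA[OF i], rule sets_completionI_sets[OF iQ])
        also have "\<dots> = measure P {w \<in> path_space. w (\<tau> (Suc i)) - w (\<tau> i) \<in> A i}"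
          unfolding measure_completion[OF iQ] unfolding Y_def using \<tau>(2) i by (intro innovation_increment_law \<tau>0 Ai) simp_all
        finally show "measure P {w \<in> path_space. w (\<tau> (Suc i)) - w (\<tau> i) \<in> A i} = C.prob (X i -` A i \<inter> space ?C)" by simp
      qed
      finally show ?thesis .
    qed
    ultimately have "C.indep_vars (\<lambda>_. borel) X {..<n}" by blast
    then show ?thesis by (simp only: X_def[abs_def])
  qed
  show ?thesis unfolding brownian_motion_def
    using Bm start cont normal indep C.prob_space_axioms by blast
qed

end

section \<open>The theorem for weights given on the half-line\<close>

theorem theorem3p13:
  fixes P :: "path measure"
    and L :: "real \<Rightarrow> path \<Rightarrow> real"
    and hp hm :: "real \<Rightarrow> real"
  assumes wiener: "wiener_measure P"
    and local_time: "local_time_0 P L"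
    and normalized: "path_martingale P (\<lambda>t w. \<bar>w t\<bar> - L t w)"
    and hp_borel: "hp \<in> borel_measurable (restrict_space borel {0..})"
    and hm_borel: "hm \<in> borel_measurable (restrict_space borel {0..})"
    and hp_nonneg: "\<And>l. 0 \<le> l \<Longrightarrow> 0 \<le> hp l"
    and hm_nonneg: "\<And>l. 0 \<le> l \<Longrightarrow> 0 \<le> hm l"
    and hp_bounded: "bounded (hp ` {0..})"
    and hm_bounded: "bounded (hm ` {0..})"
    and h_integrable: "set_integrable lborel {0..} (\<lambda>u. hp u + hm u)"
    and h_integral: "1 / 2 * (LBINT u:{0..}. hp u + hm u) = 1"
  shows "(\<forall>s\<ge>0. \<forall>\<Gamma>\<in>sets (Filt s).
           ((\<lambda>t. (LINT w|P. indicator \<Gamma> w *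
                    (hp (L t w) * indicator {0<..} (w t) + hm (L t w) * indicator {..<0} (w t)))
                / (LINT w|P. hp (L t w) * indicator {0<..} (w t) + hm (L t w) * indicator {..<0} (w t)))
             \<longlongrightarrow> (LINT w|P. indicator \<Gamma> w * M_proc hp hm L s w)) at_top)
       \<and> (\<forall>Q. prob_space Q \<and> sets Q = sets Filt_inf \<and>
              (\<forall>s\<ge>0. \<forall>\<Gamma>\<in>sets (Filt s).
                 measure Q \<Gamma> = (LINT w|P. indicator \<Gamma> w * M_proc hp hm L s w)) \<longrightarrow>
            brownian_motion (completion Q)
              (\<lambda>t w. w t - (LBINT s:{0..t}.
                 (hp (L s w) * indicator {0<..} (w s) - hm (L s w) * indicator {..<0} (w s))
                   / M_proc hp hm L s w)))"
proof -
  obtain Kp where Kp: "\<And>l. 0 \<le> l \<Longrightarrow> \<bar>hp l\<bar> \<le> Kp" using hp_bounded by (auto simp: bounded_iff)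
  obtain Km where Km: "\<And>l. 0 \<le> l \<Longrightarrow> \<bar>hm l\<bar> \<le> Km" using hm_bounded by (auto simp: bounded_iff)
  define K where "K = max Kp Km"
  have K0: "0 \<le> K" using Kp[of 0] by (simp add: K_def)
  \<comment> \<open>\<open>hp\<close> and \<open>hm\<close> are specified for non-negative arguments
    only. Their extensions by 0 agree with them at L, which is non-negative on every path of
    \<open>path_space\<close> and not just almost surely.\<close>
  define a where "a l = indicator {0..} l *\<^sub>R hp l" for l
  define b where "b l = indicator {0..} l *\<^sub>R hm l" for l
  have ab: "a l = hp l" "b l = hm l" if "0 \<le> l" for l using that by (simp_all add: a_def b_def)
  have half: "(\<lambda>x. (a x + b x) / 2) = (\<lambda>x. (indicator {0..} x *\<^sub>R (hp x + hm x)) / 2)"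
    by (auto simp: a_def b_def fun_eq_iff indicator_def)
  interpret Y: penalisation P L a b K
  proof unfold_locales
    show "wiener_measure P" by (rule wiener)
    show "L t \<in> borel_measurable (Filt t)" if "0 \<le> t" for t using local_time that by (simp add: local_time_0_def)
    show "0 \<le> L t w" if "0 \<le> t" "w \<in> path_space" for t w using local_time that by (simp add: local_time_0_def)
    show "AE w in P. L 0 w = 0 \<and> continuous_on {0..} (\<lambda>t. L t w) \<and> mono_on {0..} (\<lambda>t. L t w)"
      using local_time by (simp only: local_time_0_def)
    show "path_martingale P (\<lambda>t w. \<bar>w t\<bar> - L t w)" by (rule normalized)
    show "a \<in> borel_measurable borel" "b \<in> borel_measurable borel"
      unfolding a_def[abs_def] b_def[abs_def] using hp_borel hm_borel by (simp_all add: borel_measurable_restrict_space_iff)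
    show "0 \<le> a x" "0 \<le> b x" for x using hp_nonneg[of x] hm_nonneg[of x] by (simp_all add: a_def b_def indicator_def)
    show "a x \<le> K" "b x \<le> K" for x using Kp[of x] Km[of x] K0 by (auto simp: a_def b_def K_def indicator_def)
    show "a x = 0" "b x = 0" if "x < 0" for x using that by (simp_all add: a_def b_def)
    show "integrable lborel (\<lambda>x. (a x + b x) / 2)"
      unfolding half using h_integrable by (simp add: set_integrable_def)
    show "(\<integral>x. (a x + b x) / 2 \<partial>lborel) = 1"
      unfolding half using h_integral by (simp add: set_lebesgue_integral_def)
  qed
  have L0: "0 \<le> L t w" if "0 \<le> t" "w \<in> path_space" for t w by (rule Y.L_nonneg[OF that])
  have M: "M_proc hp hm L t w = Y.Mart t w" if "0 \<le> t" "w \<in> path_space" for t w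
  proof -
    have "H_fun hp hm l = Hint Y.h l" for l
    proof -
      have "Hint Y.h l = (LBINT u:{0..l}. 1 / 2 * (hp u + hm u))"
        unfolding Hint_def by (rule set_lebesgue_integral_cong) (auto simp: Y.h_def ab)
      then show ?thesis by (simp add: H_fun_def set_integral_mult_right)
    qed
    \<comment> \<open>Passage from positive and negative parts to the half sum \<open>h\<close> and
      the half difference \<open>k\<close>.\<close>
    moreover have "max (w t) 0 * p + max (- w t) 0 * q = \<bar>w t\<bar> * ((p + q) / 2) + w t * ((p - q) / 2)" for p q
      by (cases "0 \<le> w t") (simp_all add: max_def field_simps)
    ultimately show ?thesis using ab[OF L0[OF that]] by (simp add: M_proc_def Y.Mart_def Y.h_def Y.k_def add.assoc)
  qed
  have IM: "(LINT w|P. indicator \<Gamma> w * M_proc hp hm L s w) = (LINT w|P. indicator \<Gamma> w * Y.Mart s w)" if "0 \<le> s" for \<Gamma> s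
    by (rule Bochner_Integration.integral_cong) (use M[OF that] in auto)
  have "((\<lambda>t. (LINT w|P. indicator \<Gamma> w *
                    (hp (L t w) * indicator {0<..} (w t) + hm (L t w) * indicator {..<0} (w t)))
                / (LINT w|P. hp (L t w) * indicator {0<..} (w t) + hm (L t w) * indicator {..<0} (w t)))
             \<longlongrightarrow> (LINT w|P. indicator \<Gamma> w * M_proc hp hm L s w)) at_top"
    if s: "0 \<le> s" and \<Gamma>: "\<Gamma> \<in> sets (Filt s)" for s \<Gamma>
    unfolding IM[OF s]
  proof (rule Lim_transform_eventually[OF Y.penalisation_limit[OF s \<Gamma>]])
    show "\<forall>\<^sub>F t in at_top. (LINT w|P. indicator \<Gamma> w * (a (L t w) * indicator {0<..} (w t) + b (L t w) * indicator {..<0} (w t)))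
        / (LINT w|P. a (L t w) * indicator {0<..} (w t) + b (L t w) * indicator {..<0} (w t))
      = (LINT w|P. indicator \<Gamma> w * (hp (L t w) * indicator {0<..} (w t) + hm (L t w) * indicator {..<0} (w t)))
        / (LINT w|P. hp (L t w) * indicator {0<..} (w t) + hm (L t w) * indicator {..<0} (w t))"
      using eventually_ge_at_top[of 0]
    proof eventually_elim
      case (elim t)
      show ?case
        by (intro arg_cong2[where f="(/)"] Bochner_Integration.integral_cong refl) (simp_all add: ab[OF L0[OF elim]])
    qed
  qed
  moreover have "brownian_motion (completion Q)
              (\<lambda>t w. w t - (LBINT s:{0..t}.
                 (hp (L s w) * indicator {0<..} (w s) - hm (L s w) * indicator {..<0} (w s))
                   / M_proc hp hm L s w))"
    if Q: "prob_space Q" "sets Q = sets Filt_inf"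
      "\<forall>s\<ge>0. \<forall>\<Gamma>\<in>sets (Filt s). measure Q \<Gamma> = (LINT w|P. indicator \<Gamma> w * M_proc hp hm L s w)" for Q
  proof -
    interpret T: h_transform P L a b K Q
    proof (intro h_transform.intro h_transform_axioms.intro)
      show "excursion_weights P L a b K" by (rule Y.excursion_weights_axioms)
      show "measure Q \<Gamma> = (LINT w|P. indicator \<Gamma> w * Y.Mart s w)" if "0 \<le> s" "\<Gamma> \<in> sets (Filt s)" for s \<Gamma>
        using Q(3) that IM[OF that(1)] by simp
    qed (rule Q)+
    show ?thesis
    proof (rule T.innovation_brownian)
      fix t :: real and w :: path
      assume tw: "0 \<le> t" "w \<in> path_space"
      have "(LBINT s:{0..t}. (hp (L s w) * indicator {0<..} (w s) - hm (L s w) * indicator {..<0} (w s)) / M_proc hp hm L s w)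
        = (LBINT s:{0..t}. Y.drift s w)"
      proof (rule set_lebesgue_integral_cong)
        show "\<forall>s. s \<in> {0..t} \<longrightarrow> (hp (L s w) * indicator {0<..} (w s) - hm (L s w) * indicator {..<0} (w s)) / M_proc hp hm L s w = Y.drift s w"
        proof (intro allI impI)
          fix s :: real assume "s \<in> {0..t}"
          then have s: "0 \<le> s" by simp
          show "(hp (L s w) * indicator {0<..} (w s) - hm (L s w) * indicator {..<0} (w s)) / M_proc hp hm L s w = Y.drift s w"
            unfolding Y.drift_def Y.bb_def M[OF s tw(2)] ab[OF L0[OF s tw(2)]] ..
        qed
      qed simp
      then show "w t - (LBINT s:{0..t}. (hp (L s w) * indicator {0<..} (w s) - hm (L s w) * indicator {..<0} (w s)) / M_proc hp hm L s w)
        = w t - (LBINT s:{0..t}. Y.drift s w)" by simp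
    qed
  qed
  ultimately show ?thesis by blast
qed

end
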